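(* Let $V$ be a non-degenerate real quadratic space and let $\sigma\in\mathrm{O}(V)$. Suppose that $$V_\sigma^{\mathrm{odd}}:=\bigoplus_{(p,l)\in I_0^{\mathrm{odd}}\cup I_1^{\mathrm{odd}}}V_{p,\sigma}^{(l)}\quad(\text{orthogonal direct sum})$$ has signature $(r,s)$, and put $n=r+s$. Then every $\tau\in\mathrm{O}(V)$ which is conjugate to $\sigma$ in $\mathrm{GL}(V)$ is conjugate to $\sigma$ in $\mathrm{O}(V)$ if and only if $I_1^{\mathrm{ev}}=\emptyset$ and the equation $$\frac n2-\frac{\epsilon_0}{2}-\epsilon_1+\sum_{(p,l)\in I_0^{\mathrm{odd}}}w_{p,l}+2\sum_{(p,l)\in I_1^{\mathrm{odd}}}z_{p,l}=r$$ has exactly one solution in integers $w_{p,l}$ ($(p,l)\in I_0^{\mathrm{odd}}$) and $z_{p,l}$ ($(p,l)\in I_1^{\mathrm{odd}}$) subject to $$0\le w_{p,l}\le\epsilon_{p,\sigma}^{(l)}\ \ ((p,l)\in I_0^{\mathrm{odd}}),\qquad 0\le z_{p,l}\le\epsilon_{p,\sigma}^{(l)}\ \ ((p,l)\in I_1^{\mathrm{odd}}).$$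
   Context: A non-degenerate real quadratic space is a finite-dimensional real vector space $V$ with a non-degenerate symmetric bilinear form $\langle\cdot,\cdot\rangle$; $\mathrm{O}(V)$ is its group of linear isometries. Signature $(r,s)$ means $r$ positive and $s$ negative squares. For a polynomial $g\in\mathbb{R}[x]$ with $g(0)\ne0$ put $g^*(x)=g(0)^{-1}x^{\deg g}g(x^{-1})$; $g$ is reciprocal if $g=g^*$. Let $\sigma\in\mathrm{O}(V)$ with characteristic polynomial $f$ (which is reciprocal). Define: - $I_0(f)$: the set of reciprocal $p\in\mathbb{R}[x]$ with $\deg p=1$ and $p\mid f$ (a subset of $\{x+1,x-1\}$); - $I_1(f)$: the set of irreducible reciprocal $p\in\mathbb{R}[x]$ with $\deg p=2$ and $p\mid f$; - $I_2(f)$: the set of products $qq^*$ with $q\in\mathbb{R}[x]$ monic, irreducible, non-reciprocal and $q\mid f$; - $I(f)=I_0(f)\cup I_1(f)\cup I_2(f)$. Regard $V$ as an $\mathbb{R}[x]$-module $V_\sigma$ with $x$ acting as $\sigma$. There is an orthogonal decomposition into $\sigma$-stable subspaces $V_\sigma=\bigoplus_{p\in I(f)}\bigoplus_{l\ge1}V_{p,\sigma}^{(l)}$ in which each $V_{p,\sigma}^{(l)}$ is a free $\mathbb{R}[x]/(p^l)$-module and $\bigoplus_{l\ge1}V_{p,\sigma}^{(l)}=\{v\in V: p(\sigma)^kv=0\text{ for } k\gg0\}$ is the $p$-primary component; fix such a decomposition. For $i=0,1$: $I_i^{\mathrm{odd}}=\{(p,l):p\in I_i(f),\ l\text{ odd},\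 V_{p,\sigma}^{(l)}\ne0\}$ and $I_i^{\mathrm{ev}}=\{(p,l):p\in I_i(f),\ l\text{ even},\ V_{p,\sigma}^{(l)}\ne0\}$. For $p\in I_0(f)\cup I_1(f)$, $\epsilon_{p,\sigma}^{(l)}$ is the rank of the free $\mathbb{R}[x]/(p^l)$-module $V_{p,\sigma}^{(l)}$ (the multiplicity of the elementary divisor $p^l$). Put $\epsilon_i=\sum_{(p,l)\in I_i^{\mathrm{odd}}}\epsilon_{p,\sigma}^{(l)}$ for $i=0,1$. *)

theory Defs
  imports
    "HOL-Analysis.Linear_Algebra"
    "HOL-Library.FuncSet"
    "Jordan_Normal_Form.Char_Poly"
begin

text \<open>The underlying space is the whole type \<open>'v\<close>. Only \<open>real_vector\<close> is required, so that no
  auxiliary norm is present and the zero space is allowed.\<close>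

definition quadratic_space :: "('v::real_vector \<Rightarrow> 'v \<Rightarrow> real) \<Rightarrow> bool" where
  "quadratic_space B \<longleftrightarrow>
     (\<exists>A::'v set. finite A \<and> span A = UNIV) \<and>
     bilinear B \<and> (\<forall>u v. B u v = B v u) \<and>
     (\<forall>u. (\<forall>v. B u v = 0) \<longrightarrow> u = 0)"

definition GL :: "('v::real_vector \<Rightarrow> 'v) set" where
  "GL = {g. linear g \<and> bij g}"

definition orth_group :: "('v::real_vector \<Rightarrow> 'v \<Rightarrow> real) \<Rightarrow> ('v \<Rightarrow> 'v) set" where
  "orth_group B = {g \<in> GL. \<forall>u v. B (g u) (g v) = B u v}"

definition conjugate_in :: "('v \<Rightarrow> 'v) set \<Rightarrow> ('v \<Rightarrow> 'v) \<Rightarrow> ('v \<Rightarrow> 'v) \<Rightarrow> bool" where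
  "conjugate_in G \<sigma> \<tau> \<longleftrightarrow> (\<exists>g\<in>G. \<tau> = g \<circ> \<sigma> \<circ> inv_into UNIV g)"

definition has_signature ::
    "('v::real_vector \<Rightarrow> 'v \<Rightarrow> real) \<Rightarrow> 'v set \<Rightarrow> nat \<Rightarrow> nat \<Rightarrow> bool" where
  "has_signature B U r s \<longleftrightarrow>
     (\<exists>P N. finite P \<and> finite N \<and> P \<inter> N = {} \<and>
        independent (P \<union> N) \<and> span (P \<union> N) = U \<and>
        pairwise (\<lambda>u v. B u v = 0) (P \<union> N) \<and>
        (\<forall>v\<in>P. B v v > 0) \<and> (\<forall>v\<in>N. B v v < 0) \<and>
        card P = r \<and> card N = s)"

definition basis_list :: "'v::real_vector list \<Rightarrow> bool" where
  "basis_list bs \<longleftrightarrow> distinct bs \<and> independent (set bs) \<and> span (set bs) = UNIV"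

definition matrix_wrt :: "'v::real_vector list \<Rightarrow> ('v \<Rightarrow> 'v) \<Rightarrow> real mat" where
  "matrix_wrt bs \<sigma> =
     mat (length bs) (length bs) (\<lambda>(i, j). representation (set bs) (\<sigma> (bs ! j)) (bs ! i))"

text \<open>For finite-dimensional \<open>'v\<close> an ordered basis exists, and matrices with respect to different
  bases are similar, so the choice made here is immaterial.\<close>

definition charpoly :: "('v::real_vector \<Rightarrow> 'v) \<Rightarrow> real poly" where
  "charpoly \<sigma> = char_poly (matrix_wrt (SOME bs. basis_list bs) \<sigma>)"

text \<open>Some polynomial constants are qualified because HOL-Algebra uses the same short names.
  A reciprocal polynomial is automatically monic.\<close>

definition poly_star :: "real poly \<Rightarrow> real poly" where
  "poly_star g = Polynomial.smult (inverse (poly g 0)) (reflect_poly g)"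

definition reciprocal :: "real poly \<Rightarrow> bool" where
  "reciprocal g \<longleftrightarrow> poly g 0 \<noteq> 0 \<and> g = poly_star g"

definition I0 :: "real poly \<Rightarrow> real poly set" where
  "I0 f = {p. reciprocal p \<and> Polynomial.degree p = 1 \<and> p dvd f}"

definition I1 :: "real poly \<Rightarrow> real poly set" where
  "I1 f = {p. Factorial_Ring.irreducible p \<and> reciprocal p \<and>
             Polynomial.degree p = 2 \<and> p dvd f}"

definition I2 :: "real poly \<Rightarrow> real poly set" where
  "I2 f = {q * poly_star q | q. monic q \<and> Factorial_Ring.irreducible q \<and>
                               poly q 0 \<noteq> 0 \<and> \<not> reciprocal q \<and> q dvd f}"

definition I_all :: "real poly \<Rightarrow> real poly set" where
  "I_all f = I0 f \<union> I1 f \<union> I2 f"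

text \<open>The module structure over real polynomials in which the indeterminate acts as \<open>\<sigma>\<close>.\<close>

definition poly_act :: "('v::real_vector \<Rightarrow> 'v) \<Rightarrow> real poly \<Rightarrow> 'v \<Rightarrow> 'v" where
  "poly_act \<sigma> g v = (\<Sum>i\<le>Polynomial.degree g. Polynomial.coeff g i *\<^sub>R (\<sigma> ^^ i) v)"

text \<open>\<open>E\<close> is a basis of \<open>W\<close> as a module over the quotient of the polynomial ring by \<open>(q)\<close>: the
  coefficients are represented by polynomials, and a coefficient vanishes in the quotient iff it
  is divisible by \<open>q\<close>. The first conjunct says that the quotient acts on \<open>W\<close>.\<close>

definition quot_basis ::
    "('v::real_vector \<Rightarrow> 'v) \<Rightarrow> real poly \<Rightarrow> 'v set \<Rightarrow> 'v set \<Rightarrow> bool" where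
  "quot_basis \<sigma> q W E \<longleftrightarrow>
     (\<forall>v\<in>W. poly_act \<sigma> q v = 0) \<and>
     finite E \<and> E \<subseteq> W \<and>
     W = {\<Sum>e\<in>E. poly_act \<sigma> (c e) e | c. True} \<and>
     (\<forall>c. (\<Sum>e\<in>E. poly_act \<sigma> (c e) e) = 0 \<longrightarrow> (\<forall>e\<in>E. q dvd c e))"

definition free_quot :: "('v::real_vector \<Rightarrow> 'v) \<Rightarrow> real poly \<Rightarrow> 'v set \<Rightarrow> bool" where
  "free_quot \<sigma> q W \<longleftrightarrow> (\<exists>E. quot_basis \<sigma> q W E)"

definition free_rank :: "('v::real_vector \<Rightarrow> 'v) \<Rightarrow> real poly \<Rightarrow> 'v set \<Rightarrow> nat" where
  "free_rank \<sigma> q W = (THE n. \<exists>E. quot_basis \<sigma> q W E \<and> card E = n)"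

definition direct_sum :: "'i set \<Rightarrow> ('i \<Rightarrow> 'v::real_vector set) \<Rightarrow> 'v set \<Rightarrow> bool" where
  "direct_sum J W U \<longleftrightarrow>
     (\<forall>j\<in>J. subspace (W j)) \<and> U = span (\<Union>j\<in>J. W j) \<and>
     (\<forall>F x. finite F \<and> F \<subseteq> J \<and> (\<forall>j\<in>F. x j \<in> W j) \<and> (\<Sum>j\<in>F. x j) = 0
        \<longrightarrow> (\<forall>j\<in>F. x j = 0))"

definition primary_component :: "('v::real_vector \<Rightarrow> 'v) \<Rightarrow> real poly \<Rightarrow> 'v set" where
  "primary_component \<sigma> p = {v. eventually (\<lambda>k. (poly_act \<sigma> p ^^ k) v = 0) sequentially}"

definition orth_decomposition ::
    "('v::real_vector \<Rightarrow> 'v \<Rightarrow> real) \<Rightarrow> ('v \<Rightarrow> 'v) \<Rightarrow> (real poly \<times> nat \<Rightarrow> 'v set) \<Rightarrow> bool" where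
  "orth_decomposition B \<sigma> W \<longleftrightarrow>
     (let J = I_all (charpoly \<sigma>) \<times> {1..} in
        direct_sum J W UNIV \<and>
        (\<forall>j\<in>J. \<sigma> ` W j \<subseteq> W j) \<and>
        (\<forall>i\<in>J. \<forall>j\<in>J. i \<noteq> j \<longrightarrow> (\<forall>u\<in>W i. \<forall>v\<in>W j. B u v = 0)) \<and>
        (\<forall>(p, l)\<in>J. free_quot \<sigma> (p ^ l) (W (p, l))) \<and>
        (\<forall>p\<in>I_all (charpoly \<sigma>).
           direct_sum {1..} (\<lambda>l. W (p, l)) (primary_component \<sigma> p)))"

definition odd_indices ::
    "real poly set \<Rightarrow> (real poly \<times> nat \<Rightarrow> 'v::real_vector set) \<Rightarrow> (real poly \<times> nat) set" where
  "odd_indices I W = {(p, l). p \<in> I \<and> l \<ge> 1 \<and> odd l \<and> W (p, l) \<noteq> {0}}"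

definition even_indices ::
    "real poly set \<Rightarrow> (real poly \<times> nat \<Rightarrow> 'v::real_vector set) \<Rightarrow> (real poly \<times> nat) set" where
  "even_indices I W = {(p, l). p \<in> I \<and> l \<ge> 1 \<and> even l \<and> W (p, l) \<noteq> {0}}"

definition eps ::
    "('v::real_vector \<Rightarrow> 'v) \<Rightarrow> (real poly \<times> nat \<Rightarrow> 'v set) \<Rightarrow> real poly \<times> nat \<Rightarrow> nat" where
  "eps \<sigma> W = (\<lambda>(p, l). free_rank \<sigma> (p ^ l) (W (p, l)))"

end

theory Submission
  imports Defs "HOL-Computational_Algebra.Field_as_Ring"
begin

text \<open>Conjugates of \<open>\<sigma>\<close> in \<open>O(V)\<close> are classified by fixing \<open>\<sigma>\<close> and varying the \<open>\<sigma>\<close>-invariant form.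
  On the \<open>p\<close>-primary component, \<open>p\<close> reciprocal, \<open>\<sigma>\<close> is described by a nilpotent \<open>N\<close> whose adjoint is
  \<open>\<kappa> N\<close> with \<open>\<kappa> = - 1\<close> if \<open>deg p = 1\<close> and \<open>\<kappa> = 1\<close> if \<open>deg p = 2\<close>. The invariants are the positive and negative
  indices of the forms \<open>B u (N ^ (m - 1) v)\<close> on \<open>ker N ^ m\<close>, symmetric unless \<open>\<kappa> = - 1\<close> and \<open>m\<close> is even; their sum is
  the multiplicity of \<open>p ^ m\<close> times \<open>deg p\<close>, and each is divisible by \<open>deg p\<close>. They form a complete set of
  invariants, because a cyclic block (or a hyperbolic pair of blocks in the alternating case) of highest
  order splits off orthogonally and has a normal form; changing the sign of \<open>B\<close> on cyclic blocks realises all values.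
  The signature of the whole form is the sum of the invariants with \<open>m\<close> odd, since the signature is additive over the image
  of \<open>N\<close> and its complement and the components of type \<open>q q\<^sup>*\<close> are hyperbolic. So the invariants with \<open>m\<close> even and \<open>deg p = 2\<close> can be
  altered freely, while those with \<open>m\<close> odd can take exactly the values solving the equation.\<close>

section \<open>Indices of symmetric forms\<close>

text \<open>The adjoint of \<sigma> is its inverse, so the adjoint of p(\<sigma>) is only a unit
  multiple of p(\<sigma>). The models replace p(\<sigma>) by an associate \<open>N\<close> whose
  adjoint is exactly N or -N for every invariant form at once; only then can the indices of
  different forms be compared. For p = x - e the adjoint of \<sigma> - e is -e \<sigma>^-1 (\<sigma>
  - e), with a sign that units cannot remove: hence the alternating forms for even exponents. In
  degree 2 the residue field is the complex field with conjugation as involution; \<open>S\<close>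
  plays the part of an imaginary element and the forms are Hermitian up to their radicals, whence
  the divisibility by 2.

  \<open>N\<close> has this adjoint on one component only, so all notions are relative to a
  subspace.

  The constants of the equation come from r - s, the sum over odd exponents of positive minus
  negative index: with rank \<epsilon> in degree 1 and 2 \<epsilon> in degree 2 the terms are 2 w -
  \<epsilon> and 2 (2 z - \<epsilon>), and r - s = 2 r - n.\<close>

locale fin_dim =
  fixes Bs :: "'v::real_vector set"
  assumes finite_Bs: "finite Bs" and independent_Bs: "independent Bs" and span_Bs: "span Bs = UNIV"

text \<open>The type carries no norm, so finite dimension enters through an explicit basis; the
  rewrites make the imported facts speak about the constants of \<open>real_vector\<close>.\<close>

sublocale fin_dim \<subseteq> fd: finite_dimensional_vector_space "scaleR :: real \<Rightarrow> 'v \<Rightarrow> 'v" Bs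
  rewrites "module.dependent (*\<^sub>R) = (dependent :: 'v set \<Rightarrow> bool)"
    and "module.representation (*\<^sub>R) = (representation :: 'v set \<Rightarrow> _)"
    and "module.subspace (*\<^sub>R) = (subspace :: 'v set \<Rightarrow> bool)"
    and "module.span (*\<^sub>R) = (span :: 'v set \<Rightarrow> _)"
    and "vector_space.extend_basis (*\<^sub>R) = (extend_basis :: 'v set \<Rightarrow> _)"
    and "vector_space.dim (*\<^sub>R) = (dim :: 'v set \<Rightarrow> _)"
    and "Vector_Spaces.linear (*\<^sub>R) (*\<^sub>R) = (linear :: ('v \<Rightarrow> 'v) \<Rightarrow> bool)"
    and "Vector_Spaces.linear (*) (*\<^sub>R) = (linear :: (real \<Rightarrow> 'v) \<Rightarrow> bool)"
proof -
  show "finite_dimensional_vector_space ((*\<^sub>R) :: real \<Rightarrow> 'v \<Rightarrow> 'v) Bs"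
    using finite_Bs independent_Bs span_Bs
    by unfold_locales (auto simp: dependent_raw_def span_raw_def)
qed (auto simp add: dependent_raw_def representation_raw_def
      subspace_raw_def span_raw_def extend_basis_raw_def dim_raw_def linear_def
      real_scaleR_def[abs_def])

sublocale fin_dim \<subseteq> fdp: finite_dimensional_vector_space_pair_1
    "scaleR :: real \<Rightarrow> 'v \<Rightarrow> 'v" Bs "scaleR :: real \<Rightarrow> 'v \<Rightarrow> 'v"
  rewrites "module.dependent (*\<^sub>R) = (dependent :: 'v set \<Rightarrow> bool)"
    and "module.subspace (*\<^sub>R) = (subspace :: 'v set \<Rightarrow> bool)"
    and "module.span (*\<^sub>R) = (span :: 'v set \<Rightarrow> _)"
    and "vector_space.dim (*\<^sub>R) = (dim :: 'v set \<Rightarrow> _)"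
    and "Vector_Spaces.linear (*\<^sub>R) (*\<^sub>R) = (linear :: ('v \<Rightarrow> 'v) \<Rightarrow> bool)"
  by unfold_locales (auto simp add: dependent_raw_def representation_raw_def
      subspace_raw_def span_raw_def extend_basis_raw_def dim_raw_def linear_def
      real_scaleR_def[abs_def])

section \<open>Bilinear forms on a real vector space\<close>

lemmas bilin = bilinear_ladd bilinear_radd bilinear_lmul bilinear_rmul bilinear_lneg bilinear_rneg
  bilinear_lzero bilinear_rzero bilinear_lsub bilinear_rsub

lemma bilinear_lsum: "bilinear c \<Longrightarrow> c (sum f I) y = (\<Sum>i\<in>I. c (f i) y)"
  using linear_sum[of "\<lambda>x. c x y" f I] by (simp add: bilinear_def)

lemma bilinear_rsum: "bilinear c \<Longrightarrow> c y (sum f I) = (\<Sum>i\<in>I. c y (f i))"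
  using linear_sum[of "\<lambda>x. c y x" f I] by (simp add: bilinear_def)

lemma bilinear_compose2:
  assumes "bilinear c" "linear f" "linear g"
  shows "bilinear (\<lambda>u v. c (f u) (g v))"
  using assms unfolding bilinear_def linear_iff by simp

lemma bilinear_uminus: "bilinear c \<Longrightarrow> bilinear (\<lambda>u v. - c u v)"
  unfolding bilinear_def linear_iff by simp

text \<open>Symmetry is asked for on \<open>A\<close> only: \<open>bet N B m\<close> is built from
  an operator whose adjoint is known on a single component, and need not be symmetric
  elsewhere.\<close>

definition symf :: "'v::real_vector set \<Rightarrow> ('v \<Rightarrow> 'v \<Rightarrow> real) \<Rightarrow> bool" where
  "symf A c \<longleftrightarrow> bilinear c \<and> (\<forall>u\<in>A. \<forall>v\<in>A. c u v = c v u)"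

lemma symf_subset: "symf A c \<Longrightarrow> A' \<subseteq> A \<Longrightarrow> symf A' c"
  unfolding symf_def by blast

lemma symf_uminus: "symf A c \<Longrightarrow> symf A (\<lambda>u v. - c u v)"
  unfolding symf_def by (auto intro: bilinear_uminus)

text \<open>Free of bases, so it is manifestly an invariant of the form. Only the values
  \<open>c x x\<close> on \<open>A\<close> enter, which is what \<open>pos_index_cong\<close>
  exploits.\<close>

definition pos_index :: "('v::real_vector \<Rightarrow> 'v \<Rightarrow> real) \<Rightarrow> 'v set \<Rightarrow> nat" where
  "pos_index c A = Max {dim X | X. subspace X \<and> X \<subseteq> A \<and> (\<forall>x\<in>X. x \<noteq> 0 \<longrightarrow> 0 < c x x)}"

abbreviation neg_index :: "('v::real_vector \<Rightarrow> 'v \<Rightarrow> real) \<Rightarrow> 'v set \<Rightarrow> nat" where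
  "neg_index c A \<equiv> pos_index (\<lambda>u v. - c u v) A"

definition sgn_index :: "('v::real_vector \<Rightarrow> 'v \<Rightarrow> real) \<Rightarrow> 'v set \<Rightarrow> int" where
  "sgn_index c A = int (pos_index c A) - int (neg_index c A)"

lemma pos_index_cong:
  assumes "\<And>u. u \<in> A \<Longrightarrow> c u u = c' u u"
  shows "pos_index c A = pos_index c' A"
  unfolding pos_index_def
  by (rule arg_cong[where f = Max], rule Collect_cong) (use assms in \<open>auto simp: subset_iff\<close>)

lemma sgn_index_cong:
  assumes "\<And>u. u \<in> A \<Longrightarrow> c u u = c' u u"
  shows "sgn_index c A = sgn_index c' A"
proof -
  have "pos_index c A = pos_index c' A" "neg_index c A = neg_index c' A"
    using assms by (auto intro!: pos_index_cong)
  then show ?thesis by (simp add: sgn_index_def)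
qed

lemma orth_quadratic:
  fixes c :: "'v::real_vector \<Rightarrow> 'v \<Rightarrow> real"
  assumes "bilinear c" "finite b" "pairwise (\<lambda>u v. c u v = 0) b" "w \<in> b"
  shows "c (\<Sum>v\<in>b. a v *\<^sub>R v) w = a w * c w w"
proof -
  have "c (\<Sum>v\<in>b. a v *\<^sub>R v) w = (\<Sum>v\<in>b. a v * c v w)"
    by (simp add: bilinear_lsum[OF assms(1)] bilin[OF assms(1)])
  also have "\<dots> = (\<Sum>v\<in>b. if v = w then a w * c w w else 0)"
    by (rule sum.cong) (use assms(3,4) in \<open>auto simp: pairwise_def\<close>)
  finally show ?thesis using assms(2,4) by simp
qed

lemma orth_quadratic2:
  fixes c :: "'v::real_vector \<Rightarrow> 'v \<Rightarrow> real"
  assumes "bilinear c" "finite b" "pairwise (\<lambda>u v. c u v = 0) b"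
  shows "c (\<Sum>v\<in>b. a v *\<^sub>R v) (\<Sum>v\<in>b. a v *\<^sub>R v) = (\<Sum>v\<in>b. (a v)\<^sup>2 * c v v)"
proof -
  have "c (\<Sum>v\<in>b. a v *\<^sub>R v) (\<Sum>v\<in>b. a v *\<^sub>R v) = (\<Sum>w\<in>b. a w * c (\<Sum>v\<in>b. a v *\<^sub>R v) w)"
    by (simp add: bilinear_rsum[OF assms(1)] bilin[OF assms(1)])
  also have "\<dots> = (\<Sum>v\<in>b. (a v)\<^sup>2 * c v v)"
    by (rule sum.cong) (simp_all add: orth_quadratic[OF assms] power2_eq_square mult.assoc)
  finally show ?thesis .
qed

lemma span_Un_spans: "span (span S \<union> span T) = span (S \<union> T)"
proof
  show "span (span S \<union> span T) \<subseteq> span (S \<union> T)"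
    by (rule span_minimal) (auto intro: span_mono[THEN subsetD, rotated])
  show "span (S \<union> T) \<subseteq> span (span S \<union> span T)"
    by (rule span_mono) (auto intro: span_base)
qed

lemma sum_in_span_Un: "x \<in> A \<Longrightarrow> y \<in> B \<Longrightarrow> x + y \<in> span (A \<union> B)"
  by (rule span_add) (auto intro: span_base)

lemma span_Un_subspaces:
  assumes "subspace A" "subspace B"
  shows "span (A \<union> B) = {x + y | x y. x \<in> A \<and> y \<in> B}"
  unfolding span_Un using assms by (auto simp: span_eq_iff[THEN iffD2])

lemma bilinear_span_singleton:
  assumes "bilinear c" "x \<in> span {a}" "c a y = (0::real)"
  shows "c x y = 0"
  using assms(2,3) by (auto simp: span_singleton bilin[OF assms(1)])

section \<open>Orthogonal bases, the law of inertia, additivity of the signature\<close>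

context fin_dim begin

text \<open>If all \<open>c u u\<close> vanish, polarization makes the form zero on \<open>A\<close>
  and any basis serves. Otherwise a vector with \<open>c u u\<close> nonzero is split off from its
  orthogonal complement.\<close>

lemma orth_basis:
  fixes A :: "'v set"
  assumes "symf A c" "subspace A"
  shows "\<exists>b. finite b \<and> independent b \<and> span b = A \<and> pairwise (\<lambda>u v. c u v = 0) b"
  using assms
proof (induction "dim A" arbitrary: A rule: less_induct)
  case less
  have c: "bilinear c" and sym: "\<And>u v. u \<in> A \<Longrightarrow> v \<in> A \<Longrightarrow> c u v = c v u"
    using less.prems by (auto simp: symf_def)
  show ?case
  proof (cases "\<exists>u\<in>A. c u u \<noteq> 0")
    case False
    have 0: "c u v = 0" if "u \<in> A" "v \<in> A" for u v
    proof -
      have "c (u + v) (u + v) = 0" "c u u = 0" "c v v = 0"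
        using False that less.prems(2) by (auto simp: subspace_add)
      then show ?thesis using sym[OF that] by (simp add: bilin[OF c])
    qed
    obtain b where "b \<subseteq> A" "independent b" "A \<subseteq> span b" "card b = dim A"
      using fd.basis_exists[of A] by blast
    moreover have "finite b" using \<open>independent b\<close> by (rule fd.finiteI_independent)
    moreover have "span b = A" using calculation less.prems(2) span_minimal by blast
    moreover have "pairwise (\<lambda>u v. c u v = 0) b" using 0 \<open>b \<subseteq> A\<close> by (auto simp: pairwise_def)
    ultimately show ?thesis by blast
  next
    case True
    then obtain u where u: "u \<in> A" "c u u \<noteq> 0" by blast
    define A' where "A' = {x \<in> A. c x u = 0}"
    have sub: "subspace A'"
      unfolding A'_def using less.prems(2) by (auto simp: subspace_def bilin[OF c])
    have "A' \<subset> A" using u by (auto simp: A'_def)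
    then have "dim A' < dim A"
      using sub less.prems(2) fd.dim_psubset[of A' A] by (simp add: span_eq_iff[THEN iffD2])
    moreover have "symf A' c" using less.prems(1) by (rule symf_subset) (auto simp: A'_def)
    ultimately obtain b where b: "finite b" "independent b" "span b = A'" "pairwise (\<lambda>u v. c u v = 0) b"
      using less.hyps sub by blast
    have "u \<notin> span b" using u b by (auto simp: A'_def)
    then have "independent (insert u b)" using b(2) by (simp add: independent_insertI)
    moreover have "span (insert u b) = A"
    proof
      show "span (insert u b) \<subseteq> A"
        by (rule span_minimal) (use u b span_superset[of b] less.prems(2) in \<open>auto simp: A'_def\<close>)
      show "A \<subseteq> span (insert u b)"
      proof
        fix x assume x: "x \<in> A"
        have "x - (c x u / c u u) *\<^sub>R u \<in> A'"
          using x u less.prems(2) by (auto simp: A'_def subspace_diff subspace_scale bilin[OF c])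
        then show "x \<in> span (insert u b)" using b(3) by (auto simp: span_insert)
      qed
    qed
    moreover have "pairwise (\<lambda>u v. c u v = 0) (insert u b)"
    proof -
      have "c x u = 0 \<and> c u x = 0" if "x \<in> b" for x
        using that span_base[of x b] b(3) sym[of x u] u by (auto simp: A'_def)
      then show ?thesis using b(4) by (auto simp: pairwise_insert)
    qed
    ultimately show ?thesis using b(1) by (intro exI[of _ "insert u b"]) auto
  qed
qed

text \<open>Sylvester's law of inertia: a subspace on which the form is positive definite meets the
  span of the members of \<open>b\<close> with nonpositive square in zero only, and counting
  dimensions bounds it by the number of positive members.\<close>

lemma pos_index_orth:
  fixes b :: "'v set"
  assumes "symf (span b) c" "finite b" "pairwise (\<lambda>u v. c u v = 0) b"
  shows "pos_index c (span b) = card {v\<in>b. 0 < c v v}"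
proof -
  define P where "P = {v\<in>b. 0 < c v v}"
  define Q where "Q = b - P"
  have c: "bilinear c" using assms(1) by (simp add: symf_def)
  have fin: "finite P" "finite Q" and PQ: "b = P \<union> Q" using assms(2) by (auto simp: P_def Q_def)
  have pwP: "pairwise (\<lambda>u v. c u v = 0) P" and pwQ: "pairwise (\<lambda>u v. c u v = 0) Q"
    using assms(3) by (auto simp: P_def Q_def pairwise_def)
  \<comment> \<open>Pairing a linear relation with one positive vector isolates its coefficient, so
    the positive members of \<open>b\<close> are independent.\<close>
  have "a x = 0" if "(\<Sum>v\<in>P. a v *\<^sub>R v) = 0" "x \<in> P" for a x
    using orth_quadratic[OF c fin(1) pwP that(2), of a] that by (auto simp: bilin[OF c] P_def)
  then have indep: "independent P" using fin(1) by (intro independent_if_scalars_zero) auto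
  have pos: "0 < c x x" if x: "x \<in> span P" "x \<noteq> 0" for x
  proof -
    obtain a where a: "x = (\<Sum>v\<in>P. a v *\<^sub>R v)" using x by (auto simp: span_finite[OF fin(1)])
    have "\<exists>v\<in>P. a v \<noteq> 0"
    proof (rule ccontr)
      assume "\<not> (\<exists>v\<in>P. a v \<noteq> 0)"
      then have "x = 0" unfolding a by (intro sum.neutral) simp
      then show False using x(2) by simp
    qed
    then obtain v where v: "v \<in> P" "a v \<noteq> 0" by blast
    then show ?thesis unfolding a orth_quadratic2[OF c fin(1) pwP]
      by (intro sum_pos2[OF fin(1) v(1)]) (auto simp: P_def)
  qed
  have np: "c x x \<le> 0" if x: "x \<in> span Q" for x
  proof -
    obtain a where a: "x = (\<Sum>v\<in>Q. a v *\<^sub>R v)" using x by (auto simp: span_finite[OF fin(2)])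
    then show ?thesis unfolding a orth_quadratic2[OF c fin(2) pwQ]
      by (intro sum_nonpos) (auto simp: Q_def P_def mult_nonneg_nonpos)
  qed
  have dimb: "dim (span b) \<le> card P + dim (span Q)"
  proof -
    have "dim {x + y |x y. x \<in> span P \<and> y \<in> span Q} \<le> dim (span P) + dim (span Q)"
      using fd.dim_sums_Int[of "span P" "span Q"] by simp
    then show ?thesis using indep unfolding PQ span_Un
      by (simp add: fd.dim_eq_card_independent)
  qed
  have le: "dim X \<le> card P" if X: "subspace X" "X \<subseteq> span b" "\<forall>x\<in>X. x \<noteq> 0 \<longrightarrow> 0 < c x x" for X
  proof -
    have "X \<inter> span Q = {0}" using X np subspace_0[OF X(1)] span_zero[of Q]
      by (auto simp: not_less[symmetric])
    moreover have "dim {x + y |x y. x \<in> X \<and> y \<in> span Q} \<le> dim (span b)"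
      by (rule fd.dim_subset) (use X(2) PQ span_mono[of Q b] in \<open>auto intro!: span_add\<close>)
    ultimately show ?thesis using fd.dim_sums_Int[of X "span Q"] X(1) dimb by simp
  qed
  show ?thesis unfolding pos_index_def P_def[symmetric]
  proof (rule Max_eqI)
    show "finite {dim X |X. subspace X \<and> X \<subseteq> span b \<and> (\<forall>x\<in>X. x \<noteq> 0 \<longrightarrow> 0 < c x x)}"
      by (rule finite_subset[of _ "{..card P}"]) (use le in auto)
    show "card P \<in> {dim X |X. subspace X \<and> X \<subseteq> span b \<and> (\<forall>x\<in>X. x \<noteq> 0 \<longrightarrow> 0 < c x x)}"
      using pos indep span_mono[of P b] PQ
      by (auto intro!: exI[of _ "span P"] simp: fd.dim_eq_card_independent)
  qed (use le in auto)
qed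

lemma neg_index_orth:
  fixes b :: "'v set"
  assumes "symf (span b) c" "finite b" "pairwise (\<lambda>u v. c u v = 0) b"
  shows "neg_index c (span b) = card {v\<in>b. c v v < 0}"
  using pos_index_orth[OF symf_uminus[OF assms(1)] assms(2)] assms(3) by simp

lemma pos_index_nonpos:
  fixes A :: "'v set"
  assumes "\<And>x. x \<in> A \<Longrightarrow> c x x \<le> 0" "subspace A"
  shows "pos_index c A = 0"
proof -
  have "dim X = 0" if "subspace X" "X \<subseteq> A" "\<forall>x\<in>X. x \<noteq> 0 \<longrightarrow> 0 < c x x" for X
  proof -
    have "X \<subseteq> {0}" using that(2,3) assms(1) by fastforce
    then show ?thesis by simp
  qed
  then have "{dim X | X. subspace X \<and> X \<subseteq> A \<and> (\<forall>x\<in>X. x \<noteq> 0 \<longrightarrow> 0 < c x x)} = {0}"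
    using assms(2) subspace_0[OF assms(2)] by (auto intro!: exI[of _ "{0}"])
  then show ?thesis by (simp add: pos_index_def)
qed

lemma pos_index_sum:
  fixes A :: "'v set"
  assumes "symf (span (A \<union> A')) c" "subspace A" "subspace A'"
    and "\<And>x y. x \<in> A \<Longrightarrow> y \<in> A' \<Longrightarrow> c x y = 0"
  shows "pos_index c (span (A \<union> A')) = pos_index c A + pos_index c A'"
proof -
  have AA: "symf A c" "symf A' c"
    using assms(1) by (auto intro: symf_subset span_base)
  obtain b where b: "finite b" "span b = A" "pairwise (\<lambda>u v. c u v = 0) b"
    using orth_basis[OF AA(1) assms(2)] by blast
  obtain b' where b': "finite b'" "span b' = A'" "pairwise (\<lambda>u v. c u v = 0) b'"
    using orth_basis[OF AA(2) assms(3)] by blast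
  have bA: "b \<subseteq> A" "b' \<subseteq> A'" using b(2) b'(2) span_superset by blast+
  have sp: "span (A \<union> A') = span (b \<union> b')" using span_Un_spans[of b b'] b(2) b'(2) by simp
  have 0: "c x y = 0 \<and> c y x = 0" if "x \<in> A" "y \<in> A'" for x y
  proof -
    have "x \<in> span (A \<union> A')" "y \<in> span (A \<union> A')" using that by (auto intro: span_base)
    then have "c y x = c x y" using assms(1) by (auto simp: symf_def)
    then show ?thesis using assms(4)[OF that] by simp
  qed
  have pw: "pairwise (\<lambda>u v. c u v = 0) (b \<union> b')"
    using b(3) b'(3) 0 bA unfolding pairwise_def by (metis UnE subsetD)
  have "pos_index c (span (A \<union> A')) = card {v \<in> b \<union> b'. 0 < c v v}"
    unfolding sp by (rule pos_index_orth) (use assms(1) sp b b' pw in auto)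
  also have "{v \<in> b \<union> b'. 0 < c v v} = {v \<in> b. 0 < c v v} \<union> {v \<in> b'. 0 < c v v}" by auto
  also have "card \<dots> = card {v \<in> b. 0 < c v v} + card {v \<in> b'. 0 < c v v}"
    by (rule card_Un_disjoint) (use b(1) b'(1) bA assms(4) in fastforce)+
  also have "\<dots> = pos_index c A + pos_index c A'"
    using pos_index_orth[of b c] pos_index_orth[of b' c] AA b b' by simp
  finally show ?thesis .
qed

lemma sgn_index_sum:
  fixes A :: "'v set"
  assumes "symf (span (A \<union> A')) c" "subspace A" "subspace A'"
    and "\<And>x y. x \<in> A \<Longrightarrow> y \<in> A' \<Longrightarrow> c x y = 0"
  shows "sgn_index c (span (A \<union> A')) = sgn_index c A + sgn_index c A'"
  using pos_index_sum[OF assms] pos_index_sum[OF symf_uminus[OF assms(1)] assms(2,3)] assms(4)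
  by (simp add: sgn_index_def)

text \<open>Covers maps with a kernel, such as \<open>N\<close> below: an orthogonal basis for the
  pulled back form is mapped to an orthogonal system, and only vectors of square zero can be
  identified or lost.\<close>

lemma pos_index_image:
  fixes A :: "'v set" and f :: "'v \<Rightarrow> 'v"
  assumes "linear f" "symf (f ` A) c" "subspace A"
  shows "pos_index c (f ` A) = pos_index (\<lambda>u v. c (f u) (f v)) A"
proof -
  have c: "bilinear c" using assms(2) by (simp add: symf_def)
  have s: "symf A (\<lambda>u v. c (f u) (f v))"
    using assms(2) bilinear_compose2[OF c assms(1) assms(1)] by (simp add: symf_def)
  obtain b where b: "finite b" "span b = A" "pairwise (\<lambda>u v. c (f u) (f v) = 0) b"
    using orth_basis[OF s assms(3)] by blast
  have sp: "span (f ` b) = f ` A" using b(2) assms(1) by (simp add: linear_span_image)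
  have pw: "pairwise (\<lambda>u v. c u v = 0) (f ` b)"
    using b(3) by (auto simp: pairwise_def)
  have "pos_index c (f ` A) = card {v \<in> f ` b. 0 < c v v}"
    using pos_index_orth[of "f ` b" c] sp pw b(1) assms(2) by simp
  also have "{v \<in> f ` b. 0 < c v v} = f ` {v \<in> b. 0 < c (f v) (f v)}" by auto
  \<comment> \<open>Distinct basis vectors with a common image are orthogonal for the pullback, so
    this image would have square zero.\<close>
  also have "card \<dots> = card {v \<in> b. 0 < c (f v) (f v)}"
  proof (rule card_image, rule inj_onI, rule ccontr)
    fix x y assume "x \<in> {v \<in> b. 0 < c (f v) (f v)}" "y \<in> {v \<in> b. 0 < c (f v) (f v)}" "f x = f y" "x \<noteq> y"
    then show False using b(3) unfolding pairwise_def by (metis (mono_tags, lifting) less_irrefl mem_Collect_eq)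
  qed
  also have "\<dots> = pos_index (\<lambda>u v. c (f u) (f v)) A"
    using pos_index_orth[of b "\<lambda>u v. c (f u) (f v)"] b s by simp
  finally show ?thesis .
qed

lemma sgn_index_image:
  fixes A :: "'v set" and f :: "'v \<Rightarrow> 'v"
  assumes "linear f" "symf (f ` A) c" "subspace A"
  shows "sgn_index c (f ` A) = sgn_index (\<lambda>u v. c (f u) (f v)) A"
  using pos_index_image[OF assms] pos_index_image[OF assms(1) symf_uminus[OF assms(2)] assms(3)]
  by (simp add: sgn_index_def)

text \<open>In an orthogonal basis the radical is spanned by the vectors of square zero, and the
  three signs partition the basis.\<close>

lemma index_rank:
  fixes A :: "'v set"
  assumes "symf A c" "subspace A"
  shows "pos_index c A + neg_index c A + dim {u\<in>A. \<forall>v\<in>A. c u v = 0} = dim A"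
proof -
  have c: "bilinear c" using assms(1) by (simp add: symf_def)
  obtain b where b: "finite b" "independent b" "span b = A" "pairwise (\<lambda>u v. c u v = 0) b"
    using orth_basis[OF assms] by blast
  define Z where "Z = {v\<in>b. c v v = 0}"
  have fZ: "finite Z" "Z \<subseteq> b" using b(1) by (auto simp: Z_def)
  have "{u\<in>A. \<forall>v\<in>A. c u v = 0} = span Z"
  proof
    show "{u\<in>A. \<forall>v\<in>A. c u v = 0} \<subseteq> span Z"
    proof clarify
      fix u assume u: "u \<in> A" "\<forall>v\<in>A. c u v = 0"
      obtain a where a: "u = (\<Sum>v\<in>b. a v *\<^sub>R v)" using u b(3) by (auto simp: span_finite[OF b(1)])
      have "a v *\<^sub>R v \<in> span Z" if v: "v \<in> b" for v
      proof (cases "c v v = 0")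
        case False
        have "v \<in> A" using v b(3) span_base by blast
        then have "a v = 0" using orth_quadratic[OF c b(1,4) v, of a] u(2) a False by auto
        then show ?thesis by (simp add: span_zero)
      next
        case True
        then show ?thesis using v by (intro span_scale span_base) (simp add: Z_def)
      qed
      then show "u \<in> span Z" unfolding a by (rule span_sum)
    qed
    have "c u v = 0" if "u \<in> Z" "v \<in> b" for u v
      using that b(4) by (auto simp: Z_def pairwise_def)
    then have "c u v = 0" if "u \<in> Z" "v \<in> A" for u v
      using that b(3) by (auto simp: span_finite[OF b(1)] bilinear_rsum[OF c] bilin[OF c])
    then have "c u v = 0" if "u \<in> span Z" "v \<in> A" for u v
      using that by (auto simp: span_finite[OF fZ(1)] bilinear_lsum[OF c] bilin[OF c])
    then show "span Z \<subseteq> {u\<in>A. \<forall>v\<in>A. c u v = 0}" using span_mono[OF fZ(2)] b(3) by auto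
  qed
  moreover have "independent Z" using b(2) fZ(2) by (rule independent_mono)
  moreover have "card {v\<in>b. 0 < c v v} + card {v\<in>b. c v v < 0} + card Z = card b"
  proof -
    have "b = ({v\<in>b. 0 < c v v} \<union> {v\<in>b. c v v < 0}) \<union> Z" by (auto simp: Z_def)
    then have "card b = card (({v\<in>b. 0 < c v v} \<union> {v\<in>b. c v v < 0}) \<union> Z)" by simp
    also have "\<dots> = card ({v\<in>b. 0 < c v v} \<union> {v\<in>b. c v v < 0}) + card Z"
      by (rule card_Un_disjoint) (use b(1) in \<open>auto simp: Z_def\<close>)
    also have "card ({v\<in>b. 0 < c v v} \<union> {v\<in>b. c v v < 0}) = card {v\<in>b. 0 < c v v} + card {v\<in>b. c v v < 0}"
      by (rule card_Un_disjoint) (use b(1) in auto)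
    finally show ?thesis by simp
  qed
  ultimately show ?thesis
    using pos_index_orth[of b c] neg_index_orth[of b c] assms(1) b
    by (simp add: fd.dim_eq_card_independent) (metis fd.dim_eq_card_independent fd.dim_span)
qed

text \<open>Three cases. If \<open>c a a\<close> is nonzero, \<open>A\<close> is an orthogonal sum.
  If \<open>a\<close> lies in the radical, its complement is \<open>A\<close> itself. If
  \<open>a\<close> is isotropic outside the radical, it lies in a hyperbolic plane, and both sides
  reduce to the signature of the complement of that plane.\<close>

lemma sgn_index_perp_vector:
  fixes A :: "'v set"
  assumes "symf A c" "subspace A" "a \<in> A"
  shows "sgn_index c A = sgn_index c (span {a}) + sgn_index c {x\<in>A. c x a = 0}"
proof -
  have c: "bilinear c" and sym: "\<And>u v. u \<in> A \<Longrightarrow> v \<in> A \<Longrightarrow> c u v = c v u"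
    using assms by (auto simp: symf_def)
  have sub: "subspace {x\<in>A'. c x y = 0}" if "subspace A'" for y A'
    using that by (auto simp: subspace_def bilin[OF c])
  show ?thesis
  proof (cases "c a a = 0")
    case False
    have eq: "span (span {a} \<union> {x\<in>A. c x a = 0}) = A"
    proof
      show "span (span {a} \<union> {x\<in>A. c x a = 0}) \<subseteq> A"
        using assms(2,3) by (intro span_minimal) (auto simp: span_singleton subspace_scale)
      show "A \<subseteq> span (span {a} \<union> {x\<in>A. c x a = 0})"
      proof
        fix x assume x: "x \<in> A"
        have "x - (c x a / c a a) *\<^sub>R a \<in> {x\<in>A. c x a = 0}"
          using x assms(2,3) False by (auto simp: subspace_diff subspace_scale bilin[OF c])
        moreover have "(c x a / c a a) *\<^sub>R a \<in> span {a}" by (simp add: span_scale span_base)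
        ultimately have "(c x a / c a a) *\<^sub>R a + (x - (c x a / c a a) *\<^sub>R a)
           \<in> span (span {a} \<union> {x\<in>A. c x a = 0})" by (intro sum_in_span_Un)
        then show "x \<in> span (span {a} \<union> {x\<in>A. c x a = 0})" by simp
      qed
    qed
    have sa: "c x y = 0" if "x \<in> span {a}" "y \<in> {x\<in>A. c x a = 0}" for x y
      using that sym[of a y] assms(3) by (auto simp: span_singleton bilin[OF c])
    have "sgn_index c (span (span {a} \<union> {x\<in>A. c x a = 0})) = sgn_index c (span {a}) + sgn_index c {x\<in>A. c x a = 0}"
      by (rule sgn_index_sum)
        (use assms sub[OF assms(2)] eq sa in auto)
    then show ?thesis by (simp only: eq)
  next
    case True
    have 0: "sgn_index c (span {a}) = 0"
    proof -
      have "c x x = 0" if "x \<in> span {a}" for x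
        using that True by (auto simp: span_singleton bilin[OF c])
      then show ?thesis
        using pos_index_nonpos[of "span {a}" c] pos_index_nonpos[of "span {a}" "\<lambda>u v. - c u v"]
        by (simp add: sgn_index_def)
    qed
    show ?thesis
    proof (cases "\<forall>y\<in>A. c y a = 0")
      case True
      then have "{x\<in>A. c x a = 0} = A" by auto
      then show ?thesis using 0 by simp
    next
      case False
      then obtain y0 where y0: "y0 \<in> A" "c y0 a \<noteq> 0" by auto
      \<comment> \<open>The partner of \<open>a\<close> in the hyperbolic plane: subtracting a
        multiple of \<open>a\<close> makes it isotropic, and the factor in front gives
        \<open>c y a = 1\<close>.\<close>
      define y where "y = (1 / c y0 a) *\<^sub>R (y0 - (c y0 y0 / (2 * c y0 a)) *\<^sub>R a)"
      have y: "y \<in> A" using y0 assms(2,3) by (simp add: y_def subspace_diff subspace_scale)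
      have ya: "c y a = 1" "c a y = 1" using sym[OF y assms(3)] \<open>c a a = 0\<close> y0(2)
        by (simp_all add: y_def bilin[OF c])
      have yy: "c y y = 0" using \<open>c a a = 0\<close> y0(2) sym[OF y0(1) assms(3)]
        by (simp add: y_def bilin[OF c])
      define P where "P = {x \<in> {x\<in>A. c x a = 0}. c x y = 0}"
      have subP: "subspace P" unfolding P_def by (intro sub assms(2))
      have Pa: "c x a = 0" "c a x = 0" "c x y = 0" "c y x = 0" if "x \<in> P" for x
        using that sym[of x a] sym[of x y] assms(3) y by (auto simp: P_def)
      \<comment> \<open>These two generators are orthogonal, with squares 2 and -2.\<close>
      define H where "H = span {a + y, a - y}"
      have HA: "H \<subseteq> A" unfolding H_def using assms(2,3) y
        by (intro span_minimal) (auto simp: subspace_add subspace_diff)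
      have aH: "a \<in> H" "y \<in> H"
      proof -
        have "(1/2) *\<^sub>R (a + y) + (1/2) *\<^sub>R (a - y) \<in> H" "(1/2) *\<^sub>R (a + y) - (1/2) *\<^sub>R (a - y) \<in> H"
          unfolding H_def by (intro span_add span_diff span_scale span_base; simp)+
        then show "a \<in> H" "y \<in> H" by (simp_all add: algebra_simps flip: scaleR_add_left)
      qed
      have ne: "a + y \<noteq> a - y"
      proof
        assume "a + y = a - y"
        then have "2 *\<^sub>R y = 0" by (simp add: algebra_simps scaleR_2) 
        then show False using yy ya by (simp add: bilin[OF c])
      qed
      have H: "sgn_index c H = 0"
      proof -
        have s: "symf (span {a + y, a - y}) c" using assms(1) HA unfolding H_def by (rule symf_subset)
        have pw: "pairwise (\<lambda>u v. c u v = 0) {a + y, a - y}"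
          using ya yy True by (auto simp: pairwise_def bilin[OF c])
        have "{v \<in> {a + y, a - y}. 0 < c v v} = {a + y}" "{v \<in> {a + y, a - y}. c v v < 0} = {a - y}"
          using ya yy True by (auto simp: bilin[OF c])
        then show ?thesis
          using pos_index_orth[OF s _ pw] neg_index_orth[OF s _ pw] by (simp add: sgn_index_def H_def)
      qed
      have eq1: "span (H \<union> P) = A"
      proof
        show "span (H \<union> P) \<subseteq> A" using HA assms(2) by (intro span_minimal) (auto simp: P_def)
        show "A \<subseteq> span (H \<union> P)"
        proof
          fix x assume x: "x \<in> A"
          have "x - (c x y *\<^sub>R a + c x a *\<^sub>R y) \<in> P"
            using x y assms(2,3) ya yy True
            by (auto simp: P_def subspace_diff subspace_add subspace_scale bilin[OF c])
          moreover have "c x y *\<^sub>R a + c x a *\<^sub>R y \<in> H"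
            using aH unfolding H_def by (intro span_add span_scale)
          ultimately have "(c x y *\<^sub>R a + c x a *\<^sub>R y) + (x - (c x y *\<^sub>R a + c x a *\<^sub>R y)) \<in> span (H \<union> P)"
            by (rule sum_in_span_Un[rotated])
          then show "x \<in> span (H \<union> P)" by simp
        qed
      qed
      have eq2: "span (span {a} \<union> P) = {x\<in>A. c x a = 0}"
      proof
        show "span (span {a} \<union> P) \<subseteq> {x\<in>A. c x a = 0}"
          using assms(2,3) True sub
          by (intro span_minimal) (auto simp: P_def subspace_scale bilin[OF c] span_singleton)
        show "{x\<in>A. c x a = 0} \<subseteq> span (span {a} \<union> P)"
        proof
          fix x assume x: "x \<in> {x\<in>A. c x a = 0}"
          have "x - c x y *\<^sub>R a \<in> P"
            using x y assms(2,3) ya yy True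
            by (auto simp: P_def subspace_diff subspace_scale bilin[OF c])
          moreover have "c x y *\<^sub>R a \<in> span {a}" by (intro span_scale span_base) simp
          ultimately have "c x y *\<^sub>R a + (x - c x y *\<^sub>R a) \<in> span (span {a} \<union> P)"
            by (rule sum_in_span_Un[rotated])
          then show "x \<in> span (span {a} \<union> P)" by simp
        qed
      qed
      have "c x p = 0" if "x \<in> H" "p \<in> P" for x p
      proof -
        have "x \<in> {x. c x p = 0}"
          using that(1) unfolding H_def
          by (rule span_induct) (use Pa[OF that(2)] in \<open>auto simp: subspace_def bilin[OF c]\<close>)
        then show ?thesis by simp
      qed
      then have "sgn_index c (span (H \<union> P)) = sgn_index c H + sgn_index c P"
        by (intro sgn_index_sum) (use subP assms(1) eq1 in \<open>auto simp: H_def\<close>)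
      moreover have "sgn_index c (span (span {a} \<union> P)) = sgn_index c (span {a}) + sgn_index c P"
        by (intro sgn_index_sum)
          (use subP assms(1) eq2 Pa in \<open>auto intro: symf_subset bilinear_span_singleton[OF c]\<close>)
      ultimately show ?thesis using H 0 unfolding eq1 eq2 by simp
    qed
  qed
qed

text \<open>Vectors of an orthogonal basis of \<open>A'\<close> are removed one at a time. It covers
  subspaces on which the form degenerates, as the telescoping in \<open>sgn_formula\<close> demands;
  there only the difference of the two indices is additive, as an isotropic line in a hyperbolic
  plane shows.\<close>

lemma sgn_index_perp:
  fixes A :: "'v set"
  assumes "symf A c" "subspace A" "subspace A'" "A' \<subseteq> A"
  shows "sgn_index c A = sgn_index c A' + sgn_index c {x\<in>A. \<forall>y\<in>A'. c x y = 0}"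
proof -
  have c: "bilinear c" and sym: "\<And>u v. u \<in> A \<Longrightarrow> v \<in> A \<Longrightarrow> c u v = c v u"
    using assms by (auto simp: symf_def)
  obtain b where b: "finite b" "span b = A'" "pairwise (\<lambda>u v. c u v = 0) b"
    using orth_basis[OF symf_subset[OF assms(1,4)] assms(3)] by blast
  have perp: "{x\<in>A. \<forall>y\<in>span b. c x y = 0} = {x\<in>A. \<forall>y\<in>b. c x y = 0}" if "finite b" for b
  proof -
    have "c x y = 0" if "\<forall>y\<in>b. c x y = 0" "y \<in> span b" for x y
      using that(2) by (rule span_induct) (use that(1) in \<open>auto simp: subspace_def bilin[OF c]\<close>)
    then show ?thesis by (auto intro: span_base)
  qed
  have "b \<subseteq> A" using b(2) assms(4) span_superset by blast
  with b(1,3) have "sgn_index c A = sgn_index c (span b) + sgn_index c {x\<in>A. \<forall>y\<in>b. c x y = 0}"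
  proof (induction b)
    case empty
    then show ?case using pos_index_nonpos[of "{0}" c] pos_index_nonpos[of "{0}" "\<lambda>u v. - c u v"]
      by (simp add: sgn_index_def bilin[OF c])
  next
    case (insert a b)
    let ?P = "{x\<in>A. \<forall>y\<in>b. c x y = 0}"
    have IH: "sgn_index c A = sgn_index c (span b) + sgn_index c ?P"
      using insert by (auto simp: pairwise_insert)
    have a: "a \<in> ?P" using insert by (auto simp: pairwise_insert)
    have P: "subspace ?P" using assms(2) by (auto simp: subspace_def bilin[OF c])
    have "sgn_index c ?P = sgn_index c (span {a}) + sgn_index c {x \<in> ?P. c x a = 0}"
      by (rule sgn_index_perp_vector[OF _ P a]) (use assms(1) in \<open>auto intro: symf_subset\<close>)
    moreover have "{x \<in> ?P. c x a = 0} = {x\<in>A. \<forall>y\<in>insert a b. c x y = 0}" by auto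
    moreover have "sgn_index c (span (insert a b)) = sgn_index c (span {a}) + sgn_index c (span b)"
    proof -
      have e: "span (insert a b) = span (span {a} \<union> span b)" by (simp add: span_Un_spans)
      have "span (insert a b) \<subseteq> A" using insert.prems assms(2) by (intro span_minimal) auto
      moreover have "a \<in> {x\<in>A. \<forall>y\<in>span b. c x y = 0}" using a perp[OF insert.hyps(1)] by auto
      ultimately show ?thesis unfolding e
        by (intro sgn_index_sum) (use assms(1) e in \<open>auto intro: symf_subset bilinear_span_singleton[OF c]\<close>)
    qed
    ultimately show ?case using IH by simp
  qed
  then show ?thesis using perp[OF b(1)] b(2) by simp
qed

section \<open>Nondegenerate subspaces and orthogonal projection\<close>

definition nondeg_on :: "'v set \<Rightarrow> ('v \<Rightarrow> 'v \<Rightarrow> real) \<Rightarrow> bool" where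
  "nondeg_on A c \<longleftrightarrow> (\<forall>u\<in>A. (\<forall>v\<in>A. c u v = 0) \<longrightarrow> u = 0)"

lemma orth_basis_nonzero:
  fixes A :: "'v set"
  assumes "symf A c" "subspace A" "nondeg_on A c"
  obtains b where "finite b" "independent b" "span b = A" "pairwise (\<lambda>u v. c u v = 0) b" "\<And>v. v \<in> b \<Longrightarrow> c v v \<noteq> 0"
proof -
  have c: "bilinear c" using assms(1) by (simp add: symf_def)
  obtain b where b: "finite b" "independent b" "span b = A" "pairwise (\<lambda>u v. c u v = 0) b"
    using orth_basis[OF assms(1,2)] by blast
  have nz: "c v v \<noteq> 0" if v: "v \<in> b" for v
  proof
    assume "c v v = 0"
    then have "\<forall>w\<in>b. c v w = 0" using b(4) v by (auto simp: pairwise_def)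
    then have "\<forall>w\<in>A. c v w = 0" using b(3)
      by (auto simp: span_finite[OF b(1)] bilinear_rsum[OF c] bilin[OF c])
    moreover have "v \<in> A" using v b(3) span_base by blast
    ultimately have "v = 0" using assms(3) by (auto simp: nondeg_on_def)
    then show False using v b(2) dependent_zero by blast
  qed
  show ?thesis by (rule that[OF b nz])
qed

lemma riesz:
  fixes A :: "'v set"
  assumes "symf A c" "subspace A" "nondeg_on A c" "linear (\<phi> :: 'v \<Rightarrow> real)"
  shows "\<exists>y\<in>A. \<forall>u\<in>A. c y u = \<phi> u"
proof -
  have c: "bilinear c" using assms(1) by (simp add: symf_def)
  obtain b where b: "finite b" "independent b" "span b = A" "pairwise (\<lambda>u v. c u v = 0) b"
    and nz: "\<And>v. v \<in> b \<Longrightarrow> c v v \<noteq> 0"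
    using orth_basis_nonzero[OF assms(1-3)] by blast
  define y where "y = (\<Sum>v\<in>b. (\<phi> v / c v v) *\<^sub>R v)"
  have "c y w = \<phi> w" if "w \<in> b" for w
    unfolding y_def using orth_quadratic[OF c b(1,4) that, of "\<lambda>v. \<phi> v / c v v"] nz[OF that] by simp
  then have "c y u = \<phi> u" if "u \<in> A" for u
    using that linear_eq_on_span[of "c y" \<phi> b u] assms(4) c b(3) by (auto simp: bilinear_def)
  moreover have "y \<in> A" unfolding y_def b(3)[symmetric] by (intro span_sum span_scale span_base)
  ultimately show ?thesis by blast
qed

lemma nondeg_split:
  fixes A :: "'v set"
  assumes "symf A c" "subspace X" "X \<subseteq> A" "nondeg_on X c" "subspace A" "u \<in> A"
  obtains x y where "x \<in> X" "y \<in> A" "\<And>z. z \<in> X \<Longrightarrow> c y z = 0" "u = x + y"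
proof -
  have c: "bilinear c" using assms(1) by (simp add: symf_def)
  have "symf X c" using assms(1,3) by (rule symf_subset)
  then obtain x where x: "x \<in> X" "\<forall>z\<in>X. c x z = c u z"
    using riesz[of X c "c u"] assms c by (auto simp: bilinear_def)
  show ?thesis
    by (rule that[of x "u - x"]) (use x assms in \<open>auto simp: bilin[OF c] subspace_diff\<close>)
qed

end

section \<open>Nilpotent operators with adjoint \<open>\<plusminus> N\<close>\<close>

lemma linear_funpow: "linear (f :: 'v::real_vector \<Rightarrow> 'v) \<Longrightarrow> linear (f ^^ k)"
proof (induction k)
  case (Suc k)
  then show ?case using linear_compose[of "f ^^ k" f] by (simp add: o_def)
qed (simp add: linear_id)

lemma funpow_funpow: "(f ^^ i) ((f ^^ j) x) = (f ^^ (i + j)) x"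
  by (simp add: funpow_add)

lemma funpow_zero_mono:
  fixes f :: "'v::real_vector \<Rightarrow> 'v"
  assumes "linear f" "(f ^^ i) x = 0" "i \<le> j"
  shows "(f ^^ j) x = 0"
proof -
  have "(f ^^ j) x = (f ^^ (j - i)) ((f ^^ i) x)" using assms(3) by (simp add: funpow_funpow)
  then show ?thesis using assms(2) linear_0[OF linear_funpow[OF assms(1)]] by simp
qed

definition ker_pow :: "('v::real_vector \<Rightarrow> 'v) \<Rightarrow> nat \<Rightarrow> 'v set \<Rightarrow> 'v set" where
  "ker_pow N m A = {u\<in>A. (N ^^ m) u = 0}"

text \<open>The exponent \<open>m - 1\<close> is split evenly, so that for \<open>m = 2 k + 1\<close> the form is the pullback of \<open>B\<close> under
  \<open>N ^ k\<close> and no signs occur when \<open>N\<close> is skew.\<close>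

definition bet :: "('v::real_vector \<Rightarrow> 'v) \<Rightarrow> ('v \<Rightarrow> 'v \<Rightarrow> real) \<Rightarrow> nat \<Rightarrow> 'v \<Rightarrow> 'v \<Rightarrow> real" where
  "bet N B m u v = B ((N ^^ ((m - 1) div 2)) u) ((N ^^ (m div 2)) v)"

lemma subspace_ker_pow: "linear N \<Longrightarrow> subspace A \<Longrightarrow> subspace (ker_pow N m A)"
  unfolding ker_pow_def subspace_def
  by (auto simp: linear_add[OF linear_funpow] linear_scale[OF linear_funpow] linear_0[OF linear_funpow])

lemma ker_pow_subset: "ker_pow N m A \<subseteq> A"
  by (auto simp: ker_pow_def)

lemma bilinear_bet: "bilinear B \<Longrightarrow> linear N \<Longrightarrow> bilinear (bet N B m)"
  unfolding bet_def by (rule bilinear_compose2[OF _ linear_funpow linear_funpow])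

lemma bet_uminus: "bet N (\<lambda>u v. - B u v) m = (\<lambda>u v. - bet N B m u v)"
  by (simp add: bet_def fun_eq_iff)

text \<open>With \<open>e = \<plusminus> 1\<close> and \<open>p = x - e\<close> this is used for the Cayley transform \<open>N = (\<sigma> - e) (\<sigma> + e)\<inverse>\<close> and \<open>S = 0\<close>, and with
  \<open>p = x\<^sup>2 - c x + 1\<close> for \<open>N = \<sigma> + \<sigma>\<inverse> - c\<close> and \<open>S = \<sigma> - \<sigma>\<inverse>\<close>, where \<open>S\<^sup>2 = (N + c)\<^sup>2 - 4\<close>, so \<open>\<omega> = 4 - c\<^sup>2\<close> and
  \<open>t = 2 c\<close>.\<close>

locale nil_sys = fin_dim Bs for Bs :: "'v::real_vector set" +
  fixes U :: "'v set" and N S :: "'v \<Rightarrow> 'v" and \<kappa> \<omega> t :: real and L :: nat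
  assumes subU: "subspace U" and linN: "linear N" and linS: "linear S"
    and NU: "\<And>u. u \<in> U \<Longrightarrow> N u \<in> U" and SU: "\<And>u. u \<in> U \<Longrightarrow> S u \<in> U"
    and commNS: "\<And>u. u \<in> U \<Longrightarrow> N (S u) = S (N u)"
    and nilN: "\<And>u. u \<in> U \<Longrightarrow> (N ^^ L) u = 0"
    and tyNS: "(\<kappa> = - 1 \<and> (\<forall>u\<in>U. S u = 0)) \<or>
      (\<kappa> = 1 \<and> \<omega> > 0 \<and> (\<forall>u\<in>U. S (S u) = - \<omega> *\<^sub>R u + t *\<^sub>R N u + N (N u)))"
begin

definition inv_sub :: "'v set \<Rightarrow> bool" where
  "inv_sub A \<longleftrightarrow> subspace A \<and> A \<subseteq> U \<and> (\<forall>u\<in>A. N u \<in> A \<and> S u \<in> A)"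

definition adm :: "('v \<Rightarrow> 'v \<Rightarrow> real) \<Rightarrow> 'v set \<Rightarrow> bool" where
  "adm B A \<longleftrightarrow> inv_sub A \<and> symf A B \<and> nondeg_on A B \<and>
     (\<forall>u\<in>A. \<forall>v\<in>A. B (N u) v = \<kappa> * B u (N v) \<and> B (S u) v = - B u (S v))"

text \<open>The exponents whose form has an index. For \<kappa> = -1 and \<open>m\<close> even,
  \<open>N ^^ (m - 1)\<close> is skew, so \<open>bet N B m\<close> is alternating.\<close>

definition valid :: "nat \<Rightarrow> bool" where
  "valid m \<longleftrightarrow> 1 \<le> m \<and> (\<kappa> = 1 \<or> odd m)"

text \<open>The real dimension of the residue field of the component, that is the degree of the
  underlying polynomial.\<close>

definition res_deg :: nat where
  "res_deg = (if \<kappa> = 1 then 2 else 1)"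

lemma kappa: "\<kappa> = 1 \<or> \<kappa> = - 1" "\<kappa> * \<kappa> = 1" "\<kappa> \<noteq> 0"
  using tyNS by auto

lemma linNp: "linear (N ^^ k)" by (rule linear_funpow[OF linN])

lemmas Np_simps = linear_add[OF linNp] linear_scale[OF linNp] linear_0[OF linNp]
  linear_diff[OF linNp] linear_neg[OF linNp]

lemma inv_subD:
  assumes "inv_sub A"
  shows "subspace A" "A \<subseteq> U" "u \<in> A \<Longrightarrow> N u \<in> A" "u \<in> A \<Longrightarrow> S u \<in> A"
  using assms by (auto simp: inv_sub_def)

lemma Np_in: "inv_sub A \<Longrightarrow> u \<in> A \<Longrightarrow> (N ^^ k) u \<in> A"
  by (induction k) (auto simp: inv_sub_def)

lemma S_Np: "u \<in> U \<Longrightarrow> S ((N ^^ k) u) = (N ^^ k) (S u)"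
proof (induction k)
  case (Suc k)
  have "(N ^^ k) u \<in> U" using Np_in[of U] Suc subU NU SU by (auto simp: inv_sub_def)
  then show ?case using Suc commNS[of "(N ^^ k) u"] by simp
qed simp

lemma admD:
  assumes "adm B A"
  shows "inv_sub A" "symf A B" "nondeg_on A B" "bilinear B" "subspace A" "A \<subseteq> U"
    "u \<in> A \<Longrightarrow> v \<in> A \<Longrightarrow> B u v = B v u"
    "u \<in> A \<Longrightarrow> v \<in> A \<Longrightarrow> B (N u) v = \<kappa> * B u (N v)"
    "u \<in> A \<Longrightarrow> v \<in> A \<Longrightarrow> B (S u) v = - B u (S v)"
  using assms by (auto simp: adm_def symf_def inv_sub_def)

lemma adj_Np:
  assumes "adm B A" "u \<in> A" "v \<in> A"
  shows "B ((N ^^ k) u) v = \<kappa> ^ k * B u ((N ^^ k) v)"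
  using assms(3)
proof (induction k arbitrary: v)
  case (Suc k)
  have "B ((N ^^ Suc k) u) v = \<kappa> * B ((N ^^ k) u) (N v)"
    using Suc admD(8)[OF assms(1), of "(N ^^ k) u" v] Np_in[OF admD(1)[OF assms(1)] assms(2)] by simp
  also have "\<dots> = \<kappa> * (\<kappa> ^ k * B u ((N ^^ k) (N v)))"
    using Suc inv_subD(3)[OF admD(1)[OF assms(1)]] by simp
  finally show ?case by (simp add: funpow_swap1)
qed simp

lemma bet_eq:
  assumes "adm B A" "u \<in> A" "v \<in> A" "1 \<le> m"
  shows "bet N B m u v = \<kappa> ^ ((m - 1) div 2) * B u ((N ^^ (m - 1)) v)"
proof -
  have "(m - 1) div 2 + m div 2 = m - 1" using assms(4) by presburger
  then show ?thesis unfolding bet_def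
    using adj_Np[OF assms(1,2), of "(N ^^ (m div 2)) v"] Np_in[OF admD(1)[OF assms(1)] assms(3)]
    by (simp add: funpow_funpow)
qed

lemma kappa_pow_valid: "valid m \<Longrightarrow> \<kappa> ^ (m - 1) = 1"
  using kappa by (auto simp: valid_def)

lemma symf_bet:
  assumes "adm B A" "valid m"
  shows "symf A (bet N B m)"
proof -
  have "bet N B m u v = bet N B m v u" if "u \<in> A" "v \<in> A" for u v
    using bet_eq[OF assms(1), of u v m] bet_eq[OF assms(1), of v u m] that assms(2)
      adj_Np[OF assms(1), of u v "m - 1"] kappa_pow_valid[OF assms(2)]
      admD(7)[OF assms(1) _ that(2), of "(N ^^ (m - 1)) u"] Np_in[OF admD(1)[OF assms(1)] that(1)]
    by (simp add: valid_def)
  then show ?thesis using bilinear_bet[OF admD(4)[OF assms(1)] linN] by (simp add: symf_def)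
qed

lemma symf_bet_ker:
  assumes "adm B A" "valid m"
  shows "symf (ker_pow N m A) (bet N B m)"
  using symf_bet[OF assms] ker_pow_subset by (rule symf_subset)

lemma adm_uminus: "adm B A \<Longrightarrow> adm (\<lambda>u v. - B u v) A"
  unfolding adm_def by (auto simp: symf_uminus nondeg_on_def)

text \<open>Telescoping from \<open>c 0 = B\<close> to \<open>c L\<close>, which vanishes by
  nilpotency; each difference is the signature of one form on a kernel, by
  \<open>sgn_index_perp\<close>.\<close>

lemma sgn_formula:
  assumes "adm B A"
  shows "sgn_index B A = (\<Sum>k<L. sgn_index (bet N B (2*k+1)) (ker_pow N (2*k+1) A))"
proof -
  define c where "c k = bet N B (2*k+1)" for k
  have c: "c k u v = B ((N ^^ k) u) ((N ^^ k) v)" for k u v by (simp add: c_def bet_def)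
  have A: "subspace A" "inv_sub A" using admD[OF assms] by auto
  have sy: "symf A (c k)" for k unfolding c_def by (rule symf_bet[OF assms]) (simp add: valid_def)
  have NA: "N ` A \<subseteq> A" "subspace (N ` A)"
    using inv_subD[OF A(2)] linear_subspace_image[OF linN] by auto
  \<comment> \<open>\<open>c (Suc k)\<close> on \<open>A\<close> is \<open>c k\<close> on \<open>N ` A\<close>, whose complement with respect to \<open>c k\<close> is \<open>ker N ^ (2 k + 1)\<close>.\<close>
  have step: "sgn_index (c k) A = sgn_index (c (Suc k)) A + sgn_index (c k) (ker_pow N (2*k+1) A)" for k
  proof -
    have "{x\<in>A. \<forall>y\<in>N ` A. c k x y = 0} = ker_pow N (2*k+1) A"
    proof -
      have "(\<forall>y\<in>N ` A. c k x y = 0) \<longleftrightarrow> (N ^^ (2*k+1)) x = 0" if x: "x \<in> A" for x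
      proof -
        have e: "c k x (N y) = \<kappa> ^ k * \<kappa> ^ (2*k+1) * B ((N ^^ (2*k+1)) x) y" if y: "y \<in> A" for y
        proof -
          have "c k x (N y) = \<kappa> ^ k * B x ((N ^^ k) ((N ^^ k) (N y)))"
            unfolding c using x y A(2) by (intro adj_Np[OF assms]) (auto intro: Np_in inv_subD)
          also have "(N ^^ k) ((N ^^ k) (N y)) = (N ^^ (2*k+1)) y"
          proof -
            have "(N ^^ k) ((N ^^ k) ((N ^^ 1) y)) = (N ^^ (k + (k + 1))) y"
              by (simp only: funpow_funpow)
            moreover have "k + (k + 1) = 2*k+1" "(N ^^ 1) y = N y" by simp_all
            ultimately show ?thesis by metis
          qed
          also have "B x ((N ^^ (2*k+1)) y) = \<kappa> ^ (2*k+1) * B ((N ^^ (2*k+1)) x) y"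
            using adj_Np[OF assms x y, of "2*k+1"] kappa by auto
          finally show ?thesis by (simp add: mult.assoc)
        qed
        have "(\<forall>y\<in>N ` A. c k x y = 0) \<longleftrightarrow> (\<forall>y\<in>A. B ((N ^^ (2*k+1)) x) y = 0)"
          using e kappa(3) by auto
        then show ?thesis using admD(3)[OF assms] Np_in[OF A(2) x, of "2*k+1"]
          by (auto simp: nondeg_on_def bilin[OF admD(4)[OF assms]] simp del: funpow.simps)
      qed
      then show ?thesis by (auto simp: ker_pow_def)
    qed
    moreover have "sgn_index (c k) (N ` A) = sgn_index (c (Suc k)) A"
      using sgn_index_image[OF linN symf_subset[OF sy NA(1)] A(1), of k]
      by (simp add: c funpow_swap1 cong: sgn_index_cong)
    ultimately show ?thesis using sgn_index_perp[OF sy A(1) NA(2,1), of k] by simp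
  qed
  have tele: "sgn_index (c 0) A = (\<Sum>k<n. sgn_index (c k) (ker_pow N (2*k+1) A)) + sgn_index (c n) A" for n
  proof (induction n)
    case (Suc n)
    then show ?case using step[of n] by simp
  qed simp
  have "sgn_index (c L) A = 0"
  proof -
    have "c L u u = 0" if "u \<in> A" for u
      using nilN[of u] that inv_subD(2)[OF A(2)] by (auto simp: c bilin[OF admD(4)[OF assms]])
    then show ?thesis using pos_index_nonpos[of A "c L"] pos_index_nonpos[of A "\<lambda>u v. - c L u v"] A(1)
      by (simp add: sgn_index_def)
  qed
  moreover have "c 0 = B" by (simp add: fun_eq_iff c)
  ultimately show ?thesis using tele[of L] by (simp add: c_def)
qed

text \<open>The radical of \<open>bet N B m\<close> on \<open>ker N ^ m\<close>; it does not depend on \<open>B\<close>.\<close>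

definition rad_pow :: "nat \<Rightarrow> 'v set \<Rightarrow> 'v set" where
  "rad_pow m A = {a + N w | a w. a \<in> ker_pow N (m - 1) A \<and> w \<in> ker_pow N (m + 1) A}"

text \<open>The radical comes out as \<open>rad_pow m A\<close>, which involves \<open>N\<close>
  alone. So the sum of the two indices is common to all admissible forms on \<open>A\<close>, and
  either index determines the other.\<close>

lemma bet_rank:
  assumes "adm B A" "valid m"
  shows "pos_index (bet N B m) (ker_pow N m A) + neg_index (bet N B m) (ker_pow N m A)
     + dim (rad_pow m A) = dim (ker_pow N m A)"
proof -
  have A: "subspace A" "inv_sub A" and B: "bilinear B" using admD[OF assms(1)] by auto
  have m: "1 \<le> m" using assms(2) by (simp add: valid_def)
  have sm: "(N ^^ m) x = (N ^^ (m - 1)) (N x)" "(N ^^ m) x = N ((N ^^ (m - 1)) x)" for x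
    using m by (cases m; simp add: funpow_swap1)+
  have "{u \<in> ker_pow N m A. \<forall>v\<in>ker_pow N m A. bet N B m u v = 0} = rad_pow m A"
  proof
    show "rad_pow m A \<subseteq> {u \<in> ker_pow N m A. \<forall>v\<in>ker_pow N m A. bet N B m u v = 0}"
    proof clarify
      fix x assume "x \<in> rad_pow m A"
      then obtain a w where x: "x = a + N w" "a \<in> ker_pow N (m - 1) A" "w \<in> ker_pow N (m + 1) A"
        by (auto simp: rad_pow_def)
      have aw: "a \<in> A" "w \<in> A" "(N ^^ (m - 1)) a = 0" "(N ^^ m) (N w) = 0"
        using x by (auto simp: ker_pow_def funpow_swap1)
      then have xA: "x \<in> A" using x(1) A by (auto intro: subspace_add inv_subD)
      have "(N ^^ m) a = 0" using aw(3) linear_0[OF linN] by (simp add: sm(2))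
      then have "x \<in> ker_pow N m A" using xA aw by (simp add: ker_pow_def x(1) Np_simps)
      moreover have "bet N B m x v = 0" if v: "v \<in> ker_pow N m A" for v
      proof -
        have vA: "v \<in> A" "(N ^^ m) v = 0" using v by (auto simp: ker_pow_def)
        have "B (N w) ((N ^^ (m - 1)) v) = \<kappa> * B w ((N ^^ m) v)"
          using admD(8)[OF assms(1) aw(2)] Np_in[OF A(2) vA(1)] by (simp add: sm(2))
        moreover have "B a ((N ^^ (m - 1)) v) = 0"
          using adj_Np[OF assms(1) aw(1) vA(1), of "m - 1"] aw(3) kappa(3) by (simp add: bilin[OF B])
        ultimately show ?thesis
          using bet_eq[OF assms(1) xA vA(1) m] vA(2) by (simp add: x(1) bilin[OF B])
      qed
      ultimately show "x \<in> ker_pow N m A \<and> (\<forall>v\<in>ker_pow N m A. bet N B m x v = 0)" by blast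
    qed
    show "{u \<in> ker_pow N m A. \<forall>v\<in>ker_pow N m A. bet N B m u v = 0} \<subseteq> rad_pow m A"
    proof clarify
      fix x assume x: "x \<in> ker_pow N m A" and x0: "\<forall>v\<in>ker_pow N m A. bet N B m x v = 0"
      have xA: "x \<in> A" "(N ^^ m) x = 0" using x by (auto simp: ker_pow_def)
      define y where "y = (N ^^ (m - 1)) x"
      have yA: "y \<in> A" unfolding y_def by (rule Np_in[OF A(2) xA(1)])
      have y0: "B y v = 0" if v: "v \<in> ker_pow N m A" for v
      proof -
        have vA: "v \<in> A" using v by (simp add: ker_pow_def)
        show ?thesis using adj_Np[OF assms(1) xA(1) vA, of "m - 1"] x0 v bet_eq[OF assms(1) xA(1) vA m] kappa(3)
          by (auto simp: y_def)
      qed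
      \<comment> \<open>\<open>y\<close> annihilates the kernel of \<open>N ^^ m\<close>, so
        \<open>B y\<close> factors through \<open>N ^^ m\<close>. Composing with a right inverse
        \<open>g\<close> and representing the resulting functional by \<open>z\<close> exhibits
        \<open>y\<close> as a multiple of \<open>(N ^^ m) z\<close>: the annihilator of a kernel is
        the image of the adjoint.\<close>
      obtain g where g: "range g \<subseteq> A" "linear g" "\<forall>v\<in>(N ^^ m) ` A. (N ^^ m) (g v) = v"
        using linear_exists_right_inverse_on[OF linNp A(1)] by blast
      have "linear (\<lambda>v. B y (g v))"
        using linear_compose[OF g(2), of "B y"] B by (simp add: bilinear_def o_def)
      then obtain z where z: "z \<in> A" "\<forall>v\<in>A. B z v = B y (g v)"
        using riesz[OF admD(2)[OF assms(1)] A(1) admD(3)[OF assms(1)]] by blast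
      have "B (\<kappa> ^ m *\<^sub>R (N ^^ m) z - y) v = 0" if v: "v \<in> A" for v
      proof -
        have "B ((N ^^ m) z) v = \<kappa> ^ m * B z ((N ^^ m) v)" by (rule adj_Np[OF assms(1) z(1) v])
        also have "B z ((N ^^ m) v) = B y (g ((N ^^ m) v))" using z(2) Np_in[OF A(2) v] by blast
        also have "\<dots> = B y v"
        proof -
          have "g ((N ^^ m) v) - v \<in> ker_pow N m A"
            using g v A(1) by (auto simp: ker_pow_def Np_simps intro!: subspace_diff)
          then show ?thesis using y0[of "g ((N ^^ m) v) - v"] by (simp add: bilin[OF B])
        qed
        finally have "B (\<kappa> ^ m *\<^sub>R (N ^^ m) z) v = (\<kappa> * \<kappa>) ^ m * B y v"
          by (simp add: bilin[OF B] power_mult_distrib)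
        then show ?thesis using kappa by (simp add: bilin[OF B])
      qed
      moreover have "\<kappa> ^ m *\<^sub>R (N ^^ m) z - y \<in> A"
        using A(1) yA Np_in[OF A(2) z(1)] by (intro subspace_diff subspace_scale)
      ultimately have yz: "y = \<kappa> ^ m *\<^sub>R (N ^^ m) z"
        using admD(3)[OF assms(1)] by (auto simp: nondeg_on_def)
      define w where "w = \<kappa> ^ m *\<^sub>R z"
      have wA: "w \<in> A" unfolding w_def using A(1) z(1) by (rule subspace_scale)
      have yw: "(N ^^ (m - 1)) (N w) = (N ^^ (m - 1)) x"
        using yz by (simp add: w_def Np_simps sm(1) linear_scale[OF linN] y_def)
      have "(N ^^ (m + 1)) w = N ((N ^^ (m - 1)) (N w))" by (simp add: sm)
      also have "\<dots> = 0" unfolding yw using xA(2) sm(2) by metis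
      finally have "w \<in> ker_pow N (m + 1) A" using wA by (simp add: ker_pow_def)
      moreover have "x - N w \<in> ker_pow N (m - 1) A"
        using xA(1) inv_subD(3)[OF A(2) wA] A(1) yw by (simp add: ker_pow_def Np_simps subspace_diff)
      ultimately show "x \<in> rad_pow m A" unfolding rad_pow_def
        by (intro CollectI exI[of _ "x - N w"] exI[of _ w]) simp
    qed
  qed
  then show ?thesis using index_rank[OF symf_bet_ker[OF assms] subspace_ker_pow[OF linN A(1)]] by simp
qed

end

text \<open>\<open>S\<close> is skew and scales the form by a positive factor, so it acts like a
  multiple of a complex structure: a vector of positive square is orthogonal to its image, which
  again has positive square, and such planes split off one after the other.\<close>

lemma (in fin_dim) even_pos_index:
  fixes A :: "'v set"
  assumes "symf A c" "subspace A" "linear S" "\<And>u. u \<in> A \<Longrightarrow> S u \<in> A" "(\<omega>::real) > 0"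
    and "\<And>u v. u \<in> A \<Longrightarrow> v \<in> A \<Longrightarrow> c (S u) v = - c u (S v)"
    and "\<And>u v. u \<in> A \<Longrightarrow> v \<in> A \<Longrightarrow> c (S u) (S v) = \<omega> * c u v"
  shows "even (pos_index c A)"
  using assms(1,2,4,6,7)
proof (induction "dim A" arbitrary: A rule: less_induct)
  case less
  have c: "bilinear c" and sym: "\<And>u v. u \<in> A \<Longrightarrow> v \<in> A \<Longrightarrow> c u v = c v u"
    using less.prems(1) by (auto simp: symf_def)
  show ?case
  proof (cases "\<forall>u\<in>A. c u u \<le> 0")
    case True
    then show ?thesis using pos_index_nonpos[of A c] less.prems by simp
  next
    case False
    then obtain u where u: "u \<in> A" "c u u > 0" by force
    have Su: "S u \<in> A" using less.prems(3) u by blast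
    have S0: "c u (S u) = 0" "c (S u) u = 0" "c (S u) (S u) > 0"
      using less.prems(4)[OF u(1) u(1)] sym[OF u(1) Su] less.prems(5)[OF u(1) u(1)] u assms(5) by auto
    define P where "P = {x\<in>A. c x u = 0 \<and> c x (S u) = 0}"
    have P: "subspace P" "P \<subseteq> A" unfolding P_def using less.prems(2) by (auto simp: subspace_def bilin[OF c])
    have "u \<notin> P" using u by (simp add: P_def)
    then have "P \<subset> A" using u(1) P(2) by blast
    then have "dim P < dim A"
      using P less.prems(2) fd.dim_psubset[of P A] by (simp add: span_eq_iff[THEN iffD2])
    moreover have "S x \<in> P" if "x \<in> P" for x
      using that less.prems(3-5) u by (auto simp: P_def)
    ultimately have ev: "even (pos_index c P)"
      using P less.prems symf_subset[OF less.prems(1) P(2)] by (intro less.hyps) (auto simp: subset_iff)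
    have HA: "span {u, S u} \<subseteq> A" using u Su less.prems(2) by (intro span_minimal) auto
    have eq: "span (span {u, S u} \<union> P) = A"
    proof
      show "span (span {u, S u} \<union> P) \<subseteq> A" using HA P less.prems(2) by (intro span_minimal) auto
      show "A \<subseteq> span (span {u, S u} \<union> P)"
      proof
        fix x assume x: "x \<in> A"
        define h where "h = (c x u / c u u) *\<^sub>R u + (c x (S u) / c (S u) (S u)) *\<^sub>R S u"
        have "x - h \<in> P" unfolding P_def h_def using x u Su S0 less.prems(2)
          by (auto intro!: subspace_diff subspace_add subspace_scale simp: bilin[OF c])
        moreover have "h \<in> span {u, S u}" unfolding h_def by (intro span_add span_scale span_base) auto
        ultimately have "h + (x - h) \<in> span (span {u, S u} \<union> P)" by (rule sum_in_span_Un[rotated])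
        then show "x \<in> span (span {u, S u} \<union> P)" by simp
      qed
    qed
    have "pos_index c (span (span {u, S u} \<union> P)) = pos_index c (span {u, S u}) + pos_index c P"
    proof (rule pos_index_sum)
      fix x y assume xy: "x \<in> span {u, S u}" "y \<in> P"
      then have "y \<in> A" "c u y = 0" "c (S u) y = 0"
        using sym[of u y] sym[of "S u" y] u Su by (auto simp: P_def)
      with xy(1) have "x \<in> {x. c x y = 0}" by (induction rule: span_induct) (auto simp: subspace_def bilin[OF c])
      then show "c x y = 0" by simp
    qed (use less.prems eq P in auto)
    moreover have "pos_index c (span {u, S u}) = 2"
    proof -
      have "u \<noteq> S u" using S0 u by auto
      moreover have "{v \<in> {u, S u}. 0 < c v v} = {u, S u}" using u S0 by auto
      moreover have "pairwise (\<lambda>u v. c u v = 0) {u, S u}" using S0 by (auto simp: pairwise_def)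
      ultimately show ?thesis
        using pos_index_orth[of "{u, S u}" c] symf_subset[OF less.prems(1) HA] by simp
    qed
    ultimately show ?thesis using ev unfolding eq by simp
  qed
qed

context nil_sys begin

lemma inv_sub_ker: "inv_sub A \<Longrightarrow> inv_sub (ker_pow N m A)"
proof -
  assume A: "inv_sub A"
  have "N u \<in> ker_pow N m A \<and> S u \<in> ker_pow N m A" if "u \<in> ker_pow N m A" for u
  proof -
    have u: "u \<in> A" "(N ^^ m) u = 0" "u \<in> U" using that inv_subD[OF A] by (auto simp: ker_pow_def)
    have "(N ^^ m) (S u) = 0" using S_Np[OF u(3), of m] u(2) by (simp add: linear_0[OF linS])
    moreover have "(N ^^ m) (N u) = 0" using u(2) by (simp add: linear_0[OF linN] flip: funpow_swap1)
    ultimately show ?thesis using u inv_subD[OF A] by (simp add: ker_pow_def)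
  qed
  then show ?thesis using subspace_ker_pow[OF linN] A ker_pow_subset[of N m A] by (auto simp: inv_sub_def)
qed

text \<open>For \<kappa> = 1 the terms of \<open>S (S v)\<close> that contain \<open>N\<close> pair
  to zero on the kernel of \<open>N ^^ m\<close>. Hence \<open>S\<close> scales \<open>bet\<close>
  by \<omega>, and up to its radical the form is the real part of a Hermitian one.\<close>

lemma res_deg_dvd_index:
  assumes "adm B A" "valid m"
  shows "res_deg dvd pos_index (bet N B m) (ker_pow N m A)"
proof (cases "\<kappa> = 1")
  case True
  then have w: "\<omega> > 0" and SS: "\<And>u. u \<in> U \<Longrightarrow> S (S u) = - \<omega> *\<^sub>R u + t *\<^sub>R N u + N (N u)" using tyNS by auto
  have A: "inv_sub A" "bilinear B" "A \<subseteq> U" using admD[OF assms(1)] by auto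
  have m: "1 \<le> m" using assms(2) by (simp add: valid_def)
  have K: "inv_sub (ker_pow N m A)" by (rule inv_sub_ker[OF A(1)])
  have b: "bet N B m u v = B u ((N ^^ (m - 1)) v)" if "u \<in> A" "v \<in> A" for u v
    using bet_eq[OF assms(1) that m] True by simp
  have sk: "bet N B m (S u) v = - bet N B m u (S v)" if "u \<in> ker_pow N m A" "v \<in> ker_pow N m A" for u v
  proof -
    have uv: "u \<in> A" "v \<in> A" "S u \<in> A" "S v \<in> A" "v \<in> U" using that A inv_subD[OF A(1)] by (auto simp: ker_pow_def)
    have "B (S u) ((N ^^ (m - 1)) v) = - B u (S ((N ^^ (m - 1)) v))"
      using admD(9)[OF assms(1) uv(1)] Np_in[OF A(1) uv(2)] by blast
    then show ?thesis using b uv S_Np[OF uv(5)] by simp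
  qed
  have bN: "bet N B m u (N v) = 0" if "u \<in> A" "v \<in> ker_pow N m A" for u v
  proof -
    have "(N ^^ (m - 1)) (N v) = (N ^^ m) v" using m by (cases m) (auto simp: funpow_swap1)
    then show ?thesis using that b[of u "N v"] inv_subD(3)[OF A(1)] by (simp add: ker_pow_def bilin[OF A(2)])
  qed
  have "even (pos_index (bet N B m) (ker_pow N m A))"
  proof (rule even_pos_index[where c = "bet N B m" and S = S, OF symf_bet_ker[OF assms] inv_subD(1)[OF K] linS _ w])
    show "S u \<in> ker_pow N m A" if "u \<in> ker_pow N m A" for u
      using that by (rule inv_subD(4)[OF K])
    show "bet N B m (S u) v = - bet N B m u (S v)" if "u \<in> ker_pow N m A" "v \<in> ker_pow N m A" for u v
      using that by (rule sk)
    fix u v assume uv: "u \<in> ker_pow N m A" "v \<in> ker_pow N m A"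
    have "bet N B m (S u) (S v) = - bet N B m u (S (S v))"
      using uv inv_subD(4)[OF K] by (intro sk)
    also have "\<dots> = \<omega> * bet N B m u v"
      using SS[of v] uv bN[of u v] bN[of u "N v"] inv_subD(3)[OF K] A(3)
      by (simp add: ker_pow_def subset_iff bilin[OF bilinear_bet[OF A(2) linN]])
    finally show "bet N B m (S u) (S v) = \<omega> * bet N B m u v" .
  qed
  then show ?thesis by (simp add: res_deg_def)
qed (simp add: res_deg_def)

end

section \<open>Partial isometries and orthogonal splitting\<close>

text \<open>Partial isometries are handled as their graphs, so that no basis has to be chosen.\<close>

definition corr :: "('v::real_vector \<times> 'v) set \<Rightarrow> ('v \<Rightarrow> 'v \<Rightarrow> real) \<Rightarrow> 'v set \<Rightarrow> ('v \<Rightarrow> 'v \<Rightarrow> real) \<Rightarrow> 'v set \<Rightarrow> bool" where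
  "corr \<Gamma> B A B' A' \<longleftrightarrow> subspace \<Gamma> \<and> fst ` \<Gamma> = A \<and> snd ` \<Gamma> = A' \<and>
     (\<forall>x x' y y'. (x, x') \<in> \<Gamma> \<longrightarrow> (y, y') \<in> \<Gamma> \<longrightarrow> B x y = B' x' y')"

text \<open>For the graph of a map this says that the map commutes with \<open>f\<close>.\<close>

definition pair_inv :: "('v \<Rightarrow> 'v) \<Rightarrow> ('v \<times> 'v) set \<Rightarrow> bool" where
  "pair_inv f \<Gamma> \<longleftrightarrow> (\<forall>x x'. (x, x') \<in> \<Gamma> \<longrightarrow> (f x, f x') \<in> \<Gamma>)"

lemma corr_add: "corr \<Gamma> B A B' A' \<Longrightarrow> (x, x') \<in> \<Gamma> \<Longrightarrow> (y, y') \<in> \<Gamma> \<Longrightarrow> (x + y, x' + y') \<in> \<Gamma>"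
  unfolding corr_def using subspace_add[of \<Gamma> "(x, x')" "(y, y')"] by simp

lemma corr_scale: "corr \<Gamma> B A B' A' \<Longrightarrow> (x, x') \<in> \<Gamma> \<Longrightarrow> (a *\<^sub>R x, a *\<^sub>R x') \<in> \<Gamma>"
  unfolding corr_def using subspace_scale[of \<Gamma> "(x, x')" a] by simp

lemma pair_inv_span:
  assumes "linear f" "\<And>x x'. (x, x') \<in> G \<Longrightarrow> (f x, f x') \<in> span G"
  shows "pair_inv f (span G)"
proof -
  have "(\<lambda>p. (f (fst p), f (snd p))) p \<in> span G" if "p \<in> span G" for p
    using that
  proof (induction rule: span_induct_alt)
    case base
    then show ?case using linear_0[OF assms(1)] span_zero[of G] by (simp add: zero_prod_def)
  next
    case (step c p q)
    obtain x x' y y' where p: "p = (x, x')" "q = (y, y')" by fastforce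
    have "c *\<^sub>R (f x, f x') + (f y, f y') \<in> span G"
      using step assms(2)[of x x'] unfolding p by (intro span_add span_scale) auto
    then show ?case by (simp add: p linear_add[OF assms(1)] linear_scale[OF assms(1)])
  qed
  then show ?thesis by (fastforce simp: pair_inv_def)
qed

lemma corr_span:
  assumes "bilinear B" "bilinear B'"
    and "\<And>x x' y y'. (x, x') \<in> G \<Longrightarrow> (y, y') \<in> G \<Longrightarrow> B x y = B' x' y'"
  shows "corr (span G) B (span (fst ` G)) B' (span (snd ` G))"
proof -
  have "B (fst p) (fst q) = B' (snd p) (snd q)" if "p \<in> span G" "q \<in> span G" for p q
  proof -
    have b: "bilinear (\<lambda>p q. B (fst p) (fst q))" "bilinear (\<lambda>p q. B' (snd p) (snd q))"
      using assms(1,2) by (auto simp: bilinear_def linear_iff)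
    show ?thesis
      by (rule bilinear_eq[OF b order_refl order_refl that]) (use assms(3) in auto)
  qed
  then show ?thesis unfolding corr_def
    by (force simp: linear_span_image[OF linear_fst] linear_span_image[OF linear_snd])
qed

lemma corr_sum:
  assumes "corr \<Gamma> B A B' A'" "corr \<Delta> B C B' C'" "bilinear B" "bilinear B'"
    and "\<And>x y. x \<in> A \<Longrightarrow> y \<in> C \<Longrightarrow> B x y = 0 \<and> B y x = 0"
    and "\<And>x y. x \<in> A' \<Longrightarrow> y \<in> C' \<Longrightarrow> B' x y = 0 \<and> B' y x = 0"
  shows "corr (span (\<Gamma> \<union> \<Delta>)) B (span (A \<union> C)) B' (span (A' \<union> C'))"
proof -
  have "fst ` (\<Gamma> \<union> \<Delta>) = A \<union> C" "snd ` (\<Gamma> \<union> \<Delta>) = A' \<union> C'"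
    using assms(1,2) by (auto simp: corr_def image_Un)
  moreover have "B x y = B' x' y'" if "(x, x') \<in> \<Gamma> \<union> \<Delta>" "(y, y') \<in> \<Gamma> \<union> \<Delta>" for x x' y y'
  proof -
    have m: "x \<in> A \<and> x' \<in> A'" if "(x, x') \<in> \<Gamma>" for x x' using that assms(1) by (force simp: corr_def)
    have n: "x \<in> C \<and> x' \<in> C'" if "(x, x') \<in> \<Delta>" for x x' using that assms(2) by (force simp: corr_def)
    have "B x y = B' x' y'" if "(x, x') \<in> \<Gamma>" "(y, y') \<in> \<Gamma>"
      using that assms(1) by (simp add: corr_def)
    moreover have "B x y = B' x' y'" if "(x, x') \<in> \<Delta>" "(y, y') \<in> \<Delta>"
      using that assms(2) by (simp add: corr_def)
    moreover have "B x y = B' x' y'" if "(x, x') \<in> \<Gamma>" "(y, y') \<in> \<Delta>"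
      using assms(5)[of x y] assms(6)[of x' y'] m[OF that(1)] n[OF that(2)] by simp
    moreover have "B x y = B' x' y'" if "(x, x') \<in> \<Delta>" "(y, y') \<in> \<Gamma>"
      using assms(5)[of y x] assms(6)[of y' x'] m[OF that(2)] n[OF that(1)] by simp
    ultimately show ?thesis using that by blast
  qed
  ultimately show ?thesis using corr_span[OF assms(3,4), of "\<Gamma> \<union> \<Delta>"] by simp
qed

lemma pair_inv_sum:
  assumes "linear f" "pair_inv f \<Gamma>" "pair_inv f \<Delta>"
  shows "pair_inv f (span (\<Gamma> \<union> \<Delta>))"
  using assms(2,3) by (intro pair_inv_span[OF assms(1)] span_base) (auto simp: pair_inv_def)

text \<open>Nondegeneracy forces the relation to be a graph: for a pair \<open>(0, x')\<close> in
  it, \<open>x'\<close> is orthogonal to all of \<open>A'\<close>. The same argument on the other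
  side gives injectivity.\<close>

lemma (in fin_dim) corr_map:
  fixes A :: "'v set"
  assumes "corr \<Gamma> B A B' A'" "bilinear B" "bilinear B'" "nondeg_on A B" "nondeg_on A' B'"
  shows "\<exists>h. linear h \<and> h ` A = A' \<and> inj_on h A \<and> (\<forall>x\<in>A. (x, h x) \<in> \<Gamma>) \<and> (\<forall>x x'. (x, x') \<in> \<Gamma> \<longrightarrow> x' = h x)
    \<and> (\<forall>x\<in>A. \<forall>y\<in>A. B x y = B' (h x) (h y))"
proof -
  have G: "subspace \<Gamma>" "fst ` \<Gamma> = A" "snd ` \<Gamma> = A'"
    and eq: "\<And>x x' y y'. (x, x') \<in> \<Gamma> \<Longrightarrow> (y, y') \<in> \<Gamma> \<Longrightarrow> B x y = B' x' y'"
    using assms(1) by (auto simp: corr_def)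
  have subA: "subspace A" using G linear_subspace_image[OF linear_fst G(1)] by simp
  have uniq0: "x' = 0" if "(0, x') \<in> \<Gamma>" for x'
  proof -
    have "\<forall>y'\<in>A'. B' x' y' = 0"
    proof
      fix y' assume "y' \<in> A'"
      then obtain y where "(y, y') \<in> \<Gamma>" using G(3) by force
      then show "B' x' y' = 0" using eq[OF that, of y y'] by (simp add: bilin[OF assms(2)])
    qed
    moreover have "x' \<in> A'" using that G(3) by force
    ultimately show ?thesis using assms(5) by (auto simp: nondeg_on_def)
  qed
  have uniq: "x' = x''" if "(x, x') \<in> \<Gamma>" "(x, x'') \<in> \<Gamma>" for x x' x''
    using uniq0[of "x' - x''"] subspace_diff[OF G(1) that] by simp
  obtain b where b: "b \<subseteq> A" "independent b" "A \<subseteq> span b" "card b = dim A"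
    using fd.basis_exists[of A] by blast
  have "\<forall>x\<in>A. \<exists>x'. (x, x') \<in> \<Gamma>" using G(2) by force
  then obtain f where f: "\<And>x. x \<in> A \<Longrightarrow> (x, f x) \<in> \<Gamma>" by metis
  obtain h where h: "linear h" "\<forall>x\<in>b. h x = f x" using linear_independent_extend[OF b(2)] by blast
  have hG: "(x, h x) \<in> \<Gamma>" if "x \<in> A" for x
  proof -
    have "subspace {x. (x, h x) \<in> \<Gamma>}"
      using corr_add[OF assms(1)] corr_scale[OF assms(1)] subspace_0[OF G(1)]
      by (auto simp: subspace_def zero_prod_def linear_0[OF h(1)] linear_add[OF h(1)] linear_scale[OF h(1)])
    then have "span b \<subseteq> {x. (x, h x) \<in> \<Gamma>}" using b(1) f h(2) by (intro span_minimal) auto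
    then show ?thesis using that b(3) by blast
  qed
  have mem: "x \<in> A" if "(x, x') \<in> \<Gamma>" for x x' using that G(2) by force
  have iso: "B x y = B' (h x) (h y)" if "x \<in> A" "y \<in> A" for x y using eq hG that by blast
  have val: "x' = h x" if "(x, x') \<in> \<Gamma>" for x x' using uniq[OF that] hG[OF mem[OF that]] by blast
  have "h ` A = A'"
  proof
    show "h ` A \<subseteq> A'" using hG G(3) by force
    show "A' \<subseteq> h ` A"
    proof
      fix x' assume "x' \<in> A'"
      then obtain x where "(x, x') \<in> \<Gamma>" using G(3) by force
      then show "x' \<in> h ` A" using val mem by blast
    qed
  qed
  moreover have "inj_on h A"
  proof -
    have "x = 0" if "x \<in> A" "h x = 0" for x
    proof -
      have "\<forall>y\<in>A. B x y = 0" using iso[OF that(1)] that(2) by (simp add: bilin[OF assms(3)])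
      then show ?thesis using assms(4) that(1) by (auto simp: nondeg_on_def)
    qed
    then show ?thesis
      using linear_inj_on_iff_eq_0[OF h(1) subA] by (simp add: Ball_def)
  qed
  ultimately show ?thesis using h(1) hG iso val by blast
qed

section \<open>Equivalence of forms with operators, and its invariants\<close>

context nil_sys begin

text \<open>On nondegenerate subspaces \<open>corr_map\<close> turns such a relation into an
  isometry that commutes with \<open>N\<close> and \<open>S\<close>.\<close>

definition equivalent :: "('v \<Rightarrow> 'v \<Rightarrow> real) \<Rightarrow> 'v set \<Rightarrow> ('v \<Rightarrow> 'v \<Rightarrow> real) \<Rightarrow> 'v set \<Rightarrow> bool" where
  "equivalent B A B' A' \<longleftrightarrow> (\<exists>\<Gamma>. corr \<Gamma> B A B' A' \<and> pair_inv N \<Gamma> \<and> pair_inv S \<Gamma>)"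

lemma map_invariants:
  assumes "adm B A" "adm B' A'" "linear h" "h ` A = A'" "inj_on h A"
    and "\<And>x. x \<in> A \<Longrightarrow> h (N x) = N (h x)"
    and "\<And>x y. x \<in> A \<Longrightarrow> y \<in> A \<Longrightarrow> B x y = B' (h x) (h y)"
  shows "dim (ker_pow N m A) = dim (ker_pow N m A')"
    and "valid m \<Longrightarrow> pos_index (bet N B m) (ker_pow N m A) = pos_index (bet N B' m) (ker_pow N m A')"
proof -
  have A: "inv_sub A" "subspace A" using admD[OF assms(1)] by auto
  have hN: "h ((N ^^ k) x) = (N ^^ k) (h x)" if "x \<in> A" for k x
    by (induction k) (use assms(6) Np_in[OF A(1) that] in auto)
  have im: "h ` ker_pow N m A = ker_pow N m A'"
  proof -
    have "(N ^^ m) x = 0 \<longleftrightarrow> (N ^^ m) (h x) = 0" if "x \<in> A" for x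
      unfolding hN[OF that, symmetric]
      using linear_inj_on_iff_eq_0[OF assms(3) A(2)] assms(5) Np_in[OF A(1) that, of m] linear_0[OF assms(3)] by auto
    then show ?thesis using assms(4) by (auto simp: ker_pow_def)
  qed
  have sK: "subspace (ker_pow N m A)" by (rule subspace_ker_pow[OF linN A(2)])
  show "dim (ker_pow N m A) = dim (ker_pow N m A')"
    unfolding im[symmetric] using fdp.dim_image_eq[OF assms(3), of "ker_pow N m A"] sK
      inj_on_subset[OF assms(5) ker_pow_subset[of N m A]] by (simp add: span_eq_iff[THEN iffD2])
  show "pos_index (bet N B m) (ker_pow N m A) = pos_index (bet N B' m) (ker_pow N m A')" if "valid m"
  proof -
    have "pos_index (bet N B' m) (h ` ker_pow N m A) = pos_index (\<lambda>u v. bet N B' m (h u) (h v)) (ker_pow N m A)"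
      by (rule pos_index_image[OF assms(3) _ sK]) (use symf_bet_ker[OF assms(2) that] im in simp)
    also have "\<dots> = pos_index (bet N B m) (ker_pow N m A)"
    proof (rule pos_index_cong)
      fix u assume "u \<in> ker_pow N m A"
      then have "u \<in> A" by (simp add: ker_pow_def)
      then show "bet N B' m (h u) (h u) = bet N B m u u"
        unfolding bet_def using hN assms(7) Np_in[OF A(1)] by metis
    qed
    finally show ?thesis using im by simp
  qed
qed

lemma equivalent_invariants:
  assumes "adm B A" "adm B' A'" "equivalent B A B' A'"
  shows "dim (ker_pow N m A) = dim (ker_pow N m A')"
    and "valid m \<Longrightarrow> pos_index (bet N B m) (ker_pow N m A) = pos_index (bet N B' m) (ker_pow N m A')"
proof -
  obtain \<Gamma> where G: "corr \<Gamma> B A B' A'" "pair_inv N \<Gamma>" using assms(3) by (auto simp: equivalent_def)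
  obtain h where h: "linear h" "h ` A = A'" "inj_on h A" "\<forall>x\<in>A. (x, h x) \<in> \<Gamma>" "\<forall>x x'. (x, x') \<in> \<Gamma> \<longrightarrow> x' = h x"
    "\<forall>x\<in>A. \<forall>y\<in>A. B x y = B' (h x) (h y)"
    using corr_map[OF G(1)] admD(3,4)[OF assms(1)] admD(3,4)[OF assms(2)] by blast
  have hN: "h (N x) = N (h x)" if "x \<in> A" for x
  proof -
    have "(N x, N (h x)) \<in> \<Gamma>" using h(4) that G(2) by (auto simp: pair_inv_def)
    then show ?thesis using h(5) by metis
  qed
  show "dim (ker_pow N m A) = dim (ker_pow N m A')"
    by (rule map_invariants[OF assms(1,2) h(1-3) hN]) (use h(6) in auto)
  show "valid m \<Longrightarrow> pos_index (bet N B m) (ker_pow N m A) = pos_index (bet N B' m) (ker_pow N m A')"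
    by (rule map_invariants[OF assms(1,2) h(1-3) hN]) (use h(6) in auto)
qed

definition orth_in :: "('v \<Rightarrow> 'v \<Rightarrow> real) \<Rightarrow> 'v set \<Rightarrow> 'v set \<Rightarrow> 'v set" where
  "orth_in B A X = {y\<in>A. \<forall>x\<in>X. B y x = 0}"

lemma adm_subset: "adm B A \<Longrightarrow> inv_sub X \<Longrightarrow> X \<subseteq> A \<Longrightarrow> nondeg_on X B \<Longrightarrow> adm B X"
  unfolding adm_def by (auto intro: symf_subset)

text \<open>The complement is invariant because the adjoints of \<open>N\<close> and
  \<open>S\<close> are multiples of these operators themselves.\<close>

lemma adm_split:
  assumes "adm B A" "adm B X" "X \<subseteq> A"
  shows "adm B (orth_in B A X)" "span (X \<union> orth_in B A X) = A" "X \<inter> orth_in B A X = {0}"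
proof -
  let ?Y = "orth_in B A X"
  have A: "inv_sub A" "subspace A" "bilinear B" and X: "inv_sub X" "subspace X" "nondeg_on X B"
    using admD[OF assms(1)] admD[OF assms(2)] by auto
  have sY: "subspace ?Y" unfolding orth_in_def using A(2) by (auto simp: subspace_def bilin[OF A(3)])
  have "N y \<in> ?Y \<and> S y \<in> ?Y" if "y \<in> ?Y" for y
  proof -
    have y: "y \<in> A" "\<And>x. x \<in> X \<Longrightarrow> B y x = 0" using that by (auto simp: orth_in_def)
    have "B (N y) x = 0 \<and> B (S y) x = 0" if "x \<in> X" for x
      using admD(8,9)[OF assms(1) y(1), of x] y(2) that inv_subD[OF X(1)] assms(3) by auto
    then show ?thesis using y(1) inv_subD[OF A(1)] by (auto simp: orth_in_def)
  qed
  then have inv: "inv_sub ?Y" using sY inv_subD(2)[OF A(1)] by (auto simp: inv_sub_def orth_in_def)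
  have dec: "\<exists>x y. x \<in> X \<and> y \<in> ?Y \<and> u = x + y" if u: "u \<in> A" for u
  proof -
    obtain x y where "x \<in> X" "y \<in> A" "\<And>z. z \<in> X \<Longrightarrow> B y z = 0" "u = x + y"
      using nondeg_split[OF admD(2)[OF assms(1)] X(2) assms(3) X(3) A(2) u] by metis
    then show ?thesis by (auto simp: orth_in_def)
  qed
  show e: "span (X \<union> ?Y) = A"
  proof
    show "span (X \<union> ?Y) \<subseteq> A" using assms(3) A(2) by (intro span_minimal) (auto simp: orth_in_def)
    show "A \<subseteq> span (X \<union> ?Y)" using dec sum_in_span_Un by blast
  qed
  show "X \<inter> ?Y = {0}" using X subspace_0[OF X(2)] subspace_0[OF sY] by (auto simp: orth_in_def nondeg_on_def)
  have "nondeg_on ?Y B"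
    unfolding nondeg_on_def
  proof (intro ballI impI)
    fix y assume y: "y \<in> ?Y" "\<forall>v\<in>?Y. B y v = 0"
    have "B y u = 0" if u: "u \<in> A" for u
    proof -
      obtain x z where "x \<in> X" "z \<in> ?Y" "u = x + z" using dec[OF u] by blast
      then show ?thesis using y by (simp add: bilin[OF A(3)] orth_in_def)
    qed
    then show "y = 0" using y(1) admD(3)[OF assms(1)] by (auto simp: nondeg_on_def orth_in_def)
  qed
  then show "adm B ?Y" using adm_subset[OF assms(1) inv] by (auto simp: orth_in_def)
qed

lemma ker_pow_sum:
  assumes "inv_sub X" "inv_sub Y" "X \<inter> Y = {0}"
  shows "ker_pow N m (span (X \<union> Y)) = span (ker_pow N m X \<union> ker_pow N m Y)"
proof -
  have s: "subspace X" "subspace Y" using assms inv_subD by auto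
  have "(N ^^ m) x = 0 \<and> (N ^^ m) y = 0" if "x \<in> X" "y \<in> Y" "(N ^^ m) (x + y) = 0" for x y
  proof -
    have "(N ^^ m) x = - (N ^^ m) y" using that(3) by (simp add: Np_simps eq_neg_iff_add_eq_0)
    then have "(N ^^ m) x \<in> X \<inter> Y" using Np_in[OF assms(1) that(1), of m] Np_in[OF assms(2) that(2), of m]
      subspace_neg[OF s(2)] by auto
    then show ?thesis using assms(3) \<open>(N ^^ m) x = - (N ^^ m) y\<close> by auto
  qed
  then show ?thesis
    unfolding span_Un_subspaces[OF s] span_Un_subspaces[OF subspace_ker_pow[OF linN s(1)] subspace_ker_pow[OF linN s(2)]]
    by (auto simp: ker_pow_def Np_simps) blast
qed

text \<open>Additivity allows subtraction: in \<open>classification\<close> the complements of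
  equivalent blocks again have equal invariants.\<close>

lemma split_invariants:
  assumes "adm B A" "adm B X" "X \<subseteq> A" "Y = orth_in B A X"
  shows "dim (ker_pow N m A) = dim (ker_pow N m X) + dim (ker_pow N m Y)"
    and "valid m \<Longrightarrow> pos_index (bet N B m) (ker_pow N m A)
       = pos_index (bet N B m) (ker_pow N m X) + pos_index (bet N B m) (ker_pow N m Y)"
proof -
  note sp = adm_split[OF assms(1-3), folded assms(4)]
  have X: "inv_sub X" and Y: "inv_sub Y" using admD[OF assms(2)] admD[OF sp(1)] by auto
  have K: "ker_pow N m A = span (ker_pow N m X \<union> ker_pow N m Y)"
    using ker_pow_sum[OF X Y sp(3)] sp(2) by simp
  have s: "subspace (ker_pow N m X)" "subspace (ker_pow N m Y)"
    using inv_subD(1)[OF X] inv_subD(1)[OF Y] by (auto intro: subspace_ker_pow linN)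
  have "ker_pow N m X \<inter> ker_pow N m Y = {0}"
    using sp(3) subspace_0[OF s(1)] subspace_0[OF s(2)] by (auto simp: ker_pow_def)
  then show "dim (ker_pow N m A) = dim (ker_pow N m X) + dim (ker_pow N m Y)"
    using fd.dim_sums_Int[OF s] unfolding K span_Un_subspaces[OF s] by simp
  show "pos_index (bet N B m) (ker_pow N m A)
       = pos_index (bet N B m) (ker_pow N m X) + pos_index (bet N B m) (ker_pow N m Y)" if "valid m"
    unfolding K
  proof (rule pos_index_sum[OF _ s])
    show "symf (span (ker_pow N m X \<union> ker_pow N m Y)) (bet N B m)"
      using symf_bet_ker[OF assms(1) that] unfolding K .
    fix x y assume "x \<in> ker_pow N m X" "y \<in> ker_pow N m Y"
    then have xy: "x \<in> X" "y \<in> Y" by (auto simp: ker_pow_def)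
    have "(N ^^ ((m - 1) div 2)) x \<in> X" "(N ^^ (m div 2)) y \<in> Y"
      using Np_in[OF X xy(1)] Np_in[OF Y xy(2)] by auto
    moreover have "B p q = 0" if "p \<in> X" "q \<in> Y" for p q
      using that admD(7)[OF assms(1), of p q] assms(3,4) by (auto simp: orth_in_def)
    ultimately show "bet N B m x y = 0" by (simp add: bet_def)
  qed
qed

text \<open>The submodule over the polynomials in \<open>N\<close> generated by two vectors. It
  serves both kinds of block: with \<open>b = S a\<close> a cyclic one, and with independent
  generators a hyperbolic pair.\<close>

definition frame :: "'v \<Rightarrow> 'v \<Rightarrow> 'v set" where
  "frame a b = span (range (\<lambda>k. (N ^^ k) a) \<union> range (\<lambda>k. (N ^^ k) b))"

text \<open>Separates a leading part from the multiples of \<open>N\<close>, so that arguments can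
  climb the filtration by the images of the powers of \<open>N\<close>.\<close>

lemma frame_decomp:
  assumes "x \<in> frame a b"
  shows "\<exists>\<alpha> \<beta> y. y \<in> frame a b \<and> x = \<alpha> *\<^sub>R a + \<beta> *\<^sub>R b + N y"
  using assms unfolding frame_def
proof (induction rule: span_induct_alt)
  case base
  show ?case by (rule exI[of _ 0], rule exI[of _ 0], rule exI[of _ 0]) (simp add: linear_0[OF linN] span_zero)
next
  case (step c x y)
  let ?X = "span (range (\<lambda>k. (N ^^ k) a) \<union> range (\<lambda>k. (N ^^ k) b))"
  obtain \<alpha> \<beta> z where y: "z \<in> ?X" "y = \<alpha> *\<^sub>R a + \<beta> *\<^sub>R b + N z" using step by blast
  have "\<exists>\<alpha>' \<beta>' w. w \<in> ?X \<and> x = \<alpha>' *\<^sub>R a + \<beta>' *\<^sub>R b + N w"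
  proof -
    obtain k g where k: "x = (N ^^ k) g" "g = a \<or> g = b" using step by auto
    show ?thesis
    proof (cases k)
      case 0
      show ?thesis
      proof (cases "g = a")
        case True
        show ?thesis by (rule exI[of _ 1], rule exI[of _ 0], rule exI[of _ 0])
          (simp add: 0 k(1) True linear_0[OF linN] span_zero)
      next
        case False
        then show ?thesis by (intro exI[of _ 0] exI[of _ 1])
          (use 0 k in \<open>simp add: linear_0[OF linN] span_zero\<close>)
      qed
    next
      case (Suc j)
      have "(N ^^ j) g \<in> ?X" using k(2) by (auto intro: span_base)
      then show ?thesis using k(1) Suc by (intro exI[of _ 0] exI[of _ "(N ^^ j) g"]) simp
    qed
  qed
  then obtain \<alpha>' \<beta>' w where x: "w \<in> ?X" "x = \<alpha>' *\<^sub>R a + \<beta>' *\<^sub>R b + N w" by blast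
  have "c *\<^sub>R w + z \<in> ?X" using x y by (intro span_add span_scale)
  moreover have "c *\<^sub>R x + y = (c * \<alpha>' + \<alpha>) *\<^sub>R a + (c * \<beta>' + \<beta>) *\<^sub>R b + N (c *\<^sub>R w + z)"
    unfolding x y by (simp add: algebra_simps linear_add[OF linN] linear_scale[OF linN])
  ultimately show ?case by blast
qed

lemma subspace_frame: "subspace (frame a b)"
  by (simp add: frame_def)

lemma frame_gen: "a \<in> frame a b" "b \<in> frame a b"
proof -
  have "(N ^^ 0) a \<in> frame a b" "(N ^^ 0) b \<in> frame a b"
    unfolding frame_def by (intro span_base UnI1 UnI2 rangeI)+
  then show "a \<in> frame a b" "b \<in> frame a b" by simp_all
qed

lemma frame_subset:
  assumes "inv_sub A" "a \<in> A" "b \<in> A"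
  shows "frame a b \<subseteq> A"
  unfolding frame_def using assms by (intro span_minimal) (auto simp: inv_subD Np_in)

lemma frame_N: "x \<in> frame a b \<Longrightarrow> N x \<in> frame a b"
proof -
  have "N ` frame a b = span (N ` (range (\<lambda>k. (N ^^ k) a) \<union> range (\<lambda>k. (N ^^ k) b)))"
    unfolding frame_def by (simp add: linear_span_image[OF linN])
  also have "\<dots> \<subseteq> frame a b"
  proof -
    have "N ((N ^^ k) g) \<in> range (\<lambda>k. (N ^^ k) g)" for k g by (rule range_eqI[of _ _ "Suc k"]) simp
    then show ?thesis unfolding frame_def by (intro span_mono) auto
  qed
  finally show "x \<in> frame a b \<Longrightarrow> N x \<in> frame a b" by auto
qed

lemma frame_Np: "x \<in> frame a b \<Longrightarrow> (N ^^ k) x \<in> frame a b"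
  by (induction k) (auto intro: frame_N)

lemma frame_nil:
  assumes "(N ^^ l) a = 0" "(N ^^ l) b = 0" "x \<in> frame a b"
  shows "(N ^^ l) x = 0"
proof -
  have "(N ^^ l) ((N ^^ k) g) = 0" if "(N ^^ l) g = 0" for k g
    using that linear_0[OF linNp, of k] funpow_funpow[of l N k g] funpow_funpow[of k N l g] by (simp add: add.commute)
  then have "span (range (\<lambda>k. (N ^^ k) a) \<union> range (\<lambda>k. (N ^^ k) b)) \<subseteq> {x. (N ^^ l) x = 0}"
    using assms by (intro span_minimal) (auto simp: subspace_def Np_simps)
  then show ?thesis using assms(3) by (auto simp: frame_def)
qed

lemma frame_inv_sub:
  assumes "inv_sub A" "a \<in> A" "b \<in> A" "S a \<in> frame a b" "S b \<in> frame a b"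
  shows "inv_sub (frame a b)"
proof -
  have AU: "A \<subseteq> U" "a \<in> U" "b \<in> U" using assms inv_subD by auto
  have "S ` frame a b = span (S ` (range (\<lambda>k. (N ^^ k) a) \<union> range (\<lambda>k. (N ^^ k) b)))"
    unfolding frame_def by (simp add: linear_span_image[OF linS])
  also have "\<dots> \<subseteq> frame a b"
    by (rule span_minimal[OF _ subspace_frame]) (use AU assms in \<open>auto simp: S_Np frame_Np\<close>)
  finally have "\<forall>x\<in>frame a b. S x \<in> frame a b" by auto
  then show ?thesis using frame_subset[OF assms(1-3)] AU
    by (auto simp: inv_sub_def subspace_frame frame_N)
qed

text \<open>The Gram matrix of \<open>B x (N ^ (l - 1) y)\<close> on the leading vectors \<open>a\<close>, \<open>b\<close> is invertible.\<close>

definition top_nondeg :: "('v \<Rightarrow> 'v \<Rightarrow> real) \<Rightarrow> nat \<Rightarrow> 'v \<Rightarrow> 'v \<Rightarrow> bool" where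
  "top_nondeg B l a b \<longleftrightarrow> 1 \<le> l \<and> (N ^^ l) a = 0 \<and> (N ^^ l) b = 0 \<and>
     (\<forall>\<alpha> \<beta>. B (\<alpha> *\<^sub>R a + \<beta> *\<^sub>R b) ((N ^^ (l - 1)) a) = 0 \<longrightarrow> B (\<alpha> *\<^sub>R a + \<beta> *\<^sub>R b) ((N ^^ (l - 1)) b) = 0
        \<longrightarrow> \<alpha> *\<^sub>R a + \<beta> *\<^sub>R b = 0)"

text \<open>Pairing with \<open>(N ^^ (l - 1)) g\<close> annihilates every multiple of
  \<open>N\<close>, since \<open>(N ^^ l) g = 0\<close>. So it sees the leading part alone, which
  \<open>top_nondeg\<close> detects.\<close>

lemma frame_lead:
  assumes "adm B A" "a \<in> A" "b \<in> A" "top_nondeg B l a b" "y \<in> A"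
    and "\<And>g. g = a \<or> g = b \<Longrightarrow> B (\<alpha> *\<^sub>R a + \<beta> *\<^sub>R b + N y) ((N ^^ (l - 1)) g) = 0"
  shows "\<alpha> *\<^sub>R a + \<beta> *\<^sub>R b = 0"
proof -
  have A: "inv_sub A" "bilinear B" using admD[OF assms(1)] by auto
  have l: "1 \<le> l" "(N ^^ l) a = 0" "(N ^^ l) b = 0" using assms(4) by (auto simp: top_nondeg_def)
  have "B (N y) ((N ^^ (l - 1)) g) = 0" if g: "g = a \<or> g = b" for g
  proof -
    have "B (N y) ((N ^^ (l - 1)) g) = \<kappa> * B y (N ((N ^^ (l - 1)) g))"
      using g assms(2,3) by (intro admD(8)[OF assms(1,5)] Np_in[OF A(1)]) auto
    also have "N ((N ^^ (l - 1)) g) = (N ^^ l) g" using l(1) by (cases l) auto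
    finally show ?thesis using g l by (auto simp: bilin[OF A(2)])
  qed
  then have "B (\<alpha> *\<^sub>R a + \<beta> *\<^sub>R b) ((N ^^ (l - 1)) g) = 0" if "g = a \<or> g = b" for g
    using assms(6)[OF that] that by (simp add: bilin[OF A(2)])
  then show ?thesis using assms(4) unfolding top_nondeg_def by blast
qed

text \<open>A vector of the radical has zero leading part, hence is a multiple of \<open>N\<close>;
  iterating makes it a multiple of \<open>N ^^ l\<close>, which is zero on the frame.\<close>

lemma frame_nondeg:
  assumes "adm B A" "a \<in> A" "b \<in> A" "top_nondeg B l a b"
  shows "nondeg_on (frame a b) B"
  unfolding nondeg_on_def
proof (intro ballI impI)
  fix v assume v: "v \<in> frame a b" "\<forall>x\<in>frame a b. B v x = 0"
  have A: "inv_sub A" "bilinear B" using admD[OF assms(1)] by auto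
  have l: "1 \<le> l" "(N ^^ l) a = 0" "(N ^^ l) b = 0" using assms(4) by (auto simp: top_nondeg_def)
  have fA: "frame a b \<subseteq> A" by (rule frame_subset[OF A(1) assms(2,3)])
  have "\<exists>w\<in>frame a b. v = (N ^^ k) w" if "k \<le> l" for k
    using that
  proof (induction k)
    case 0
    then show ?case using v by auto
  next
    case (Suc k)
    then obtain w where w: "w \<in> frame a b" "v = (N ^^ k) w" by auto
    obtain \<alpha> \<beta> y where y: "y \<in> frame a b" "w = \<alpha> *\<^sub>R a + \<beta> *\<^sub>R b + N y"
      using frame_decomp[OF w(1)] by blast
    have "\<alpha> *\<^sub>R a + \<beta> *\<^sub>R b = 0"
    proof (rule frame_lead[OF assms])
      show "y \<in> A" using y(1) fA by blast
      fix g assume g: "g = a \<or> g = b"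
      then have gA: "g \<in> A" "g \<in> frame a b" using assms frame_gen by auto
      \<comment> \<open>The test vector carries the exponent that is missing to \<open>l - 1\<close>
        once the \<open>k\<close> factors of \<open>w\<close> have been moved over.\<close>
      have "0 = B ((N ^^ k) w) ((N ^^ (l - 1 - k)) g)"
        using v(2) w(2) frame_Np[OF gA(2), of "l - 1 - k"] by auto
      also have "\<dots> = \<kappa> ^ k * B w ((N ^^ k) ((N ^^ (l - 1 - k)) g))"
        using w(1) fA gA Np_in[OF A(1)] by (intro adj_Np[OF assms(1)]) auto
      also have "(N ^^ k) ((N ^^ (l - 1 - k)) g) = (N ^^ (l - 1)) g"
        using Suc.prems by (simp add: funpow_funpow)
      finally show "B (\<alpha> *\<^sub>R a + \<beta> *\<^sub>R b + N y) ((N ^^ (l - 1)) g) = 0" using kappa(3) y(2) by auto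
    qed
    then have "v = (N ^^ Suc k) y" using y w by (simp add: funpow_swap1)
    then show ?case using y(1) by blast
  qed
  then obtain w where "w \<in> frame a b" "v = (N ^^ l) w" by blast
  then show "v = 0" using frame_nil[OF l(2,3)] by simp
qed

text \<open>A block of order \<open>l\<close> is visible at the exponent \<open>l\<close> only.
  Above it the power of \<open>N\<close> vanishes. Below it a vector killed by \<open>N ^^ m\<close>
  has zero leading part, so it is some \<open>N y\<close>, and moving this \<open>N\<close> across
  completes the power to \<open>N ^^ m\<close>.\<close>

lemma frame_bet_zero:
  assumes "adm B A" "a \<in> A" "b \<in> A" "top_nondeg B l a b" "1 \<le> m" "m \<noteq> l"
    and "u \<in> ker_pow N m (frame a b)" "v \<in> ker_pow N m (frame a b)"
  shows "bet N B m u v = 0"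
proof -
  have A: "inv_sub A" "bilinear B" using admD[OF assms(1)] by auto
  have l: "1 \<le> l" "(N ^^ l) a = 0" "(N ^^ l) b = 0" using assms(4) by (auto simp: top_nondeg_def)
  have fA: "frame a b \<subseteq> A" by (rule frame_subset[OF A(1) assms(2,3)])
  have uv: "u \<in> frame a b" "v \<in> frame a b" "(N ^^ m) u = 0" "(N ^^ m) v = 0" "u \<in> A" "v \<in> A"
    using assms(7,8) fA by (auto simp: ker_pow_def)
  have b: "bet N B m u v = \<kappa> ^ ((m - 1) div 2) * B u ((N ^^ (m - 1)) v)"
    by (rule bet_eq[OF assms(1) uv(5,6) assms(5)])
  show ?thesis
  proof (cases "m < l")
    case False
    then have "(N ^^ (m - 1)) v = 0"
      using assms(6) funpow_zero_mono[OF linN frame_nil[OF l(2,3) uv(2)], of "m - 1"] by simp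
    then show ?thesis by (simp add: b bilin[OF A(2)])
  next
    case True
    obtain \<alpha> \<beta> y where y: "y \<in> frame a b" "u = \<alpha> *\<^sub>R a + \<beta> *\<^sub>R b + N y"
      using frame_decomp[OF uv(1)] by blast
    have yA: "y \<in> A" using y(1) fA by blast
    have "\<alpha> *\<^sub>R a + \<beta> *\<^sub>R b = 0"
    proof (rule frame_lead[OF assms(1-4) yA])
      fix g assume g: "g = a \<or> g = b"
      then have gA: "g \<in> A" using assms by auto
      have "(N ^^ (l - 1)) u = 0" using funpow_zero_mono[OF linN uv(3), of "l - 1"] True by simp
      then show "B (\<alpha> *\<^sub>R a + \<beta> *\<^sub>R b + N y) ((N ^^ (l - 1)) g) = 0"
        unfolding y(2)[symmetric] using adj_Np[OF assms(1) uv(5) gA, of "l - 1"] kappa(3)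
        by (simp add: bilin[OF A(2)])
    qed
    then have "u = N y" using y(2) by simp
    then have "B u ((N ^^ (m - 1)) v) = \<kappa> * B y (N ((N ^^ (m - 1)) v))"
      using admD(8)[OF assms(1) yA] Np_in[OF A(1) uv(6)] by blast
    also have "N ((N ^^ (m - 1)) v) = (N ^^ m) v" using assms(5) by (cases m) auto
    finally show ?thesis using uv(4) by (simp add: b bilin[OF A(2)])
  qed
qed

text \<open>By the adjoint rule the form on a frame is determined by the values of one generator
  against the powers of \<open>N\<close> on another. The last premise offers
  \<open>pair_inv N G\<close> as an assumption because the square of \<open>S\<close> involves
  \<open>N\<close>.\<close>

lemma frame_equivalent:
  assumes "adm B A" "adm B' A'" "a \<in> A" "b \<in> A" "a' \<in> A'" "b' \<in> A'"
    and "\<And>k. B a ((N ^^ k) a) = B' a' ((N ^^ k) a')" "\<And>k. B a ((N ^^ k) b) = B' a' ((N ^^ k) b')"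
    and "\<And>k. B b ((N ^^ k) a) = B' b' ((N ^^ k) a')" "\<And>k. B b ((N ^^ k) b) = B' b' ((N ^^ k) b')"
    and "\<And>G. G = span (range (\<lambda>k. ((N ^^ k) a, (N ^^ k) a')) \<union> range (\<lambda>k. ((N ^^ k) b, (N ^^ k) b'))) \<Longrightarrow>
       pair_inv N G \<Longrightarrow> (S a, S a') \<in> G \<and> (S b, S b') \<in> G"
  shows "equivalent B (frame a b) B' (frame a' b')"
proof -
  have A: "inv_sub A" "bilinear B" and A': "inv_sub A'" "bilinear B'"
    using admD[OF assms(1)] admD[OF assms(2)] by auto
  have AU: "a \<in> U" "b \<in> U" "a' \<in> U" "b' \<in> U" using assms inv_subD(2)[OF A(1)] inv_subD(2)[OF A'(1)] by auto
  define G where "G = range (\<lambda>k. ((N ^^ k) a, (N ^^ k) a')) \<union> range (\<lambda>k. ((N ^^ k) b, (N ^^ k) b'))"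
  have GE: "(\<exists>k g g'. (g, g') \<in> {(a, a'), (b, b')} \<and> x = (N ^^ k) g \<and> x' = (N ^^ k) g')" if "(x, x') \<in> G" for x x'
    using that by (auto simp: G_def)
  have GI: "((N ^^ k) g, (N ^^ k) g') \<in> G" if "(g, g') \<in> {(a, a'), (b, b')}" for k g g'
    using that by (auto simp: G_def)
  have "B x y = B' x' y'" if xy: "(x, x') \<in> G" "(y, y') \<in> G" for x x' y y'
  proof -
    obtain i g g' where x: "(g, g') \<in> {(a, a'), (b, b')}" "x = (N ^^ i) g" "x' = (N ^^ i) g'" using GE[OF xy(1)] by blast
    obtain j h h' where y: "(h, h') \<in> {(a, a'), (b, b')}" "y = (N ^^ j) h" "y' = (N ^^ j) h'" using GE[OF xy(2)] by blast
    have m: "g \<in> A" "h \<in> A" "g' \<in> A'" "h' \<in> A'" using x(1) y(1) assms by auto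
    have "B x y = \<kappa> ^ i * B g ((N ^^ (i + j)) h)"
      using adj_Np[OF assms(1) m(1), of "(N ^^ j) h" i] Np_in[OF A(1) m(2)] by (simp add: x y funpow_funpow)
    moreover have "B' x' y' = \<kappa> ^ i * B' g' ((N ^^ (i + j)) h')"
      using adj_Np[OF assms(2) m(3), of "(N ^^ j) h'" i] Np_in[OF A'(1) m(4)] by (simp add: x y funpow_funpow)
    moreover have "B g ((N ^^ (i + j)) h) = B' g' ((N ^^ (i + j)) h')"
      using x(1) y(1) assms(7-10) by auto
    ultimately show ?thesis by simp
  qed
  moreover have "span (fst ` G) = frame a b" "span (snd ` G) = frame a' b'"
    unfolding G_def frame_def by (simp_all add: image_Un image_image)
  ultimately have c: "corr (span G) B (frame a b) B' (frame a' b')"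
    using corr_span[OF A(2) A'(2), of G] by metis
  have pN: "pair_inv N (span G)"
  proof (rule pair_inv_span[OF linN], rule span_base)
    fix x x' assume "(x, x') \<in> G"
    then obtain i g g' where x: "(g, g') \<in> {(a, a'), (b, b')}" "x = (N ^^ i) g" "x' = (N ^^ i) g'" using GE by blast
    then show "(N x, N x') \<in> G" using GI[OF x(1), of "Suc i"] by simp
  qed
  have pNp: "((N ^^ k) x, (N ^^ k) x') \<in> span G" if "(x, x') \<in> span G" for k x x'
    by (induction k) (use that pN in \<open>auto simp: pair_inv_def\<close>)
  have S0: "(S g, S g') \<in> span G" if "(g, g') \<in> {(a, a'), (b, b')}" for g g'
    using assms(11)[of "span G"] pN that by (auto simp: G_def)
  have pS: "pair_inv S (span G)"
  proof (rule pair_inv_span[OF linS])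
    fix x x' assume "(x, x') \<in> G"
    then obtain i g g' where x: "(g, g') \<in> {(a, a'), (b, b')}" "x = (N ^^ i) g" "x' = (N ^^ i) g'" using GE by blast
    then have "g \<in> U" "g' \<in> U" using AU by auto
    then show "(S x, S x') \<in> span G" using pNp[OF S0[OF x(1)], of i] by (simp add: S_Np x)
  qed
  show ?thesis using c pN pS by (auto simp: equivalent_def)
qed

end

section \<open>Normal forms and classification\<close>

context nil_sys begin

lemma type_cases:
  obtains "\<kappa> = - 1" "\<And>u. u \<in> U \<Longrightarrow> S u = 0"
  | "\<kappa> = 1" "\<omega> > 0" "\<And>u. u \<in> U \<Longrightarrow> S (S u) = - \<omega> *\<^sub>R u + t *\<^sub>R N u + N (N u)"
  using tyNS by blast

text \<open>For \<kappa> = 1 the operator \<open>N\<close> is selfadjoint and commutes with the skew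
  \<open>S\<close>, so the value equals its own negative; for \<kappa> = -1 the operator
  \<open>S\<close> is zero on \<open>U\<close>.\<close>

lemma skew_values:
  assumes "adm B A" "e \<in> A"
  shows "B e ((N ^^ k) (S e)) = 0" "B (S e) ((N ^^ k) e) = 0"
proof -
  have A: "inv_sub A" "bilinear B" "A \<subseteq> U" using admD[OF assms(1)] by auto
  have Se: "S e \<in> A" "e \<in> U" using assms(2) A inv_subD by auto
  have 1: "B (S e) ((N ^^ k) e) = - B e ((N ^^ k) (S e))"
    using admD(9)[OF assms(1,2), of "(N ^^ k) e"] Np_in[OF A(1) assms(2)] S_Np[OF Se(2)] by simp
  have 2: "B e ((N ^^ k) (S e)) = \<kappa> ^ k * B (S e) ((N ^^ k) e)"
    using adj_Np[OF assms(1) Se(1) assms(2), of k] admD(7)[OF assms(1) assms(2), of "(N ^^ k) (S e)"]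
      Np_in[OF A(1) Se(1), of k] by simp
  show "B e ((N ^^ k) (S e)) = 0"
  proof (cases rule: type_cases)
    case 1
    then show ?thesis using Se(2) by (simp add: Np_simps bilin[OF A(2)])
  next
    case 2
    then show ?thesis using \<open>B e ((N ^^ k) (S e)) = \<kappa> ^ k * B (S e) ((N ^^ k) e)\<close> 1 by simp
  qed
  then show "B (S e) ((N ^^ k) e) = 0" using 1 by simp
qed

text \<open>Together with \<open>skew_values\<close> this reduces all values on the generators
  \<open>e\<close> and \<open>S e\<close> to the single sequence
  \<open>B e ((N ^^ k) e)\<close>.\<close>

lemma skew_square:
  assumes "adm B A" "e \<in> A" "\<kappa> = 1" "\<And>u. u \<in> U \<Longrightarrow> S (S u) = - \<omega> *\<^sub>R u + t *\<^sub>R N u + N (N u)"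
  shows "B (S e) ((N ^^ k) (S e)) = \<omega> * B e ((N ^^ k) e) - t * B e ((N ^^ (k + 1)) e) - B e ((N ^^ (k + 2)) e)"
proof -
  have A: "inv_sub A" "bilinear B" "A \<subseteq> U" using admD[OF assms(1)] by auto
  have Se: "S e \<in> A" "e \<in> U" "S e \<in> U" using assms(2) A(3) inv_subD(4)[OF A(1)] by auto
  have "B (S e) ((N ^^ k) (S e)) = - B e (S ((N ^^ k) (S e)))"
    using admD(9)[OF assms(1,2), of "(N ^^ k) (S e)"] Np_in[OF A(1) Se(1)] by simp
  also have "S ((N ^^ k) (S e)) = (N ^^ k) (S (S e))" by (rule S_Np[OF Se(3)])
  also have "\<dots> = - \<omega> *\<^sub>R (N ^^ k) e + t *\<^sub>R (N ^^ (k + 1)) e + (N ^^ (k + 2)) e"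
    unfolding assms(4)[OF Se(2)] by (simp add: Np_simps funpow_swap1)
  finally show ?thesis by (simp add: bilin[OF A(2)])
qed

lemma top_nondeg_cyclic:
  assumes "adm B A" "e \<in> A" "(N ^^ l) e = 0" "1 \<le> l" "B e ((N ^^ (l - 1)) e) \<noteq> 0"
  shows "top_nondeg B l e (S e)"
proof -
  have A: "inv_sub A" "bilinear B" "A \<subseteq> U" using admD[OF assms(1)] by auto
  have eU: "e \<in> U" using assms A by auto
  have "(N ^^ l) (S e) = 0" using S_Np[OF eU, of l] assms(3) linear_0[OF linS] by simp
  moreover have "\<alpha> *\<^sub>R e + \<beta> *\<^sub>R S e = 0"
    if 1: "B (\<alpha> *\<^sub>R e + \<beta> *\<^sub>R S e) ((N ^^ (l - 1)) e) = 0"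
      and 2: "B (\<alpha> *\<^sub>R e + \<beta> *\<^sub>R S e) ((N ^^ (l - 1)) (S e)) = 0" for \<alpha> \<beta>
  proof -
    have a: "\<alpha> = 0" using 1 assms(5) skew_values[OF assms(1,2), of "l - 1"] by (simp add: bilin[OF A(2)])
    show ?thesis
    proof (cases rule: type_cases)
      case 1
      then show ?thesis using a eU by simp
    next
      case t: 2
      have z: "(N ^^ Suc (l - 1)) e = 0" "(N ^^ Suc (Suc (l - 1))) e = 0"
        by (rule funpow_zero_mono[OF linN assms(3)], simp)+
      have "B (S e) ((N ^^ (l - 1)) (S e)) = \<omega> * B e ((N ^^ (l - 1)) e)"
        using skew_square[OF assms(1,2) t(1) t(3), of "l - 1"] z
        by (simp add: bilin[OF A(2)] del: funpow.simps)
      then show ?thesis using a 2 t(2) assms(5) by (simp add: bilin[OF A(2)])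
    qed
  qed
  ultimately show ?thesis using assms unfolding top_nondeg_def by blast
qed

text \<open>An approximation in the manner of Hensel: once the top value is scaled to \<delta>,
  adding a multiple of \<open>(N ^^ q) e\<close> to \<open>e\<close> clears the value at
  \<open>l - 1 - q\<close> and leaves the higher ones unchanged. The variable \<open>j\<close>
  counts the values already cleared.\<close>

lemma normalize_cyclic:
  assumes "adm B A" "e \<in> A" "(N ^^ l) e = 0" "valid l" "\<delta> = 1 \<or> \<delta> = - 1" "\<delta> * B e ((N ^^ (l - 1)) e) > 0"
  shows "\<exists>e'\<in>A. (N ^^ l) e' = 0 \<and> (\<forall>k. B e' ((N ^^ k) e') = (if k = l - 1 then \<delta> else 0))"
proof -
  have A: "inv_sub A" "bilinear B" "subspace A" using admD[OF assms(1)] by auto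
  have l: "1 \<le> l" "\<kappa> = 1 \<or> odd l" using assms(4) by (auto simp: valid_def)
  have "\<exists>e\<in>A. (N ^^ l) e = 0 \<and> B e ((N ^^ (l - 1)) e) = \<delta> \<and>
    (\<forall>k. l - 1 \<le> k + j \<longrightarrow> k \<noteq> l - 1 \<longrightarrow> B e ((N ^^ k) e) = 0)" for j
  proof (induction j)
    case 0
    define s where "s = sqrt (\<delta> * B e ((N ^^ (l - 1)) e))"
    have s: "s > 0" "s * s = \<delta> * B e ((N ^^ (l - 1)) e)" using assms(6) by (auto simp: s_def)
    define e1 where "e1 = (1 / s) *\<^sub>R e"
    have "e1 \<in> A" "(N ^^ l) e1 = 0" using assms(2,3) A(3) by (auto simp: e1_def subspace_scale Np_simps)
    moreover have "B e1 ((N ^^ (l - 1)) e1) = \<delta>"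
    proof -
      have "B e1 ((N ^^ (l - 1)) e1) = B e ((N ^^ (l - 1)) e) / (s * s)"
        by (simp add: e1_def Np_simps bilin[OF A(2)])
      then show ?thesis using s assms(5,6) by auto
    qed
    moreover have "B e1 ((N ^^ k) e1) = 0" if "l - 1 \<le> k + 0" "k \<noteq> l - 1" for k
      using funpow_zero_mono[OF linN \<open>(N ^^ l) e1 = 0\<close>, of k] that by (simp add: bilin[OF A(2)])
    ultimately show ?case by blast
  next
    case (Suc j)
    then obtain e where e: "e \<in> A" "(N ^^ l) e = 0" "B e ((N ^^ (l - 1)) e) = \<delta>"
      and ej: "\<And>k. l - 1 \<le> k + j \<Longrightarrow> k \<noteq> l - 1 \<Longrightarrow> B e ((N ^^ k) e) = 0" by blast
    show ?case
    proof (cases "Suc j \<le> l - 1")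
      case False
      then have "B e ((N ^^ k) e) = 0" if "k \<noteq> l - 1" for k using ej[of k] that by simp
      then show ?thesis using e by blast
    next
      case True
      define q where "q = Suc j"
      define m where "m = l - 1 - q"
      have mq: "m + q = l - 1" "q \<ge> 1" using True by (auto simp: m_def q_def)
      define f where "f k = B e ((N ^^ k) e)" for k
      have f0: "f k = 0" if "k > m" "k \<noteq> l - 1" for k
        unfolding f_def using that mq by (intro ej) (auto simp: m_def q_def)
      have fl: "f (l - 1) = \<delta>" using e by (simp add: f_def)
      show ?thesis
      proof (cases "f m = 0")
        case True
        have "f k = 0" if "l - 1 \<le> k + Suc j" "k \<noteq> l - 1" for k
          using f0[of k] True that mq by (cases "k = m") (auto simp: q_def)
        then show ?thesis using e unfolding f_def by blast
      next
        case False
        \<comment> \<open>The correction needs \<open>N ^^ q\<close> to be selfadjoint. For \<kappa>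
          = -1 a nonzero value at \<open>m\<close> forces \<open>m\<close> to be even, and
          \<open>l - 1\<close> is even because \<open>l\<close> is valid; so the difference
          \<open>q\<close> is even.\<close>
        have kq: "\<kappa> ^ q = 1"
        proof (cases "\<kappa> = 1")
          case k: False
          have "f m = \<kappa> ^ m * f m"
            using adj_Np[OF assms(1) e(1) e(1), of m] admD(7)[OF assms(1) e(1), of "(N ^^ m) e"]
              Np_in[OF A(1) e(1), of m] by (simp add: f_def)
          then have "\<kappa> ^ m = 1" using False by simp
          then have "even m" using kappa(1) k by (cases "even m") auto
          moreover have "even (l - 1)" using l k by auto
          ultimately have "even q" using mq(1) by presburger
          then show ?thesis using kappa(1) by auto
        qed simp
        \<comment> \<open>At \<open>m\<close> the cross terms contribute
          \<open>2 * c * \<delta>\<close>, which cancels \<open>f m\<close> because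
          \<open>\<delta> * \<delta> = 1\<close>.\<close>
        define c where "c = - f m * \<delta> / 2"
        define e1 where "e1 = e + c *\<^sub>R (N ^^ q) e"
        have e1: "e1 \<in> A" unfolding e1_def using e(1) A Np_in[OF A(1) e(1)] by (intro subspace_add subspace_scale)
        have "(N ^^ l) ((N ^^ q) e) = 0"
          using funpow_zero_mono[OF linN e(2), of "l + q"] by (simp add: funpow_funpow)
        then have e1l: "(N ^^ l) e1 = 0" using e(2) by (simp add: e1_def Np_simps)
        have val: "B e1 ((N ^^ k) e1) = f k + 2 * c * f (k + q) + c * c * f (k + q + q)" for k
        proof -
          have N: "(N ^^ k) e1 = (N ^^ k) e + c *\<^sub>R (N ^^ (k + q)) e"
            by (simp add: e1_def Np_simps funpow_funpow)
          have "B ((N ^^ q) e) ((N ^^ i) e) = f (i + q)" for i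
            using adj_Np[OF assms(1) e(1) Np_in[OF A(1) e(1), of i], of q] kq
            by (simp add: funpow_funpow f_def add.commute)
          then show ?thesis unfolding N by (simp add: e1_def bilin[OF A(2)] f_def algebra_simps)
        qed
        have fb: "f k = 0" if "k \<ge> l" for k
          using funpow_zero_mono[OF linN e(2) that] by (simp add: f_def bilin[OF A(2)])
        have "B e1 ((N ^^ (l - 1)) e1) = \<delta>"
          using val[of "l - 1"] mq fl fb[of "l - 1 + q"] fb[of "l - 1 + q + q"] by simp
        moreover have "B e1 ((N ^^ k) e1) = 0" if k: "l - 1 \<le> k + Suc j" "k \<noteq> l - 1" for k
        proof (cases "k = m")
          case True
          have "f (m + q) = \<delta>" "f (m + q + q) = 0" using mq fl fb[of "m + q + q"] by auto
          moreover have "\<delta> * \<delta> = 1" using assms(5) by auto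
          ultimately show ?thesis unfolding val True by (simp add: c_def mult.assoc)
        next
          case False
          then have "k > m" using k mq by (simp add: q_def)
          then have "f k = 0" "f (k + q) = 0" "f (k + q + q) = 0" using f0[of k] k fb mq by auto
          then show ?thesis unfolding val by simp
        qed
        ultimately show ?thesis using e1 e1l by blast
      qed
    qed
  qed
  from this[of l] obtain e' where "e' \<in> A" "(N ^^ l) e' = 0" "B e' ((N ^^ (l - 1)) e') = \<delta>"
    "\<forall>k. k \<noteq> l - 1 \<longrightarrow> B e' ((N ^^ k) e') = 0" by auto
  then show ?thesis by (intro bexI[of _ e']) auto
qed

text \<open>\<open>S (S e)\<close> is a combination of \<open>e\<close>, \<open>N e\<close> and
  \<open>N (N e)\<close>, so including \<open>S e\<close> is enough to make the frame stable under
  \<open>S\<close>.\<close>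

lemma frame_cyclic:
  assumes "adm B A" "e \<in> A" "(N ^^ l) e = 0" "1 \<le> l" "B e ((N ^^ (l - 1)) e) \<noteq> 0"
  shows "adm B (frame e (S e))" "frame e (S e) \<subseteq> A"
proof -
  have A: "inv_sub A" "bilinear B" "A \<subseteq> U" using admD[OF assms(1)] by auto
  have Se: "S e \<in> A" "e \<in> U" using assms(2) A inv_subD by auto
  show s: "frame e (S e) \<subseteq> A" by (rule frame_subset[OF A(1) assms(2) Se(1)])
  have "S (S e) \<in> frame e (S e)"
  proof (cases rule: type_cases)
    case 1
    then show ?thesis using Se(2) linear_0[OF linS] subspace_0[OF subspace_frame] by simp
  next
    case 2
    show ?thesis unfolding 2(3)[OF Se(2)]
      by (intro subspace_add[OF subspace_frame] subspace_scale[OF subspace_frame] frame_N frame_gen)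
  qed
  then have "inv_sub (frame e (S e))"
    using frame_inv_sub[OF A(1) assms(2) Se(1)] frame_gen by blast
  moreover have "nondeg_on (frame e (S e)) B"
    by (rule frame_nondeg[OF assms(1,2) Se(1) top_nondeg_cyclic[OF assms]])
  ultimately show "adm B (frame e (S e))" using adm_subset[OF assms(1)] s by blast
qed

lemma cyclic_equivalent:
  assumes "adm B A" "adm B' A'" "e \<in> A" "e' \<in> A'" "\<And>k. B e ((N ^^ k) e) = B' e' ((N ^^ k) e')"
  shows "equivalent B (frame e (S e)) B' (frame e' (S e'))"
proof -
  have A: "inv_sub A" "A \<subseteq> U" and A': "inv_sub A'" "A' \<subseteq> U" using admD[OF assms(1)] admD[OF assms(2)] by auto
  have m: "S e \<in> A" "S e' \<in> A'" "e \<in> U" "e' \<in> U" using assms A A' inv_subD by auto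
  show ?thesis
  proof (rule frame_equivalent[OF assms(1,2,3) m(1) assms(4) m(2)])
    show "B (S e) ((N ^^ k) (S e)) = B' (S e') ((N ^^ k) (S e'))" for k
    proof (cases rule: type_cases)
      case 1
      then show ?thesis using m admD(4)[OF assms(1)] admD(4)[OF assms(2)] by (simp add: bilin)
    next
      case 2
      show ?thesis using skew_square[OF assms(1,3) 2(1,3), of k] skew_square[OF assms(2,4) 2(1,3), of k] by (simp only: assms(5))
    qed
    fix G assume G: "G = span (range (\<lambda>k. ((N ^^ k) e, (N ^^ k) e')) \<union> range (\<lambda>k. ((N ^^ k) (S e), (N ^^ k) (S e'))))"
      and pN: "pair_inv N G"
    have "((N ^^ 0) e, (N ^^ 0) e') \<in> G" "((N ^^ 0) (S e), (N ^^ 0) (S e')) \<in> G"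
      unfolding G by (intro span_base; blast)+
    then have g: "(e, e') \<in> G" "(S e, S e') \<in> G" by simp_all
    have "(S (S e), S (S e')) \<in> G"
    proof (cases rule: type_cases)
      case 1
      then show ?thesis using m linear_0[OF linS] span_zero unfolding G by (simp add: zero_prod_def[symmetric])
    next
      case 2
      have n: "(N e, N e') \<in> G" "(N (N e), N (N e')) \<in> G" using g pN by (auto simp: pair_inv_def)
      have "(- \<omega>) *\<^sub>R (e, e') + t *\<^sub>R (N e, N e') + (N (N e), N (N e')) \<in> G"
        using g(1) n unfolding G by (intro span_add span_scale)
      then show ?thesis using 2(3)[OF m(3)] 2(3)[OF m(4)] by simp
    qed
    then show "(S e, S e') \<in> G \<and> (S (S e), S (S e')) \<in> G" using g by blast
  qed (use assms(5) skew_values[OF assms(1,3)] skew_values[OF assms(2,4)] in auto)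
qed

text \<open>Here \<open>B x ((N ^^ k) x)\<close> vanishes for odd \<open>k\<close>, in particular at
  \<open>l - 1\<close>, so one generator alone cannot carry a nondegenerate block of order
  \<open>l\<close>. The approximation is that of \<open>normalize_cyclic\<close>, with three values
  to clear at each level.\<close>

lemma normalize_hyperbolic:
  assumes "adm B A" "e \<in> A" "f \<in> A" "(N ^^ l) e = 0" "(N ^^ l) f = 0" "\<kappa> = - 1" "even l" "1 \<le> l"
    and "B e ((N ^^ (l - 1)) f) \<noteq> 0"
  shows "\<exists>e'\<in>A. \<exists>f'\<in>A. (N ^^ l) e' = 0 \<and> (N ^^ l) f' = 0 \<and> (\<forall>k. B e' ((N ^^ k) e') = 0 \<and> B f' ((N ^^ k) f') = 0
     \<and> B e' ((N ^^ k) f') = (if k = l - 1 then 1 else 0))"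
proof -
  have A: "inv_sub A" "bilinear B" "subspace A" using admD[OF assms(1)] by auto
  have swap: "B x ((N ^^ k) y) = \<kappa> ^ k * B y ((N ^^ k) x)" if "x \<in> A" "y \<in> A" for x y k
    using adj_Np[OF assms(1) that(2,1), of k] admD(7)[OF assms(1) that(1), of "(N ^^ k) y"]
      Np_in[OF A(1) that(2), of k] by simp
  have selfodd: "B x ((N ^^ k) x) = 0" if "x \<in> A" "odd k" for x k
    using swap[OF that(1) that(1), of k] that(2) assms(6) by simp
  have ol: "odd (l - 1)" using assms(7,8) by simp
  have "\<exists>e\<in>A. \<exists>f\<in>A. (N ^^ l) e = 0 \<and> (N ^^ l) f = 0 \<and> (\<forall>k. l - 1 \<le> k + j \<longrightarrow> B e ((N ^^ k) e) = 0 \<and> B f ((N ^^ k) f) = 0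
     \<and> B e ((N ^^ k) f) = (if k = l - 1 then 1 else 0))" for j
  proof (induction j)
    case 0
    define f1 where "f1 = (1 / B e ((N ^^ (l - 1)) f)) *\<^sub>R f"
    have f1: "f1 \<in> A" "(N ^^ l) f1 = 0" using assms(3,5) A(3) by (auto simp: f1_def subspace_scale Np_simps)
    have top: "B e ((N ^^ (l - 1)) f1) = 1" using assms(9) by (simp add: f1_def Np_simps bilin[OF A(2)])
    have "B e ((N ^^ k) e) = 0 \<and> B f1 ((N ^^ k) f1) = 0 \<and> B e ((N ^^ k) f1) = (if k = l - 1 then 1 else 0)"
      if "l - 1 \<le> k + 0" for k
    proof (cases "k = l - 1")
      case True
      then show ?thesis using top selfodd[OF assms(2) ol] selfodd[OF f1(1) ol] by simp
    next
      case False
      then have "l \<le> k" using that by simp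
      then have "(N ^^ k) e = 0" "(N ^^ k) f1 = 0"
        using funpow_zero_mono[OF linN assms(4)] funpow_zero_mono[OF linN f1(2)] by auto
      then show ?thesis using False by (simp add: bilin[OF A(2)])
    qed
    then show ?case using f1 assms(2,4) by blast
  next
    case (Suc j)
    then obtain e f where e: "e \<in> A" "(N ^^ l) e = 0" and f: "f \<in> A" "(N ^^ l) f = 0"
      and h: "\<And>k. l - 1 \<le> k + j \<Longrightarrow> B e ((N ^^ k) e) = 0 \<and> B f ((N ^^ k) f) = 0
        \<and> B e ((N ^^ k) f) = (if k = l - 1 then 1 else 0)" by blast
    show ?case
    proof (cases "Suc j \<le> l - 1")
      case False
      then have "l - 1 \<le> k + j" for k by simp
      then show ?thesis using e f h by blast
    next
      case True
      define q where "q = Suc j"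
      define m where "m = l - 1 - q"
      have mq: "m + q = l - 1" "q \<ge> 1" using True by (auto simp: m_def q_def)
      define ee where "ee k = B e ((N ^^ k) e)" for k
      define ff where "ff k = B f ((N ^^ k) f)" for k
      define ef where "ef k = B e ((N ^^ k) f)" for k
      have fe: "B f ((N ^^ k) e) = \<kappa> ^ k * ef k" for k using swap[OF f(1) e(1)] by (simp add: ef_def)
      have hk: "ee k = 0" "ff k = 0" "ef k = (if k = l - 1 then 1 else 0)" if "k > m" for k
        using h[of k] that mq by (auto simp: ee_def ff_def ef_def m_def q_def)
      \<comment> \<open>\<open>a\<close> clears the mixed value at \<open>m\<close>;
        \<open>b\<close> and \<open>c\<close> clear the two self-values, which change by twice the
        coefficient when \<open>\<kappa> ^ q = - 1\<close>. When \<open>\<kappa> ^ q = 1\<close>,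
        the exponent \<open>m\<close> is odd and the self-values are zero already.\<close>
      define a where "a = - (\<kappa> ^ q) * ef m"
      define b where "b = - ee m / 2"
      define c where "c = ff m / 2"
      define e1 where "e1 = e + (a *\<^sub>R (N ^^ q) e + b *\<^sub>R (N ^^ q) f)"
      define f1 where "f1 = f + c *\<^sub>R (N ^^ q) e"
      have in1: "e1 \<in> A" "f1 \<in> A" unfolding e1_def f1_def
        using e(1) f(1) A Np_in[OF A(1) e(1)] Np_in[OF A(1) f(1)] by (auto intro!: subspace_add subspace_scale)
      have "(N ^^ l) ((N ^^ q) e) = 0" "(N ^^ l) ((N ^^ q) f) = 0"
        using funpow_zero_mono[OF linN e(2), of "l + q"] funpow_zero_mono[OF linN f(2), of "l + q"]
        by (simp_all add: funpow_funpow)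
      then have nil1: "(N ^^ l) e1 = 0" "(N ^^ l) f1 = 0" using e(2) f(2) by (simp_all add: e1_def f1_def Np_simps)
      have Nk: "(N ^^ k) e1 = (N ^^ k) e + (a *\<^sub>R (N ^^ (k + q)) e + b *\<^sub>R (N ^^ (k + q)) f)"
        "(N ^^ k) f1 = (N ^^ k) f + c *\<^sub>R (N ^^ (k + q)) e" for k
        by (simp_all add: e1_def f1_def Np_simps funpow_funpow)
      have L: "B ((N ^^ q) x) ((N ^^ i) y) = \<kappa> ^ q * B x ((N ^^ (i + q)) y)" if "x \<in> A" "y \<in> A" for x y i
        using adj_Np[OF assms(1) that(1) Np_in[OF A(1) that(2), of i], of q]
        by (simp add: funpow_funpow add.commute)
      have kk: "\<kappa> ^ q * \<kappa> ^ q = 1" using kappa(2) by (simp flip: power_mult_distrib)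
      note Ls = L[OF e(1) e(1)] L[OF e(1) f(1)] L[OF f(1) e(1)] L[OF f(1) f(1)]
      have z2: "ee (k + (q + q)) = 0" "ff (k + (q + q)) = 0" "ef (k + (q + q)) = 0" if "k \<ge> m" for k
        using that mq hk[of "k + (q + q)"] by auto
      have z1: "ee (k + q) = 0" "ff (k + q) = 0" if "k \<ge> m" for k
        using that mq by (auto intro!: hk)
      have ef1: "ef (k + q) = (if k = m then 1 else 0)" "\<kappa> ^ (k + q) * ef (k + q) = (if k = m then - 1 else 0)" if "k \<ge> m" for k
        using that mq hk(3)[of "k + q"] ol assms(6) by auto
      have kmq: "\<kappa> ^ (m + q) = - 1" using mq(1) ol assms(6) by simp
      have v1: "B e1 ((N ^^ k) e1) = ee k + b * (if k = m then 1 - \<kappa> ^ q else 0)" if "k \<ge> m" for k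
      proof -
        have "B e1 ((N ^^ k) e1) = ee k + (a * ee (k + q) + b * ef (k + q))
           + \<kappa> ^ q * (a * ee (k + q) + b * (\<kappa> ^ (k + q) * ef (k + q)))"
          unfolding Nk by (simp add: e1_def bilin[OF A(2)] Ls fe ee_def[symmetric] ff_def[symmetric] ef_def[symmetric] algebra_simps z2[OF that])
        then show ?thesis by (auto simp: z1[OF that] ef1[OF that] kmq algebra_simps)
      qed
      have v2: "B f1 ((N ^^ k) f1) = ff k + c * (if k = m then \<kappa> ^ q - 1 else 0)" if "k \<ge> m" for k
      proof -
        have "B f1 ((N ^^ k) f1) = ff k + c * (\<kappa> ^ (k + q) * ef (k + q)) + \<kappa> ^ q * (c * ef (k + q))"
          unfolding Nk by (simp add: f1_def bilin[OF A(2)] Ls fe ee_def[symmetric] ff_def[symmetric] ef_def[symmetric] algebra_simps z2[OF that])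
        then show ?thesis by (auto simp: z1[OF that] ef1[OF that] kmq algebra_simps)
      qed
      have v3: "B e1 ((N ^^ k) f1) = ef k + \<kappa> ^ q * a * (if k = m then 1 else 0)" if "k \<ge> m" for k
      proof -
        have "B e1 ((N ^^ k) f1) = ef k + c * ee (k + q) + \<kappa> ^ q * (a * ef (k + q) + b * ff (k + q))"
          unfolding Nk by (simp add: e1_def bilin[OF A(2)] Ls fe ee_def[symmetric] ff_def[symmetric] ef_def[symmetric] algebra_simps z2[OF that])
        then show ?thesis by (auto simp: z1[OF that] ef1[OF that] kmq algebra_simps)
      qed
      have "B e1 ((N ^^ k) e1) = 0 \<and> B f1 ((N ^^ k) f1) = 0 \<and> B e1 ((N ^^ k) f1) = (if k = l - 1 then 1 else 0)"
        if k: "l - 1 \<le> k + Suc j" for k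
      proof (cases "k = m")
        case True
        have "\<kappa> ^ q = - 1 \<or> (ee m = 0 \<and> ff m = 0)"
        proof (cases "even m")
          case True
          then have "odd q" using mq(1) ol by presburger
          then show ?thesis using assms(6) by simp
        next
          case False
          then show ?thesis using selfodd e(1) f(1) by (simp add: ee_def ff_def)
        qed
        moreover have "m \<noteq> l - 1" using mq by simp
        ultimately show ?thesis using v1[of k] v2[of k] v3[of k] True kk by (auto simp: a_def b_def c_def)
      next
        case False
        then have "k > m" using k mq by (simp add: q_def)
        then show ?thesis using v1[of k] v2[of k] v3[of k] False hk[of k] by simp
      qed
      then show ?thesis using in1 nil1 by blast
    qed
  qed
  note ex = this
  have "(l - 1 \<le> k + l) = True" for k by simp
  then show ?thesis using ex[of l] by (simp only: simp_thms)
qed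

end

section \<open>Completeness of the invariants; cyclic blocks\<close>

context nil_sys begin

lemma pos_index_posD:
  assumes "0 < pos_index c A" "subspace (A :: 'v set)"
  shows "\<exists>e\<in>A. 0 < c e e"
proof (rule ccontr)
  assume "\<not> ?thesis"
  then have "pos_index c A = 0" using pos_index_nonpos[of A c] assms(2) by (simp add: not_less)
  then show False using assms(1) by simp
qed

lemma ker_pow_full: "A \<subseteq> U \<Longrightarrow> ker_pow N L A = A"
  using nilN by (auto simp: ker_pow_def)

lemma equivalent_uminus:
  "equivalent B A B' A' \<Longrightarrow> equivalent (\<lambda>u v. - B u v) A (\<lambda>u v. - B' u v) A'"
proof -
  have "corr \<Gamma> B A B' A' \<Longrightarrow> corr \<Gamma> (\<lambda>u v. - B u v) A (\<lambda>u v. - B' u v) A'" for \<Gamma>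
    by (simp add: corr_def)
  then show "equivalent B A B' A' \<Longrightarrow> ?thesis" unfolding equivalent_def by blast
qed

text \<open>The power of \<kappa> converts between the sign of \<open>bet\<close> and that of
  \<open>B e ((N ^^ (l - 1)) e)\<close>, which is the value being normalised.\<close>

lemma cyclic_generator:
  assumes "adm B A" "valid l" "e \<in> ker_pow N l A" "\<delta> = 1 \<or> \<delta> = - 1" "\<delta> * bet N B l e e > 0"
  shows "\<exists>e'\<in>A. (N ^^ l) e' = 0 \<and>
    (\<forall>k. B e' ((N ^^ k) e') = (if k = l - 1 then \<delta> * \<kappa> ^ ((l - 1) div 2) else 0))"
proof -
  have e: "e \<in> A" "(N ^^ l) e = 0" using assms(3) by (auto simp: ker_pow_def)
  have l: "1 \<le> l" using assms(2) by (simp add: valid_def)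
  have "\<kappa> ^ j = 1 \<or> \<kappa> ^ j = - 1" for j
    using kappa(1) by (metis power_one neg_one_even_power neg_one_odd_power)
  then have "\<delta> * \<kappa> ^ ((l - 1) div 2) = 1 \<or> \<delta> * \<kappa> ^ ((l - 1) div 2) = - 1"
    using assms(4) by (metis mult.left_neutral mult_minus1 minus_minus)
  moreover have "\<delta> * \<kappa> ^ ((l - 1) div 2) * B e ((N ^^ (l - 1)) e) > 0"
    using assms(5) bet_eq[OF assms(1) e(1) e(1) l] by (simp add: mult.assoc)
  ultimately show ?thesis using normalize_cyclic[OF assms(1) e assms(2)] by blast
qed

text \<open>Equal kernel dimensions give both sides the same highest order \<open>l\<close>. There
  equivalent blocks are found and split off, and the invariants of the complements stay equal, so
  induction on the dimension applies.\<close>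

theorem classification:
  assumes "adm B A" "adm B' A'" "\<And>m. dim (ker_pow N m A) = dim (ker_pow N m A')"
    and "\<And>m. valid m \<Longrightarrow> pos_index (bet N B m) (ker_pow N m A) = pos_index (bet N B' m) (ker_pow N m A')"
    and "\<And>m. valid m \<Longrightarrow> neg_index (bet N B m) (ker_pow N m A) = neg_index (bet N B' m) (ker_pow N m A')"
  shows "equivalent B A B' A'"
  using assms
proof (induction "dim A" arbitrary: A A' rule: less_induct)
  case less
  note adm = less.prems(1) and adm' = less.prems(2)
  have A: "inv_sub A" "subspace A" "A \<subseteq> U" "bilinear B" using admD[OF adm] by auto
  have A': "inv_sub A'" "subspace A'" "A' \<subseteq> U" "bilinear B'" using admD[OF adm'] by auto
  \<comment> \<open>Equality of kernel dimensions transfers "\<open>N ^^ m\<close> is zero" from one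
    side to the other; this makes the highest orders agree.\<close>
  have full: "ker_pow N m A = A" if "ker_pow N m A' = A'" for m
  proof -
    have "ker_pow N L A = A" "ker_pow N L A' = A'" using ker_pow_full[OF A(3)] ker_pow_full[OF A'(3)] by auto
    then have "dim A = dim A'" using less.prems(3)[of L] by simp
    then have "dim A \<le> dim (ker_pow N m A)" using less.prems(3)[of m] that by simp
    then show ?thesis
      by (intro fd.subspace_dim_equal subspace_ker_pow linN A(2) ker_pow_subset)
  qed
  have full': "ker_pow N m A' = A'" if "ker_pow N m A = A" for m
  proof -
    have "ker_pow N L A = A" "ker_pow N L A' = A'" using ker_pow_full[OF A(3)] ker_pow_full[OF A'(3)] by auto
    then have "dim A = dim A'" using less.prems(3)[of L] by simp
    then have "dim A' \<le> dim (ker_pow N m A')" using less.prems(3)[of m] that by simp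
    then show ?thesis
      by (intro fd.subspace_dim_equal subspace_ker_pow linN A'(2) ker_pow_subset)
  qed
  have step: "equivalent B A B' A'"
    if X: "adm B X" "X \<subseteq> A" "X \<noteq> {0}" and X': "adm B' X'" "X' \<subseteq> A'" and eq: "equivalent B X B' X'" for X X'
  proof -
    define Y where "Y = orth_in B A X"
    define Y' where "Y' = orth_in B' A' X'"
    note sp = adm_split[OF adm X(1,2), folded Y_def] and sp' = adm_split[OF adm' X', folded Y'_def]
    have nadm: "adm (\<lambda>u v. - B u v) A" "adm (\<lambda>u v. - B u v) X" "adm (\<lambda>u v. - B' u v) A'" "adm (\<lambda>u v. - B' u v) X'"
      using adm adm' X X' by (auto intro: adm_uminus)
    have nY: "Y = orth_in (\<lambda>u v. - B u v) A X" "Y' = orth_in (\<lambda>u v. - B' u v) A' X'"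
      by (simp_all add: Y_def Y'_def orth_in_def)
    have ker: "dim (ker_pow N m A) = dim (ker_pow N m X) + dim (ker_pow N m Y)"
      "dim (ker_pow N m A') = dim (ker_pow N m X') + dim (ker_pow N m Y')"
      "dim (ker_pow N m X) = dim (ker_pow N m X')" for m
      using split_invariants(1)[OF adm X(1,2) Y_def] split_invariants(1)[OF adm' X' Y'_def]
        equivalent_invariants(1)[OF X(1) X'(1) eq] by auto
    have "dim X > 0"
    proof -
      have "\<not> X \<subseteq> {0}" using X(3) subspace_0[OF admD(5)[OF X(1)]] by auto
      then have "dim X \<noteq> 0" by simp
      then show ?thesis by linarith
    qed
    then have "dim Y < dim A"
    proof -
      have "X \<subseteq> U" "Y \<subseteq> U" using A(3) X(2) by (auto simp: Y_def orth_in_def)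
      then have "ker_pow N L A = A" "ker_pow N L X = X" "ker_pow N L Y = Y"
        using ker_pow_full A(3) by auto
      then show ?thesis using ker(1)[of L] \<open>dim X > 0\<close> by simp
    qed
    moreover have "dim (ker_pow N m Y) = dim (ker_pow N m Y')" for m
      using ker less.prems(3)[of m] by simp
    moreover have "pos_index (bet N B m) (ker_pow N m Y) = pos_index (bet N B' m) (ker_pow N m Y')" if "valid m" for m
      using split_invariants(2)[OF adm X(1,2) Y_def that] split_invariants(2)[OF adm' X' Y'_def that]
        equivalent_invariants(2)[OF X(1) X'(1) eq that] less.prems(4)[OF that] by simp
    moreover have "neg_index (bet N B m) (ker_pow N m Y) = neg_index (bet N B' m) (ker_pow N m Y')" if "valid m" for m
      using split_invariants(2)[OF nadm(1,2) X(2) nY(1) that] split_invariants(2)[OF nadm(3,4) X'(2) nY(2) that]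
        equivalent_invariants(2)[OF nadm(2,4) equivalent_uminus[OF eq] that] less.prems(5)[OF that]
      by (simp add: bet_uminus)
    ultimately have "equivalent B Y B' Y'" using less.hyps sp(1) sp'(1) by blast
    then obtain \<Delta> where D: "corr \<Delta> B Y B' Y'" "pair_inv N \<Delta>" "pair_inv S \<Delta>" by (auto simp: equivalent_def)
    obtain \<Gamma> where G: "corr \<Gamma> B X B' X'" "pair_inv N \<Gamma>" "pair_inv S \<Gamma>" using eq by (auto simp: equivalent_def)
    have o: "B x y = 0 \<and> B y x = 0" if "x \<in> X" "y \<in> Y" for x y
      using that admD(7)[OF adm, of x y] X(2) by (auto simp: Y_def orth_in_def)
    have o': "B' x y = 0 \<and> B' y x = 0" if "x \<in> X'" "y \<in> Y'" for x y
      using that admD(7)[OF adm', of x y] X'(2) by (auto simp: Y'_def orth_in_def)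
    have "corr (span (\<Gamma> \<union> \<Delta>)) B A B' A'"
      using corr_sum[OF G(1) D(1) A(4) A'(4) o o'] sp(2) sp'(2) by simp
    then show ?thesis unfolding equivalent_def
      using pair_inv_sum[OF linN G(2) D(2)] pair_inv_sum[OF linS G(3) D(3)] by blast
  qed
  define l where "l = (LEAST m. ker_pow N m A = A)"
  have "ker_pow N L A = A" by (rule ker_pow_full[OF A(3)])
  then have l: "ker_pow N l A = A" unfolding l_def by (rule LeastI)
  have l': "ker_pow N l A' = A'" by (rule full'[OF l])
  show ?case
  proof (cases "l = 0")
    case True
    then have A0: "A = {0}" "A' = {0}"
      using l l' subspace_0[OF A(2)] subspace_0[OF A'(2)] by (auto simp: ker_pow_def)
    have "corr {(0, 0)} B {0} B' {0}"
      unfolding corr_def using subspace_single_0[where 'a = "'v \<times> 'v"] A(4) A'(4)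
      by (simp add: bilin zero_prod_def)
    then show ?thesis unfolding equivalent_def A0
      by (intro exI[of _ "{(0, 0)}"]) (simp add: pair_inv_def linear_0[OF linN] linear_0[OF linS])
  next
    case False
    then have l1: "1 \<le> l" by simp
    have ne: "ker_pow N (l - 1) A \<noteq> A" using not_less_Least[of "l - 1" "\<lambda>m. ker_pow N m A = A"] l1
      by (auto simp: l_def[symmetric])
    then have ne': "ker_pow N (l - 1) A' \<noteq> A'" using full by blast
    obtain u where u: "u \<in> A" "(N ^^ (l - 1)) u \<noteq> 0" using ne by (auto simp: ker_pow_def)
    obtain u' where u': "u' \<in> A'" "(N ^^ (l - 1)) u' \<noteq> 0" using ne' by (auto simp: ker_pow_def)
    \<comment> \<open>Nondegeneracy provides a pair of vectors whose pairing through the highest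
      power of \<open>N\<close> is nonzero.\<close>
    obtain v where v: "v \<in> A" "B ((N ^^ (l - 1)) u) v \<noteq> 0"
      using admD(3)[OF adm] Np_in[OF A(1) u(1)] u(2) by (auto simp: nondeg_on_def)
    obtain v' where v': "v' \<in> A'" "B' ((N ^^ (l - 1)) u') v' \<noteq> 0"
      using admD(3)[OF adm'] Np_in[OF A'(1) u'(1)] u'(2) by (auto simp: nondeg_on_def)
    have nu: "B u ((N ^^ (l - 1)) v) \<noteq> 0" using adj_Np[OF adm u(1) v(1)] v(2) by auto
    have nu': "B' u' ((N ^^ (l - 1)) v') \<noteq> 0" using adj_Np[OF adm' u'(1) v'(1)] v'(2) by auto
    have nil: "(N ^^ l) x = 0" if "x \<in> A" for x using l that by (auto simp: ker_pow_def)
    have nil': "(N ^^ l) x = 0" if "x \<in> A'" for x using l' that by (auto simp: ker_pow_def)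
    show ?thesis
    proof (cases "valid l")
      case True
      \<comment> \<open>The form at the exponent \<open>l\<close> is not zero, so it takes a
        positive or a negative value; equality of both indices lets the same sign be found on both
        sides.\<close>
      have "\<exists>\<delta> e e'. (\<delta> = 1 \<or> \<delta> = - 1) \<and> e \<in> A \<and> e' \<in> A' \<and> \<delta> * bet N B l e e > 0 \<and> \<delta> * bet N B' l e' e' > 0"
      proof (cases "pos_index (bet N B l) A > 0")
        case p: True
        then have "pos_index (bet N B' l) A' > 0" using less.prems(4)[OF True] l l' by simp
        then show ?thesis using pos_index_posD[OF p A(2)] pos_index_posD[of "bet N B' l" A'] A'(2)
          by (metis mult_1)
      next
        case p: False
        have "neg_index (bet N B l) A > 0"
        proof (rule ccontr)
          assume "\<not> ?thesis"
          then have "dim {u\<in>A. \<forall>v\<in>A. bet N B l u v = 0} = dim A"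
            using p index_rank[OF symf_bet[OF adm True] A(2)] by simp
          moreover have "subspace {u\<in>A. \<forall>v\<in>A. bet N B l u v = 0}"
            using A(2) by (auto simp: subspace_def bilin[OF bilinear_bet[OF A(4) linN]])
          ultimately have "{u\<in>A. \<forall>v\<in>A. bet N B l u v = 0} = A"
            by (intro fd.subspace_dim_equal) (use A(2) in auto)
          then have "bet N B l u v = 0" using u(1) v(1) by blast
          then show False using bet_eq[OF adm u(1) v(1) l1] nu kappa(3) by simp
        qed
        moreover from this have "neg_index (bet N B' l) A' > 0" using less.prems(5)[OF True] l l' by simp
        ultimately obtain e e' where "e \<in> A" "e' \<in> A'" "0 < - bet N B l e e" "0 < - bet N B' l e' e'"
          using pos_index_posD[of "\<lambda>u v. - bet N B l u v" A] pos_index_posD[of "\<lambda>u v. - bet N B' l u v" A'] A(2) A'(2) by blast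
        then show ?thesis by (intro exI[of _ "- 1"] exI[of _ e] exI[of _ e']) simp
      qed
      then obtain \<delta> e0 e0' where d: "\<delta> = 1 \<or> \<delta> = - 1" "e0 \<in> ker_pow N l A" "e0' \<in> ker_pow N l A'"
        "\<delta> * bet N B l e0 e0 > 0" "\<delta> * bet N B' l e0' e0' > 0" using l l' by auto
      obtain e where e: "e \<in> A" "(N ^^ l) e = 0"
        "\<And>k. B e ((N ^^ k) e) = (if k = l - 1 then \<delta> * \<kappa> ^ ((l - 1) div 2) else 0)"
        using cyclic_generator[OF adm True d(2,1,4)] by blast
      obtain e' where e': "e' \<in> A'" "(N ^^ l) e' = 0"
        "\<And>k. B' e' ((N ^^ k) e') = (if k = l - 1 then \<delta> * \<kappa> ^ ((l - 1) div 2) else 0)"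
        using cyclic_generator[OF adm' True d(3,1,5)] by blast
      have n: "B e ((N ^^ (l - 1)) e) \<noteq> 0" "B' e' ((N ^^ (l - 1)) e') \<noteq> 0"
        using e(3) e'(3) d(1) kappa(3) by auto
      have "e \<noteq> 0" using n(1) by (auto simp: bilin[OF A(4)])
      then have "frame e (S e) \<noteq> {0}" using frame_gen[of e "S e"] by auto
      moreover have "equivalent B (frame e (S e)) B' (frame e' (S e'))"
        by (rule cyclic_equivalent[OF adm adm' e(1) e'(1)]) (simp add: e(3) e'(3))
      ultimately show ?thesis
        using step frame_cyclic[OF adm e(1,2) l1 n(1)] frame_cyclic[OF adm' e'(1,2) l1 n(2)] by blast
    next
      case False
      then have k: "\<kappa> = - 1" "even l" using l1 kappa(1) by (auto simp: valid_def)
      have S0: "S x = 0" if "x \<in> U" for x using k(1) that tyNS by auto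
      obtain e f where e: "e \<in> A" "f \<in> A" "(N ^^ l) e = 0" "(N ^^ l) f = 0"
        "\<And>k. B e ((N ^^ k) e) = 0 \<and> B f ((N ^^ k) f) = 0 \<and> B e ((N ^^ k) f) = (if k = l - 1 then 1 else 0)"
        using normalize_hyperbolic[OF adm u(1) v(1) nil[OF u(1)] nil[OF v(1)] k l1 nu] by blast
      obtain e' f' where e': "e' \<in> A'" "f' \<in> A'" "(N ^^ l) e' = 0" "(N ^^ l) f' = 0"
        "\<And>k. B' e' ((N ^^ k) e') = 0 \<and> B' f' ((N ^^ k) f') = 0 \<and> B' e' ((N ^^ k) f') = (if k = l - 1 then 1 else 0)"
        using normalize_hyperbolic[OF adm' u'(1) v'(1) nil'[OF u'(1)] nil'[OF v'(1)] k l1 nu'] by blast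
      have swap: "C y ((N ^^ k) x) = \<kappa> ^ k * C x ((N ^^ k) y)" if "adm C D" "x \<in> D" "y \<in> D" for C D x y k
        using adj_Np[OF that(1) that(2,3), of k] admD(7)[OF that(1) that(3), of "(N ^^ k) x"]
          Np_in[OF admD(1)[OF that(1)] that(2), of k] by simp
      have adm_frame: "adm C (frame x y) \<and> frame x y \<subseteq> D"
        if h: "adm C D" "x \<in> D" "y \<in> D" "(N ^^ l) x = 0" "(N ^^ l) y = 0"
          "\<And>k. C x ((N ^^ k) x) = 0 \<and> C y ((N ^^ k) y) = 0 \<and> C x ((N ^^ k) y) = (if k = l - 1 then 1 else 0)" for C D x y
      proof -
        have D: "inv_sub D" "D \<subseteq> U" "bilinear C" using admD[OF h(1)] by auto
        have "inv_sub (frame x y)"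
          using frame_inv_sub[OF D(1) h(2,3)] S0 h(2,3) D(2) subspace_0[OF subspace_frame] by (simp add: subset_iff)
        moreover have "top_nondeg C l x y"
          unfolding top_nondeg_def
        proof (intro conjI allI impI)
          fix \<alpha> \<beta> assume z: "C (\<alpha> *\<^sub>R x + \<beta> *\<^sub>R y) ((N ^^ (l - 1)) x) = 0" "C (\<alpha> *\<^sub>R x + \<beta> *\<^sub>R y) ((N ^^ (l - 1)) y) = 0"
          then show "\<alpha> *\<^sub>R x + \<beta> *\<^sub>R y = 0"
            using h(6)[of "l - 1"] swap[OF h(1-3), of "l - 1"] kappa(3) by (simp add: bilin[OF D(3)])
        qed (use l1 h in auto)
        ultimately show ?thesis
          using adm_subset[OF h(1)] frame_nondeg[OF h(1-3)] frame_subset[OF D(1) h(2,3)] by blast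
      qed
      note F = adm_frame[OF adm e] and F' = adm_frame[OF adm' e']
      have "equivalent B (frame e f) B' (frame e' f')"
      proof (rule frame_equivalent[OF adm adm' e(1,2) e'(1,2)])
        show "B f ((N ^^ k) e) = B' f' ((N ^^ k) e')" for k
          using swap[OF adm e(1,2), of k] swap[OF adm' e'(1,2), of k] e(5)[of k] e'(5)[of k] by simp
        fix G assume G: "G = span (range (\<lambda>k. ((N ^^ k) e, (N ^^ k) e')) \<union> range (\<lambda>k. ((N ^^ k) f, (N ^^ k) f')))"
        have "(0, 0) \<in> G" unfolding G using span_zero by (simp add: zero_prod_def[symmetric])
        then show "(S e, S e') \<in> G \<and> (S f, S f') \<in> G" using S0 e(1,2) e'(1,2) A(3) A'(3) by (simp add: subset_iff)
      qed (use e(5) e'(5) in simp_all)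
      moreover have "frame e f \<noteq> {0}"
      proof
        assume "frame e f = {0}"
        then have "e = 0" using frame_gen[of e f] by auto
        then show False using e(5)[of "l - 1"] by (simp add: bilin[OF A(4)])
      qed
      ultimately show ?thesis using step F F' by blast
    qed
  qed
qed

text \<open>Supplies the block for the later change of sign: as it contributes to one positive index
  only, negating the form on it moves \<open>res_deg\<close> from that index to its negative
  counterpart and affects no other exponent.\<close>

lemma cyclic_block:
  assumes "adm B A" "valid l" "0 < pos_index (bet N B l) (ker_pow N l A)"
  shows "\<exists>X\<subseteq>A. adm B X \<and>
     (\<forall>m. valid m \<longrightarrow> pos_index (bet N B m) (ker_pow N m X) = (if m = l then res_deg else 0) \<and>
        neg_index (bet N B m) (ker_pow N m X) = 0)"
proof -
  have A: "inv_sub A" "subspace A" "A \<subseteq> U" "bilinear B" using admD[OF assms(1)] by auto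
  have l1: "1 \<le> l" using assms(2) by (simp add: valid_def)
  obtain e where "e \<in> ker_pow N l A" and pos: "0 < bet N B l e e"
    using pos_index_posD[OF assms(3) subspace_ker_pow[OF linN A(2)]] by blast
  then have e: "e \<in> A" "(N ^^ l) e = 0" by (auto simp: ker_pow_def)
  have n: "B e ((N ^^ (l - 1)) e) \<noteq> 0" using pos bet_eq[OF assms(1) e(1) e(1) l1] by auto
  define X where "X = frame e (S e)"
  have X: "adm B X" "X \<subseteq> A" unfolding X_def using frame_cyclic[OF assms(1) e l1 n] by auto
  have iX: "inv_sub X" "subspace X" using admD[OF X(1)] by auto
  have Se: "S e \<in> A" "e \<in> U" "e \<in> X" "S e \<in> X" "(N ^^ l) (S e) = 0"
    using e A inv_subD(4)[OF A(1)] frame_gen[where a = e and b = "S e"] S_Np[of e l] linear_0[OF linS]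
    unfolding X_def by (simp_all add: subset_iff)
  note top = top_nondeg_cyclic[OF assms(1) e l1 n]
  have z: "pos_index (bet N B m) (ker_pow N m X) = 0 \<and> neg_index (bet N B m) (ker_pow N m X) = 0"
    if "valid m" "m \<noteq> l" for m
  proof -
    have "bet N B m u u = 0" if "u \<in> ker_pow N m X" for u
      using frame_bet_zero[OF assms(1) e(1) Se(1) top _ \<open>m \<noteq> l\<close>, of u u] that \<open>valid m\<close> by (simp add: X_def valid_def)
    then show ?thesis
      using pos_index_nonpos[OF _ subspace_ker_pow[OF linN iX(2)], of m "bet N B m"]
        pos_index_nonpos[OF _ subspace_ker_pow[OF linN iX(2)], of m "\<lambda>u v. - bet N B m u v"] by simp
  qed
  have KX: "ker_pow N l X = X" using frame_nil[OF e(2) Se(5)] by (auto simp: ker_pow_def X_def)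
  let ?b = "bet N B l"
  have b: "bilinear ?b" by (rule bilinear_bet[OF A(4) linN])
  have sy: "symf X ?b" by (rule symf_bet[OF X(1) assms(2)])
  \<comment> \<open>The image of \<open>N\<close> lies in the radical of the form at
    \<open>l\<close>, so its indices on \<open>X\<close> can be read off on the span of
    \<open>e\<close> and \<open>S e\<close>.\<close>
  have bN: "?b u (N v) = 0" if "u \<in> X" "v \<in> X" for u v
  proof -
    have "(N ^^ (l - 1)) (N v) = (N ^^ l) v" using l1 by (cases l) (auto simp: funpow_swap1)
    moreover have "(N ^^ l) v = 0" using that(2) KX by (auto simp: ker_pow_def)
    ultimately show ?thesis using bet_eq[OF X(1) that(1) inv_subD(3)[OF iX(1) that(2)] l1]
      by (simp add: bilin[OF A(4)])
  qed
  have NX: "subspace (N ` X)" "N ` X \<subseteq> X" using linear_subspace_image[OF linN iX(2)] inv_subD(3)[OF iX(1)] by auto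
  have sp: "span (span {e, S e} \<union> N ` X) = X"
  proof
    show "span (span {e, S e} \<union> N ` X) \<subseteq> X"
      using Se NX iX(2) by (intro span_minimal) (auto intro: span_minimal[THEN subsetD, rotated 2])
    show "X \<subseteq> span (span {e, S e} \<union> N ` X)"
    proof
      fix x assume "x \<in> X"
      then obtain \<alpha> \<beta> y where y: "y \<in> X" "x = \<alpha> *\<^sub>R e + \<beta> *\<^sub>R S e + N y"
        using frame_decomp[of x e "S e"] by (auto simp: X_def)
      have "\<alpha> *\<^sub>R e + \<beta> *\<^sub>R S e \<in> span {e, S e}" by (intro span_add span_scale span_base) auto
      then show "x \<in> span (span {e, S e} \<union> N ` X)" unfolding y(2) using y(1) by (intro sum_in_span_Un) auto
    qed
  qed
  have eX: "span {e, S e} \<subseteq> X" using Se iX(2) by (intro span_minimal) auto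
  have split: "pos_index c X = pos_index c (span {e, S e}) + pos_index c (N ` X)"
    if "symf X c" "\<And>u v. u \<in> X \<Longrightarrow> v \<in> X \<Longrightarrow> c u (N v) = 0" for c
    using pos_index_sum[of "span {e, S e}" "N ` X" c] NX that eX unfolding sp by auto
  have "?b x x = 0" if "x \<in> N ` X" for x using that bN NX(2) by blast
  then have N0: "pos_index ?b (N ` X) = 0" "neg_index ?b (N ` X) = 0"
    using pos_index_nonpos[OF _ NX(1), of ?b] pos_index_nonpos[OF _ NX(1), of "\<lambda>u v. - ?b u v"] by simp_all
  have eS: "?b e (S e) = 0" "?b (S e) e = 0"
    using bet_eq[OF X(1) Se(3,4) l1] bet_eq[OF X(1) Se(4,3) l1] skew_values[OF X(1) Se(3)] by auto
  have pw: "pairwise (\<lambda>u v. ?b u v = 0) {e, S e}" using eS by (auto simp: pairwise_def)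
  have sb: "symf (span {e, S e}) ?b" using sy eX by (rule symf_subset)
  have neg: "neg_index ?b (span {e, S e}) = card {v \<in> {e, S e}. ?b v v < 0}"
    using neg_index_orth[OF sb _ pw] by simp
  have posi: "pos_index ?b (span {e, S e}) = card {v \<in> {e, S e}. 0 < ?b v v}"
    using pos_index_orth[OF sb _ pw] by simp
  have "pos_index ?b (span {e, S e}) = res_deg \<and> neg_index ?b (span {e, S e}) = 0"
  proof (cases rule: type_cases)
    case 1
    then have "S e = 0" using Se by simp
    then have s: "{v \<in> {e, S e}. 0 < ?b v v} = {e}" "{v \<in> {e, S e}. ?b v v < 0} = {}" using pos by (auto simp: bilin[OF b])
    have "res_deg = 1" using 1(1) unfolding res_deg_def by simp
    then show ?thesis unfolding posi neg s by simp
  next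
    case 2
    have z: "(N ^^ Suc (l - 1)) e = 0" "(N ^^ Suc (Suc (l - 1))) e = 0"
      by (rule funpow_zero_mono[OF linN e(2)], simp)+
    have "?b (S e) (S e) = \<omega> * ?b e e"
      using skew_square[OF X(1) Se(3) 2(1,3), of "l - 1"] z bet_eq[OF X(1) Se(4,4) l1] bet_eq[OF X(1) Se(3,3) l1]
      by (simp add: bilin[OF A(4)] 2(1) del: funpow.simps)
    then have S: "?b (S e) (S e) > 0" using pos 2(2) by simp
    then have s: "{v \<in> {e, S e}. 0 < ?b v v} = {e, S e}" "{v \<in> {e, S e}. ?b v v < 0} = {}" using pos by auto
    have "res_deg = 2" using 2(1) unfolding res_deg_def by simp
    moreover have "e \<noteq> S e" using eS pos by auto
    ultimately show ?thesis unfolding posi neg s by simp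
  qed
  then have "pos_index ?b X = res_deg \<and> neg_index ?b X = 0"
    using split[OF sy bN] split[OF symf_uminus[OF sy]] bN N0 by simp
  then show ?thesis using X z KX by (intro exI[of _ X]) auto
qed

end

section \<open>Primary components of an isometry\<close>

lemma poly_act_upto:
  assumes "Polynomial.degree g \<le> n"
  shows "poly_act \<sigma> g v = (\<Sum>i\<le>n. Polynomial.coeff g i *\<^sub>R (\<sigma> ^^ i) v)"
  unfolding poly_act_def
  by (rule sum.mono_neutral_left) (use assms in \<open>auto simp: Polynomial.coeff_eq_0\<close>)

lemma poly_act_linear: "linear \<sigma> \<Longrightarrow> linear (poly_act \<sigma> g)"
  by (intro linearI)
    (simp_all add: poly_act_def linear_add[OF linear_funpow] linear_scale[OF linear_funpow]
      scaleR_add_right sum.distrib scaleR_sum_right mult.commute)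

lemma poly_act_0 [simp]: "poly_act \<sigma> 0 v = 0"
  by (simp add: poly_act_def)

lemma poly_act_pCons:
  assumes "linear \<sigma>"
  shows "poly_act \<sigma> (pCons a g) v = a *\<^sub>R v + \<sigma> (poly_act \<sigma> g v)"
proof -
  have "Polynomial.degree (pCons a g) \<le> Suc (Polynomial.degree g)" by (rule degree_pCons_le)
  then have "poly_act \<sigma> (pCons a g) v = (\<Sum>i\<le>Suc (Polynomial.degree g). Polynomial.coeff (pCons a g) i *\<^sub>R (\<sigma> ^^ i) v)"
    by (rule poly_act_upto)
  also have "\<dots> = a *\<^sub>R v + (\<Sum>i\<le>Polynomial.degree g. Polynomial.coeff g i *\<^sub>R \<sigma> ((\<sigma> ^^ i) v))"
    unfolding sum.atMost_Suc_shift by simp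
  finally show ?thesis by (simp add: poly_act_def linear_sum[OF assms] linear_scale[OF assms])
qed

lemma poly_act_const: "linear \<sigma> \<Longrightarrow> poly_act \<sigma> [:a:] v = a *\<^sub>R v"
  by (simp add: poly_act_pCons linear_0)

lemma poly_act_1: "linear \<sigma> \<Longrightarrow> poly_act \<sigma> 1 v = v"
  by (simp add: poly_act_const one_pCons)

lemma poly_act_add: "poly_act \<sigma> (g + h) v = poly_act \<sigma> g v + poly_act \<sigma> h v"
proof -
  let ?n = "max (Polynomial.degree g) (Polynomial.degree h)"
  have "Polynomial.degree (g + h) \<le> ?n" by (rule degree_add_le_max)
  then show ?thesis
    using poly_act_upto[of "g + h" ?n \<sigma> v] poly_act_upto[of g ?n \<sigma> v] poly_act_upto[of h ?n \<sigma> v]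
    by (simp add: scaleR_add_left sum.distrib)
qed

lemma poly_act_smult: "poly_act \<sigma> (Polynomial.smult a g) v = a *\<^sub>R poly_act \<sigma> g v"
  using poly_act_upto[of "Polynomial.smult a g" "Polynomial.degree g" \<sigma> v] degree_smult_le[of a g]
  by (simp add: poly_act_def scaleR_sum_right)

lemma poly_act_commute:
  assumes "linear h" "\<And>v. h (\<sigma> v) = \<sigma> (h v)"
  shows "h (poly_act \<sigma> g v) = poly_act \<sigma> g (h v)"
proof -
  have "h ((\<sigma> ^^ i) v) = (\<sigma> ^^ i) (h v)" for i by (induction i) (simp_all add: assms(2))
  then show ?thesis by (simp add: poly_act_def linear_sum[OF assms(1)] linear_scale[OF assms(1)])
qed

lemma poly_act_mult:
  assumes "linear \<sigma>"
  shows "poly_act \<sigma> (g * h) v = poly_act \<sigma> g (poly_act \<sigma> h v)"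
proof (induction g)
  case (pCons a g)
  then show ?case
    by (simp add: poly_act_add poly_act_smult poly_act_pCons[OF assms] )
qed simp

lemma poly_act_power:
  assumes "linear \<sigma>"
  shows "poly_act \<sigma> (p ^ k) v = (poly_act \<sigma> p ^^ k) v"
  by (induction k) (simp_all add: poly_act_1[OF assms] poly_act_mult[OF assms])

lemma poly_act_comm:
  assumes "linear \<sigma>"
  shows "poly_act \<sigma> g (poly_act \<sigma> h v) = poly_act \<sigma> h (poly_act \<sigma> g v)"
  by (simp add: mult.commute flip: poly_act_mult[OF assms])

lemma poly_act_in:
  assumes "subspace A" "\<And>v. v \<in> A \<Longrightarrow> \<sigma> v \<in> A" "v \<in> A"
  shows "poly_act \<sigma> g v \<in> A"
proof -
  have "(\<sigma> ^^ i) v \<in> A" for i by (induction i) (auto intro: assms)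
  then show ?thesis unfolding poly_act_def by (intro subspace_sum subspace_scale assms(1))
qed

lemma span_UN_E:
  assumes "v \<in> span (\<Union>j\<in>J. W j)" "\<And>j. j \<in> J \<Longrightarrow> subspace (W j)"
  obtains F x where "finite F" "F \<subseteq> J" "\<And>j. j \<in> F \<Longrightarrow> x j \<in> W j" "v = (\<Sum>j\<in>F. x j)"
proof -
  have "\<exists>F x. finite F \<and> F \<subseteq> J \<and> (\<forall>j\<in>F. x j \<in> W j) \<and> v = (\<Sum>j\<in>F. x j)"
    using assms(1)
  proof (induction rule: span_induct_alt)
    case base
    then show ?case by (intro exI[of _ "{}"]) simp
  next
    case (step c w y)
    obtain j where j: "j \<in> J" "w \<in> W j" using step by blast
    obtain F x where F: "finite F" "F \<subseteq> J" "\<forall>j\<in>F. x j \<in> W j" "y = (\<Sum>j\<in>F. x j)" using step by blast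
    define x' where "x' = x(j := c *\<^sub>R w + (if j \<in> F then x j else 0))"
    have "(\<Sum>i\<in>insert j F. x' i) = x' j + (\<Sum>i\<in>F - {j}. x i)"
      using F(1) by (subst sum.insert_remove) (auto simp: x'_def intro!: sum.cong)
    also have "\<dots> = c *\<^sub>R w + y"
      using F(1,4) sum.remove[of F j x] by (auto simp: x'_def)
    finally have "c *\<^sub>R w + y = (\<Sum>i\<in>insert j F. x' i)" by simp
    moreover have "\<forall>i\<in>insert j F. x' i \<in> W i"
      using F j assms(2)[OF j(1)] by (auto simp: x'_def intro!: subspace_add subspace_scale)
    ultimately show ?case using F j by (intro exI[of _ "insert j F"] exI[of _ x']) auto
  qed
  then show ?thesis using that by blast
qed

section \<open>Indices of orthogonal families of subspaces\<close>

context fin_dim begin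

lemma pos_index_zero: "pos_index c {0 :: 'v} = 0" if "bilinear c"
  using pos_index_nonpos[of "{0}" c] by (simp add: bilin[OF that])

lemma pos_index_family:
  fixes A :: "'i \<Rightarrow> 'v set"
  assumes "finite I" "\<And>i. i \<in> I \<Longrightarrow> subspace (A i)" "symf (span (\<Union>i\<in>I. A i)) c"
    and "\<And>i j x y. i \<in> I \<Longrightarrow> j \<in> I \<Longrightarrow> i \<noteq> j \<Longrightarrow> x \<in> A i \<Longrightarrow> y \<in> A j \<Longrightarrow> c x y = 0"
  shows "pos_index c (span (\<Union>i\<in>I. A i)) = (\<Sum>i\<in>I. pos_index c (A i))"
  using assms
proof (induction I)
  case empty
  then show ?case using pos_index_zero by (simp add: symf_def)
next
  case (insert i I)
  have c: "bilinear c" using insert.prems(2) by (simp add: symf_def)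
  have sp: "span (\<Union>i\<in>insert i I. A i) = span (A i \<union> span (\<Union>i\<in>I. A i))"
    using span_Un_spans[of "A i" "\<Union>i\<in>I. A i"] insert.prems(1) by (simp add: span_eq_iff[THEN iffD2])
  have s: "symf (span (\<Union>i\<in>I. A i)) c"
    by (rule symf_subset[OF insert.prems(2) span_mono]) auto
  have "pos_index c (span (A i \<union> span (\<Union>i\<in>I. A i))) = pos_index c (A i) + pos_index c (span (\<Union>i\<in>I. A i))"
  proof (rule pos_index_sum)
    fix x y assume xy: "x \<in> A i" "y \<in> span (\<Union>i\<in>I. A i)"
    have "c x y = 0" if "j \<in> I" "y \<in> A j" for j y
      using insert.prems(3)[of i j x y] insert.hyps(2) that xy(1) by blast
    then have "span (\<Union>i\<in>I. A i) \<subseteq> {y. c x y = 0}"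
      by (intro span_minimal) (auto simp: subspace_def bilin[OF c])
    then show "c x y = 0" using xy by blast
  qed (use insert.prems sp in auto)
  moreover have "pos_index c (span (\<Union>i\<in>I. A i)) = (\<Sum>i\<in>I. pos_index c (A i))"
    by (rule insert.IH) (use insert.prems s in blast)+
  ultimately show ?case using insert.hyps unfolding sp by simp
qed

lemma sgn_index_family:
  fixes A :: "'i \<Rightarrow> 'v set"
  assumes "finite I" "\<And>i. i \<in> I \<Longrightarrow> subspace (A i)" "symf (span (\<Union>i\<in>I. A i)) c"
    and "\<And>i j x y. i \<in> I \<Longrightarrow> j \<in> I \<Longrightarrow> i \<noteq> j \<Longrightarrow> x \<in> A i \<Longrightarrow> y \<in> A j \<Longrightarrow> c x y = 0"
  shows "sgn_index c (span (\<Union>i\<in>I. A i)) = (\<Sum>i\<in>I. sgn_index c (A i))"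
  using pos_index_family[OF assms] pos_index_family[OF assms(1,2) symf_uminus[OF assms(3)]] assms(4)
  by (simp add: sgn_index_def sum_subtractf)

lemma inj_on_image_eq:
  fixes A :: "'v set" and f :: "'v \<Rightarrow> 'v"
  assumes "linear f" "subspace A" "f ` A \<subseteq> A" "\<And>x. x \<in> A \<Longrightarrow> f x = 0 \<Longrightarrow> x = 0"
  shows "inj_on f A" "f ` A = A"
proof -
  show i: "inj_on f A" using linear_inj_on_iff_eq_0[OF assms(1,2)] assms(4) by blast
  then have "dim (f ` A) = dim A"
    using fdp.dim_image_eq[OF assms(1), of A] assms(2) by (simp add: span_eq_iff[THEN iffD2])
  then show "f ` A = A" using fd.subspace_dim_equal[OF linear_subspace_image[OF assms(1,2)] assms(2,3)] by simp
qed

end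

text \<open>The objects that vary while \<open>\<sigma>\<close> stays fixed: the nondegenerate
  symmetric forms on the whole space that are invariant under it.\<close>

definition iso_form :: "('v::real_vector \<Rightarrow> 'v) \<Rightarrow> ('v \<Rightarrow> 'v \<Rightarrow> real) \<Rightarrow> bool" where
  "iso_form \<sigma> B \<longleftrightarrow> symf UNIV B \<and> (\<forall>u. (\<forall>v. B u v = 0) \<longrightarrow> u = 0) \<and> (\<forall>u v. B (\<sigma> u) (\<sigma> v) = B u v)"

lemma iso_formD:
  assumes "iso_form \<sigma> B"
  shows "bilinear B" "B u v = B v u" "B (\<sigma> u) (\<sigma> v) = B u v" "(\<And>v. B u v = 0) \<Longrightarrow> u = 0" "symf A B"
  using assms by (auto simp: iso_form_def symf_def)

text \<open>The adjoint of g(\<sigma>) is g(\<sigma>^-1). Multiplying by \<sigma> to the degree of g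
  turns it into the reflected polynomial at \<sigma> and keeps inverses out.\<close>

lemma iso_form_poly_act:
  assumes "iso_form \<sigma> B"
  shows "B (poly_act \<sigma> g u) ((\<sigma> ^^ Polynomial.degree g) v) = B u (poly_act \<sigma> (reflect_poly g) v)"
proof -
  let ?d = "Polynomial.degree g"
  have pow: "B ((\<sigma> ^^ i) u) ((\<sigma> ^^ i) v) = B u v" for i u v
    by (induction i) (simp_all add: iso_formD(3)[OF assms])
  have "B (poly_act \<sigma> g u) ((\<sigma> ^^ ?d) v) = (\<Sum>i\<le>?d. Polynomial.coeff g i * B ((\<sigma> ^^ i) u) ((\<sigma> ^^ ?d) v))"
    by (simp add: poly_act_def bilinear_lsum[OF iso_formD(1)[OF assms]] bilin[OF iso_formD(1)[OF assms]])
  also have "\<dots> = (\<Sum>i\<le>?d. Polynomial.coeff g i * B u ((\<sigma> ^^ (?d - i)) v))"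
  proof (rule sum.cong)
    fix i assume "i \<in> {..?d}"
    then have "(\<sigma> ^^ ?d) v = (\<sigma> ^^ i) ((\<sigma> ^^ (?d - i)) v)" by (simp add: funpow_funpow)
    then show "Polynomial.coeff g i * B ((\<sigma> ^^ i) u) ((\<sigma> ^^ ?d) v) = Polynomial.coeff g i * B u ((\<sigma> ^^ (?d - i)) v)"
      by (simp only: pow)
  qed simp
  also have "\<dots> = (\<Sum>i\<le>?d. Polynomial.coeff g (?d - i) * B u ((\<sigma> ^^ i) v))"
    by (rule sum.reindex_bij_witness[of _ "\<lambda>i. ?d - i" "\<lambda>i. ?d - i"]) auto
  also have "\<dots> = (\<Sum>i\<le>?d. Polynomial.coeff (reflect_poly g) i * B u ((\<sigma> ^^ i) v))"
    by (rule sum.cong) (auto simp: coeff_reflect_poly)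
  also have "\<dots> = B u (poly_act \<sigma> (reflect_poly g) v)"
    using poly_act_upto[OF degree_reflect_poly_le[of g], of \<sigma> v]
    by (simp add: bilinear_rsum[OF iso_formD(1)[OF assms]] bilin[OF iso_formD(1)[OF assms]])
  finally show ?thesis .
qed

lemma reciprocal_reflect: "reciprocal p \<Longrightarrow> poly p 0 \<noteq> 0 \<and> reflect_poly p = Polynomial.smult (poly p 0) p"
proof -
  assume "reciprocal p"
  then have 1: "poly p 0 \<noteq> 0" "p = Polynomial.smult (inverse (poly p 0)) (reflect_poly p)"
    by (auto simp: reciprocal_def poly_star_def)
  have "Polynomial.smult (poly p 0) p = Polynomial.smult (poly p 0) (Polynomial.smult (inverse (poly p 0)) (reflect_poly p))"
    using 1(2) by simp
  also have "\<dots> = reflect_poly p" using 1(1) by simp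
  finally show ?thesis using 1(1) by simp
qed

text \<open>Through \<open>iso_form_poly_act\<close> this makes the adjoint of p(\<sigma>) a unit
  multiple of p(\<sigma>), for all three types of index.\<close>

lemma I_all_reflect:
  assumes "p \<in> I_all f"
  shows "\<exists>c. c \<noteq> 0 \<and> reflect_poly p = Polynomial.smult c p"
proof (cases "p \<in> I0 f \<union> I1 f")
  case True
  then show ?thesis using reciprocal_reflect[of p] by (auto simp: I0_def I1_def)
next
  case False
  then obtain q where q: "p = q * poly_star q" "poly q 0 \<noteq> 0" using assms by (auto simp: I_all_def I2_def)
  have "reflect_poly (reflect_poly q) = q" using q(2) by (simp add: poly_0_coeff_0)
  then have "reflect_poly p = p"
    unfolding q(1) poly_star_def by (simp add: reflect_poly_mult reflect_poly_smult mult.commute)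
  then show ?thesis by (intro exI[of _ 1]) simp
qed

text \<open>Contains no form: \<open>\<sigma>\<close> and the decomposition are fixed, and
  statements about forms are proved for every \<open>iso_form\<close>. Orthogonality of the
  decomposition for one particular form is added in \<open>orth_isom_sys\<close>.\<close>

locale isom_sys = fin_dim Bs for Bs :: "'v::real_vector set" +
  fixes \<sigma> :: "'v \<Rightarrow> 'v" and f :: "real poly" and W :: "real poly \<times> nat \<Rightarrow> 'v set"
  assumes lin: "linear \<sigma>" and bij: "bij \<sigma>"
    and dirW: "direct_sum (I_all f \<times> {1..}) W UNIV"
    and invW: "\<And>j. j \<in> I_all f \<times> {1..} \<Longrightarrow> \<sigma> ` W j \<subseteq> W j"
    and freeW: "\<And>p l. p \<in> I_all f \<Longrightarrow> 1 \<le> l \<Longrightarrow> free_quot \<sigma> (p ^ l) (W (p, l))"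
    and primW: "\<And>p. p \<in> I_all f \<Longrightarrow> direct_sum {1..} (\<lambda>l. W (p, l)) (primary_component \<sigma> p)"
begin

abbreviation V :: "real poly \<Rightarrow> 'v set" where "V p \<equiv> primary_component \<sigma> p"

lemma subW: "p \<in> I_all f \<Longrightarrow> 1 \<le> l \<Longrightarrow> subspace (W (p, l))"
  using dirW by (auto simp: direct_sum_def)

lemma V_span: "p \<in> I_all f \<Longrightarrow> V p = span (\<Union>l\<in>{1..}. W (p, l))"
  using primW by (auto simp: direct_sum_def)

lemma subV: "p \<in> I_all f \<Longrightarrow> subspace (V p)"
  by (simp add: V_span)

lemma W_V: "p \<in> I_all f \<Longrightarrow> 1 \<le> l \<Longrightarrow> W (p, l) \<subseteq> V p"
  by (auto simp: V_span intro!: span_base)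

lemma W_direct:
  assumes "finite F" "F \<subseteq> I_all f \<times> {1..}" "\<And>j. j \<in> F \<Longrightarrow> x j \<in> W j" "(\<Sum>j\<in>F. x j) = 0" "j \<in> F"
  shows "x j = 0"
proof -
  have "\<forall>F x. finite F \<and> F \<subseteq> I_all f \<times> {1..} \<and> (\<forall>j\<in>F. x j \<in> W j) \<and> (\<Sum>j\<in>F. x j) = 0
      \<longrightarrow> (\<forall>j\<in>F. x j = 0)"
    using dirW unfolding direct_sum_def by (elim conjE)
  from this[THEN spec[of _ F], THEN spec[of _ x]] show ?thesis using assms by simp
qed

text \<open>A common element has one expansion over the indices with \<open>p\<close> and another
  over those with \<open>q\<close>; their difference is a relation in the direct sum of all
  \<open>W j\<close>.\<close>

lemma V_disjoint:
  assumes "p \<in> I_all f" "q \<in> I_all f" "p \<noteq> q" "v \<in> V p" "v \<in> V q"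
  shows "v = 0"
proof -
  obtain F x where F: "finite F" "F \<subseteq> {1..}" "\<And>l. l \<in> F \<Longrightarrow> x l \<in> W (p, l)" "v = (\<Sum>l\<in>F. x l)"
    using assms(4) subW[OF assms(1)] unfolding V_span[OF assms(1)] by (elim span_UN_E) auto
  obtain G y where G: "finite G" "G \<subseteq> {1..}" "\<And>l. l \<in> G \<Longrightarrow> y l \<in> W (q, l)" "v = (\<Sum>l\<in>G. y l)"
    using assms(5) subW[OF assms(2)] unfolding V_span[OF assms(2)] by (elim span_UN_E) auto
  define H where "H = (\<lambda>l. (p, l)) ` F \<union> (\<lambda>l. (q, l)) ` G"
  define z where "z j = (if fst j = p then x (snd j) else - y (snd j))" for j
  have H: "finite H" "H \<subseteq> I_all f \<times> {1..}" using F G assms by (auto simp: H_def)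
  have zW: "z j \<in> W j" if "j \<in> H" for j
    using that F(3) G(3) subspace_neg[OF subW[OF assms(2)]] G(2) assms(3) by (auto simp: H_def z_def)
  have "(\<Sum>j\<in>H. z j) = (\<Sum>j\<in>(\<lambda>l. (p, l)) ` F. z j) + (\<Sum>j\<in>(\<lambda>l. (q, l)) ` G. z j)"
    unfolding H_def by (rule sum.union_disjoint) (use F G assms(3) in auto)
  also have "\<dots> = (\<Sum>l\<in>F. x l) + (\<Sum>l\<in>G. - y l)"
    using assms(3) by (simp add: sum.reindex inj_on_def z_def)
  also have "\<dots> = 0" using F(4) G(4) by (simp add: sum_negf)
  finally have "z j = 0" if "j \<in> H" for j using W_direct[OF H zW _ that] by blast
  then have "x l = 0" if "l \<in> F" for l using that by (force simp: H_def z_def)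
  then show ?thesis using F(4) by simp
qed

text \<open>Each vector of the finite basis involves finitely many summands. Finiteness is thus
  drawn from the space and not from \<open>f\<close>, and directness makes every other summand
  zero.\<close>

lemma finite_support: "\<exists>F. finite F \<and> F \<subseteq> I_all f \<times> {1..} \<and> span (\<Union>j\<in>F. W j) = UNIV \<and>
    (\<forall>j\<in>I_all f \<times> {1..} - F. W j = {0})"
proof -
  have "\<exists>F. finite F \<and> F \<subseteq> I_all f \<times> {1..} \<and> b \<in> span (\<Union>j\<in>F. W j)" for b
  proof -
    have "b \<in> span (\<Union>j\<in>I_all f \<times> {1..}. W j)" using dirW by (auto simp: direct_sum_def)
    then obtain F x where F: "finite F" "F \<subseteq> I_all f \<times> {1..}" "\<And>j. j \<in> F \<Longrightarrow> x j \<in> W j" "b = (\<Sum>j\<in>F. x j)"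
      using subW by (elim span_UN_E) auto
    then have "b \<in> span (\<Union>j\<in>F. W j)" unfolding F(4) by (intro span_sum span_base) blast
    then show ?thesis using F by blast
  qed
  then obtain Fb where Fb: "\<And>b. finite (Fb b) \<and> Fb b \<subseteq> I_all f \<times> {1..} \<and> b \<in> span (\<Union>j\<in>Fb b. W j)" by metis
  define F where "F = (\<Union>b\<in>Bs. Fb b)"
  have F: "finite F" "F \<subseteq> I_all f \<times> {1..}" using Fb finite_Bs by (auto simp: F_def)
  have "Bs \<subseteq> span (\<Union>j\<in>F. W j)"
  proof
    fix b assume "b \<in> Bs"
    then have "span (\<Union>j\<in>Fb b. W j) \<subseteq> span (\<Union>j\<in>F. W j)" by (intro span_mono) (auto simp: F_def)
    then show "b \<in> span (\<Union>j\<in>F. W j)" using Fb by blast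
  qed
  then have sp: "span (\<Union>j\<in>F. W j) = UNIV" using span_minimal[of Bs "span (\<Union>j\<in>F. W j)"] span_Bs by auto
  have "w = 0" if j: "j \<in> I_all f \<times> {1..} - F" and w: "w \<in> W j" for j w
  proof -
    have "w \<in> span (\<Union>j\<in>F. W j)" using sp by simp
    then obtain G x where G: "finite G" "G \<subseteq> F" "\<And>j. j \<in> G \<Longrightarrow> x j \<in> W j" "w = (\<Sum>j\<in>G. x j)"
      by (rule span_UN_E) (use F(2) subW in auto)
    define z where "z = x(j := - w)"
    have jG: "j \<notin> G" using j G(2) by blast
    have "(\<Sum>i\<in>insert j G. z i) = 0"
    proof -
      have "(\<Sum>i\<in>G. z i) = w" unfolding G(4) by (rule sum.cong) (use jG in \<open>auto simp: z_def\<close>)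
      then show ?thesis using G(1) jG by (simp add: z_def)
    qed
    moreover have "z i \<in> W i" if "i \<in> insert j G" for i
    proof -
      have "subspace (W j)" using j subW by auto
      then show ?thesis using that G(3)[of i] w by (cases "i = j") (simp_all add: z_def subspace_neg)
    qed
    ultimately have "z j = 0" using G(1,2) F(2) j by (intro W_direct[of "insert j G" z]) auto
    then show ?thesis by (simp add: z_def)
  qed
  moreover have "0 \<in> W j" if "j \<in> I_all f \<times> {1..}" for j using that subW subspace_0 by auto
  ultimately show ?thesis using F sp by (intro exI[of _ F]) blast
qed

definition supp :: "(real poly \<times> nat) set" where
  "supp = (SOME F. finite F \<and> F \<subseteq> I_all f \<times> {1..} \<and> span (\<Union>j\<in>F. W j) = UNIV \<and>
    (\<forall>j\<in>I_all f \<times> {1..} - F. W j = {0}))"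

lemma supp: "finite supp" "supp \<subseteq> I_all f \<times> {1..}" "span (\<Union>j\<in>supp. W j) = UNIV"
    "p \<in> I_all f \<Longrightarrow> 1 \<le> l \<Longrightarrow> (p, l) \<notin> supp \<Longrightarrow> W (p, l) = {0}"
  using someI_ex[OF finite_support, folded supp_def] by auto

text \<open>Strictly above every occurring exponent, so it is a common nilpotency exponent and also
  a sufficient range for sums over the odd exponents 2 k + 1. The inserted 0 covers an empty
  support.\<close>

definition K :: nat where "K = Suc (Max (insert 0 (snd ` supp)))"

lemma K_ge: "p \<in> I_all f \<Longrightarrow> 1 \<le> l \<Longrightarrow> W (p, l) \<noteq> {0} \<Longrightarrow> l < K"
proof -
  assume "p \<in> I_all f" "1 \<le> l" "W (p, l) \<noteq> {0}"
  then have "(p, l) \<in> supp" using supp(4) by blast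
  then have "l \<in> insert 0 (snd ` supp)" by force
  then have "l \<le> Max (insert 0 (snd ` supp))" using supp(1) by (intro Max_ge) auto
  then show "l < K" by (simp add: K_def)
qed

lemma pow_W: "p \<in> I_all f \<Longrightarrow> 1 \<le> l \<Longrightarrow> v \<in> W (p, l) \<Longrightarrow> (poly_act \<sigma> p ^^ l) v = 0"
  using freeW[of p l] by (auto simp: free_quot_def quot_basis_def simp flip: poly_act_power[OF lin])

lemma pow_V:
  assumes "p \<in> I_all f" "v \<in> V p"
  shows "(poly_act \<sigma> p ^^ K) v = 0"
proof -
  note linp = linear_funpow[OF poly_act_linear[OF lin]]
  have "(poly_act \<sigma> p ^^ K) w = 0" if "1 \<le> l" "w \<in> W (p, l)" for l w
  proof (cases "W (p, l) = {0}")
    case True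
    then show ?thesis using that linear_0[OF linp] by auto
  next
    case False
    then show ?thesis
      using funpow_zero_mono[OF poly_act_linear[OF lin] pow_W[OF assms(1) that]] K_ge[OF assms(1) that(1)] by simp
  qed
  then have "span (\<Union>l\<in>{1..}. W (p, l)) \<subseteq> {v. (poly_act \<sigma> p ^^ K) v = 0}"
    by (intro span_minimal) (auto simp: subspace_def linear_0[OF linp] linear_add[OF linp] linear_scale[OF linp])
  then show ?thesis using assms(2) V_span[OF assms(1)] by blast
qed

lemma V_I: "(poly_act \<sigma> p ^^ k) v = 0 \<Longrightarrow> v \<in> V p"
  unfolding primary_component_def
  using funpow_zero_mono[OF poly_act_linear[OF lin]] by (auto simp: eventually_sequentially intro!: exI[of _ k])

lemma V_commuting:
  assumes "p \<in> I_all f" "linear h" "\<And>v. h (\<sigma> v) = \<sigma> (h v)" "v \<in> V p"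
  shows "h v \<in> V p"
proof -
  have "(poly_act \<sigma> p ^^ K) (h v) = h ((poly_act \<sigma> p ^^ K) v)"
    unfolding poly_act_power[OF lin, symmetric] by (rule poly_act_commute[where h = h and \<sigma> = \<sigma>, OF assms(2,3), symmetric])
  then show ?thesis using pow_V[OF assms(1,4)] V_I[where p = p and k = K] linear_0[OF assms(2)] by simp
qed

lemma V_sigma: "p \<in> I_all f \<Longrightarrow> v \<in> V p \<Longrightarrow> \<sigma> v \<in> V p"
  using V_commuting[OF _ lin] by blast

definition primes :: "real poly set" where "primes = fst ` supp"

lemma primes: "finite primes" "primes \<subseteq> I_all f" "span (\<Union>p\<in>primes. V p) = UNIV"
proof -
  show "finite primes" "primes \<subseteq> I_all f" using supp(1,2) by (auto simp: primes_def)
  have "W j \<subseteq> (\<Union>p\<in>primes. V p)" if "j \<in> supp" for j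
  proof -
    have "j \<in> I_all f \<times> {1..}" using supp(2) that by blast
    then have "W j \<subseteq> V (fst j)" using W_V[of "fst j" "snd j"] by (simp add: mem_Times_iff)
    moreover have "fst j \<in> primes" using that by (simp add: primes_def)
    ultimately show ?thesis by blast
  qed
  then have "span (\<Union>j\<in>supp. W j) \<subseteq> span (\<Union>p\<in>primes. V p)" by (intro span_mono UN_least)
  then show "span (\<Union>p\<in>primes. V p) = UNIV" unfolding supp(3) by blast
qed

text \<open>q(\<sigma>) is bijective on \<open>V p\<close> and nilpotent on \<open>V q\<close>.
  Writing \<open>u\<close> as q(\<sigma>) u' and moving q(\<sigma>) to the other side lowers the
  order of nilpotency of \<open>v\<close> by one.\<close>

lemma V_orth:
  assumes "iso_form \<sigma> B" "p \<in> I_all f" "q \<in> I_all f" "p \<noteq> q" "u \<in> V p" "v \<in> V q"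
  shows "B u v = 0"
proof -
  obtain c where c: "c \<noteq> 0" "reflect_poly q = Polynomial.smult c q" using I_all_reflect[OF assms(3)] by blast
  let ?q = "poly_act \<sigma> q" and ?d = "Polynomial.degree q"
  have linq: "linear ?q" by (rule poly_act_linear[OF lin])
  have "?q ` V p = V p"
  proof (rule inj_on_image_eq(2)[OF linq subV[OF assms(2)]])
    show "?q ` V p \<subseteq> V p" using poly_act_in[where \<sigma> = \<sigma> and A = "V p", OF subV[OF assms(2)] V_sigma[OF assms(2)]] by blast
    fix x assume "x \<in> V p" "?q x = 0"
    then show "x = 0" using V_I[where p = q and k = 1 and v = x] V_disjoint[OF assms(2,3,4)] by simp
  qed
  then have surj: "\<exists>u'\<in>V p. u = ?q u'" if "u \<in> V p" for u using that by blast
  have "bij (\<sigma> ^^ ?d)" using bij by (rule bij_fn)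
  then have sd: "\<exists>v'. v = (\<sigma> ^^ ?d) v'" for v by (metis bij_pointE)
  have "(?q ^^ k) v = 0 \<Longrightarrow> u \<in> V p \<Longrightarrow> B u v = 0" for k u v
  proof (induction k arbitrary: u v)
    case 0
    then show ?case using iso_formD(1)[OF assms(1)] by (simp add: bilin)
  next
    case (Suc k)
    obtain u' where u': "u' \<in> V p" "u = ?q u'" using surj Suc.prems by blast
    \<comment> \<open>Supplies the power of \<open>\<sigma>\<close> that
      \<open>iso_form_poly_act\<close> expects in the second argument.\<close>
    obtain v' where v': "v = (\<sigma> ^^ ?d) v'" using sd by blast
    have "(\<sigma> ^^ ?d) ((?q ^^ Suc k) v') = (?q ^^ Suc k) ((\<sigma> ^^ ?d) v')"
      unfolding poly_act_power[OF lin, symmetric]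
      by (rule poly_act_commute[OF linear_funpow[OF lin]]) (simp add: funpow_swap1)
    also have "\<dots> = 0" using Suc.prems v' by simp
    finally have "(\<sigma> ^^ ?d) ((?q ^^ Suc k) v') = (\<sigma> ^^ ?d) 0" by (simp add: linear_0[OF linear_funpow[OF lin]])
    then have "(?q ^^ Suc k) v' = 0" by (rule injD[OF bij_is_inj[OF \<open>bij (\<sigma> ^^ ?d)\<close>]])
    then have "(?q ^^ k) (?q v') = 0" by (simp only: funpow_Suc_right o_apply)
    then have "B u' (?q v') = 0" using Suc.IH u'(1) by blast
    then show ?case unfolding u'(2) v' iso_form_poly_act[OF assms(1)] c(2)
      by (simp add: poly_act_smult bilin[OF iso_formD(1)[OF assms(1)]])
  qed
  then show ?thesis using pow_V[OF assms(3,6)] assms(5) by blast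
qed

lemma V_nondeg:
  assumes "iso_form \<sigma> B" "p \<in> I_all f"
  shows "nondeg_on (V p) B"
  unfolding nondeg_on_def
proof (intro ballI impI)
  fix u assume u: "u \<in> V p" "\<forall>v\<in>V p. B u v = 0"
  have "B u v = 0" if "q \<in> primes" "v \<in> V q" for q v
    using that u V_orth[OF assms _ _ u(1), of q v] primes(2) by (cases "p = q") auto
  then have "span (\<Union>q\<in>primes. V q) \<subseteq> {v. B u v = 0}"
    by (intro span_minimal) (auto simp: subspace_def bilin[OF iso_formD(1)[OF assms(1)]])
  then show "u = 0" using primes(3) iso_formD(4)[OF assms(1), of u] by blast
qed

lemma sgn_index_V:
  assumes "iso_form \<sigma> B"
  shows "sgn_index B UNIV = (\<Sum>p\<in>primes. sgn_index B (V p))"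
proof -
  have "sgn_index B (span (\<Union>p\<in>primes. V p)) = (\<Sum>p\<in>primes. sgn_index B (V p))"
  proof (rule sgn_index_family[OF primes(1)])
    show "B x y = 0" if "p \<in> primes" "q \<in> primes" "p \<noteq> q" "x \<in> V p" "y \<in> V q" for p q x y
      using V_orth[OF assms _ _ that(3-5)] that(1,2) primes(2) by blast
  qed (use primes(2) subV iso_formD(5)[OF assms] in auto)
  then show ?thesis by (simp add: primes(3))
qed

end

lemma funpow_mult_on:
  assumes "\<And>v. v \<in> A \<Longrightarrow> g v \<in> A" "\<And>v. v \<in> A \<Longrightarrow> h v \<in> A"
    and "\<And>v. v \<in> A \<Longrightarrow> f v = g (h v)" "\<And>v. v \<in> A \<Longrightarrow> g (h v) = h (g v)" "v \<in> A"
  shows "(f ^^ k) v = (g ^^ k) ((h ^^ k) v)"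
proof -
  have hA: "(h ^^ k) v \<in> A" if "v \<in> A" for k v by (induction k) (auto intro: assms that)
  have gA: "(g ^^ k) v \<in> A" if "v \<in> A" for k v by (induction k) (auto intro: assms that)
  have comm: "h ((g ^^ k) v) = (g ^^ k) (h v)" if "v \<in> A" for k v
  proof (induction k)
    case (Suc k)
    then show ?case using assms(4)[OF gA[OF that, of k]] by simp
  qed simp
  show ?thesis
  proof (induction k)
    case (Suc k)
    have "f ((g ^^ k) ((h ^^ k) v)) = g (h ((g ^^ k) ((h ^^ k) v)))"
      by (intro assms(3) gA hA assms(5))
    also have "h ((g ^^ k) ((h ^^ k) v)) = (g ^^ k) (h ((h ^^ k) v))"
      by (intro comm hA assms(5))
    finally show ?case using Suc by simp
  qed simp
qed

section \<open>Shape of the reciprocal factors of degree one and two\<close>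

lemma real_linear_poly_not_unit: "\<not> [:a, 1:] dvd (1 :: real poly)"
  by (simp add: is_unit_pCons_iff)

lemma I0_form:
  assumes "p \<in> I0 f"
  shows "\<exists>e. p = [:- e, 1:] \<and> e * e = 1"
proof -
  have p: "reciprocal p" "Polynomial.degree p = 1" using assms by (auto simp: I0_def)
  obtain c a where ca: "p = [:c, a:]" using p(2) by (metis degree1_coeffs)
  have r: "c \<noteq> 0" "reflect_poly p = Polynomial.smult c p" using reciprocal_reflect[OF p(1)] ca by auto
  have "Polynomial.coeff (reflect_poly p) 0 = a" "Polynomial.coeff (reflect_poly p) 1 = c"
    using p(2) by (simp_all add: coeff_reflect_poly) (simp_all add: ca)
  then have e: "a = c * c" "c = c * a"
    using arg_cong[OF r(2), of "\<lambda>p. Polynomial.coeff p 0"] arg_cong[OF r(2), of "\<lambda>p. Polynomial.coeff p 1"]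
    by (simp_all add: ca)
  have "a = 1" using e(2) r(1) by simp
  then show ?thesis using e(1) ca by (intro exI[of _ "- c"]) simp
qed

lemma I1_form:
  assumes "p \<in> I1 f"
  shows "\<exists>t. p = [:1, - t, 1:] \<and> t * t < 4"
proof -
  have p: "reciprocal p" "Polynomial.degree p = 2" "Factorial_Ring.irreducible p" using assms by (auto simp: I1_def)
  obtain c b a where cba: "p = [:c, b, a:]" using p(2) by (metis degree2_coeffs)
  have r: "c \<noteq> 0" "reflect_poly p = Polynomial.smult c p" using reciprocal_reflect[OF p(1)] cba by auto
  have "Polynomial.coeff (reflect_poly p) 0 = a" "Polynomial.coeff (reflect_poly p) 1 = b"
    "Polynomial.coeff (reflect_poly p) 2 = c"
    using p(2) by (simp_all add: coeff_reflect_poly) (simp_all add: cba numeral_2_eq_2)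
  then have e: "a = c * c" "b = c * b" "c = c * a"
    using arg_cong[OF r(2), of "\<lambda>p. Polynomial.coeff p 0"] arg_cong[OF r(2), of "\<lambda>p. Polynomial.coeff p 1"]
      arg_cong[OF r(2), of "\<lambda>p. Polynomial.coeff p 2"]
    by (simp_all add: cba numeral_2_eq_2)
  then have a: "a = 1" using r(1) by simp
  \<comment> \<open>The two cases to be excluded, constant term -1 and nonnegative discriminant,
    both yield a factorization into real linear factors.\<close>
  have red: False if "p = [:x, 1:] * [:y, 1:]" for x y
    using irreducibleD[OF p(3) that] real_linear_poly_not_unit by blast
  have "c = 1"
  proof (rule ccontr)
    assume "c \<noteq> 1"
    then have "b = 0" "c = - 1" using e a by (auto simp: square_eq_1_iff)
    then have "p = [:- 1, 1:] * [:1, 1:]" using cba a by simp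
    then show False using red by blast
  qed
  moreover have "b * b < 4"
  proof (rule ccontr)
    assume "\<not> ?thesis"
    define s where "s = sqrt (b * b - 4)"
    have s: "s * s = b * b - 4" using \<open>\<not> b * b < 4\<close> by (simp add: s_def)
    have "(b + s) / 2 * ((b - s) / 2) = 1" using s by (simp add: field_simps)
    then have "p = [:(b + s) / 2, 1:] * [:(b - s) / 2, 1:]"
      using cba a \<open>c = 1\<close> by (simp add: field_simps)
    then show False using red by blast
  qed
  ultimately show ?thesis using cba a by (intro exI[of _ "- b"]) simp
qed

lemma linear_inv_bij:
  fixes g :: "'v::real_vector \<Rightarrow> 'v"
  assumes "linear g" "bij g"
  shows "linear (inv_into UNIV g)"
proof (rule linearI)
  have i: "g (inv_into UNIV g v) = v" "inv_into UNIV g (g v) = v" for v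
    using assms(2) by (auto simp: bij_def surj_f_inv_f inv_f_f)
  show "inv_into UNIV g (x + y) = inv_into UNIV g x + inv_into UNIV g y" for x y
    using i(2)[of "inv_into UNIV g x + inv_into UNIV g y"] by (simp add: linear_add[OF assms(1)] i(1))
  show "inv_into UNIV g (c *\<^sub>R x) = c *\<^sub>R inv_into UNIV g x" for c x
    using i(2)[of "c *\<^sub>R inv_into UNIV g x"] by (simp add: linear_scale[OF assms(1)] i(1))
qed

lemma bij_inv_simps:
  assumes "bij g"
  shows "g (inv_into UNIV g v) = v" "inv_into UNIV g (g v) = v"
  using assms by (auto simp: bij_def surj_f_inv_f inv_f_f)

section \<open>Nilpotent models of the reciprocal components\<close>

context isom_sys begin

abbreviation si :: "'v \<Rightarrow> 'v" where "si \<equiv> inv_into UNIV \<sigma>"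

lemma si [simp]: "\<sigma> (si v) = v" "si (\<sigma> v) = v"
  by (rule bij_inv_simps[OF bij])+

lemma lin_si: "linear si"
  by (rule linear_inv_bij[OF lin bij])

lemma si_adj: "iso_form \<sigma> B \<Longrightarrow> B (si u) v = B u (\<sigma> v)" "iso_form \<sigma> B \<Longrightarrow> B u (si v) = B (\<sigma> u) v"
  using iso_formD(3)[of \<sigma> B "si u" v] iso_formD(3)[of \<sigma> B u "si v"] by auto

lemma sigma_inj0: "\<sigma> x = 0 \<Longrightarrow> x = 0"
  using linear_0[OF lin_si] by (metis si(2))

lemma sigma_image: "subspace A \<Longrightarrow> \<sigma> ` A \<subseteq> A \<Longrightarrow> \<sigma> ` A = A"
  using inj_on_image_eq(2)[OF lin] sigma_inj0 by blast

lemma si_in: "subspace A \<Longrightarrow> \<sigma> ` A \<subseteq> A \<Longrightarrow> v \<in> A \<Longrightarrow> si v \<in> A"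
  using sigma_image[of A] by (metis imageE si(2))

lemma si_commute: "(\<And>v. h (\<sigma> v) = \<sigma> (h v)) \<Longrightarrow> h (si v) = si (h v)"
  by (metis si)

text \<open>The \<open>\<Theta>\<close> clause says that \<open>N\<close> is \<open>p(\<sigma>)\<close> up to an automorphism, so that both have the same kernels; the
  next one recovers \<open>\<sigma>\<close> from \<open>N\<close> and \<open>S\<close> (a Neumann series inverts the Cayley transform).\<close>

definition model :: "real poly \<Rightarrow> ('v \<Rightarrow> 'v) \<Rightarrow> ('v \<Rightarrow> 'v) \<Rightarrow> real \<Rightarrow> real \<Rightarrow> real \<Rightarrow> bool" where
  "model p N S \<kappa> \<omega> t \<longleftrightarrow> nil_sys Bs (V p) N S \<kappa> \<omega> t K \<and>
     (\<forall>B. iso_form \<sigma> B \<longrightarrow> (\<forall>u\<in>V p. \<forall>v\<in>V p. B (N u) v = \<kappa> * B u (N v) \<and> B (S u) v = - B u (S v))) \<and>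
     (\<exists>\<Theta>. linear \<Theta> \<and> (\<forall>u\<in>V p. \<Theta> (N u) = poly_act \<sigma> p u \<and> N (\<Theta> u) = poly_act \<sigma> p u) \<and>
        (\<forall>A. subspace A \<longrightarrow> A \<subseteq> V p \<longrightarrow> \<sigma> ` A \<subseteq> A \<longrightarrow> inj_on \<Theta> A \<and> \<Theta> ` A = A)) \<and>
     (\<exists>c a b M. \<forall>u\<in>V p. \<sigma> u = c *\<^sub>R u + a *\<^sub>R (\<Sum>k<M. (N ^^ k) u) + b *\<^sub>R S u) \<and>
     (\<forall>A. subspace A \<longrightarrow> A \<subseteq> V p \<longrightarrow> \<sigma> ` A \<subseteq> A \<longrightarrow> (\<forall>u\<in>A. N u \<in> A \<and> S u \<in> A)) \<and>
     (\<forall>h. linear h \<longrightarrow> (\<forall>v. h (\<sigma> v) = \<sigma> (h v)) \<longrightarrow> (\<forall>u\<in>V p. h (N u) = N (h u))) \<and>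
     (\<kappa> = 1 \<and> p \<in> I1 f \<and> Polynomial.degree p = 2 \<or> \<kappa> = - 1 \<and> p \<in> I0 f \<and> Polynomial.degree p = 1)"

text \<open>Symmetry in \<sigma> and \<sigma>^-1 makes \<open>N\<close> selfadjoint, and
  antisymmetry makes \<open>S\<close> skew, for every invariant form. Since \<open>N\<close> is
  \<sigma>^-1 p(\<sigma>), the automorphism \<Theta> is \<open>\<sigma>\<close> itself.\<close>

lemma model_I1:
  assumes p: "p \<in> I1 f"
  shows "\<exists>N S \<kappa> \<omega> t. model p N S \<kappa> \<omega> t"
proof -
  have pI: "p \<in> I_all f" using p by (simp add: I_all_def)
  obtain t where t: "p = [:1, - t, 1:]" "t * t < 4" using I1_form[OF p] by blast
  define N where "N v = \<sigma> v + si v - t *\<^sub>R v" for v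
  define S where "S v = \<sigma> v - si v" for v
  have ls: "linear N" "linear S" unfolding N_def S_def
    by (auto intro!: linearI simp: linear_add[OF lin] linear_scale[OF lin] linear_add[OF lin_si] linear_scale[OF lin_si] algebra_simps)
  have act: "poly_act \<sigma> p v = v - t *\<^sub>R \<sigma> v + \<sigma> (\<sigma> v)" for v
    by (simp add: t(1) poly_act_pCons[OF lin] linear_0[OF lin] linear_add[OF lin] linear_diff[OF lin] linear_scale[OF lin] linear_neg[OF lin])
  have sN: "\<sigma> (N v) = poly_act \<sigma> p v" "N (\<sigma> v) = poly_act \<sigma> p v" for v
    unfolding act N_def by (simp_all add: linear_add[OF lin] linear_diff[OF lin] linear_scale[OF lin])
  have inN: "N u \<in> A \<and> S u \<in> A" if "subspace A" "\<sigma> ` A \<subseteq> A" "u \<in> A" for A u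
    unfolding N_def S_def using that si_in[OF that]
    by (auto intro!: subspace_add subspace_diff subspace_scale)
  have sV: "\<sigma> ` V p \<subseteq> V p" using V_sigma[OF pI] by blast
  have m1: "nil_sys Bs (V p) N S 1 (4 - t * t) (2 * t) K"
  proof (intro nil_sys.intro nil_sys_axioms.intro fin_dim_axioms)
    show "(N ^^ K) u = 0" if "u \<in> V p" for u
    proof -
      have "(poly_act \<sigma> p ^^ K) u = (\<sigma> ^^ K) ((N ^^ K) u)"
        by (rule funpow_mult_on[where A = UNIV]) (auto simp: sN)
      then have "(\<sigma> ^^ K) ((N ^^ K) u) = 0" using pow_V[OF pI that] by simp
      moreover have "(\<sigma> ^^ k) x = 0 \<Longrightarrow> x = 0" for k x by (induction k) (auto dest: sigma_inj0)
      ultimately show ?thesis by blast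
    qed
    show "1 = - (1::real) \<and> (\<forall>u\<in>V p. S u = 0) \<or>
      1 = (1::real) \<and> 0 < 4 - t * t \<and> (\<forall>u\<in>V p. S (S u) = - (4 - t * t) *\<^sub>R u + (2 * t) *\<^sub>R N u + N (N u))"
    proof -
      have "S (S u) = - (4 - t * t) *\<^sub>R u + (2 * t) *\<^sub>R N u + N (N u)" for u
      proof -
        have "4 *\<^sub>R u = u + u + u + u" by (simp flip: scaleR_2 scaleR_add_left add: add.assoc)
        then have 4: "- (4 - t * t) *\<^sub>R u = (t * t) *\<^sub>R u - (u + u + u + u)" by (simp add: scaleR_diff_left)
        have 2: "(2 * t) *\<^sub>R x = t *\<^sub>R x + t *\<^sub>R x" for x :: 'v by (simp flip: scaleR_add_left)
        show ?thesis unfolding 4 2 S_def N_def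
          by (simp add: linear_add[OF lin] linear_diff[OF lin] linear_scale[OF lin]
            linear_add[OF lin_si] linear_diff[OF lin_si] linear_scale[OF lin_si] algebra_simps)
      qed
      then show ?thesis using t(2) by simp
    qed
    show "N (S u) = S (N u)" for u unfolding S_def N_def
      by (simp add: linear_add[OF lin] linear_diff[OF lin] linear_scale[OF lin]
          linear_add[OF lin_si] linear_diff[OF lin_si] linear_scale[OF lin_si] algebra_simps)
  qed (use subV[OF pI] ls inN[OF subV[OF pI] sV] in auto)
  have m2: "\<forall>B. iso_form \<sigma> B \<longrightarrow> (\<forall>u\<in>V p. \<forall>v\<in>V p. B (N u) v = 1 * B u (N v) \<and> B (S u) v = - B u (S v))"
    unfolding N_def S_def by (simp add: bilin[OF iso_formD(1)] si_adj)
  have m3: "\<exists>\<Theta>. linear \<Theta> \<and> (\<forall>u\<in>V p. \<Theta> (N u) = poly_act \<sigma> p u \<and> N (\<Theta> u) = poly_act \<sigma> p u) \<and>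
        (\<forall>A. subspace A \<longrightarrow> A \<subseteq> V p \<longrightarrow> \<sigma> ` A \<subseteq> A \<longrightarrow> inj_on \<Theta> A \<and> \<Theta> ` A = A)"
    using lin sN sigma_image bij by (intro exI[of _ \<sigma>]) (auto simp: bij_def intro: inj_on_subset)
  \<comment> \<open>Twice \<open>\<sigma>\<close> is t + N + S. The clause asks for a sum of powers
    of \<open>N\<close> starting with the identity; with M = 2 this is 1 + N, which leaves t - 1 as
    the other coefficient.\<close>
  have m4: "\<exists>c a b M. \<forall>u\<in>V p. \<sigma> u = c *\<^sub>R u + a *\<^sub>R (\<Sum>k<M. (N ^^ k) u) + b *\<^sub>R S u"
  proof (intro exI ballI)
    fix u
    have "2 *\<^sub>R \<sigma> u = (t - 1) *\<^sub>R u + (u + N u) + S u"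
      by (simp add: N_def S_def scaleR_2 algebra_simps)
    then have "(1/2) *\<^sub>R (2 *\<^sub>R \<sigma> u) = (1/2) *\<^sub>R ((t - 1) *\<^sub>R u + (u + N u) + S u)" by simp
    then show "\<sigma> u = ((t - 1) / 2) *\<^sub>R u + (1/2) *\<^sub>R (\<Sum>k<2. (N ^^ k) u) + (1/2) *\<^sub>R S u"
      by (simp add: numeral_2_eq_2 scaleR_add_right)
  qed
  have m5: "\<forall>A. subspace A \<longrightarrow> A \<subseteq> V p \<longrightarrow> \<sigma> ` A \<subseteq> A \<longrightarrow> (\<forall>u\<in>A. N u \<in> A \<and> S u \<in> A)"
    using inN by blast
  have m6: "\<forall>h. linear h \<longrightarrow> (\<forall>v. h (\<sigma> v) = \<sigma> (h v)) \<longrightarrow> (\<forall>u\<in>V p. h (N u) = N (h u))"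
    unfolding N_def by (simp add: linear_add linear_diff linear_scale si_commute)
  have "Polynomial.degree p = 2" using p by (simp add: I1_def)
  then have m7: "(1::real) = 1 \<and> p \<in> I1 f \<and> Polynomial.degree p = 2 \<or> (1::real) = - 1 \<and> p \<in> I0 f \<and> Polynomial.degree p = 1"
    using p by simp
  have "model p N S 1 (4 - t * t) (2 * t)"
    unfolding model_def by (intro conjI m1 m2 m3 m4 m5 m6 m7)
  then show ?thesis by blast
qed

text \<open>On \<open>V p\<close> the operator \<sigma> + e is 2 e plus a nilpotent, hence
  invertible there, though perhaps not on the whole space. So the Cayley transform is formed with a
  left inverse \<open>g\<close> that is valid on \<open>V p\<close>.\<close>

lemma model_I0:
  assumes p: "p \<in> I0 f"
  shows "\<exists>N S \<kappa> \<omega> t. model p N S \<kappa> \<omega> t"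
proof -
  have pI: "p \<in> I_all f" using p by (simp add: I_all_def)
  obtain e where e: "p = [:- e, 1:]" "e * e = 1" using I0_form[OF p] by blast
  have e0: "e \<noteq> 0" using e(2) by auto
  define \<Theta> where "\<Theta> v = \<sigma> v + e *\<^sub>R v" for v
  have lT: "linear \<Theta>" unfolding \<Theta>_def
    by (auto intro!: linearI simp: linear_add[OF lin] linear_scale[OF lin] algebra_simps)
  have act: "poly_act \<sigma> p v = \<sigma> v - e *\<^sub>R v" for v
    by (simp add: e(1) poly_act_pCons[OF lin] linear_0[OF lin])
  have linp: "linear (poly_act \<sigma> p)" by (rule poly_act_linear[OF lin])
  have sV: "\<sigma> ` V p \<subseteq> V p" using V_sigma[OF pI] by blast
  \<comment> \<open>On the kernel of \<Theta> the operator p(\<sigma>) would be multiplication by -2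
    e, which is not nilpotent.\<close>
  have inj0: "u = 0" if "u \<in> V p" "\<Theta> u = 0" for u
  proof -
    have "poly_act \<sigma> p u = (- 2 * e) *\<^sub>R u"
    proof -
      have "\<sigma> u = (- e) *\<^sub>R u" using that(2) by (simp add: \<Theta>_def eq_neg_iff_add_eq_0)
      then have "poly_act \<sigma> p u = (- e - e) *\<^sub>R u" unfolding act by (simp only: scaleR_diff_left)
      then show ?thesis by simp
    qed
    then have "(poly_act \<sigma> p ^^ k) u = ((- 2 * e) ^ k) *\<^sub>R u" for k
      by (induction k) (simp_all add: linear_scale[OF linp] mult.commute)
    then show ?thesis using pow_V[OF pI that(1)] e0 by auto
  qed
  have TA: "inj_on \<Theta> A \<and> \<Theta> ` A = A" if "subspace A" "A \<subseteq> V p" "\<sigma> ` A \<subseteq> A" for A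
  proof -
    have "\<Theta> ` A \<subseteq> A" unfolding \<Theta>_def using that by (auto intro!: subspace_add subspace_scale)
    then show ?thesis using inj_on_image_eq[OF lT that(1)] inj0 that(2) by blast
  qed
  have TV: "inj_on \<Theta> (V p)" "\<Theta> ` V p = V p" using TA[OF subV[OF pI] order_refl sV] by auto
  obtain g where g: "linear g" "\<And>u. u \<in> V p \<Longrightarrow> g (\<Theta> u) = u"
    using linear_exists_left_inverse_on[OF lT subV[OF pI] TV(1)] by blast
  define N where "N v = poly_act \<sigma> p (g v)" for v
  have lN: "linear N" unfolding N_def using linear_compose[OF g(1) linp] by (simp add: o_def)
  have NT: "N (\<Theta> u) = poly_act \<sigma> p u" if "u \<in> V p" for u using g(2)[OF that] by (simp add: N_def)
  have pT: "poly_act \<sigma> p (\<Theta> v) = \<Theta> (poly_act \<sigma> p v)" for v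
    by (simp add: \<Theta>_def act linear_add[OF lin] linear_diff[OF lin] linear_scale[OF lin] algebra_simps)
  have TN: "\<Theta> (N u) = poly_act \<sigma> p u" if u: "u \<in> V p" for u
  proof -
    obtain w where "w \<in> V p" "u = \<Theta> w" using TV(2) u by blast
    then show ?thesis using NT pT by simp
  qed
  have NA: "N u \<in> A" if A: "subspace A" "A \<subseteq> V p" "\<sigma> ` A \<subseteq> A" "u \<in> A" for A u
  proof -
    have "\<Theta> ` A = A" using TA[OF A(1-3)] by blast
    then obtain w where "w \<in> A" "u = \<Theta> w" using A(4) by blast
    moreover have "poly_act \<sigma> p w \<in> A" if "w \<in> A"
      by (rule poly_act_in[OF A(1) _ that]) (use A(3) in blast)
    ultimately show ?thesis using NT[of w] A(2) by auto
  qed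
  have nil: "(N ^^ K) u = 0" if u: "u \<in> V p" for u
  proof -
    have TVi: "\<Theta> v \<in> V p" if "v \<in> V p" for v using TV(2) that by blast
    have NVi: "N v \<in> V p" if "v \<in> V p" for v using NA[OF subV[OF pI] order_refl sV that] .
    have "(poly_act \<sigma> p ^^ K) u = (\<Theta> ^^ K) ((N ^^ K) u)"
      by (rule funpow_mult_on[where A = "V p"]) (use u TVi NVi TN NT in auto)
    then have "(\<Theta> ^^ K) ((N ^^ K) u) = 0" using pow_V[OF pI u] by simp
    moreover have "x \<in> V p \<Longrightarrow> (\<Theta> ^^ k) x = 0 \<Longrightarrow> x = 0" for k x
    proof (induction k arbitrary: x)
      case (Suc k)
      have "(\<Theta> ^^ k) (\<Theta> x) = 0" using Suc.prems(2) by (simp only: funpow_Suc_right o_apply)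
      then have "\<Theta> x = 0" using Suc.IH TVi Suc.prems(1) by blast
      then show ?case using inj0 Suc.prems(1) by blast
    qed simp
    moreover have "(N ^^ k) u \<in> V p" for k by (induction k) (auto intro: u NVi)
    ultimately show ?thesis by blast
  qed
  have m1: "nil_sys Bs (V p) N (\<lambda>_. 0) (- 1) 0 0 K"
    by (intro nil_sys.intro nil_sys_axioms.intro fin_dim_axioms)
      (use subV[OF pI] lN NA[OF subV[OF pI] order_refl sV] nil subspace_0[OF subV[OF pI]] linear_0[OF lN] in
        \<open>auto simp: linear_zero\<close>)
  have m2: "B (N u) v = - 1 * B u (N v) \<and> B 0 v = - B u 0"
    if h: "iso_form \<sigma> B" "u \<in> V p" "v \<in> V p" for B u v
  proof -
    note b = bilin[OF iso_formD(1)[OF h(1)]]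
    obtain x where x: "x \<in> V p" "u = \<Theta> x" using TV(2) h(2) by blast
    obtain y where y: "y \<in> V p" "v = \<Theta> y" using TV(2) h(3) by blast
    \<comment> \<open>When the products are expanded, \<open>B (\<sigma> x) (\<sigma> y)\<close>
      cancels against \<open>e * e * B x y\<close> by invariance, and the mixed terms that remain
      are antisymmetric.\<close>
    have "B (poly_act \<sigma> p x) (\<Theta> y) = - B (\<Theta> x) (poly_act \<sigma> p y)"
      using e(2) by (simp add: act \<Theta>_def b iso_formD(3)[OF h(1)] algebra_simps flip: mult.assoc)
    then show ?thesis by (simp add: x(2) y(2) NT x(1) y(1) b)
  qed
  have m4: "\<exists>c a b M. \<forall>u\<in>V p. \<sigma> u = c *\<^sub>R u + a *\<^sub>R (\<Sum>k<M. (N ^^ k) u) + b *\<^sub>R 0"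
  proof (intro exI ballI)
    fix u assume u: "u \<in> V p"
    \<comment> \<open>The finite geometric series for the inverse of 1 - N, applied to
      \<open>u\<close>. With \<sigma> (1 - N) = e (1 + N), proved as \<open>key\<close>, it
      expresses \<open>\<sigma> u\<close> through \<open>N\<close>.\<close>
    define T where "T = (\<Sum>k<K. (N ^^ k) u)"
    have NV: "(N ^^ k) u \<in> V p" for k
      by (induction k) (use u NA[OF subV[OF pI] order_refl sV] in auto)
    have TVp: "T \<in> V p" unfolding T_def by (intro subspace_sum subV[OF pI] NV)
    have key: "\<sigma> (v - N v) = e *\<^sub>R (v + N v)" if v: "v \<in> V p" for v
    proof -
      obtain w where w: "w \<in> V p" "v = \<Theta> w" using TV(2) v by blast
      have "N v = \<sigma> w - e *\<^sub>R w" "v = \<sigma> w + e *\<^sub>R w" using NT[OF w(1)] by (simp_all add: w(2) act \<Theta>_def)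
      then have "v - N v = e *\<^sub>R w + e *\<^sub>R w" "v + N v = \<sigma> w + \<sigma> w" by simp_all
      then show ?thesis by (simp add: linear_add[OF lin] linear_scale[OF lin] scaleR_add_right)
    qed
    have "N T = (\<Sum>k<K. (N ^^ Suc k) u)" by (simp add: T_def linear_sum[OF lN])
    moreover have "(\<Sum>k<n. (N ^^ k) u) - (\<Sum>k<n. (N ^^ Suc k) u) = u - (N ^^ n) u" for n
      by (induction n) (auto simp: algebra_simps)
    ultimately have TN: "T - N T = u" using nil[OF u] by (simp add: T_def)
    have "T + N T = 2 *\<^sub>R T - u" using TN by (simp add: scaleR_2 algebra_simps)
    then have "\<sigma> u = e *\<^sub>R (2 *\<^sub>R T - u)" using key[OF TVp] TN by simp
    then show "\<sigma> u = (- e) *\<^sub>R u + (2 * e) *\<^sub>R (\<Sum>k<K. (N ^^ k) u) + 0 *\<^sub>R 0"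
      by (simp add: T_def algebra_simps)
  qed
  have m6: "h (N u) = N (h u)" if h: "linear h" "\<forall>v. h (\<sigma> v) = \<sigma> (h v)" and u: "u \<in> V p" for h u
  proof -
    obtain w where w: "w \<in> V p" "u = \<Theta> w" using TV(2) u by blast
    have "h (\<Theta> w) = \<Theta> (h w)" using h by (simp add: \<Theta>_def linear_add[OF h(1)] linear_scale[OF h(1)])
    moreover have "h w \<in> V p" using V_commuting[OF pI h(1) _ w(1)] h(2) by blast
    moreover have "h (poly_act \<sigma> p w) = poly_act \<sigma> p (h w)"
      by (rule poly_act_commute[where h = h and \<sigma> = \<sigma>, OF h(1)]) (use h(2) in blast)
    ultimately show ?thesis using NT w by simp
  qed
  have m3: "\<exists>\<Theta>. linear \<Theta> \<and> (\<forall>u\<in>V p. \<Theta> (N u) = poly_act \<sigma> p u \<and> N (\<Theta> u) = poly_act \<sigma> p u) \<and>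
        (\<forall>A. subspace A \<longrightarrow> A \<subseteq> V p \<longrightarrow> \<sigma> ` A \<subseteq> A \<longrightarrow> inj_on \<Theta> A \<and> \<Theta> ` A = A)"
    using lT TN NT TA by (intro exI[of _ \<Theta>]) simp
  have m5: "\<forall>A. subspace A \<longrightarrow> A \<subseteq> V p \<longrightarrow> \<sigma> ` A \<subseteq> A \<longrightarrow> (\<forall>u\<in>A. N u \<in> A \<and> 0 \<in> A)"
    using NA by (simp add: subspace_0)
  have "Polynomial.degree p = 1" using p by (simp add: I0_def)
  then have m7: "(- 1::real) = 1 \<and> p \<in> I1 f \<and> Polynomial.degree p = 2 \<or> (- 1::real) = - 1 \<and> p \<in> I0 f \<and> Polynomial.degree p = 1"
    using p by simp
  have "model p N (\<lambda>_. 0) (- 1) 0 0"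
    unfolding model_def
    by (intro conjI m1 m3 m4 m5 m7 allI impI ballI) (simp_all add: m2[simplified] m6)
  then show ?thesis by blast
qed

end

section \<open>Components with a non-reciprocal irreducible factor\<close>

context isom_sys begin

text \<open>Both polynomials are monic of the same degree, so divisibility would make them equal and
  \<open>q\<close> reciprocal. Irreducibility then yields coprime powers and a Bezout
  identity.\<close>

lemma I2_coprime:
  assumes "monic q" "Factorial_Ring.irreducible q" "poly q 0 \<noteq> 0" "\<not> reciprocal q"
  shows "\<exists>a b. a * q ^ k + b * poly_star q ^ k = (1 :: real poly)"
proof -
  have dq: "Polynomial.degree (poly_star q) = Polynomial.degree q"
    using assms(3) by (simp add: poly_star_def poly_0_coeff_0)
  have "q \<noteq> 0" using assms(3) by auto
  have mon: "monic (poly_star q)"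
    using assms(3) dq unfolding poly_star_def
    by (simp add: coeff_reflect_poly poly_0_coeff_0)
  have "\<not> q dvd poly_star q"
  proof
    assume "q dvd poly_star q"
    then obtain r where r: "poly_star q = q * r" by blast
    have "poly_star q \<noteq> 0" using mon by auto
    then have "Polynomial.degree r = 0" using dq r by (auto simp: Polynomial.degree_mult_eq)
    then obtain c where c: "r = [:c:]" by (metis degree_0_id)
    then have "lead_coeff (poly_star q) = c * lead_coeff q" unfolding r by (simp add: lead_coeff_mult)
    then have "c = 1" using mon assms(1) by simp
    then have "poly_star q = q" using r c by simp
    then show False using assms(3,4) by (simp add: reciprocal_def)
  qed
  then have "coprime q (poly_star q)"
    using assms(2) by (meson coprimeI dvd_trans irreducibleD')
  then have cop: "coprime (q ^ k) (poly_star q ^ k)" by (simp add: coprime_power_left_iff coprime_power_right_iff)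
  obtain a b where "bezout_coefficients (q ^ k) (poly_star q ^ k) = (a, b)" by fastforce
  then have "a * q ^ k + b * poly_star q ^ k = gcd (q ^ k) (poly_star q ^ k)" by (rule bezout_coefficients)
  then show ?thesis using cop by (auto simp: coprime_iff_gcd_eq_1)
qed

text \<open>Write \<open>u\<close> as r(\<sigma>) u' and move r(\<sigma>) across: up to a constant
  and a power of \<open>\<sigma>\<close> it becomes q(\<sigma>), which kills
  \<open>A\<close>.\<close>

lemma isotropic_ker:
  assumes "iso_form \<sigma> B" "subspace A" "\<sigma> ` A \<subseteq> A" "reflect_poly r = Polynomial.smult c q"
    and "\<And>v. v \<in> A \<Longrightarrow> poly_act \<sigma> q v = 0" "\<And>v. v \<in> A \<Longrightarrow> poly_act \<sigma> r v = 0 \<Longrightarrow> v = 0"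
    and "u \<in> A" "v \<in> A"
  shows "B u v = 0"
proof -
  have linr: "linear (poly_act \<sigma> r)" by (rule poly_act_linear[OF lin])
  have "poly_act \<sigma> r ` A \<subseteq> A"
  proof
    fix x assume "x \<in> poly_act \<sigma> r ` A"
    then obtain y where y: "y \<in> A" "x = poly_act \<sigma> r y" by blast
    show "x \<in> A" unfolding y(2) by (rule poly_act_in[OF assms(2) _ y(1)]) (use assms(3) in blast)
  qed
  then have "poly_act \<sigma> r ` A = A" by (rule inj_on_image_eq(2)[OF linr assms(2) _ assms(6)])
  then obtain u' where u': "u' \<in> A" "u = poly_act \<sigma> r u'" using assms(7) by blast
  let ?d = "Polynomial.degree r"
  have "(\<sigma> ^^ k) ` A = A" for k
  proof (induction k)
    case (Suc k)
    have "(\<sigma> ^^ Suc k) ` A = \<sigma> ` (\<sigma> ^^ k) ` A" by (simp add: image_comp)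
    then show ?case using Suc sigma_image[OF assms(2,3)] by simp
  qed simp
  then obtain v' where v': "v' \<in> A" "v = (\<sigma> ^^ ?d) v'" using assms(8) by blast
  show ?thesis unfolding u'(2) v'(2) iso_form_poly_act[OF assms(1)] assms(4) poly_act_smult assms(5)[OF v'(1)]
    by (simp add: bilin[OF iso_formD(1)[OF assms(1)]])
qed

text \<open>The two halves are the generalized kernels of \<open>q\<close> and of \<open>q\<^sup>*\<close>, where \<open>p = q q\<^sup>*\<close>.\<close>

lemma I2_split:
  assumes "p \<in> I2 f"
  shows "\<exists>X Y E. subspace X \<and> subspace Y \<and> X \<subseteq> V p \<and> Y \<subseteq> V p \<and> \<sigma> ` X = X \<and> \<sigma> ` Y = Y \<and>
     linear E \<and> (\<forall>v\<in>V p. E v \<in> X \<and> v - E v \<in> Y) \<and> (\<forall>v\<in>X. E v = v) \<and>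
     (\<forall>B. iso_form \<sigma> B \<longrightarrow> (\<forall>u\<in>X. \<forall>v\<in>X. B u v = 0) \<and> (\<forall>u\<in>Y. \<forall>v\<in>Y. B u v = 0))"
proof -
  have pI: "p \<in> I_all f" using assms by (simp add: I_all_def)
  obtain q where q: "p = q * poly_star q" "monic q" "Factorial_Ring.irreducible q" "poly q 0 \<noteq> 0" "\<not> reciprocal q"
    using assms by (auto simp: I2_def)
  obtain a b where ab: "a * q ^ K + b * poly_star q ^ K = 1" using I2_coprime[OF q(2-5)] by blast
  let ?P = "poly_act \<sigma>" and ?q = "q ^ K" and ?r = "poly_star q ^ K"
  note PL = linear_0[OF poly_act_linear[OF lin]] linear_add[OF poly_act_linear[OF lin]]
    linear_scale[OF poly_act_linear[OF lin]] linear_diff[OF poly_act_linear[OF lin]]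
  define X where "X = {v\<in>V p. ?P ?q v = 0}"
  define Y where "Y = {v\<in>V p. ?P ?r v = 0}"
  \<comment> \<open>On \<open>V p\<close> the Bezout identity makes this the projection onto
    \<open>X\<close> along \<open>Y\<close>.\<close>
  define E where "E = ?P (b * ?r)"
  have bez: "?P a (?P ?q v) + E v = v" for v
    unfolding E_def using poly_act_1[OF lin, of v] ab
    by (simp add: poly_act_mult[OF lin] flip: poly_act_add poly_act_mult[OF lin])
  have bez': "?P a (?P ?q v) + ?P b (?P ?r v) = v" for v
    using bez[of v] by (simp add: E_def poly_act_mult[OF lin])
  have sub: "subspace X" "subspace Y" unfolding X_def Y_def
    using subV[OF pI] by (auto simp: subspace_def PL)
  have sV: "\<sigma> v \<in> V p" if "v \<in> V p" for v using V_sigma[OF pI that] .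
  have comm: "?P g (\<sigma> v) = \<sigma> (?P g v)" for g v
    by (rule poly_act_commute[where h = \<sigma> and \<sigma> = \<sigma>, OF lin, symmetric]) simp
  have sX: "\<sigma> ` X \<subseteq> X" "\<sigma> ` Y \<subseteq> Y" using sV by (auto simp: X_def Y_def comm linear_0[OF lin])
  have pK: "?P ?q (?P ?r v) = 0" if "v \<in> V p" for v
  proof -
    have "?P (?q * ?r) v = 0" using pow_V[OF pI that] by (simp add: q(1) flip: poly_act_power[OF lin] power_mult_distrib)
    then show ?thesis by (simp add: poly_act_mult[OF lin])
  qed
  have PV: "?P g v \<in> V p" if "v \<in> V p" for g v by (rule poly_act_in[OF subV[OF pI] sV that])
  have EX: "E v \<in> X" if "v \<in> V p" for v
  proof -
    have "E v \<in> V p" unfolding E_def by (rule PV[OF that])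
    moreover have "?P ?q (E v) = ?P b (?P ?q (?P ?r v))"
      unfolding E_def poly_act_mult[OF lin] by (rule poly_act_comm[OF lin])
    ultimately show ?thesis using pK[OF that] by (simp add: X_def PL)
  qed
  have EY: "v - E v \<in> Y" if "v \<in> V p" for v
  proof -
    have e: "v - E v = ?P a (?P ?q v)" using bez[of v] by (simp add: algebra_simps)
    have "?P ?r (?P a (?P ?q v)) = ?P a (?P ?q (?P ?r v))"
      by (metis poly_act_comm[OF lin])
    then show ?thesis unfolding e using pK[OF that] PV that by (simp add: Y_def PL)
  qed
  have EXX: "E v = v" if "v \<in> X" for v using bez[of v] that by (simp add: X_def PL)
  have rr: "reflect_poly ?r = Polynomial.smult ((1 / poly q 0) ^ K) ?q"
  proof -
    have "reflect_poly (reflect_poly q) = q" using q(4) by (simp add: poly_0_coeff_0)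
    then have "reflect_poly (poly_star q) = Polynomial.smult (1 / poly q 0) q"
      by (simp add: poly_star_def reflect_poly_smult inverse_eq_divide)
    then show ?thesis by (simp add: reflect_poly_power smult_power)
  qed
  have rq: "reflect_poly ?q = Polynomial.smult ((poly q 0) ^ K) ?r"
  proof -
    have "reflect_poly q = Polynomial.smult (poly q 0) (poly_star q)" using q(4) by (simp add: poly_star_def)
    then show ?thesis by (simp add: reflect_poly_power smult_power)
  qed
  have inj: "v = 0" if "?P ?q v = 0" "?P ?r v = 0" for v using bez'[of v] that by (simp add: PL)
  have "(\<forall>u\<in>X. \<forall>v\<in>X. B u v = 0) \<and> (\<forall>u\<in>Y. \<forall>v\<in>Y. B u v = 0)" if B: "iso_form \<sigma> B" for B
  proof (intro conjI ballI)
    show "B u v = 0" if "u \<in> X" "v \<in> X" for u v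
      by (rule isotropic_ker[OF B sub(1) sX(1) rr _ _ that]) (use inj in \<open>auto simp: X_def\<close>)
    show "B u v = 0" if "u \<in> Y" "v \<in> Y" for u v
      by (rule isotropic_ker[OF B sub(2) sX(2) rq _ _ that]) (use inj in \<open>auto simp: Y_def\<close>)
  qed
  moreover have "linear E" unfolding E_def by (rule poly_act_linear[OF lin])
  moreover have "X \<subseteq> V p" "Y \<subseteq> V p" by (auto simp: X_def Y_def)
  ultimately show ?thesis using sub sigma_image[OF sub(1) sX(1)] sigma_image[OF sub(2) sX(2)] EX EY EXX
    by (intro exI[of _ X] exI[of _ Y] exI[of _ E]) auto
qed

text \<open>\<open>X\<close> is its own orthogonal complement in \<open>V p\<close>, so
  \<open>sgn_index_perp\<close> gives twice the signature of a form that is zero on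
  \<open>X\<close>.\<close>

lemma I2_sgn:
  assumes "p \<in> I2 f" "iso_form \<sigma> B"
  shows "sgn_index B (V p) = 0"
proof -
  have pI: "p \<in> I_all f" using assms by (simp add: I_all_def)
  obtain X Y E where s: "subspace X" "subspace Y" "X \<subseteq> V p" "Y \<subseteq> V p"
    and E: "\<And>v. v \<in> V p \<Longrightarrow> E v \<in> X \<and> v - E v \<in> Y"
    and iso: "\<And>u v. u \<in> X \<Longrightarrow> v \<in> X \<Longrightarrow> B u v = 0" "\<And>u v. u \<in> Y \<Longrightarrow> v \<in> Y \<Longrightarrow> B u v = 0"
    using I2_split[OF assms(1)] assms(2) by metis
  note b = bilin[OF iso_formD(1)[OF assms(2)]]
  have perp: "{v\<in>V p. \<forall>x\<in>X. B v x = 0} = X"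
  proof
    show "{v\<in>V p. \<forall>x\<in>X. B v x = 0} \<subseteq> X"
    proof clarify
      fix v assume v: "v \<in> V p" "\<forall>x\<in>X. B v x = 0"
      define y where "y = v - E v"
      have y: "y \<in> Y" "E v \<in> X" using E[OF v(1)] by (auto simp: y_def)
      have yX: "B y x = 0" if "x \<in> X" for x using v(2) iso(1)[OF y(2) that] that by (simp add: y_def b)
      have "B y w = 0" if "w \<in> V p" for w
        using yX[of "E w"] iso(2)[OF y(1), of "w - E w"] E[OF that] by (simp add: b)
      then have "y = 0" using V_nondeg[OF assms(2) pI] y s(4) by (auto simp: nondeg_on_def)
      then show "v \<in> X" using y(2) by (simp add: y_def)
    qed
    show "X \<subseteq> {v\<in>V p. \<forall>x\<in>X. B v x = 0}" using s iso by blast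
  qed
  have "sgn_index B (V p) = sgn_index B X + sgn_index B X"
    using sgn_index_perp[OF iso_formD(5)[OF assms(2)] subV[OF pI] s(1,3)] unfolding perp .
  moreover have "sgn_index B X = 0"
    using pos_index_nonpos[of X B] pos_index_nonpos[of X "\<lambda>u v. - B u v"] iso(1) s(1) by (simp add: sgn_index_def)
  ultimately show ?thesis by simp
qed

text \<open>Each form identifies \<open>Y\<close> with the dual of \<open>X\<close>, compatibly with
  \<open>\<sigma>\<close>. The identity on \<open>X\<close> together with the comparison of the two
  identifications on \<open>Y\<close> is an equivalence, so such a component carries no invariants
  of the form.\<close>

lemma I2_corr:
  assumes "p \<in> I2 f" "iso_form \<sigma> B" "iso_form \<sigma> B'"
  shows "\<exists>\<Gamma>. corr \<Gamma> B (V p) B' (V p) \<and> pair_inv \<sigma> \<Gamma>"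
proof -
  have pI: "p \<in> I_all f" using assms by (simp add: I_all_def)
  obtain X Y E where s: "subspace X" "subspace Y" "X \<subseteq> V p" "Y \<subseteq> V p" "\<sigma> ` X = X" "\<sigma> ` Y = Y" "linear E"
    and E: "\<And>v. v \<in> V p \<Longrightarrow> E v \<in> X \<and> v - E v \<in> Y" "\<And>v. v \<in> X \<Longrightarrow> E v = v"
    and iso0: "\<And>B. iso_form \<sigma> B \<Longrightarrow> (\<forall>u\<in>X. \<forall>v\<in>X. B u v = 0) \<and> (\<forall>u\<in>Y. \<forall>v\<in>Y. B u v = 0)"
    using I2_split[OF assms(1)] by metis
  note b = bilin[OF iso_formD(1)[OF assms(2)]] bilin[OF iso_formD(1)[OF assms(3)]]
  note iso = iso0[OF assms(2)] iso0[OF assms(3)]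
  define \<Gamma> where "\<Gamma> = {(u + v, u + v') | u v v'. u \<in> X \<and> v \<in> Y \<and> v' \<in> Y \<and> (\<forall>w\<in>X. B w v = B' w v')}"
  have G: "(u + v, u + v') \<in> \<Gamma>" if "u \<in> X" "v \<in> Y" "v' \<in> Y" "\<And>w. w \<in> X \<Longrightarrow> B w v = B' w v'" for u v v'
    using that by (auto simp: \<Gamma>_def)
  \<comment> \<open>Through \<open>C'\<close> the vector \<open>y\<close> represents the functional
    sending w to \<open>C (E w) v\<close>; removing its part in \<open>X\<close> changes nothing on
    the isotropic \<open>X\<close>.\<close>
  have ex: "\<exists>v'\<in>Y. \<forall>w\<in>X. C w v = C' w v'" if C: "iso_form \<sigma> C" "iso_form \<sigma> C'" for C C' v
  proof -
    have "linear (\<lambda>w. C (E w) v)"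
      using iso_formD(1)[OF C(1)] s(7) by (auto simp: bilinear_def linear_iff)
    then obtain y where y: "y \<in> V p" "\<forall>w\<in>V p. C' y w = C (E w) v"
      using riesz[OF iso_formD(5)[OF C(2)] subV[OF pI] V_nondeg[OF C(2) pI]] by blast
    have "C w v = C' w (y - E y)" if w: "w \<in> X" for w
    proof -
      have "C w v = C' y w" using y(2) w E(2)[OF w] s(3) by auto
      also have "\<dots> = C' w y" by (rule iso_formD(2)[OF C(2)])
      also have "\<dots> = C' w (y - E y)" using iso0[OF C(2)] w E(1)[OF y(1)] by (simp add: bilin[OF iso_formD(1)[OF C(2)]])
      finally show ?thesis .
    qed
    then show ?thesis using E(1)[OF y(1)] by blast
  qed
  have "subspace \<Gamma>"
  proof (rule subspaceI)
    show "0 \<in> \<Gamma>" using G[of 0 0 0] subspace_0[OF s(1)] subspace_0[OF s(2)] by (simp add: b zero_prod_def)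
  next
    fix x y assume "x \<in> \<Gamma>" "y \<in> \<Gamma>"
    then obtain u v v' u2 v2 v2' where x: "x = (u + v, u + v')" "y = (u2 + v2, u2 + v2')"
      "u \<in> X" "v \<in> Y" "v' \<in> Y" "\<forall>w\<in>X. B w v = B' w v'" "u2 \<in> X" "v2 \<in> Y" "v2' \<in> Y" "\<forall>w\<in>X. B w v2 = B' w v2'"
      by (auto simp: \<Gamma>_def)
    have "((u + u2) + (v + v2), (u + u2) + (v' + v2')) \<in> \<Gamma>"
      using x s(1,2) by (intro G) (auto simp: b subspace_add)
    then show "x + y \<in> \<Gamma>" by (simp add: x(1,2) algebra_simps)
  next
    fix c x assume "x \<in> \<Gamma>"
    then obtain u v v' where x: "x = (u + v, u + v')" "u \<in> X" "v \<in> Y" "v' \<in> Y" "\<forall>w\<in>X. B w v = B' w v'"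
      by (auto simp: \<Gamma>_def)
    have "(c *\<^sub>R u + c *\<^sub>R v, c *\<^sub>R u + c *\<^sub>R v') \<in> \<Gamma>"
      using x s(1,2) by (intro G) (auto simp: b subspace_scale)
    then show "c *\<^sub>R x \<in> \<Gamma>" by (simp add: x(1) scaleR_add_right)
  qed
  moreover have "fst ` \<Gamma> = V p"
  proof
    show "fst ` \<Gamma> \<subseteq> V p" using s(3,4) subV[OF pI] by (auto simp: \<Gamma>_def intro!: subspace_add)
    show "V p \<subseteq> fst ` \<Gamma>"
    proof
      fix x assume x: "x \<in> V p"
      obtain v' where "v' \<in> Y" "\<forall>w\<in>X. B w (x - E x) = B' w v'" using ex[OF assms(2,3)] by blast
      then have "(E x + (x - E x), E x + v') \<in> \<Gamma>" using E(1)[OF x] by (intro G) auto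
      then show "x \<in> fst ` \<Gamma>" by force
    qed
  qed
  moreover have "snd ` \<Gamma> = V p"
  proof
    show "snd ` \<Gamma> \<subseteq> V p" using s(3,4) subV[OF pI] by (auto simp: \<Gamma>_def intro!: subspace_add)
    show "V p \<subseteq> snd ` \<Gamma>"
    proof
      fix x assume x: "x \<in> V p"
      obtain v' where "v' \<in> Y" "\<forall>w\<in>X. B' w (x - E x) = B w v'" using ex[OF assms(3,2)] by blast
      then have "(E x + v', E x + (x - E x)) \<in> \<Gamma>" using E(1)[OF x] by (intro G) auto
      then show "x \<in> snd ` \<Gamma>" by force
    qed
  qed
  moreover have "B x y = B' x' y'" if xy: "(x, x') \<in> \<Gamma>" "(y, y') \<in> \<Gamma>" for x x' y y'
  proof -
    obtain u v v' where x: "x = u + v" "x' = u + v'" "u \<in> X" "v \<in> Y" "v' \<in> Y" "\<forall>w\<in>X. B w v = B' w v'"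
      using xy(1) by (auto simp: \<Gamma>_def)
    obtain u2 v2 v2' where y: "y = u2 + v2" "y' = u2 + v2'" "u2 \<in> X" "v2 \<in> Y" "v2' \<in> Y" "\<forall>w\<in>X. B w v2 = B' w v2'"
      using xy(2) by (auto simp: \<Gamma>_def)
    have "B u u2 = 0" "B v v2 = 0" "B' u u2 = 0" "B' v' v2' = 0" using iso x y by auto
    moreover have "B u v2 = B' u v2'" "B v u2 = B' v' u2"
      using x y iso_formD(2)[OF assms(2), of v u2] iso_formD(2)[OF assms(3), of v' u2] by auto
    ultimately show ?thesis unfolding x(1,2) y(1,2) by (simp add: b)
  qed
  moreover have "pair_inv \<sigma> \<Gamma>"
    unfolding pair_inv_def
  proof (intro allI impI)
    fix x x' assume "(x, x') \<in> \<Gamma>"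
    then obtain u v v' where x: "x = u + v" "x' = u + v'" "u \<in> X" "v \<in> Y" "v' \<in> Y" "\<forall>w\<in>X. B w v = B' w v'"
      by (auto simp: \<Gamma>_def)
    have "(\<sigma> u + \<sigma> v, \<sigma> u + \<sigma> v') \<in> \<Gamma>"
    proof (rule G)
      show "\<sigma> u \<in> X" "\<sigma> v \<in> Y" "\<sigma> v' \<in> Y" using x s(5,6) by auto
      fix w assume "w \<in> X"
      then obtain w0 where w0: "w0 \<in> X" "w = \<sigma> w0" using s(5) by blast
      then show "B w (\<sigma> v) = B' w (\<sigma> v')" using x(6) iso_formD(3)[OF assms(2)] iso_formD(3)[OF assms(3)] by simp
    qed
    then show "(\<sigma> x, \<sigma> x') \<in> \<Gamma>" by (simp add: x(1,2) linear_add[OF lin])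
  qed
  ultimately show ?thesis unfolding corr_def by blast
qed

end

section \<open>Ranks of free modules as dimensions\<close>

lemma (in fin_dim) dim_family:
  fixes g :: "'i \<Rightarrow> 'v"
  assumes "finite I" "\<And>a. (\<Sum>i\<in>I. a i *\<^sub>R g i) = 0 \<Longrightarrow> \<forall>i\<in>I. a i = (0::real)"
  shows "dim (span (g ` I)) = card I"
proof -
  have inj: "inj_on g I"
  proof (rule inj_onI, rule ccontr)
    fix i j assume ij: "i \<in> I" "j \<in> I" "g i = g j" "i \<noteq> j"
    define a where "a k = (if k = i then 1 else 0) - (if k = j then 1 else (0::real))" for k
    have "(\<Sum>k\<in>I. a k *\<^sub>R g k) = (\<Sum>k\<in>I. if k = i then g k else 0) - (\<Sum>k\<in>I. if k = j then g k else 0)"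
      unfolding sum_subtractf[symmetric] by (rule sum.cong) (auto simp: a_def)
    also have "\<dots> = 0" using ij assms(1) by simp
    finally have "a i = 0" using assms(2) ij(1) by blast
    then show False using ij(4) by (simp add: a_def)
  qed
  have "independent (g ` I)"
  proof (rule independent_if_scalars_zero)
    fix u x assume u: "(\<Sum>x\<in>g ` I. u x *\<^sub>R x) = 0" "x \<in> g ` I"
    have "(\<Sum>i\<in>I. u (g i) *\<^sub>R g i) = 0" using u(1) by (simp add: sum.reindex[OF inj])
    then show "u x = 0" using assms(2)[of "\<lambda>i. u (g i)"] u(2) by auto
  qed (use assms(1) in simp)
  then show ?thesis by (simp add: fd.dim_eq_card_independent card_image[OF inj])
qed

context isom_sys begin

lemma poly_act_sum: "poly_act \<sigma> (\<Sum>i\<in>I. g i) v = (\<Sum>i\<in>I. poly_act \<sigma> (g i) v)"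
  by (induction I rule: infinite_finite_induct) (simp_all add: poly_act_add)

lemma poly_act_monom: "poly_act \<sigma> (Polynomial.monom c i) v = c *\<^sub>R (\<sigma> ^^ i) v"
proof (induction i)
  case 0
  then show ?case by (simp add: monom_0 poly_act_const[OF lin])
next
  case (Suc i)
  then show ?case by (simp add: monom_Suc poly_act_pCons[OF lin] linear_scale[OF lin])
qed

text \<open>If p^k kills a vector, then p^l divides p^k times each of its coefficients, so p^(l - k)
  divides the coefficients and can be taken out of the sum.\<close>

lemma quot_basis_ker:
  assumes "quot_basis \<sigma> (p ^ l) A E" "p \<noteq> 0" "k \<le> l" "u \<in> A" "poly_act \<sigma> (p ^ k) u = 0"
  shows "\<exists>w\<in>A. u = poly_act \<sigma> (p ^ (l - k)) w"
proof -
  have A: "A = {\<Sum>e\<in>E. poly_act \<sigma> (c e) e | c. True}" and E: "finite E"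
    and ind: "\<And>c. (\<Sum>e\<in>E. poly_act \<sigma> (c e) e) = 0 \<Longrightarrow> \<forall>e\<in>E. p ^ l dvd c e"
    using assms(1) by (auto simp: quot_basis_def)
  obtain c where c: "u = (\<Sum>e\<in>E. poly_act \<sigma> (c e) e)" using assms(4) A by blast
  have "(\<Sum>e\<in>E. poly_act \<sigma> (p ^ k * c e) e) = 0"
    using assms(5) unfolding c by (simp add: poly_act_mult[OF lin] linear_sum[OF poly_act_linear[OF lin]])
  then have d: "p ^ l dvd p ^ k * c e" if "e \<in> E" for e using ind[of "\<lambda>e. p ^ k * c e"] that by blast
  have "p ^ (l - k) dvd c e" if "e \<in> E" for e
  proof -
    have "p ^ l = p ^ k * p ^ (l - k)" using assms(3) by (simp flip: power_add)
    then show ?thesis using d[OF that] assms(2) by simp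
  qed
  then obtain c' where c': "\<And>e. e \<in> E \<Longrightarrow> c e = p ^ (l - k) * c' e" unfolding dvd_def by metis
  have "u = poly_act \<sigma> (p ^ (l - k)) (\<Sum>e\<in>E. poly_act \<sigma> (c' e) e)"
    unfolding c linear_sum[OF poly_act_linear[OF lin]]
    by (rule sum.cong) (simp_all add: c' poly_act_mult[OF lin])
  then show ?thesis using A by blast
qed

text \<open>Division of the coefficients by \<open>p\<close> with remainder shows that the vectors
  \<open>(\<sigma> ^^ i) e\<close>, i below the degree of \<open>p\<close>, form a real basis of a
  complement of p(\<sigma>) A. The rank is thus read off from dimensions and does not depend on
  \<open>E\<close>.\<close>

lemma quot_basis_dim:
  assumes "quot_basis \<sigma> (p ^ l) A E" "p \<noteq> 0" "1 \<le> l" "subspace A" "\<sigma> ` A \<subseteq> A"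
  shows "dim A = dim (poly_act \<sigma> p ` A) + Polynomial.degree p * card E"
proof -
  have A: "A = {\<Sum>e\<in>E. poly_act \<sigma> (c e) e | c. True}" and E: "finite E" "E \<subseteq> A"
    and ind: "\<And>c e. (\<Sum>e\<in>E. poly_act \<sigma> (c e) e) = 0 \<Longrightarrow> e \<in> E \<Longrightarrow> p ^ l dvd c e"
    using assms(1) by (auto simp: quot_basis_def)
  let ?d = "Polynomial.degree p" and ?P = "poly_act \<sigma> p"
  define I where "I = E \<times> {..<?d}"
  define g where "g = (\<lambda>(e, i). (\<sigma> ^^ i) e)"
  have fI: "finite I" using E by (simp add: I_def)
  \<comment> \<open>Collects the real coefficients at one \<open>e\<close> into a polynomial of
    degree below that of \<open>p\<close>, so that real relations become module relations.\<close>
  define r where "r a e = (\<Sum>i<?d. Polynomial.monom (a (e, i)) i)" for a :: "'v \<times> nat \<Rightarrow> real" and e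
  have sumr: "(\<Sum>x\<in>I. a x *\<^sub>R g x) = (\<Sum>e\<in>E. poly_act \<sigma> (r a e) e)" for a
    unfolding I_def r_def poly_act_sum poly_act_monom by (simp add: sum.cartesian_product g_def case_prod_beta)
  have rdeg: "r a e = 0 \<or> Polynomial.degree (r a e) < ?d" for a e
  proof (cases "?d = 0")
    case False
    then have "Polynomial.degree (r a e) \<le> ?d - 1" unfolding r_def
      by (intro Polynomial.degree_sum_le) (auto intro!: order_trans[OF Polynomial.degree_monom_le])
    then show ?thesis using False by linarith
  qed (simp add: r_def)
  have rcoeff: "Polynomial.coeff (r a e) i = a (e, i)" if "i < ?d" for a e i
    using that by (simp add: r_def coeff_sum)
  have small: "r a e = 0" if "p dvd r a e" for a e
    using rdeg[of a e] that assms(2) dvd_imp_degree_le[of p "r a e"] by auto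
  have pl: "p dvd p ^ l" using assms(3) by (cases l) auto
  have zero: "r a e = 0" if h: "(\<Sum>x\<in>I. a x *\<^sub>R g x) \<in> ?P ` A" "e \<in> E" for a e
  proof -
    obtain y where y: "y \<in> A" "(\<Sum>x\<in>I. a x *\<^sub>R g x) = ?P y" using h(1) by blast
    then obtain c where "y = (\<Sum>e\<in>E. poly_act \<sigma> (c e) e)" using A by blast
    with y(2) have c: "(\<Sum>x\<in>I. a x *\<^sub>R g x) = ?P (\<Sum>e\<in>E. poly_act \<sigma> (c e) e)" by simp
    have "(\<Sum>e\<in>E. poly_act \<sigma> (r a e + p * (- c e)) e) = 0"
    proof -
      have "poly_act \<sigma> (- g) v = - poly_act \<sigma> g v" for g v
        using poly_act_smult[of \<sigma> "- 1" g v] by simp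
      then have "(\<Sum>e\<in>E. poly_act \<sigma> (r a e + p * (- c e)) e) = (\<Sum>e\<in>E. poly_act \<sigma> (r a e) e) - ?P (\<Sum>e\<in>E. poly_act \<sigma> (c e) e)"
        unfolding linear_sum[OF poly_act_linear[OF lin]] sum_subtractf[symmetric]
        by (intro sum.cong) (simp_all only: poly_act_add poly_act_mult[OF lin] linear_neg[OF poly_act_linear[OF lin]] add_uminus_conv_diff)
      then show ?thesis using c sumr[of a] by simp
    qed
    then have "p ^ l dvd r a e + p * (- c e)" using ind[of "\<lambda>e. r a e + p * (- c e)"] h(2) by blast
    then have "p dvd r a e + p * (- c e)" using pl dvd_trans by blast
    then have "p dvd (r a e + p * (- c e)) + p * c e" by (rule dvd_add) simp
    then have "p dvd r a e" by simp
    then show ?thesis by (rule small)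
  qed
  have PA: "subspace (?P ` A)" by (rule linear_subspace_image[OF poly_act_linear[OF lin] assms(4)])
  have ssig: "(\<sigma> ^^ i) v \<in> A" if "v \<in> A" for v i by (induction i) (use that assms(5) in auto)
  have PAA: "?P ` A \<subseteq> A"
  proof
    fix x assume "x \<in> ?P ` A"
    then obtain y where y: "y \<in> A" "x = ?P y" by blast
    show "x \<in> A" unfolding y(2) by (rule poly_act_in[OF assms(4) _ y(1)]) (use assms(5) in blast)
  qed
  have gspan: "span (g ` I) \<subseteq> {\<Sum>x\<in>I. a x *\<^sub>R g x | a. True}"
  proof -
    have sub: "subspace {\<Sum>x\<in>I. a x *\<^sub>R g x | a. True}"
    proof (rule subspaceI)
      show "0 \<in> {\<Sum>x\<in>I. a x *\<^sub>R g x | a. True}" by (intro CollectI exI[of _ "\<lambda>_. 0"]) simp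
      fix x y assume "x \<in> {\<Sum>x\<in>I. a x *\<^sub>R g x | a. True}" "y \<in> {\<Sum>x\<in>I. a x *\<^sub>R g x | a. True}"
      then obtain a b where "x = (\<Sum>x\<in>I. a x *\<^sub>R g x)" "y = (\<Sum>x\<in>I. b x *\<^sub>R g x)" by blast
      then have "x + y = (\<Sum>x\<in>I. (a x + b x) *\<^sub>R g x)" by (simp add: scaleR_add_left sum.distrib)
      then show "x + y \<in> {\<Sum>x\<in>I. a x *\<^sub>R g x | a. True}" by (intro CollectI exI[of _ "\<lambda>x. a x + b x"]) simp
    next
      fix c x assume "x \<in> {\<Sum>x\<in>I. a x *\<^sub>R g x | a. True}"
      then obtain a where "x = (\<Sum>x\<in>I. a x *\<^sub>R g x)" by blast
      then have "c *\<^sub>R x = (\<Sum>x\<in>I. (c * a x) *\<^sub>R g x)" by (simp add: scaleR_sum_right)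
      then show "c *\<^sub>R x \<in> {\<Sum>x\<in>I. a x *\<^sub>R g x | a. True}" by (intro CollectI exI[of _ "\<lambda>x. c * a x"]) simp
    qed
    show ?thesis
    proof (rule span_minimal[OF _ sub], clarify)
      fix i assume i: "i \<in> I"
      show "\<exists>a. g i = (\<Sum>x\<in>I. a x *\<^sub>R g x) \<and> True"
        using fI i by (intro exI[of _ "\<lambda>x. if x = i then 1 else 0"]) (simp add: if_distrib[of "\<lambda>c. c *\<^sub>R _"] cong: if_cong)
    qed
  qed
  have "dim (span (g ` I)) = card I"
  proof (rule dim_family[OF fI])
    fix a assume "(\<Sum>i\<in>I. a i *\<^sub>R g i) = 0"
    then have "(\<Sum>i\<in>I. a i *\<^sub>R g i) \<in> ?P ` A" using subspace_0[OF PA] by simp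
    then have r0: "r a e = 0" if "e \<in> E" for e using zero that by blast
    have "a (e, i) = 0" if "e \<in> E" "i < ?d" for e i
      using rcoeff[OF that(2), of a e] r0[OF that(1)] by simp
    then show "\<forall>i\<in>I. a i = 0" by (auto simp: I_def)
  qed
  moreover have "card I = ?d * card E" by (simp add: I_def card_cartesian_product)
  moreover have "?P ` A \<inter> span (g ` I) = {0}"
  proof
    show "?P ` A \<inter> span (g ` I) \<subseteq> {0}"
    proof
      fix x assume x: "x \<in> ?P ` A \<inter> span (g ` I)"
      then obtain a where a: "x = (\<Sum>x\<in>I. a x *\<^sub>R g x)" using gspan by blast
      then have "r a e = 0" if "e \<in> E" for e using zero x that by blast
      then have "x = 0" unfolding a sumr by simp
      then show "x \<in> {0}" by simp
    qed
  qed (use subspace_0[OF PA] span_zero in auto)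
  moreover have "{x + y | x y. x \<in> ?P ` A \<and> y \<in> span (g ` I)} = A"
  proof
    have "span (g ` I) \<subseteq> A" using E ssig by (intro span_minimal assms(4)) (auto simp: I_def g_def)
    then show "{x + y | x y. x \<in> ?P ` A \<and> y \<in> span (g ` I)} \<subseteq> A"
      using PAA by (auto intro!: subspace_add[OF assms(4)])
    show "A \<subseteq> {x + y | x y. x \<in> ?P ` A \<and> y \<in> span (g ` I)}"
    proof
      fix u assume "u \<in> A"
      then obtain c where c: "u = (\<Sum>e\<in>E. poly_act \<sigma> (c e) e)" using A by blast
      have "poly_act \<sigma> (c e) e = ?P (poly_act \<sigma> (c e div p) e) + poly_act \<sigma> (c e mod p) e" for e
        using poly_act_add[of \<sigma> "p * (c e div p)" "c e mod p" e] by (simp add: poly_act_mult[OF lin])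
      then have "u = ?P (\<Sum>e\<in>E. poly_act \<sigma> (c e div p) e) + (\<Sum>e\<in>E. poly_act \<sigma> (c e mod p) e)"
        unfolding c linear_sum[OF poly_act_linear[OF lin]] by (simp add: sum.distrib)
      moreover have "(\<Sum>e\<in>E. poly_act \<sigma> (c e div p) e) \<in> A"
        unfolding A by (intro CollectI exI[of _ "\<lambda>e. c e div p"]) simp
      moreover have "poly_act \<sigma> (c e mod p) e \<in> span (g ` I)" if e: "e \<in> E" for e
      proof (cases "c e mod p = 0")
        case False
        then have "Polynomial.degree (c e mod p) < ?d" using degree_mod_less[of p "c e"] assms(2) by auto
        then have "(\<sigma> ^^ i) e \<in> g ` I" if "i \<le> Polynomial.degree (c e mod p)" for i
          using e that by (intro image_eqI[of _ _ "(e, i)"]) (auto simp: g_def I_def)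
        then show ?thesis unfolding poly_act_def by (intro span_sum span_scale span_base) simp
      qed (simp add: span_zero)
      ultimately show "u \<in> {x + y | x y. x \<in> ?P ` A \<and> y \<in> span (g ` I)}" by (blast intro: span_sum)
    qed
  qed
  ultimately show ?thesis using fd.dim_sums_Int[OF PA subspace_span[of "g ` I"]] by simp
qed

text \<open>By \<open>quot_basis_dim\<close> all bases have the same number of elements, so the
  \<open>THE\<close> in \<open>free_rank\<close> denotes it.\<close>

lemma eps_dim:
  assumes "p \<in> I_all f" "1 \<le> l" "p \<noteq> 0" "Polynomial.degree p > 0"
  shows "dim (W (p, l)) = dim (poly_act \<sigma> p ` W (p, l)) + Polynomial.degree p * eps \<sigma> W (p, l)"
proof -
  have sW: "\<sigma> ` W (p, l) \<subseteq> W (p, l)" using invW[of "(p, l)"] assms by auto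
  obtain E where E: "quot_basis \<sigma> (p ^ l) (W (p, l)) E" using freeW[OF assms(1,2)] by (auto simp: free_quot_def)
  note d = quot_basis_dim[OF _ assms(3,2) subW[OF assms(1,2)] sW]
  have "eps \<sigma> W (p, l) = card E"
    unfolding eps_def free_rank_def prod.case
  proof (rule the_equality)
    show "\<exists>E'. quot_basis \<sigma> (p ^ l) (W (p, l)) E' \<and> card E' = card E" using E by blast
    fix n assume "\<exists>E'. quot_basis \<sigma> (p ^ l) (W (p, l)) E' \<and> card E' = n"
    then obtain E' where "quot_basis \<sigma> (p ^ l) (W (p, l)) E'" "card E' = n" by blast
    then show "n = card E" using d[of E'] d[OF E] assms(4) by simp
  qed
  then show ?thesis using d[OF E] by simp
qed

end

lemma iso_form_uminus: "iso_form \<sigma> B \<Longrightarrow> iso_form \<sigma> (\<lambda>u v. - B u v)"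
  unfolding iso_form_def using symf_uminus[of UNIV B] by simp

section \<open>The invariants of a pair of form and isometry\<close>

context isom_sys begin

abbreviation I01 :: "real poly set" where "I01 \<equiv> I0 f \<union> I1 f"

lemma I01_all: "p \<in> I01 \<Longrightarrow> p \<in> I_all f"
  by (auto simp: I_all_def)

text \<open>One choice for each polynomial, made before any form is given: the same operators serve
  all invariant forms, which makes their indices comparable.\<close>

definition the_model :: "real poly \<Rightarrow> ('v \<Rightarrow> 'v) \<times> ('v \<Rightarrow> 'v) \<times> real \<times> real \<times> real" where
  "the_model p = (SOME M. case M of (N, S, \<kappa>, \<omega>, t) \<Rightarrow> model p N S \<kappa> \<omega> t)"

definition Nop :: "real poly \<Rightarrow> 'v \<Rightarrow> 'v" where "Nop p = fst (the_model p)"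
definition Sop :: "real poly \<Rightarrow> 'v \<Rightarrow> 'v" where "Sop p = fst (snd (the_model p))"
definition kap :: "real poly \<Rightarrow> real" where "kap p = fst (snd (snd (the_model p)))"
definition om :: "real poly \<Rightarrow> real" where "om p = fst (snd (snd (snd (the_model p))))"
definition tr :: "real poly \<Rightarrow> real" where "tr p = snd (snd (snd (snd (the_model p))))"

lemma the_model:
  assumes "p \<in> I01"
  shows "model p (Nop p) (Sop p) (kap p) (om p) (tr p)"
proof -
  have "\<exists>M. case M of (N, S, \<kappa>, \<omega>, t) \<Rightarrow> model p N S \<kappa> \<omega> t"
    using model_I0[of p] model_I1[of p] assms by auto
  then have "case the_model p of (N, S, \<kappa>, \<omega>, t) \<Rightarrow> model p N S \<kappa> \<omega> t"
    unfolding the_model_def by (rule someI_ex)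
  then show ?thesis by (simp add: Nop_def Sop_def kap_def om_def tr_def split: prod.splits)
qed

lemma model_parts:
  assumes "p \<in> I01"
  shows "\<forall>B. iso_form \<sigma> B \<longrightarrow> (\<forall>u\<in>V p. \<forall>v\<in>V p. B (Nop p u) v = kap p * B u (Nop p v) \<and> B (Sop p u) v = - B u (Sop p v))"
    and "\<exists>\<Theta>. linear \<Theta> \<and> (\<forall>u\<in>V p. \<Theta> (Nop p u) = poly_act \<sigma> p u \<and> Nop p (\<Theta> u) = poly_act \<sigma> p u) \<and>
        (\<forall>A. subspace A \<longrightarrow> A \<subseteq> V p \<longrightarrow> \<sigma> ` A \<subseteq> A \<longrightarrow> inj_on \<Theta> A \<and> \<Theta> ` A = A)"
    and "\<exists>c a b M. \<forall>u\<in>V p. \<sigma> u = c *\<^sub>R u + a *\<^sub>R (\<Sum>k<M. (Nop p ^^ k) u) + b *\<^sub>R Sop p u"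
    and "\<forall>A. subspace A \<longrightarrow> A \<subseteq> V p \<longrightarrow> \<sigma> ` A \<subseteq> A \<longrightarrow> (\<forall>u\<in>A. Nop p u \<in> A \<and> Sop p u \<in> A)"
    and "\<forall>h. linear h \<longrightarrow> (\<forall>v. h (\<sigma> v) = \<sigma> (h v)) \<longrightarrow> (\<forall>u\<in>V p. h (Nop p u) = Nop p (h u))"
    and "kap p = 1 \<and> p \<in> I1 f \<and> Polynomial.degree p = 2 \<or> kap p = - 1 \<and> p \<in> I0 f \<and> Polynomial.degree p = 1"
proof -
  note M = the_model[OF assms, unfolded model_def]
  show "\<forall>B. iso_form \<sigma> B \<longrightarrow> (\<forall>u\<in>V p. \<forall>v\<in>V p. B (Nop p u) v = kap p * B u (Nop p v) \<and> B (Sop p u) v = - B u (Sop p v))"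
    using M by (elim conjE)
  show "\<exists>\<Theta>. linear \<Theta> \<and> (\<forall>u\<in>V p. \<Theta> (Nop p u) = poly_act \<sigma> p u \<and> Nop p (\<Theta> u) = poly_act \<sigma> p u) \<and>
        (\<forall>A. subspace A \<longrightarrow> A \<subseteq> V p \<longrightarrow> \<sigma> ` A \<subseteq> A \<longrightarrow> inj_on \<Theta> A \<and> \<Theta> ` A = A)"
    using M by (elim conjE)
  show "\<exists>c a b M. \<forall>u\<in>V p. \<sigma> u = c *\<^sub>R u + a *\<^sub>R (\<Sum>k<M. (Nop p ^^ k) u) + b *\<^sub>R Sop p u"
    using M by (elim conjE)
  show "\<forall>A. subspace A \<longrightarrow> A \<subseteq> V p \<longrightarrow> \<sigma> ` A \<subseteq> A \<longrightarrow> (\<forall>u\<in>A. Nop p u \<in> A \<and> Sop p u \<in> A)"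
    using M by (elim conjE)
  show "\<forall>h. linear h \<longrightarrow> (\<forall>v. h (\<sigma> v) = \<sigma> (h v)) \<longrightarrow> (\<forall>u\<in>V p. h (Nop p u) = Nop p (h u))"
    using M by (elim conjE)
  show "kap p = 1 \<and> p \<in> I1 f \<and> Polynomial.degree p = 2 \<or> kap p = - 1 \<and> p \<in> I0 f \<and> Polynomial.degree p = 1"
    using M by (elim conjE)
qed

lemma nil_sys_V:
  assumes "p \<in> I01"
  shows "nil_sys Bs (V p) (Nop p) (Sop p) (kap p) (om p) (tr p) K"
  using the_model[OF assms] by (simp add: model_def)

abbreviation adm_p :: "real poly \<Rightarrow> ('v \<Rightarrow> 'v \<Rightarrow> real) \<Rightarrow> 'v set \<Rightarrow> bool" where
  "adm_p p \<equiv> nil_sys.adm (V p) (Nop p) (Sop p) (kap p)"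

lemma kap:
  assumes "p \<in> I01"
  shows "p \<in> I1 f \<Longrightarrow> kap p = 1" "p \<in> I0 f \<Longrightarrow> kap p = - 1"
    "nil_sys.res_deg (kap p) = Polynomial.degree p" "Polynomial.degree p > 0" "p \<noteq> 0"
proof -
  interpret M: nil_sys Bs "V p" "Nop p" "Sop p" "kap p" "om p" "tr p" K by (rule nil_sys_V[OF assms])
  have k: "kap p = 1 \<and> p \<in> I1 f \<and> Polynomial.degree p = 2 \<or> kap p = - 1 \<and> p \<in> I0 f \<and> Polynomial.degree p = 1"
    by (rule model_parts(6)[OF assms])
  show "p \<in> I1 f \<Longrightarrow> kap p = 1" "p \<in> I0 f \<Longrightarrow> kap p = - 1" using k by (auto simp: I0_def I1_def)
  show "nil_sys.res_deg (kap p) = Polynomial.degree p" using k unfolding M.res_deg_def by auto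
  show "Polynomial.degree p > 0" "p \<noteq> 0" using k by auto
qed

text \<open>The condition \<open>valid\<close>, expressed by the type of the polynomial and not by
  the chosen model.\<close>

definition val :: "real poly \<Rightarrow> nat \<Rightarrow> bool" where
  "val p m \<longleftrightarrow> p \<in> I01 \<and> 1 \<le> m \<and> (p \<in> I1 f \<or> odd m)"

lemma valid_iff: "p \<in> I01 \<Longrightarrow> nil_sys.valid (kap p) m \<longleftrightarrow> val p m"
proof -
  assume p: "p \<in> I01"
  interpret M: nil_sys Bs "V p" "Nop p" "Sop p" "kap p" "om p" "tr p" K by (rule nil_sys_V[OF p])
  show ?thesis using kap[OF p] p unfolding M.valid_def val_def by auto
qed

lemma model_inv:
  assumes "p \<in> I01" "subspace A" "A \<subseteq> V p" "\<sigma> ` A \<subseteq> A" "u \<in> A"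
  shows "Nop p u \<in> A" "Sop p u \<in> A"
  using model_parts(4)[OF assms(1)] assms(2-5) by simp_all

lemma adm_sub:
  assumes "p \<in> I01" "iso_form \<sigma> B" "subspace A" "A \<subseteq> V p" "\<sigma> ` A \<subseteq> A" "nondeg_on A B"
  shows "adm_p p B A"
proof -
  interpret M: nil_sys Bs "V p" "Nop p" "Sop p" "kap p" "om p" "tr p" K by (rule nil_sys_V[OF assms(1)])
  have a: "\<forall>u\<in>V p. \<forall>v\<in>V p. B (Nop p u) v = kap p * B u (Nop p v) \<and> B (Sop p u) v = - B u (Sop p v)"
    using model_parts(1)[OF assms(1)] assms(2) by simp
  have "M.inv_sub A" unfolding M.inv_sub_def using assms(3,4) model_inv[OF assms(1,3,4,5)] by blast
  then show ?thesis unfolding M.adm_def using a assms(4,6) iso_formD(5)[OF assms(2)] by blast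
qed

lemma adm_V:
  assumes "p \<in> I01" "iso_form \<sigma> B"
  shows "adm_p p B (V p)"
  by (rule adm_sub[OF assms subV[OF I01_all[OF assms(1)]] order_refl _ V_nondeg[OF assms(2) I01_all[OF assms(1)]]])
    (use V_sigma[OF I01_all[OF assms(1)]] in blast)

text \<open>On \<open>V p\<close> the operator \<open>\<sigma>\<close> is a linear combination of
  powers of \<open>N\<close> and of \<open>S\<close>, so relations stable under these two are stable
  under it.\<close>

lemma pair_inv_sigma:
  assumes "p \<in> I01" "subspace \<Gamma>" "fst ` \<Gamma> \<subseteq> V p" "snd ` \<Gamma> \<subseteq> V p" "pair_inv (Nop p) \<Gamma>" "pair_inv (Sop p) \<Gamma>"
  shows "pair_inv \<sigma> \<Gamma>"
  unfolding pair_inv_def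
proof (intro allI impI)
  fix x x' assume x: "(x, x') \<in> \<Gamma>"
  obtain c a b M where m: "\<And>u. u \<in> V p \<Longrightarrow> \<sigma> u = c *\<^sub>R u + a *\<^sub>R (\<Sum>k<M. (Nop p ^^ k) u) + b *\<^sub>R Sop p u"
    using model_parts(3)[OF assms(1)] by (elim exE) simp
  have xV: "x \<in> V p" "x' \<in> V p" using x assms(3,4) by force+
  have "((Nop p ^^ k) x, (Nop p ^^ k) x') \<in> \<Gamma>" for k
    by (induction k) (use x assms(5) in \<open>auto simp: pair_inv_def\<close>)
  then have "(\<Sum>k<M. ((Nop p ^^ k) x, (Nop p ^^ k) x')) \<in> \<Gamma>" by (intro subspace_sum[OF assms(2)])
  moreover have "(Sop p x, Sop p x') \<in> \<Gamma>" using x assms(6) by (simp add: pair_inv_def)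
  ultimately have "c *\<^sub>R (x, x') + a *\<^sub>R (\<Sum>k<M. ((Nop p ^^ k) x, (Nop p ^^ k) x')) + b *\<^sub>R (Sop p x, Sop p x') \<in> \<Gamma>"
    using x by (intro subspace_add[OF assms(2)] subspace_scale[OF assms(2)])
  then show "(\<sigma> x, \<sigma> x') \<in> \<Gamma>" unfolding m[OF xV(1)] m[OF xV(2)] by (simp add: sum_prod)
qed

text \<open>\<open>Nop\<close> and \<open>V\<close> depend on \<open>\<sigma>\<close> alone, so for
  fixed \<open>p\<close> and \<open>m\<close> this is a function of the form.\<close>

definition idx :: "('v \<Rightarrow> 'v \<Rightarrow> real) \<Rightarrow> real poly \<Rightarrow> nat \<Rightarrow> nat" where
  "idx B p m = pos_index (bet (Nop p) B m) (ker_pow (Nop p) m (V p))"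

abbreviation nidx :: "('v \<Rightarrow> 'v \<Rightarrow> real) \<Rightarrow> real poly \<Rightarrow> nat \<Rightarrow> nat" where
  "nidx B \<equiv> idx (\<lambda>u v. - B u v)"

lemma nidx_eq: "nidx B p m = neg_index (bet (Nop p) B m) (ker_pow (Nop p) m (V p))"
  by (simp add: idx_def bet_uminus)

lemma idx_dvd:
  assumes "val p m" "iso_form \<sigma> B"
  shows "Polynomial.degree p dvd idx B p m"
proof -
  have p: "p \<in> I01" using assms(1) by (simp add: val_def)
  interpret M: nil_sys Bs "V p" "Nop p" "Sop p" "kap p" "om p" "tr p" K by (rule nil_sys_V[OF p])
  show ?thesis using M.res_deg_dvd_index[OF adm_V[OF p assms(2)]] valid_iff[OF p] assms(1) kap(3)[OF p]
    by (simp add: idx_def)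
qed

lemma sgn_V:
  assumes "p \<in> I01" "iso_form \<sigma> B"
  shows "sgn_index B (V p) = (\<Sum>k<K. int (idx B p (2*k+1)) - int (nidx B p (2*k+1)))"
proof -
  interpret M: nil_sys Bs "V p" "Nop p" "Sop p" "kap p" "om p" "tr p" K by (rule nil_sys_V[OF assms(1)])
  show ?thesis unfolding nidx_eq unfolding idx_def sgn_index_def[symmetric]
    by (rule M.sgn_formula[OF adm_V[OF assms]])
qed

text \<open>The radical in \<open>bet_rank\<close> involves no form.\<close>

lemma rank_independent:
  assumes "val p m" "iso_form \<sigma> B" "iso_form \<sigma> B'"
  shows "idx B p m + nidx B p m = idx B' p m + nidx B' p m"
proof -
  have p: "p \<in> I01" using assms(1) by (simp add: val_def)
  interpret M: nil_sys Bs "V p" "Nop p" "Sop p" "kap p" "om p" "tr p" K by (rule nil_sys_V[OF p])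
  have v: "M.valid m" using valid_iff[OF p] assms(1) by simp
  show ?thesis unfolding nidx_eq unfolding idx_def
    using M.bet_rank[OF adm_V[OF p assms(2)] v] M.bet_rank[OF adm_V[OF p assms(3)] v] by simp
qed

lemma idx_map:
  assumes "val p m" "iso_form \<sigma> B" "iso_form \<sigma> B'" "linear h" "bij h" "\<And>v. h (\<sigma> v) = \<sigma> (h v)"
    and "\<And>u v. B' u v = B (h u) (h v)"
  shows "idx B' p m = idx B p m"
proof -
  have p: "p \<in> I01" using assms(1) by (simp add: val_def)
  interpret M: nil_sys Bs "V p" "Nop p" "Sop p" "kap p" "om p" "tr p" K by (rule nil_sys_V[OF p])
  have inj: "inj_on h (V p)" using assms(5) by (auto simp: bij_def intro: inj_on_subset)
  have "h ` V p \<subseteq> V p" using V_commuting[OF I01_all[OF p] assms(4,6)] by blast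
  moreover have "x = 0" if "h x = 0" for x
    using assms(5) linear_0[OF assms(4)] that by (metis bij_def injD)
  ultimately have im: "h ` V p = V p" using inj_on_image_eq(2)[OF assms(4) subV[OF I01_all[OF p]]] by blast
  have hN: "h (Nop p x) = Nop p (h x)" if "x \<in> V p" for x
    using model_parts(5)[OF p] assms(4,6) that by simp
  have "M.valid m" using valid_iff[OF p] assms(1) by simp
  then show ?thesis unfolding idx_def
    by (intro M.map_invariants(2)[OF adm_V[OF p assms(3)] adm_V[OF p assms(2)] assms(4) im inj hN assms(7)])
qed

lemma V_corr:
  assumes "iso_form \<sigma> B" "iso_form \<sigma> B'" "\<And>m. val p m \<Longrightarrow> idx B p m = idx B' p m" "p \<in> I_all f"
  shows "\<exists>\<Gamma>. corr \<Gamma> B (V p) B' (V p) \<and> pair_inv \<sigma> \<Gamma>"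
proof (cases "p \<in> I01")
  case False
  then have "p \<in> I2 f" using assms(4) by (simp add: I_all_def)
  then show ?thesis using I2_corr assms(1,2) by blast
next
  case True
  interpret M: nil_sys Bs "V p" "Nop p" "Sop p" "kap p" "om p" "tr p" K by (rule nil_sys_V[OF True])
  have "M.equivalent B (V p) B' (V p)"
  proof (rule M.classification[OF adm_V[OF True assms(1)] adm_V[OF True assms(2)] refl])
    fix m assume "M.valid m"
    then have v: "val p m" using valid_iff[OF True] by simp
    show "pos_index (bet (Nop p) B m) (ker_pow (Nop p) m (V p)) = pos_index (bet (Nop p) B' m) (ker_pow (Nop p) m (V p))"
      using assms(3)[OF v] by (simp add: idx_def)
    show "neg_index (bet (Nop p) B m) (ker_pow (Nop p) m (V p)) = neg_index (bet (Nop p) B' m) (ker_pow (Nop p) m (V p))"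
      using assms(3)[OF v] rank_independent[OF v assms(1,2)] unfolding nidx_eq by simp
  qed
  then obtain \<Gamma> where G: "corr \<Gamma> B (V p) B' (V p)" "pair_inv (Nop p) \<Gamma>" "pair_inv (Sop p) \<Gamma>"
    unfolding M.equivalent_def by blast
  then have "pair_inv \<sigma> \<Gamma>" by (intro pair_inv_sigma[OF True]) (auto simp: corr_def)
  then show ?thesis using G(1) by blast
qed

text \<open>Different components are orthogonal for both forms, so the union of the relations on the
  single components still matches the forms and spans the graph of a global isometry.\<close>

theorem idx_complete:
  assumes "iso_form \<sigma> B" "iso_form \<sigma> B'" "\<And>p m. val p m \<Longrightarrow> idx B p m = idx B' p m"
  shows "\<exists>h. linear h \<and> bij h \<and> (\<forall>v. h (\<sigma> v) = \<sigma> (h v)) \<and> (\<forall>u v. B u v = B' (h u) (h v))"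
proof -
  have b: "bilinear B" "bilinear B'" using iso_formD(1) assms by auto
  have "\<forall>p\<in>primes. \<exists>\<Gamma>. corr \<Gamma> B (V p) B' (V p) \<and> pair_inv \<sigma> \<Gamma>"
    using V_corr[OF assms] primes(2) by blast
  then obtain \<Gamma> where G: "\<And>p. p \<in> primes \<Longrightarrow> corr (\<Gamma> p) B (V p) B' (V p) \<and> pair_inv \<sigma> (\<Gamma> p)" by metis
  define D where "D = (\<Union>p\<in>primes. \<Gamma> p)"
  have mem: "x \<in> V p \<and> x' \<in> V p" if "p \<in> primes" "(x, x') \<in> \<Gamma> p" for p x x'
    using G[OF that(1)] that(2) unfolding corr_def by force
  have "B x y = B' x' y'" if xy: "(x, x') \<in> D" "(y, y') \<in> D" for x x' y y'
  proof -
    obtain p where p: "p \<in> primes" "(x, x') \<in> \<Gamma> p" using xy(1) by (auto simp: D_def)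
    obtain q where q: "q \<in> primes" "(y, y') \<in> \<Gamma> q" using xy(2) by (auto simp: D_def)
    show ?thesis
    proof (cases "p = q")
      case True
      then show ?thesis using G[OF p(1)] p q unfolding corr_def by blast
    next
      case False
      have "p \<in> I_all f" "q \<in> I_all f" using p q primes(2) by auto
      then show ?thesis
        using V_orth[OF assms(1) _ _ False, of x y] V_orth[OF assms(2) _ _ False, of x' y'] mem[OF p] mem[OF q] by simp
    qed
  qed
  then have c: "corr (span D) B (span (fst ` D)) B' (span (snd ` D))" by (rule corr_span[OF b])
  have "fst ` D = (\<Union>p\<in>primes. V p)" "snd ` D = (\<Union>p\<in>primes. V p)"
    unfolding D_def image_UN using G by (auto simp: corr_def)
  then have c: "corr (span D) B UNIV B' UNIV" using c primes(3) by simp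
  have pi: "pair_inv \<sigma> (span D)"
  proof (rule pair_inv_span[OF lin], rule span_base)
    fix x x' assume "(x, x') \<in> D"
    then show "(\<sigma> x, \<sigma> x') \<in> D" using G unfolding D_def pair_inv_def by blast
  qed
  have nd: "nondeg_on UNIV B" "nondeg_on UNIV B'" using assms(1,2) by (auto simp: iso_form_def nondeg_on_def)
  obtain h where h: "linear h" "h ` UNIV = UNIV" "inj_on h UNIV" "\<forall>x. (x, h x) \<in> span D"
    "\<forall>x x'. (x, x') \<in> span D \<longrightarrow> x' = h x" "\<forall>x y. B x y = B' (h x) (h y)"
    using corr_map[OF c b nd] by auto
  have "h (\<sigma> v) = \<sigma> (h v)" for v using h(4,5) pi unfolding pair_inv_def by metis
  moreover have "bij h" using h(2,3) by (simp add: bij_def)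
  ultimately show ?thesis using h by blast
qed

text \<open>The cyclic block counts with the degree of \<open>p\<close> in the positive index at
  \<open>(p, m)\<close>; negated, it counts there in the negative index, and elsewhere in
  neither.\<close>

lemma flip:
  assumes "val p m" "iso_form \<sigma> B" "0 < idx B p m"
  shows "\<exists>B'. iso_form \<sigma> B' \<and> idx B' p m + Polynomial.degree p = idx B p m \<and>
    (\<forall>q l. val q l \<longrightarrow> (q, l) \<noteq> (p, m) \<longrightarrow> idx B' q l = idx B q l)"
proof -
  have p: "p \<in> I01" using assms(1) by (simp add: val_def)
  interpret M: nil_sys Bs "V p" "Nop p" "Sop p" "kap p" "om p" "tr p" K by (rule nil_sys_V[OF p])
  note b = bilin[OF iso_formD(1)[OF assms(2)]]
  have v: "M.valid m" using valid_iff[OF p] assms(1) by simp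
  obtain X where X: "X \<subseteq> V p" "M.adm B X"
    and Xi: "\<And>l. M.valid l \<Longrightarrow> pos_index (bet (Nop p) B l) (ker_pow (Nop p) l X) = (if l = m then M.res_deg else 0)
       \<and> neg_index (bet (Nop p) B l) (ker_pow (Nop p) l X) = 0"
    using M.cyclic_block[OF adm_V[OF p assms(2)] v] assms(3) unfolding idx_def by blast
  have sX: "subspace X" "M.inv_sub X" "nondeg_on X B" using M.admD[OF X(2)] by auto
  \<comment> \<open>Applied to the diagonal of \<open>X\<close>, \<open>pair_inv_sigma\<close> turns
    invariance under the operators of the model into invariance under
    \<open>\<sigma>\<close>.\<close>
  have sigX: "\<sigma> ` X \<subseteq> X"
  proof -
    have "subspace ((\<lambda>x. (x, x)) ` X)" using sX(1)
      by (intro linear_subspace_image) (auto intro!: linearI)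
    then have "pair_inv \<sigma> ((\<lambda>x. (x, x)) ` X)"
      by (rule pair_inv_sigma[OF p]) (use X(1) M.inv_subD[OF sX(2)] in \<open>auto simp: pair_inv_def image_iff\<close>)
    then show ?thesis by (auto simp: pair_inv_def)
  qed
  have "\<exists>x\<in>X. \<forall>z\<in>X. B (u - x) z = 0" for u
    using nondeg_split[OF iso_formD(5)[OF assms(2), of UNIV] sX(1) subset_UNIV sX(3) subspace_UNIV UNIV_I, of u]
    by (metis add_diff_cancel_left')
  \<comment> \<open>The orthogonal projection onto \<open>X\<close>. Its linearity and its commuting
    with \<open>\<sigma>\<close> follow from uniqueness.\<close>
  then obtain \<pi> where pi: "\<And>u. \<pi> u \<in> X" "\<And>u z. z \<in> X \<Longrightarrow> B (u - \<pi> u) z = 0" by metis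
  have uniq: "x = y" if "x \<in> X" "y \<in> X" "\<And>z. z \<in> X \<Longrightarrow> B x z = B y z" for x y
    using sX(3) subspace_diff[OF sX(1) that(1,2)] that(3) unfolding nondeg_on_def by (auto simp: b)
  have piB: "B (\<pi> u) z = B u z" if "z \<in> X" for u z using pi(2)[OF that, of u] by (simp add: b)
  have lpi: "linear \<pi>"
    by (rule linearI; rule uniq) (auto simp: pi(1) subspace_add[OF sX(1)] subspace_scale[OF sX(1)] piB b)
  have pis: "\<pi> (\<sigma> u) = \<sigma> (\<pi> u)" for u
  proof (rule uniq)
    show "\<sigma> (\<pi> u) \<in> X" using sigX pi(1) by blast
    fix z assume "z \<in> X"
    then obtain z0 where z: "z0 \<in> X" "z = \<sigma> z0" using sigma_image[OF sX(1) sigX] by blast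
    then have "B (\<pi> (\<sigma> u)) z = B (\<sigma> u) (\<sigma> z0)" using piB[of z "\<sigma> u"] sigX by auto
    then show "B (\<pi> (\<sigma> u)) z = B (\<sigma> (\<pi> u)) z" using z piB[OF z(1), of u] by (simp add: iso_formD(3)[OF assms(2)])
  qed (rule pi(1))
  have piX: "\<pi> x = x" if "x \<in> X" for x by (rule uniq) (use that pi piB in auto)
  have sym: "B u v = B v u" for u v by (rule iso_formD(2)[OF assms(2)])
  have pi2: "B (\<pi> u) (\<pi> v) = B (\<pi> u) v" for u v
    using piB[OF pi(1)[of u], of v] sym by metis
  \<comment> \<open>\<open>- B\<close> on the cyclic block \<open>X\<close> and \<open>B\<close> on its complement\<close>
  define B' where "B' u v = B u v - 2 * B (\<pi> u) (\<pi> v)" for u v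
  have B': "iso_form \<sigma> B'"
    unfolding iso_form_def
  proof (intro conjI allI impI)
    show "symf UNIV B'" unfolding symf_def B'_def bilinear_def
      using sym by (auto intro!: linearI simp: b linear_add[OF lpi] linear_scale[OF lpi] algebra_simps)
    show "B' (\<sigma> u) (\<sigma> v) = B' u v" for u v by (simp add: B'_def pis iso_formD(3)[OF assms(2)])
    fix u assume u: "\<forall>v. B' u v = 0"
    have "B (u - 2 *\<^sub>R \<pi> u) v = 0" for v using u[rule_format, of v] by (simp add: B'_def pi2 b)
    then have 1: "u - 2 *\<^sub>R \<pi> u = 0" by (rule iso_formD(4)[OF assms(2)])
    then have "u = 2 *\<^sub>R \<pi> u" by simp
    then have "\<pi> u = 2 *\<^sub>R \<pi> u" using piX[OF pi(1)[of u]] linear_scale[OF lpi, of 2 "\<pi> u"] by metis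
    then have "\<pi> u = 0" by (simp add: scaleR_2)
    then show "u = 0" using 1 by simp
  qed
  have B'X: "B' x y = - B x y" if "x \<in> X" "y \<in> X" for x y using that by (simp add: B'_def piX)
  have pi0: "\<pi> y = 0" if "\<And>x. x \<in> X \<Longrightarrow> B y x = 0" for y
    by (rule uniq) (use that pi(1) subspace_0[OF sX(1)] piB in \<open>auto simp: b\<close>)
  define Y where "Y = M.orth_in B (V p) X"
  have B'Y: "B' x y = B x y" if "x \<in> Y" for x y
    using that pi0[of x] by (simp add: Y_def M.orth_in_def B'_def b)
  have Y': "Y = M.orth_in B' (V p) X"
  proof -
    have "B' y x = - B y x" if "x \<in> X" for y x using piB[OF that, of y] by (simp add: B'_def piX[OF that])
    then show ?thesis by (simp add: Y_def M.orth_in_def)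
  qed
  have admV: "M.adm B (V p)" "M.adm B' (V p)" using adm_V[OF p assms(2)] adm_V[OF p B'] by auto
  have "nondeg_on X B'" using sX(3) B'X by (simp add: nondeg_on_def)
  then have admX: "M.adm B' X" by (rule adm_sub[OF p B' sX(1) X(1) sigX])
  have invY: "M.inv_sub Y" using M.admD(1)[OF M.adm_split(1)[OF admV(1) X(2,1)]] by (simp add: Y_def)
  have idp: "idx B p l = (if l = m then M.res_deg else 0) + pos_index (bet (Nop p) B l) (ker_pow (Nop p) l Y)"
    "idx B' p l = pos_index (bet (Nop p) B l) (ker_pow (Nop p) l Y)" if "val p l" for l
  proof -
    have vl: "M.valid l" using that valid_iff[OF p] by simp
    show "idx B p l = (if l = m then M.res_deg else 0) + pos_index (bet (Nop p) B l) (ker_pow (Nop p) l Y)"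
      using M.split_invariants(2)[OF admV(1) X(2,1) Y_def vl] Xi[OF vl] by (simp add: idx_def)
    have "pos_index (bet (Nop p) B' l) (ker_pow (Nop p) l X) = neg_index (bet (Nop p) B l) (ker_pow (Nop p) l X)"
    proof (rule pos_index_cong)
      fix u assume "u \<in> ker_pow (Nop p) l X"
      then have "u \<in> X" by (simp add: ker_pow_def)
      then show "bet (Nop p) B' l u u = - bet (Nop p) B l u u" unfolding bet_def
        by (intro B'X M.Np_in[OF sX(2)])
    qed
    moreover have "pos_index (bet (Nop p) B' l) (ker_pow (Nop p) l Y) = pos_index (bet (Nop p) B l) (ker_pow (Nop p) l Y)"
    proof (rule pos_index_cong)
      fix u assume "u \<in> ker_pow (Nop p) l Y"
      then have "u \<in> Y" by (simp add: ker_pow_def)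
      then show "bet (Nop p) B' l u u = bet (Nop p) B l u u" unfolding bet_def
        by (intro B'Y M.Np_in[OF invY])
    qed
    ultimately show "idx B' p l = pos_index (bet (Nop p) B l) (ker_pow (Nop p) l Y)"
      using M.split_invariants(2)[OF admV(2) admX X(1) Y' vl] Xi[OF vl] by (simp add: idx_def)
  qed
  have "idx B' q l = idx B q l" if q: "val q l" "q \<noteq> p" for q l
    unfolding idx_def
  proof (rule pos_index_cong)
    have qI: "q \<in> I01" using q(1) by (simp add: val_def)
    interpret Q: nil_sys Bs "V q" "Nop q" "Sop q" "kap q" "om q" "tr q" K by (rule nil_sys_V[OF qI])
    fix u assume "u \<in> ker_pow (Nop q) l (V q)"
    then have u: "u \<in> V q" by (simp add: ker_pow_def)
    have "(Nop q ^^ k) u \<in> V q" for k using Q.Np_in[OF Q.admD(1)[OF adm_V[OF qI assms(2)]] u] .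
    moreover have "\<pi> w = 0" if "w \<in> V q" for w
      using pi0[of w] V_orth[OF assms(2) I01_all[OF qI] I01_all[OF p] q(2) that] X(1) by blast
    ultimately show "bet (Nop q) B' l u u = bet (Nop q) B l u u" unfolding bet_def B'_def by (simp add: b)
  qed
  moreover have "idx B' p l = idx B p l" if "val p l" "l \<noteq> m" for l using idp[OF that(1)] that(2) by simp
  moreover have "idx B' p m + Polynomial.degree p = idx B p m" using idp[OF assms(1)] kap(3)[OF p] by simp
  ultimately show ?thesis using B' by (intro exI[of _ B']) auto
qed

text \<open>A decrease of the positive index for the negated form is an increase for the form
  itself, since the two indices have a constant sum.\<close>

lemma flip_up:
  assumes "val p m" "iso_form \<sigma> B" "0 < nidx B p m"
  shows "\<exists>B'. iso_form \<sigma> B' \<and> idx B' p m = idx B p m + Polynomial.degree p \<and>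
    (\<forall>q l. val q l \<longrightarrow> (q, l) \<noteq> (p, m) \<longrightarrow> idx B' q l = idx B q l)"
proof -
  obtain C where C: "iso_form \<sigma> C" "idx C p m + Polynomial.degree p = nidx B p m"
    "\<And>q l. val q l \<Longrightarrow> (q, l) \<noteq> (p, m) \<Longrightarrow> idx C q l = nidx B q l"
    using flip[OF assms(1) iso_form_uminus[OF assms(2)] assms(3)] by blast
  have r: "idx C q l + nidx C q l = idx B q l + nidx B q l" if "val q l" for q l
    by (rule rank_independent[OF that C(1) assms(2)])
  have "nidx C p m = idx B p m + Polynomial.degree p" using r[OF assms(1)] C(2) by simp
  moreover have "nidx C q l = idx B q l" if "val q l" "(q, l) \<noteq> (p, m)" for q l using r[OF that(1)] C(3)[OF that] by simp
  ultimately show ?thesis using iso_form_uminus[OF C(1)] by blast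
qed

end

text \<open>Ties the indices to the given decomposition. Ranks are computed with the one form for
  which the summands are orthogonal and carry over to every invariant form by
  \<open>rank_independent\<close>.\<close>

locale orth_isom_sys = isom_sys +
  fixes B :: "'a \<Rightarrow> 'a \<Rightarrow> real"
  assumes formB: "iso_form \<sigma> B"
    and orthW: "\<And>i j u v. i \<in> I_all f \<times> {1..} \<Longrightarrow> j \<in> I_all f \<times> {1..} \<Longrightarrow> i \<noteq> j \<Longrightarrow> u \<in> W i \<Longrightarrow> v \<in> W j \<Longrightarrow> B u v = 0"
begin

lemma adm_W:
  assumes "p \<in> I01" "1 \<le> l"
  shows "adm_p p B (W (p, l))"
proof (rule adm_sub[OF assms(1) formB])
  have pI: "p \<in> I_all f" by (rule I01_all[OF assms(1)])
  show "subspace (W (p, l))" "W (p, l) \<subseteq> V p" "\<sigma> ` W (p, l) \<subseteq> W (p, l)"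
    using subW[OF pI assms(2)] W_V[OF pI assms(2)] invW[of "(p, l)"] pI assms(2) by auto
  show "nondeg_on (W (p, l)) B"
    unfolding nondeg_on_def
  proof (intro ballI impI)
    fix u assume u: "u \<in> W (p, l)" "\<forall>v\<in>W (p, l). B u v = 0"
    have "B u v = 0" if "1 \<le> l'" "v \<in> W (p, l')" for l' v
      using u that orthW[of "(p, l)" "(p, l')" u v] pI assms(2) by (cases "l' = l") auto
    then have "span (\<Union>l'\<in>{1..}. W (p, l')) \<subseteq> {v. B u v = 0}"
      by (intro span_minimal) (auto simp: subspace_def bilin[OF iso_formD(1)[OF formB]])
    then have "\<forall>v\<in>V p. B u v = 0" using V_span[OF pI] by blast
    then show "u = 0" using V_nondeg[OF formB pI] W_V[OF pI assms(2)] u(1) by (auto simp: nondeg_on_def)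
  qed
qed

text \<open>Carries freeness over from p(\<sigma>) to \<open>Nop p\<close>, which differs from it on
  \<open>W (p, l)\<close> by the automorphism \<Theta>.\<close>

lemma W_structure:
  assumes "p \<in> I01" "1 \<le> l"
  shows "Nop p ` W (p, l) = poly_act \<sigma> p ` W (p, l)" "u \<in> W (p, l) \<Longrightarrow> (Nop p ^^ l) u = 0"
    "k \<le> l \<Longrightarrow> u \<in> W (p, l) \<Longrightarrow> (Nop p ^^ k) u = 0 \<Longrightarrow> u \<in> (Nop p ^^ (l - k)) ` W (p, l)"
proof -
  have pI: "p \<in> I_all f" by (rule I01_all[OF assms(1)])
  let ?A = "W (p, l)"
  have A: "subspace ?A" "?A \<subseteq> V p" "\<sigma> ` ?A \<subseteq> ?A"
    using subW[OF pI assms(2)] W_V[OF pI assms(2)] invW[of "(p, l)"] pI assms(2) by auto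
  obtain \<Theta> where T: "linear \<Theta>" "\<And>u. u \<in> V p \<Longrightarrow> \<Theta> (Nop p u) = poly_act \<sigma> p u"
    "\<And>u. u \<in> V p \<Longrightarrow> Nop p (\<Theta> u) = poly_act \<sigma> p u"
    "\<And>A. subspace A \<Longrightarrow> A \<subseteq> V p \<Longrightarrow> \<sigma> ` A \<subseteq> A \<Longrightarrow> inj_on \<Theta> A \<and> \<Theta> ` A = A"
    using model_parts(2)[OF assms(1)] by (elim exE conjE) simp
  have TA: "inj_on \<Theta> ?A" "\<Theta> ` ?A = ?A" using T(4)[OF A] by auto
  have Ti: "\<Theta> v \<in> ?A" if "v \<in> ?A" for v using TA(2) that by blast
  have Ni: "Nop p v \<in> ?A" if "v \<in> ?A" for v by (rule model_inv[OF assms(1) A that])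
  have AV: "v \<in> V p" if "v \<in> ?A" for v using A(2) that by blast
  have "Nop p ` ?A = Nop p ` \<Theta> ` ?A" using TA(2) by simp
  also have "\<dots> = poly_act \<sigma> p ` ?A" unfolding image_image by (rule image_cong) (use T(3) AV in auto)
  finally show "Nop p ` ?A = poly_act \<sigma> p ` ?A" .
  have m1: "(poly_act \<sigma> p ^^ j) v = (\<Theta> ^^ j) ((Nop p ^^ j) v)" if "v \<in> ?A" for v j
    by (rule funpow_mult_on[where A = ?A]) (use Ti Ni T(2,3) AV that in auto)
  have m2: "(poly_act \<sigma> p ^^ j) v = (Nop p ^^ j) ((\<Theta> ^^ j) v)" if "v \<in> ?A" for v j
    by (rule funpow_mult_on[where A = ?A]) (use Ti Ni T(2,3) AV that in auto)
  have Np: "(Nop p ^^ j) v \<in> ?A" "(\<Theta> ^^ j) v \<in> ?A" if "v \<in> ?A" for v j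
    by (induction j) (use that Ni Ti in auto)
  have T0: "x \<in> ?A \<Longrightarrow> (\<Theta> ^^ j) x = 0 \<Longrightarrow> x = 0" for j x
  proof (induction j arbitrary: x)
    case (Suc j)
    have "(\<Theta> ^^ j) (\<Theta> x) = 0" using Suc.prems(2) by (simp only: funpow_Suc_right o_apply)
    then have "\<Theta> x = \<Theta> 0" using Suc.IH Ti Suc.prems(1) linear_0[OF T(1)] by metis
    then show ?case using TA(1) Suc.prems(1) subspace_0[OF A(1)] by (meson inj_onD)
  qed simp
  show "(Nop p ^^ l) u = 0" if "u \<in> ?A"
    using m1[OF that, of l] pow_W[OF pI assms(2) that] T0[OF Np(1)[OF that, of l]] by metis
  show "u \<in> (Nop p ^^ (l - k)) ` ?A" if h: "k \<le> l" "u \<in> ?A" "(Nop p ^^ k) u = 0"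
  proof -
    obtain E where E: "quot_basis \<sigma> (p ^ l) ?A E" using freeW[OF pI assms(2)] by (auto simp: free_quot_def)
    have "(poly_act \<sigma> p ^^ k) u = 0"
      using m1[OF h(2), of k] h(3) linear_0[OF linear_funpow[OF T(1), of k]] by simp
    then obtain w where w: "w \<in> ?A" "u = poly_act \<sigma> (p ^ (l - k)) w"
      using quot_basis_ker[OF E kap(5)[OF assms(1)] h(1,2)] by (auto simp: poly_act_power[OF lin])
    then have "u = (Nop p ^^ (l - k)) ((\<Theta> ^^ (l - k)) w)" using m2[OF w(1)] by (simp add: poly_act_power[OF lin])
    then show ?thesis using Np(2)[OF w(1)] by blast
  qed
qed

text \<open>In a free module of exponent \<open>l\<close> the radical exhausts the kernel of
  \<open>N ^^ m\<close> unless m = l, and for m = l it is the image of \<open>N\<close>, whose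
  codimension is the degree times the rank.\<close>

lemma W_rank:
  assumes "val p m" "1 \<le> l"
  shows "pos_index (bet (Nop p) B m) (ker_pow (Nop p) m (W (p, l))) +
    neg_index (bet (Nop p) B m) (ker_pow (Nop p) m (W (p, l))) = (if l = m then Polynomial.degree p * eps \<sigma> W (p, m) else 0)"
proof -
  have p: "p \<in> I01" using assms(1) by (simp add: val_def)
  have m1: "1 \<le> m" using assms(1) by (simp add: val_def)
  have pI: "p \<in> I_all f" by (rule I01_all[OF p])
  interpret M: nil_sys Bs "V p" "Nop p" "Sop p" "kap p" "om p" "tr p" K by (rule nil_sys_V[OF p])
  let ?A = "W (p, l)" and ?N = "Nop p"
  have A: "M.inv_sub ?A" "subspace ?A" using M.admD[OF adm_W[OF p assms(2)]] by auto
  note st = W_structure[OF p assms(2)]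
  have v: "M.valid m" using valid_iff[OF p] assms(1) by simp
  note rk = M.bet_rank[OF adm_W[OF p assms(2)] v]
  show ?thesis
  proof (cases "l = m")
    case False
    have "ker_pow ?N m ?A \<subseteq> M.rad_pow m ?A"
    proof
      fix u assume u: "u \<in> ker_pow ?N m ?A"
      then have uA: "u \<in> ?A" "(?N ^^ m) u = 0" by (auto simp: ker_pow_def)
      show "u \<in> M.rad_pow m ?A"
      proof (cases "m < l")
        case True
        then obtain w where w: "w \<in> ?A" "u = (?N ^^ (l - m)) w" using st(3)[of m u] uA by auto
        define w' where "w' = (?N ^^ (l - m - 1)) w"
        have "l - m = Suc (l - m - 1)" using True by simp
        then have uw: "u = ?N w'" unfolding w(2) w'_def by (metis funpow.simps(2) o_apply)
        have "w' \<in> ?A" unfolding w'_def by (rule M.Np_in[OF A(1) w(1)])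
        moreover have "(?N ^^ (m + 1)) w' = 0" using uA(2) uw by (simp add: funpow_swap1)
        ultimately have "w' \<in> ker_pow ?N (m + 1) ?A" by (simp add: ker_pow_def)
        moreover have "0 \<in> ker_pow ?N (m - 1) ?A" by (rule subspace_0[OF subspace_ker_pow[OF M.linN A(2)]])
        ultimately show ?thesis unfolding M.rad_pow_def uw by (intro CollectI exI[of _ 0] exI[of _ w']) simp
      next
        case f: False
        then have "(?N ^^ (m - 1)) u = 0" using funpow_zero_mono[OF M.linN st(2)[OF uA(1)], of "m - 1"] False by simp
        then have "u \<in> ker_pow ?N (m - 1) ?A" using uA(1) by (simp add: ker_pow_def)
        moreover have "0 \<in> ker_pow ?N (m + 1) ?A" by (rule subspace_0[OF subspace_ker_pow[OF M.linN A(2)]])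
        ultimately show ?thesis unfolding M.rad_pow_def
          by (intro CollectI exI[of _ u] exI[of _ 0]) (simp add: linear_0[OF M.linN])
      qed
    qed
    then have "dim (ker_pow ?N m ?A) \<le> dim (M.rad_pow m ?A)" by (rule fd.dim_subset)
    then show ?thesis using rk False by simp
  next
    case True
    have full: "ker_pow ?N k ?A = ?A" if "l \<le> k" for k
      using funpow_zero_mono[OF M.linN st(2) that] by (auto simp: ker_pow_def)
    have "M.rad_pow l ?A = ?N ` ?A"
    proof
      show "M.rad_pow l ?A \<subseteq> ?N ` ?A"
      proof
        fix x assume "x \<in> M.rad_pow l ?A"
        then obtain a w where x: "x = a + ?N w" "a \<in> ker_pow ?N (l - 1) ?A" "w \<in> ker_pow ?N (l + 1) ?A"
          by (auto simp: M.rad_pow_def)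
        have "a \<in> (?N ^^ (l - (l - 1))) ` ?A" using x(2) by (intro st(3)) (auto simp: ker_pow_def)
        then have "a \<in> ?N ` ?A" using assms(2) by simp
        moreover have "?N w \<in> ?N ` ?A" using x(3) by (simp add: ker_pow_def)
        ultimately show "x \<in> ?N ` ?A" unfolding x(1) by (intro subspace_add linear_subspace_image[OF M.linN A(2)])
      qed
      show "?N ` ?A \<subseteq> M.rad_pow l ?A"
      proof clarify
        fix w assume "w \<in> ?A"
        then have "w \<in> ker_pow ?N (l + 1) ?A" using full[of "l + 1"] by simp
        moreover have "0 \<in> ker_pow ?N (l - 1) ?A" by (rule subspace_0[OF subspace_ker_pow[OF M.linN A(2)]])
        ultimately show "?N w \<in> M.rad_pow l ?A" unfolding M.rad_pow_def
          by (intro CollectI exI[of _ 0] exI[of _ w]) simp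
      qed
    qed
    then show ?thesis
      using rk full[of l] eps_dim[OF pI assms(2) kap(5)[OF p] kap(4)[OF p]] st(1) True by simp
  qed
qed

text \<open>The kernel of \<open>N ^^ m\<close> splits orthogonally over the
  \<open>W (p, l)\<close>, and by \<open>W_rank\<close> only l = m contributes. Stating it for both
  signs of \<open>B\<close> gives the negative index as well.\<close>

lemma idx_W_aux:
  assumes "val p m" "C = B \<or> C = (\<lambda>u v. - B u v)"
  shows "idx C p m = pos_index (bet (Nop p) C m) (ker_pow (Nop p) m (W (p, m)))"
proof -
  have p: "p \<in> I01" using assms(1) by (simp add: val_def)
  have m1: "1 \<le> m" using assms(1) by (simp add: val_def)
  have pI: "p \<in> I_all f" by (rule I01_all[OF p])
  interpret M: nil_sys Bs "V p" "Nop p" "Sop p" "kap p" "om p" "tr p" K by (rule nil_sys_V[OF p])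
  let ?N = "Nop p"
  have v: "M.valid m" using valid_iff[OF p] assms(1) by simp
  have C: "iso_form \<sigma> C" using assms(2) formB iso_form_uminus by blast
  have orthC: "C u w = 0" if "1 \<le> i" "1 \<le> j" "i \<noteq> j" "u \<in> W (p, i)" "w \<in> W (p, j)" for i j u w
    using orthW[of "(p, i)" "(p, j)" u w] that assms(2) pI by auto
  have inv: "(?N ^^ k) u \<in> W (p, l)" if "1 \<le> l" "u \<in> W (p, l)" for k l u
    using M.Np_in[OF M.admD(1)[OF adm_W[OF p that(1)]] that(2)] .
  have sW: "subspace (ker_pow ?N m (W (p, l)))" if "1 \<le> l" for l
    by (rule subspace_ker_pow[OF M.linN subW[OF pI that]])
  define Ls where "Ls = {l. (p, l) \<in> supp}"
  have Ls: "finite Ls" "\<And>l. l \<in> Ls \<Longrightarrow> 1 \<le> l"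
  proof -
    have "Ls = snd ` (supp \<inter> {p} \<times> UNIV)" by (force simp: Ls_def)
    then show "finite Ls" using supp(1) by simp
    show "\<And>l. l \<in> Ls \<Longrightarrow> 1 \<le> l" using supp(2) by (auto simp: Ls_def)
  qed
  let ?U = "\<Union>l\<in>Ls. ker_pow ?N m (W (p, l))"
  have KV: "ker_pow ?N m (V p) = span ?U"
  proof
    have "ker_pow ?N m (W (p, l)) \<subseteq> ker_pow ?N m (V p)" if "l \<in> Ls" for l
      using W_V[OF pI Ls(2)[OF that]] by (auto simp: ker_pow_def)
    then show "span ?U \<subseteq> ker_pow ?N m (V p)"
      by (intro span_minimal subspace_ker_pow M.linN subV pI) blast
    show "ker_pow ?N m (V p) \<subseteq> span ?U"
    proof
      fix u assume "u \<in> ker_pow ?N m (V p)"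
      then have u: "u \<in> V p" "(?N ^^ m) u = 0" by (auto simp: ker_pow_def)
      obtain F x where F: "finite F" "F \<subseteq> {1..}" "\<And>l. l \<in> F \<Longrightarrow> x l \<in> W (p, l)" "u = (\<Sum>l\<in>F. x l)"
        using u(1) subW[OF pI] unfolding V_span[OF pI] by (elim span_UN_E) auto
      have F1: "1 \<le> l" if "l \<in> F" for l using F(2) that by auto
      have "(\<Sum>l\<in>F. (?N ^^ m) (x l)) = 0" using u(2) unfolding F(4) by (simp add: linear_sum[OF M.linNp])
      then have s0: "(\<Sum>j\<in>Pair p ` F. (\<lambda>j. (?N ^^ m) (x (snd j))) j) = 0"
        by (subst sum.reindex) (auto simp: inj_on_def)
      have "(?N ^^ m) (x l) = 0" if "l \<in> F" for l
      proof -
        have "Pair p ` F \<subseteq> I_all f \<times> {1..}" using F(2) pI by auto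
        moreover have "(?N ^^ m) (x (snd j)) \<in> W j" if "j \<in> Pair p ` F" for j using that inv[OF F1 F(3)] by auto
        ultimately show ?thesis
          using W_direct[of "Pair p ` F" "\<lambda>j. (?N ^^ m) (x (snd j))" "(p, l)"] F(1) s0 that by simp
      qed
      then have k: "x l \<in> ker_pow ?N m (W (p, l))" if "l \<in> F" for l using F(3) that by (simp add: ker_pow_def)
      have "x l \<in> span ?U" if "l \<in> F" for l
      proof (cases "l \<in> Ls")
        case True
        then show ?thesis using k[OF that] by (intro span_base) blast
      next
        case False
        then have "W (p, l) = {0}" using supp(4)[OF pI F1[OF that]] by (simp add: Ls_def)
        then have "x l = 0" using F(3)[OF that] by simp
        then show ?thesis by (simp add: span_zero)
      qed
      then show "u \<in> span ?U" unfolding F(4) by (rule span_sum)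
    qed
  qed
  have "idx C p m = (\<Sum>l\<in>Ls. pos_index (bet ?N C m) (ker_pow ?N m (W (p, l))))"
    unfolding idx_def KV
  proof (rule pos_index_family[OF Ls(1)])
    show "symf (span ?U) (bet ?N C m)" using M.symf_bet_ker[OF adm_V[OF p C] v] unfolding KV .
    fix i j x y assume ij: "i \<in> Ls" "j \<in> Ls" "i \<noteq> j" "x \<in> ker_pow ?N m (W (p, i))" "y \<in> ker_pow ?N m (W (p, j))"
    then have "x \<in> W (p, i)" "y \<in> W (p, j)" by (auto simp: ker_pow_def)
    then show "bet ?N C m x y = 0" unfolding bet_def
      using ij(1-3) by (intro orthC[of i j] inv Ls(2))
  qed (use sW Ls(2) in blast)
  also have "\<dots> = (\<Sum>l\<in>Ls. if l = m then pos_index (bet ?N C m) (ker_pow ?N m (W (p, m))) else 0)"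
  proof (rule sum.cong)
    fix l assume "l \<in> Ls"
    then show "pos_index (bet ?N C m) (ker_pow ?N m (W (p, l))) = (if l = m then pos_index (bet ?N C m) (ker_pow ?N m (W (p, m))) else 0)"
      using W_rank[OF assms(1) Ls(2), of l] assms(2) by (auto simp: bet_uminus)
  qed simp
  also have "\<dots> = pos_index (bet ?N C m) (ker_pow ?N m (W (p, m)))"
  proof (cases "m \<in> Ls")
    case False
    then have W0: "W (p, m) = {0}" using supp(4)[OF pI m1] by (simp add: Ls_def)
    have "(?N ^^ m) 0 = 0" by (rule linear_0[OF M.linNp])
    then have "{u\<in>{0}. (?N ^^ m) u = 0} = {0}" by blast
    then have "ker_pow ?N m (W (p, m)) = {0}" unfolding ker_pow_def W0 .
    then have "pos_index (bet ?N C m) (ker_pow ?N m (W (p, m))) = 0"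
      by (simp only: pos_index_zero[OF bilinear_bet[OF iso_formD(1)[OF C] M.linN]])
    then show ?thesis using False Ls(1) by simp
  next
    case True
    then show ?thesis using Ls(1) by simp
  qed
  finally show ?thesis .
qed

lemma idx_rank:
  assumes "val p m" "iso_form \<sigma> C"
  shows "idx C p m + nidx C p m = Polynomial.degree p * eps \<sigma> W (p, m)"
proof -
  have "1 \<le> m" using assms(1) by (simp add: val_def)
  then have "idx B p m + nidx B p m = Polynomial.degree p * eps \<sigma> W (p, m)"
    using idx_W_aux[OF assms(1), of B] idx_W_aux[OF assms(1), of "\<lambda>u v. - B u v"] W_rank[OF assms(1), of m]
    by (simp add: bet_uminus)
  then show ?thesis using rank_independent[OF assms formB] by simp
qed

text \<open>In the signature formula for this summand only the exponent \<open>l\<close> survives,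
  by \<open>W_rank\<close>; \<open>K_ge\<close> places it inside the range of summation.\<close>

lemma sgn_W:
  assumes "val p l" "odd l" "W (p, l) \<noteq> {0}"
  shows "sgn_index B (W (p, l)) = int (idx B p l) - int (nidx B p l)"
proof -
  have p: "p \<in> I01" and l1: "1 \<le> l" using assms(1) by (auto simp: val_def)
  interpret M: nil_sys Bs "V p" "Nop p" "Sop p" "kap p" "om p" "tr p" K by (rule nil_sys_V[OF p])
  obtain k0 where k0: "l = 2 * k0 + 1" using assms(2) by (auto elim: oddE)
  have "k0 < K" using K_ge[OF I01_all[OF p] l1 assms(3)] k0 by simp
  let ?s = "\<lambda>k. sgn_index (bet (Nop p) B (2*k+1)) (ker_pow (Nop p) (2*k+1) (W (p, l)))"
  have "sgn_index B (W (p, l)) = (\<Sum>k<K. ?s k)" by (rule M.sgn_formula[OF adm_W[OF p l1]])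
  also have "\<dots> = (\<Sum>k<K. if k = k0 then ?s k0 else 0)"
  proof (rule sum.cong)
    fix k
    have "val p (2*k+1)" using p by (simp add: val_def)
    then show "?s k = (if k = k0 then ?s k0 else 0)"
      using W_rank[of p "2*k+1" l] l1 k0 by (auto simp: sgn_index_def)
  qed simp
  also have "\<dots> = ?s k0" using \<open>k0 < K\<close> by simp
  also have "\<dots> = int (idx B p l) - int (nidx B p l)"
    using idx_W_aux[OF assms(1), of B] idx_W_aux[OF assms(1), of "\<lambda>u v. - B u v"] k0
    by (simp add: sgn_index_def bet_uminus)
  finally show ?thesis .
qed

text \<open>With rank zero p(\<sigma>) would be surjective on \<open>W (p, l)\<close>, where it is
  nilpotent.\<close>

lemma eps_zero: "p \<in> I01 \<Longrightarrow> 1 \<le> l \<Longrightarrow> eps \<sigma> W (p, l) = 0 \<longleftrightarrow> W (p, l) = {0}"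
proof -
  assume p: "p \<in> I01" and l: "1 \<le> l"
  have pI: "p \<in> I_all f" by (rule I01_all[OF p])
  let ?A = "W (p, l)" and ?P = "poly_act \<sigma> p"
  have A: "subspace ?A" "\<sigma> ` ?A \<subseteq> ?A" using subW[OF pI l] invW[of "(p, l)"] pI l by auto
  have lP: "linear ?P" by (rule poly_act_linear[OF lin])
  note d = eps_dim[OF pI l kap(5)[OF p] kap(4)[OF p]]
  show "eps \<sigma> W (p, l) = 0 \<longleftrightarrow> ?A = {0}"
  proof
    assume "?A = {0}"
    then show "eps \<sigma> W (p, l) = 0" using d kap(4)[OF p] by (simp add: linear_0[OF lP])
  next
    assume "eps \<sigma> W (p, l) = 0"
    then have e: "dim ?A \<le> dim (?P ` ?A)" using d by simp
    have "?P ` ?A \<subseteq> ?A"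
    proof
      fix x assume "x \<in> ?P ` ?A"
      then obtain y where y: "y \<in> ?A" "x = ?P y" by blast
      show "x \<in> ?A" unfolding y(2) by (rule poly_act_in[OF A(1) _ y(1)]) (use A(2) in blast)
    qed
    then have PA: "?P ` ?A = ?A"
      using fd.subspace_dim_equal[OF linear_subspace_image[OF lP A(1)] A(1) _ e] by blast
    have "(?P ^^ k) ` ?A = ?A" for k
    proof (induction k)
      case (Suc k)
      have "(?P ^^ Suc k) ` ?A = ?P ` (?P ^^ k) ` ?A" by (simp add: image_comp)
      then show ?case using Suc PA by simp
    qed simp
    from this[of l] have "?A \<subseteq> {0}" using pow_W[OF pI l] by auto
    then show "?A = {0}" using subspace_0[OF A(1)] by auto
  qed
qed

lemma val_supp: "val p m \<Longrightarrow> (p, m) \<notin> supp \<Longrightarrow> eps \<sigma> W (p, m) = 0"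
  using eps_zero[of p m] supp(4)[of p m] I01_all[of p] by (auto simp: val_def)

text \<open>Any invariant form is changed one index at a time towards the target, and the total
  distance over the finite set \<open>F\<close> decreases. Outside \<open>F\<close> the rank is
  zero, so index and target agree already.\<close>

theorem realization:
  assumes "\<And>p m. val p m \<Longrightarrow> Polynomial.degree p dvd T p m \<and> T p m \<le> Polynomial.degree p * eps \<sigma> W (p, m)"
    and "iso_form \<sigma> C"
  shows "\<exists>C'. iso_form \<sigma> C' \<and> (\<forall>p m. val p m \<longrightarrow> idx C' p m = T p m)"
proof -
  define F where "F = {(p, m). (p, m) \<in> supp \<and> val p m}"
  have fF: "finite F" using supp(1) by (rule finite_subset[rotated]) (auto simp: F_def)
  define df where "df C j = nat \<bar>int (idx C (fst j) (snd j)) - int (T (fst j) (snd j))\<bar>" for C j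
  show ?thesis using assms(2)
  proof (induction "\<Sum>j\<in>F. df C j" arbitrary: C rule: less_induct)
    case less
    show ?case
    proof (cases "\<forall>p m. val p m \<longrightarrow> idx C p m = T p m")
      case True
      then show ?thesis using less.prems by blast
    next
      case False
      then obtain p m where pm: "val p m" "idx C p m \<noteq> T p m" by blast
      let ?d = "Polynomial.degree p"
      have rk: "idx C p m + nidx C p m = ?d * eps \<sigma> W (p, m)" by (rule idx_rank[OF pm(1) less.prems])
      have F: "(p, m) \<in> F"
      proof (rule ccontr)
        assume "(p, m) \<notin> F"
        then have "eps \<sigma> W (p, m) = 0" using val_supp pm(1) by (auto simp: F_def)
        then show False using rk assms(1)[OF pm(1)] pm(2) by simp
      qed
      have d0: "?d > 0" using kap(4) pm(1) by (simp add: val_def)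
      \<comment> \<open>Index and target are multiples of the step width, so a step towards the
        target cannot overshoot.\<close>
      have dv: "?d dvd idx C p m" "?d dvd T p m" using idx_dvd[OF pm(1) less.prems] assms(1)[OF pm(1)] by auto
      obtain a where a: "idx C p m = ?d * a" using dv(1) by blast
      obtain b where b: "T p m = ?d * b" using dv(2) by blast
      have "\<exists>C'. iso_form \<sigma> C' \<and> df C' (p, m) < df C (p, m) \<and>
        (\<forall>q l. val q l \<longrightarrow> (q, l) \<noteq> (p, m) \<longrightarrow> idx C' q l = idx C q l)"
      proof (cases "idx C p m > T p m")
        case True
        then have "b < a" using a b d0 by simp
        then obtain k where "a = Suc (b + k)" using less_imp_Suc_add by blast
        then have ge: "idx C p m \<ge> T p m + ?d" using a b by (simp add: algebra_simps)
        obtain C' where C': "iso_form \<sigma> C'" "idx C' p m + ?d = idx C p m"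
          "\<forall>q l. val q l \<longrightarrow> (q, l) \<noteq> (p, m) \<longrightarrow> idx C' q l = idx C q l"
          using flip[OF pm(1) less.prems] True by auto
        have "df C' (p, m) < df C (p, m)" using C'(2) ge d0 by (simp add: df_def)
        then show ?thesis using C' by blast
      next
        case lt: False
        then have "idx C p m < T p m" using pm(2) by simp
        then have "a < b" using a b by simp
        then obtain k where "b = Suc (a + k)" using less_imp_Suc_add by blast
        then have ge: "T p m \<ge> idx C p m + ?d" using a b by (simp add: algebra_simps)
        then have "0 < nidx C p m" using rk assms(1)[OF pm(1)] d0 by linarith
        then obtain C' where C': "iso_form \<sigma> C'" "idx C' p m = idx C p m + ?d"
          "\<forall>q l. val q l \<longrightarrow> (q, l) \<noteq> (p, m) \<longrightarrow> idx C' q l = idx C q l"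
          using flip_up[OF pm(1) less.prems] by blast
        have "df C' (p, m) < df C (p, m)" using C'(2) ge d0 by (simp add: df_def)
        then show ?thesis using C' by blast
      qed
      then obtain C' where C': "iso_form \<sigma> C'" "df C' (p, m) < df C (p, m)"
        "\<And>q l. val q l \<Longrightarrow> (q, l) \<noteq> (p, m) \<Longrightarrow> idx C' q l = idx C q l" by blast
      have "(\<Sum>j\<in>F. df C' j) < (\<Sum>j\<in>F. df C j)"
      proof (rule sum_strict_mono_ex1[OF fF])
        show "\<forall>j\<in>F. df C' j \<le> df C j"
        proof
          fix j assume "j \<in> F"
          then show "df C' j \<le> df C j"
            using C'(2) C'(3)[of "fst j" "snd j"] by (cases "j = (p, m)") (auto simp: df_def F_def)
        qed
        show "\<exists>j\<in>F. df C' j < df C j" using F C'(2) by blast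
      qed
      then show ?thesis using less.hyps C'(1) by blast
    qed
  qed
qed

end

section \<open>Conjugacy and counting solutions\<close>

text \<open>For nondegenerate forms dimension and signature fix both indices, so orthogonal bases
  can be matched sign by sign and rescaled.\<close>

lemma (in fin_dim) sylvester:
  fixes B C :: "'v \<Rightarrow> 'v \<Rightarrow> real"
  assumes "symf UNIV B" "symf UNIV C" "nondeg_on UNIV B" "nondeg_on UNIV C"
    and "sgn_index C UNIV = sgn_index B UNIV"
  shows "\<exists>g. linear g \<and> bij g \<and> (\<forall>u v. C u v = B (g u) (g v))"
proof -
  have bB: "bilinear B" and bC: "bilinear C" using assms(1,2) by (auto simp: symf_def)
  have rk: "pos_index c UNIV + neg_index c UNIV = dim (UNIV :: 'v set)" if "symf UNIV c" "nondeg_on UNIV c" for c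
  proof -
    have "{u \<in> UNIV. \<forall>v\<in>UNIV. c u v = 0} = {0}" using that by (auto simp: nondeg_on_def symf_def bilin)
    then show ?thesis using index_rank[OF that(1) subspace_UNIV] by simp
  qed
  have eq: "pos_index C UNIV = pos_index B UNIV" "neg_index C UNIV = neg_index B UNIV"
    using rk[OF assms(1,3)] rk[OF assms(2,4)] assms(5) by (auto simp: sgn_index_def)
  obtain b where b: "finite b" "independent b" "span b = UNIV" "pairwise (\<lambda>u v. B u v = 0) b" "\<And>v. v \<in> b \<Longrightarrow> B v v \<noteq> 0"
    using orth_basis_nonzero[OF assms(1) subspace_UNIV assms(3)] by blast
  obtain d where d: "finite d" "independent d" "span d = UNIV" "pairwise (\<lambda>u v. C u v = 0) d" "\<And>v. v \<in> d \<Longrightarrow> C v v \<noteq> 0"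
    using orth_basis_nonzero[OF assms(2) subspace_UNIV assms(4)] by blast
  have "card {v\<in>d. 0 < C v v} = card {v\<in>b. 0 < B v v}"
    using pos_index_orth[of d C] pos_index_orth[of b B] b d assms(1,2) eq by simp
  then obtain \<phi> where \<phi>: "bij_betw \<phi> {v\<in>d. 0 < C v v} {v\<in>b. 0 < B v v}"
    using finite_same_card_bij[of "{v\<in>d. 0 < C v v}" "{v\<in>b. 0 < B v v}"] b(1) d(1) by auto
  have "card {v\<in>d. C v v < 0} = card {v\<in>b. B v v < 0}"
    using neg_index_orth[of d C] neg_index_orth[of b B] b d assms(1,2) eq by simp
  then obtain \<psi> where \<psi>: "bij_betw \<psi> {v\<in>d. C v v < 0} {v\<in>b. B v v < 0}"
    using finite_same_card_bij[of "{v\<in>d. C v v < 0}" "{v\<in>b. B v v < 0}"] b(1) d(1) by auto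
  \<comment> \<open>Positive vectors go to positive ones and negative to negative, so the quotients
    under the square root in \<open>g0\<close> are positive.\<close>
  define \<chi> where "\<chi> v = (if 0 < C v v then \<phi> v else \<psi> v)" for v
  have \<chi>: "\<chi> v \<in> b \<and> C v v / B (\<chi> v) (\<chi> v) > 0" if "v \<in> d" for v
  proof (cases "0 < C v v")
    case True
    then have "\<phi> v \<in> {v\<in>b. 0 < B v v}" using \<phi> that by (auto simp: bij_betw_def)
    then show ?thesis using True by (simp add: \<chi>_def)
  next
    case False
    then have "C v v < 0" using d(5)[OF that] by simp
    moreover from this have "\<psi> v \<in> {v\<in>b. B v v < 0}" using \<psi> that by (auto simp: bij_betw_def)
    ultimately show ?thesis using False by (simp add: \<chi>_def divide_neg_neg)
  qed
  have inj: "\<chi> v \<noteq> \<chi> w" if "v \<in> d" "w \<in> d" "v \<noteq> w" for v w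
  proof
    assume e: "\<chi> v = \<chi> w"
    have s: "0 < C v v \<longleftrightarrow> 0 < C w w" using \<chi>[OF that(1)] \<chi>[OF that(2)] e by (auto simp: zero_less_divide_iff)
    show False
    proof (cases "0 < C v v")
      case True
      then show False using \<phi> s that e unfolding bij_betw_def inj_on_def by (auto simp: \<chi>_def)
    next
      case False
      then have "C v v < 0" "C w w < 0" using s d(5) that by (auto simp: not_less less_le)
      then show False using \<psi> that e False s unfolding bij_betw_def inj_on_def by (auto simp: \<chi>_def)
    qed
  qed
  define g0 where "g0 v = sqrt (C v v / B (\<chi> v) (\<chi> v)) *\<^sub>R \<chi> v" for v
  obtain g where g: "linear g" "\<forall>v\<in>d. g v = g0 v" using linear_independent_extend[OF d(2)] by blast
  have base: "C v w = B (g v) (g w)" if "v \<in> d" "w \<in> d" for v w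
  proof (cases "v = w")
    case True
    define q where "q = C v v / B (\<chi> v) (\<chi> v)"
    have q: "q > 0" "B (\<chi> v) (\<chi> v) \<noteq> 0" using \<chi>[OF that(1)] b(5) by (auto simp: q_def)
    have gv: "g v = sqrt q *\<^sub>R \<chi> v" using g(2) that(1) by (simp add: g0_def q_def)
    have "B (g v) (g v) = (sqrt q * sqrt q) * B (\<chi> v) (\<chi> v)" by (simp only: gv bilin[OF bB] real_scaleR_def mult.assoc)
    also have "sqrt q * sqrt q = q" using q(1) by simp
    also have "q * B (\<chi> v) (\<chi> v) = C v v" using q(2) by (simp add: q_def)
    finally show ?thesis using True by simp
  next
    case False
    have "C v w = 0" using d(4) that False by (auto simp: pairwise_def)
    moreover have "B (\<chi> v) (\<chi> w) = 0" using b(4) \<chi>[OF that(1)] \<chi>[OF that(2)] inj[OF that False] by (auto simp: pairwise_def)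
    ultimately show ?thesis using g(2) that by (simp add: g0_def bilin[OF bB])
  qed
  have all: "C u v = B (g u) (g v)" for u v
    by (rule bilinear_eq[OF bC bilinear_compose2[OF bB g(1) g(1)], of UNIV d UNIV d]) (use d(3) base in auto)
  have "u = 0" if "g u = 0" for u
    using all[of u] that assms(4) by (auto simp: nondeg_on_def bilin[OF bB])
  then have "inj g \<and> g ` UNIV = UNIV" using inj_on_image_eq[OF g(1) subspace_UNIV] by auto
  then show ?thesis using g(1) all by (auto simp: bij_def)
qed

context orth_isom_sys begin

lemma bB: "bilinear B" using formB by (rule iso_formD(1))

lemma nondeg_UNIV: "iso_form \<sigma> C \<Longrightarrow> nondeg_on UNIV C"
  by (auto simp: iso_form_def nondeg_on_def)

text \<open>Writing \<open>\<tau> = g \<sigma> g\<inverse>\<close>, the pair \<open>(B, \<tau>)\<close> is transported by \<open>g\<close> to another \<open>\<sigma>\<close>-invariant form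
  on the same space; so one fixes \<open>\<sigma>\<close> and varies the form.\<close>

lemma conjugacy_iff:
  "(\<forall>\<tau>\<in>orth_group B. conjugate_in GL \<sigma> \<tau> \<longrightarrow> conjugate_in (orth_group B) \<sigma> \<tau>) \<longleftrightarrow>
   (\<forall>C. iso_form \<sigma> C \<longrightarrow> sgn_index C UNIV = sgn_index B UNIV \<longrightarrow> (\<forall>p m. val p m \<longrightarrow> idx C p m = idx B p m))"
  (is "?L \<longleftrightarrow> ?R")
proof
  assume L: ?L
  show ?R
  proof (intro allI impI)
    fix C p m assume C: "iso_form \<sigma> C" "sgn_index C UNIV = sgn_index B UNIV" and v: "val p m"
    obtain g where g: "linear g" "bij g" "\<And>u v. C u v = B (g u) (g v)"
      using sylvester[OF iso_formD(5)[OF formB] iso_formD(5)[OF C(1)] nondeg_UNIV[OF formB] nondeg_UNIV[OF C(1)] C(2)] by blast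
    let ?gi = "inv_into UNIV g"
    note gi = bij_inv_simps[OF g(2)]
    define \<tau> where "\<tau> = g \<circ> \<sigma> \<circ> ?gi"
    have "linear \<tau>" unfolding \<tau>_def by (intro linear_compose linear_inv_bij g lin)
    moreover have "bij \<tau>" unfolding \<tau>_def by (intro bij_comp g bij bij_imp_bij_inv)
    moreover have "B (\<tau> u) (\<tau> v) = B u v" for u v
    proof -
      have "B (\<tau> u) (\<tau> v) = C (\<sigma> (?gi u)) (\<sigma> (?gi v))" by (simp add: \<tau>_def g(3))
      also have "\<dots> = C (?gi u) (?gi v)" by (rule iso_formD(3)[OF C(1)])
      also have "\<dots> = B u v" by (simp add: g(3) gi)
      finally show ?thesis .
    qed
    ultimately have "\<tau> \<in> orth_group B" by (simp add: orth_group_def GL_def)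
    moreover have "conjugate_in GL \<sigma> \<tau>" unfolding conjugate_in_def GL_def \<tau>_def using g by blast
    ultimately have "conjugate_in (orth_group B) \<sigma> \<tau>" using L by blast
    then obtain k where k: "k \<in> orth_group B" "\<tau> = k \<circ> \<sigma> \<circ> inv_into UNIV k" by (auto simp: conjugate_in_def)
    have k': "linear k" "bij k" "\<And>u v. B (k u) (k v) = B u v" using k(1) by (auto simp: orth_group_def GL_def)
    let ?ki = "inv_into UNIV k"
    note ki = bij_inv_simps[OF k'(2)]
    \<comment> \<open>Both \<open>g\<close> and \<open>k\<close> conjugate \<open>\<sigma>\<close>
      into \<tau>, so \<open>h\<close> commutes with \<open>\<sigma>\<close>; as \<open>k\<close>
      preserves \<open>B\<close>, it also carries \<open>C\<close> to \<open>B\<close>.\<close>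
    define h where "h = ?ki \<circ> g"
    have "linear h" unfolding h_def by (intro linear_compose linear_inv_bij g k')
    moreover have "bij h" unfolding h_def by (intro bij_comp g k' bij_imp_bij_inv)
    moreover have "h (\<sigma> x) = \<sigma> (h x)" for x
    proof -
      have "\<tau> (g x) = g (\<sigma> x)" by (simp add: \<tau>_def gi)
      then have "g (\<sigma> x) = k (\<sigma> (?ki (g x)))" by (simp add: k(2))
      then show ?thesis by (simp add: h_def ki)
    qed
    moreover have "C u v = B (h u) (h v)" for u v
      using k'(3)[of "h u" "h v"] by (simp add: h_def ki g(3))
    ultimately show "idx C p m = idx B p m" using idx_map[OF v formB C(1)] by blast
  qed
next
  assume R: ?R
  show ?L
  proof (intro ballI impI)
    fix \<tau> assume \<tau>: "\<tau> \<in> orth_group B" "conjugate_in GL \<sigma> \<tau>"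
    then obtain g where g: "linear g" "bij g" "\<tau> = g \<circ> \<sigma> \<circ> inv_into UNIV g" by (auto simp: conjugate_in_def GL_def)
    note gi = bij_inv_simps[OF g(2)]
    define C where "C u v = B (g u) (g v)" for u v
    have C: "iso_form \<sigma> C"
      unfolding iso_form_def
    proof (intro conjI allI impI)
      show "symf UNIV C" unfolding symf_def C_def using bilinear_compose2[OF bB g(1) g(1)] iso_formD(2)[OF formB] by blast
      show "u = 0" if "\<forall>v. C u v = 0" for u
      proof -
        have "B (g u) v = 0" for v using that[rule_format, of "inv_into UNIV g v"] by (simp add: C_def gi)
        then have "g u = 0" by (rule iso_formD(4)[OF formB])
        then have "g u = g 0" using linear_0[OF g(1)] by simp
        then show ?thesis using g(2) by (simp add: bij_def inj_eq)
      qed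
      show "C (\<sigma> u) (\<sigma> v) = C u v" for u v
      proof -
        have "B (\<tau> (g u)) (\<tau> (g v)) = B (g u) (g v)" using \<tau>(1) by (simp add: orth_group_def)
        then show ?thesis by (simp add: g(3) gi C_def)
      qed
    qed
    have "sgn_index B (g ` UNIV) = sgn_index C UNIV"
      unfolding C_def by (rule sgn_index_image[OF g(1) _ subspace_UNIV]) (rule iso_formD(5)[OF formB])
    then have "sgn_index C UNIV = sgn_index B UNIV" using g(2) by (simp add: bij_def)
    then have "idx C p m = idx B p m" if "val p m" for p m using R C that by blast
    then obtain h where h: "linear h" "bij h" "\<And>v. h (\<sigma> v) = \<sigma> (h v)" "\<And>u v. C u v = B (h u) (h v)"
      using idx_complete[OF C formB] by blast
    let ?hi = "inv_into UNIV h"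
    note hi = bij_inv_simps[OF h(2)]
    \<comment> \<open>Corrects \<open>g\<close> by an element of the centralizer of
      \<open>\<sigma>\<close>, which keeps the conjugate \<tau> and makes the map an isometry of
      \<open>B\<close>.\<close>
    define k where "k = g \<circ> ?hi"
    have k: "linear k" "bij k" unfolding k_def
      by (intro linear_compose linear_inv_bij g h, intro bij_comp g h bij_imp_bij_inv)
    note kk = bij_inv_simps[OF k(2)]
    have "B (k u) (k v) = B u v" for u v
    proof -
      have "B (k u) (k v) = C (?hi u) (?hi v)" by (simp add: k_def C_def)
      then show ?thesis by (simp add: h(4) hi)
    qed
    then have "k \<in> orth_group B" using k by (simp add: orth_group_def GL_def)
    moreover have "\<tau> = k \<circ> \<sigma> \<circ> inv_into UNIV k"
    proof
      fix x
      obtain y where x: "x = g y" using g(2) by (metis bij_pointE)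
      have "inv_into UNIV k x = h y"
        using kk(2)[of "h y"] by (simp add: k_def hi x)
      moreover have "k (\<sigma> (h y)) = g (\<sigma> y)" by (simp add: k_def hi flip: h(3))
      ultimately show "\<tau> x = (k \<circ> \<sigma> \<circ> inv_into UNIV k) x" by (simp add: g(3) x gi)
    qed
    ultimately show "conjugate_in (orth_group B) \<sigma> \<tau>" unfolding conjugate_in_def by blast
  qed
qed

section \<open>Odd indices, signatures and solutions of the equation\<close>

definition J0 :: "(real poly \<times> nat) set" where "J0 = odd_indices (I0 f) W"
definition J1 :: "(real poly \<times> nat) set" where "J1 = odd_indices (I1 f) W"
definition J1ev :: "(real poly \<times> nat) set" where "J1ev = even_indices (I1 f) W"

lemma J_props:
  "(p, l) \<in> J0 \<Longrightarrow> val p l \<and> odd l \<and> Polynomial.degree p = 1 \<and> W (p, l) \<noteq> {0}"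
  "(p, l) \<in> J1 \<Longrightarrow> val p l \<and> odd l \<and> Polynomial.degree p = 2 \<and> W (p, l) \<noteq> {0}"
  "(p, l) \<in> J1ev \<Longrightarrow> val p l \<and> even l \<and> Polynomial.degree p = 2 \<and> W (p, l) \<noteq> {0}"
  by (auto simp: J0_def J1_def J1ev_def odd_indices_def even_indices_def val_def I0_def I1_def)

lemma J_supp: "J0 \<subseteq> supp" "J1 \<subseteq> supp"
  using J_props(1,2) supp(4) I01_all unfolding val_def by (auto, metis, metis)

lemma J_finite: "finite J0" "finite J1"
  using J_supp supp(1) by (auto intro: finite_subset)

lemma J_disjoint: "J0 \<inter> J1 = {}"
  using J_props by fastforce

definition sg :: "('a \<Rightarrow> 'a \<Rightarrow> real) \<Rightarrow> real poly \<times> nat \<Rightarrow> int" where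
  "sg C = (\<lambda>(p, m). int (idx C p m) - int (nidx C p m))"

lemma val_cases:
  assumes "val p m" "odd m" "(p, m) \<notin> J0 \<union> J1"
  shows "W (p, m) = {0}"
  using assms by (auto simp: val_def J0_def J1_def odd_indices_def)

text \<open>One finite index set serves all invariant forms, as the summands outside it have rank
  zero. So prescribing the indices at odd exponents prescribes the signature of the whole
  form.\<close>

lemma sgn_UNIV:
  assumes "iso_form \<sigma> C"
  shows "sgn_index C UNIV = (\<Sum>j\<in>J0 \<union> J1. sg C j)"
proof -
  let ?P = "primes \<inter> I01"
  define S where "S = (\<lambda>(p, k). (p, 2*k+1)) ` (?P \<times> {..<K})"
  have fin: "finite ?P" "finite S" using primes(1) by (auto simp: S_def)
  have "sgn_index C UNIV = (\<Sum>p\<in>primes. sgn_index C (V p))" by (rule sgn_index_V[OF assms])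
  also have "\<dots> = (\<Sum>p\<in>?P. sgn_index C (V p))"
  proof (rule sum.mono_neutral_right[OF primes(1)])
    show "\<forall>p\<in>primes - primes \<inter> I01. sgn_index C (V p) = 0"
    proof
      fix p assume "p \<in> primes - primes \<inter> I01"
      then have "p \<in> I2 f" using primes(2) by (auto simp: I_all_def)
      then show "sgn_index C (V p) = 0" using I2_sgn assms by blast
    qed
  qed simp
  also have "\<dots> = (\<Sum>p\<in>?P. \<Sum>k<K. sg C (p, 2*k+1))"
    by (rule sum.cong) (use sgn_V[OF _ assms] in \<open>auto simp: sg_def\<close>)
  also have "\<dots> = (\<Sum>j\<in>S. sg C j)"
    unfolding S_def by (subst sum.reindex) (auto simp: inj_on_def sum.cartesian_product case_prod_beta)
  also have "\<dots> = (\<Sum>j\<in>J0 \<union> J1. sg C j)"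
  proof (rule sum.mono_neutral_right[OF fin(2)])
    show "J0 \<union> J1 \<subseteq> S"
    proof
      fix j assume j: "j \<in> J0 \<union> J1"
      obtain p l where pl: "j = (p, l)" by fastforce
      have v: "val p l" "odd l" "W (p, l) \<noteq> {0}" "(p, l) \<in> supp" using J_props[of p l] J_supp j pl by auto
      obtain k where k: "l = 2*k+1" using v(2) by (auto elim: oddE)
      have pI: "p \<in> I01" "1 \<le> l" using v(1) by (auto simp: val_def)
      have "k < K" using K_ge[OF I01_all[OF pI(1)] pI(2) v(3)] k by simp
      moreover have "p \<in> primes" using v(4) by (force simp: primes_def)
      ultimately show "j \<in> S" unfolding S_def pl k using pI(1) by (intro image_eqI[of _ _ "(p, k)"]) auto
    qed
    show "\<forall>j\<in>S - (J0 \<union> J1). sg C j = 0"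
    proof
      fix j assume j: "j \<in> S - (J0 \<union> J1)"
      then obtain p k where pk: "j = (p, 2*k+1)" "p \<in> I01" by (auto simp: S_def)
      have v: "val p (2*k+1)" using pk(2) by (simp add: val_def)
      then have "eps \<sigma> W (p, 2*k+1) = 0" using val_cases[OF v] j pk eps_zero[OF pk(2), of "2*k+1"] by simp
      then show "sg C j = 0" using idx_rank[OF v assms] pk(1) by (simp add: sg_def)
    qed
  qed
  finally show ?thesis .
qed

text \<open>With \<open>sgn_UNIV\<close> it identifies r - s with the signature of \<open>B\<close>
  on the whole space: the part outside the odd summands contributes zero.\<close>

lemma signature_odd:
  assumes "has_signature B (span (\<Union>j\<in>J0 \<union> J1. W j)) r s"
  shows "int r - int s = (\<Sum>j\<in>J0 \<union> J1. sg B j)"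
proof -
  obtain P N where PN: "finite P" "finite N" "P \<inter> N = {}" "span (P \<union> N) = span (\<Union>j\<in>J0 \<union> J1. W j)"
    "pairwise (\<lambda>u v. B u v = 0) (P \<union> N)" "\<forall>v\<in>P. B v v > 0" "\<forall>v\<in>N. B v v < 0" "card P = r" "card N = s"
    using assms by (auto simp: has_signature_def)
  have "{v \<in> P \<union> N. 0 < B v v} = P" "{v \<in> P \<union> N. B v v < 0} = N" using PN(6,7) by force+
  then have "sgn_index B (span (P \<union> N)) = int r - int s"
    using pos_index_orth[of "P \<union> N" B] neg_index_orth[of "P \<union> N" B] PN iso_formD(5)[OF formB] by (simp add: sgn_index_def)
  moreover have "sgn_index B (span (\<Union>j\<in>J0 \<union> J1. W j)) = (\<Sum>j\<in>J0 \<union> J1. sgn_index B (W j))"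
  proof (rule sgn_index_family)
    have J: "j \<in> I_all f \<times> {1..}" if "j \<in> J0 \<union> J1" for j using that J_supp supp(2) by blast
    show "subspace (W j)" if "j \<in> J0 \<union> J1" for j using J[OF that] subW[of "fst j" "snd j"] by (simp add: mem_Times_iff)
    show "B x y = 0" if "i \<in> J0 \<union> J1" "j \<in> J0 \<union> J1" "i \<noteq> j" "x \<in> W i" "y \<in> W j" for i j x y
      using orthW[OF J[OF that(1)] J[OF that(2)] that(3-5)] .
  qed (use J_finite iso_formD(5)[OF formB] in auto)
  moreover have "(\<Sum>j\<in>J0 \<union> J1. sgn_index B (W j)) = (\<Sum>j\<in>J0 \<union> J1. sg B j)"
  proof (rule sum.cong)
    fix j assume j: "j \<in> J0 \<union> J1"
    obtain p l where pl: "j = (p, l)" by fastforce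
    show "sgn_index B (W j) = sg B j" using sgn_W[of p l] J_props[of p l] j by (auto simp: pl sg_def)
  qed simp
  ultimately show ?thesis using PN(4) by simp
qed

text \<open>The equation in the form "sum of positive minus negative indices = r - s", where the
  positive index is w in degree one and 2 z in degree two. Extensional functions have fixed values
  off the index sets, so that uniqueness really counts solutions.\<close>

definition admissible :: "nat \<Rightarrow> nat \<Rightarrow> (real poly \<times> nat \<Rightarrow> int) \<times> (real poly \<times> nat \<Rightarrow> int) \<Rightarrow> bool" where
  "admissible r s wz \<longleftrightarrow> fst wz \<in> (\<Pi>\<^sub>E j\<in>J0. {0..int (eps \<sigma> W j)}) \<and> snd wz \<in> (\<Pi>\<^sub>E j\<in>J1. {0..int (eps \<sigma> W j)}) \<and>
     (\<Sum>j\<in>J0. 2 * fst wz j - int (eps \<sigma> W j)) + (\<Sum>j\<in>J1. 2 * (2 * snd wz j - int (eps \<sigma> W j))) = int r - int s"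

text \<open>Substitute s = n - r, halve, and solve for r.\<close>

lemma admissible_iff:
  assumes "n = r + s"
  shows "admissible r s wz \<longleftrightarrow> fst wz \<in> (\<Pi>\<^sub>E j\<in>J0. {0..int (eps \<sigma> W j)}) \<and> snd wz \<in> (\<Pi>\<^sub>E j\<in>J1. {0..int (eps \<sigma> W j)}) \<and>
      real n / 2 - real (\<Sum>j\<in>J0. eps \<sigma> W j) / 2 - real (\<Sum>j\<in>J1. eps \<sigma> W j)
         + real_of_int (\<Sum>j\<in>J0. fst wz j) + 2 * real_of_int (\<Sum>j\<in>J1. snd wz j) = real r"
proof -
  define a b c d where "a = (\<Sum>j\<in>J0. fst wz j)" "b = (\<Sum>j\<in>J1. snd wz j)" "c = (\<Sum>j\<in>J0. eps \<sigma> W j)" "d = (\<Sum>j\<in>J1. eps \<sigma> W j)"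
  have "(\<Sum>j\<in>J0. 2 * fst wz j - int (eps \<sigma> W j)) + (\<Sum>j\<in>J1. 2 * (2 * snd wz j - int (eps \<sigma> W j))) = 2 * a - int c + 2 * (2 * b - int d)"
    by (simp add: a_b_c_d_def sum_subtractf sum_distrib_left)
  moreover have "2 * a - int c + 2 * (2 * b - int d) = int r - int s \<longleftrightarrow>
    real_of_int (2 * a - int c + 2 * (2 * b - int d)) = real_of_int (int r - int s)" by (simp only: of_int_eq_iff)
  moreover have "\<dots> \<longleftrightarrow> real n / 2 - real c / 2 - real d + real_of_int a + 2 * real_of_int b = real r"
    using assms by (simp add: field_simps)
  ultimately show ?thesis unfolding admissible_def a_b_c_d_def by simp
qed

text \<open>The solution belonging to a form. In degree two the index is even by
  \<open>idx_dvd\<close>, so the division loses nothing.\<close>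

definition sol :: "('a \<Rightarrow> 'a \<Rightarrow> real) \<Rightarrow> (real poly \<times> nat \<Rightarrow> int) \<times> (real poly \<times> nat \<Rightarrow> int)" where
  "sol C = (restrict (\<lambda>(p, m). int (idx C p m)) J0, restrict (\<lambda>(p, m). int (idx C p m) div 2) J1)"

lemma sg_values:
  assumes "iso_form \<sigma> C"
  shows "(p, m) \<in> J0 \<Longrightarrow> sg C (p, m) = 2 * int (idx C p m) - int (eps \<sigma> W (p, m)) \<and> idx C p m \<le> eps \<sigma> W (p, m)"
    and "(p, m) \<in> J1 \<Longrightarrow> sg C (p, m) = 2 * (2 * (int (idx C p m) div 2) - int (eps \<sigma> W (p, m)))
       \<and> int (idx C p m) div 2 \<le> int (eps \<sigma> W (p, m)) \<and> int (idx C p m) = 2 * (int (idx C p m) div 2)"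
proof -
  assume "(p, m) \<in> J0"
  then show "sg C (p, m) = 2 * int (idx C p m) - int (eps \<sigma> W (p, m)) \<and> idx C p m \<le> eps \<sigma> W (p, m)"
    using J_props(1)[of p m] idx_rank[of p m, OF _ assms] by (auto simp: sg_def)
next
  assume "(p, m) \<in> J1"
  then have v: "val p m" "Polynomial.degree p = 2" using J_props(2)[of p m] by auto
  have "even (idx C p m)" using idx_dvd[OF v(1) assms] v(2) by simp
  then obtain a where a: "idx C p m = 2 * a" by blast
  show "sg C (p, m) = 2 * (2 * (int (idx C p m) div 2) - int (eps \<sigma> W (p, m)))
       \<and> int (idx C p m) div 2 \<le> int (eps \<sigma> W (p, m)) \<and> int (idx C p m) = 2 * (int (idx C p m) div 2)"
    using idx_rank[OF v(1) assms] v(2) a by (auto simp: sg_def)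
qed

lemma sol_admissible:
  assumes "iso_form \<sigma> C" "has_signature B (span (\<Union>j\<in>J0 \<union> J1. W j)) r s"
    and "sgn_index C UNIV = sgn_index B UNIV"
  shows "admissible r s (sol C)"
proof -
  have "(\<Sum>j\<in>J0 \<union> J1. sg C j) = int r - int s"
    using signature_odd[OF assms(2)] sgn_UNIV[OF assms(1)] sgn_UNIV[OF formB] assms(3) by simp
  then have "(\<Sum>j\<in>J0. sg C j) + (\<Sum>j\<in>J1. sg C j) = int r - int s"
    by (simp add: sum.union_disjoint[OF J_finite J_disjoint])
  moreover have "(\<Sum>j\<in>J0. sg C j) = (\<Sum>j\<in>J0. 2 * fst (sol C) j - int (eps \<sigma> W j))"
    by (rule sum.cong) (use sg_values(1)[OF assms(1)] in \<open>auto simp: sol_def\<close>)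
  moreover have "(\<Sum>j\<in>J1. sg C j) = (\<Sum>j\<in>J1. 2 * (2 * snd (sol C) j - int (eps \<sigma> W j)))"
    by (rule sum.cong) (use sg_values(2)[OF assms(1)] in \<open>auto simp: sol_def\<close>)
  moreover have "fst (sol C) \<in> (\<Pi>\<^sub>E j\<in>J0. {0..int (eps \<sigma> W j)})"
    using sg_values(1)[OF assms(1)] by (auto simp: sol_def)
  moreover have "snd (sol C) \<in> (\<Pi>\<^sub>E j\<in>J1. {0..int (eps \<sigma> W j)})"
    using sg_values(2)[OF assms(1)] by (auto simp: sol_def)
  ultimately show ?thesis unfolding admissible_def by simp
qed

lemma sol_realized:
  assumes "has_signature B (span (\<Union>j\<in>J0 \<union> J1. W j)) r s" "admissible r s wz"
  shows "\<exists>C. iso_form \<sigma> C \<and> sgn_index C UNIV = sgn_index B UNIV \<and> sol C = wz"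
proof -
  have b0: "0 \<le> fst wz j \<and> fst wz j \<le> int (eps \<sigma> W j)" if "j \<in> J0" for j
    using assms(2) that by (auto simp: admissible_def PiE_iff)
  have b1: "0 \<le> snd wz j \<and> snd wz j \<le> int (eps \<sigma> W j)" if "j \<in> J1" for j
    using assms(2) that by (auto simp: admissible_def PiE_iff)
  \<comment> \<open>Indices outside the equation, at even exponents in degree two or of rank zero,
    keep their values for \<open>B\<close>.\<close>
  define T where "T p m = (if (p, m) \<in> J0 then nat (fst wz (p, m)) else if (p, m) \<in> J1 then 2 * nat (snd wz (p, m)) else idx B p m)" for p m
  have "Polynomial.degree p dvd T p m \<and> T p m \<le> Polynomial.degree p * eps \<sigma> W (p, m)" if v: "val p m" for p m
  proof -
    consider "(p, m) \<in> J0" | "(p, m) \<in> J1" "(p, m) \<notin> J0" | "(p, m) \<notin> J0" "(p, m) \<notin> J1" by blast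
    then show ?thesis
    proof cases
      case 1
      then show ?thesis using J_props(1)[of p m] b0[of "(p, m)"] by (auto simp: T_def)
    next
      case 2
      then show ?thesis using J_props(2)[of p m] b1[of "(p, m)"] by (auto simp: T_def)
    next
      case 3
      then show ?thesis using idx_dvd[OF v formB] idx_rank[OF v formB] by (auto simp: T_def)
    qed
  qed
  then obtain C where C: "iso_form \<sigma> C" "\<And>p m. val p m \<Longrightarrow> idx C p m = T p m"
    using realization[of T B] formB by blast
  have c0: "int (idx C p m) = fst wz (p, m)" if "(p, m) \<in> J0" for p m
    using C(2)[of p m] J_props(1)[OF that] b0[OF that] that by (simp add: T_def)
  have c1: "int (idx C p m) = 2 * snd wz (p, m)" if "(p, m) \<in> J1" for p m
    using C(2)[of p m] J_props(2)[OF that] b1[OF that] that J_disjoint by (auto simp: T_def)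
  have s0: "fst (sol C) = fst wz"
  proof
    fix j :: "real poly \<times> nat"
    obtain p m where j: "j = (p, m)" by (cases j)
    show "fst (sol C) j = fst wz j"
    proof (cases "(p, m) \<in> J0")
      case True
      then show ?thesis using c0[OF True] by (simp add: sol_def j)
    next
      case False
      then show ?thesis using assms(2) by (simp add: sol_def j admissible_def PiE_iff extensional_def)
    qed
  qed
  have s1: "snd (sol C) = snd wz"
  proof
    fix j :: "real poly \<times> nat"
    obtain p m where j: "j = (p, m)" by (cases j)
    show "snd (sol C) j = snd wz j"
    proof (cases "(p, m) \<in> J1")
      case True
      then show ?thesis using c1[OF True] by (simp add: sol_def j)
    next
      case False
      then show ?thesis using assms(2) by (simp add: sol_def j admissible_def PiE_iff extensional_def)
    qed
  qed
  have "(\<Sum>j\<in>J0. sg C j) = (\<Sum>j\<in>J0. 2 * fst wz j - int (eps \<sigma> W j))"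
    by (rule sum.cong) (use sg_values(1)[OF C(1)] c0 in auto)
  moreover have "(\<Sum>j\<in>J1. sg C j) = (\<Sum>j\<in>J1. 2 * (2 * snd wz j - int (eps \<sigma> W j)))"
    by (rule sum.cong) (use sg_values(2)[OF C(1)] c1 in auto)
  moreover have "(\<Sum>j\<in>J0 \<union> J1. sg C j) = (\<Sum>j\<in>J0. sg C j) + (\<Sum>j\<in>J1. sg C j)"
    by (rule sum.union_disjoint[OF J_finite J_disjoint])
  ultimately have "(\<Sum>j\<in>J0 \<union> J1. sg C j) = int r - int s" using assms(2) by (simp add: admissible_def)
  then have "sgn_index C UNIV = sgn_index B UNIV"
    using signature_odd[OF assms(1)] sgn_UNIV[OF C(1)] sgn_UNIV[OF formB] by simp
  then show ?thesis using C(1) s0 s1 by (intro exI[of _ C]) (simp add: prod_eq_iff)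
qed

text \<open>By \<open>conjugacy_iff\<close> the claim is that the signature determines all indices.
  The odd ones compatible with it correspond to the solutions of the equation, while an even one in
  degree two can move without changing the signature.\<close>

theorem rigidity_iff:
  assumes sig: "has_signature B (span (\<Union>j\<in>J0 \<union> J1. W j)) r s"
  shows "(\<forall>\<tau>\<in>orth_group B. conjugate_in GL \<sigma> \<tau> \<longrightarrow> conjugate_in (orth_group B) \<sigma> \<tau>) \<longleftrightarrow>
    J1ev = {} \<and> (\<exists>!wz. admissible r s wz)"
  unfolding conjugacy_iff
proof
  assume L: "\<forall>C. iso_form \<sigma> C \<longrightarrow> sgn_index C UNIV = sgn_index B UNIV \<longrightarrow> (\<forall>p m. val p m \<longrightarrow> idx C p m = idx B p m)"
  have "False" if "(p, m) \<in> J1ev" for p m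
  proof -
    have v: "val p m" "even m" "Polynomial.degree p = 2" "W (p, m) \<noteq> {0}" using J_props(3)[OF that] by auto
    have "eps \<sigma> W (p, m) \<noteq> 0" using eps_zero[of p m] v by (auto simp: val_def)
    then have pos: "0 < idx B p m \<or> 0 < nidx B p m" using idx_rank[OF v(1) formB] v(3) by auto
    \<comment> \<open>The rank is nonzero, so one of the two indices at this even exponent is
      positive and can be lowered in favour of the other.\<close>
    have "\<exists>C. iso_form \<sigma> C \<and> idx C p m \<noteq> idx B p m \<and> (\<forall>q l. val q l \<longrightarrow> (q, l) \<noteq> (p, m) \<longrightarrow> idx C q l = idx B q l)"
      using pos
    proof
      assume "0 < idx B p m"
      then obtain C where "iso_form \<sigma> C" "idx C p m + Polynomial.degree p = idx B p m"
        "\<forall>q l. val q l \<longrightarrow> (q, l) \<noteq> (p, m) \<longrightarrow> idx C q l = idx B q l" using flip[OF v(1) formB] by blast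
      then show ?thesis using v(3) by (intro exI[of _ C]) simp
    next
      assume "0 < nidx B p m"
      then obtain C where "iso_form \<sigma> C" "idx C p m = idx B p m + Polynomial.degree p"
        "\<forall>q l. val q l \<longrightarrow> (q, l) \<noteq> (p, m) \<longrightarrow> idx C q l = idx B q l" using flip_up[OF v(1) formB] by blast
      then show ?thesis using v(3) by (intro exI[of _ C]) simp
    qed
    then obtain C where C: "iso_form \<sigma> C" "idx C p m \<noteq> idx B p m"
      "\<And>q l. val q l \<Longrightarrow> (q, l) \<noteq> (p, m) \<Longrightarrow> idx C q l = idx B q l" by blast
    have "sgn_index C UNIV = sgn_index B UNIV"
      unfolding sgn_UNIV[OF C(1)] sgn_UNIV[OF formB]
    proof (rule sum.cong)
      fix j assume j: "j \<in> J0 \<union> J1"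
      obtain q l where ql: "j = (q, l)" by fastforce
      have vq: "val q l" "odd l" using J_props[of q l] j ql by auto
      then have "(q, l) \<noteq> (p, m)" using v(2) by auto
      then show "sg C j = sg B j" using C(3)[OF vq(1)] rank_independent[OF vq(1) C(1) formB] by (simp add: sg_def ql)
    qed simp
    then show False using L C v(1) by blast
  qed
  moreover have "\<exists>!wz. admissible r s wz"
  proof (rule ex1I[of _ "sol B"])
    show "admissible r s (sol B)" by (rule sol_admissible[OF formB sig refl])
    fix wz assume "admissible r s wz"
    then obtain C where C: "iso_form \<sigma> C" "sgn_index C UNIV = sgn_index B UNIV" "sol C = wz"
      using sol_realized[OF sig] by blast
    \<comment> \<open>The form realising a second solution has the signature of \<open>B\<close>,
      hence by assumption the same indices, hence the same solution.\<close>
    have "idx C p m = idx B p m" if "val p m" for p m using L C that by blast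
    then have "sol C = sol B" unfolding sol_def using J_props(1,2) by (auto simp: restrict_def fun_eq_iff)
    then show "wz = sol B" using C(3) by simp
  qed
  ultimately show "J1ev = {} \<and> (\<exists>!wz. admissible r s wz)" by auto
next
  assume R: "J1ev = {} \<and> (\<exists>!wz. admissible r s wz)"
  show "\<forall>C. iso_form \<sigma> C \<longrightarrow> sgn_index C UNIV = sgn_index B UNIV \<longrightarrow> (\<forall>p m. val p m \<longrightarrow> idx C p m = idx B p m)"
  proof (intro allI impI)
    fix C p m assume C: "iso_form \<sigma> C" "sgn_index C UNIV = sgn_index B UNIV" and v: "val p m"
    have "admissible r s (sol C)" "admissible r s (sol B)"
      using sol_admissible[OF C(1) sig C(2)] sol_admissible[OF formB sig refl] by auto
    then have "sol C = sol B" using R by blast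
    then have f: "fst (sol C) (p, m) = fst (sol B) (p, m)" "snd (sol C) (p, m) = snd (sol B) (p, m)" by simp_all
    show "idx C p m = idx B p m"
    proof (cases "W (p, m) = {0}")
      case True
      then have "eps \<sigma> W (p, m) = 0" using eps_zero[of p m] v by (auto simp: val_def)
      then show ?thesis using idx_rank[OF v C(1)] idx_rank[OF v formB] by simp
    next
      case False
      then consider "(p, m) \<in> J0" | "(p, m) \<in> J1" | "(p, m) \<in> J1ev"
        using v by (auto simp: val_def J0_def J1_def J1ev_def odd_indices_def even_indices_def)
      then show ?thesis
      proof cases
        case 1
        then show ?thesis using f(1) by (simp add: sol_def)
      next
        case 2
        then have "int (idx C p m) div 2 = int (idx B p m) div 2" using f(2) by (simp add: sol_def)
        then show ?thesis using sg_values(2)[OF C(1) 2] sg_values(2)[OF formB 2] by linarith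
      next
        case 3
        then show ?thesis using R by simp
      qed
    qed
  qed
qed

end

theorem theorem2:
  fixes B :: "'v::real_vector \<Rightarrow> 'v \<Rightarrow> real"
    and \<sigma> :: "'v \<Rightarrow> 'v"
    and W :: "real poly \<times> nat \<Rightarrow> 'v set"
    and r s n :: nat
  defines "J0 \<equiv> odd_indices (I0 (charpoly \<sigma>)) W"
    and "J1 \<equiv> odd_indices (I1 (charpoly \<sigma>)) W"
    and "J1ev \<equiv> even_indices (I1 (charpoly \<sigma>)) W"
  assumes "quadratic_space B"
    and "\<sigma> \<in> orth_group B"
    and "orth_decomposition B \<sigma> W"
    and "has_signature B (span (\<Union>j\<in>J0 \<union> J1. W j)) r s"
    and "n = r + s"
  shows "(\<forall>\<tau>\<in>orth_group B. conjugate_in GL \<sigma> \<tau> \<longrightarrow> conjugate_in (orth_group B) \<sigma> \<tau>) \<longleftrightarrow>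
    J1ev = {} \<and>
    (\<exists>!wz :: (real poly \<times> nat \<Rightarrow> int) \<times> (real poly \<times> nat \<Rightarrow> int).
       fst wz \<in> (\<Pi>\<^sub>E j\<in>J0. {0..int (eps \<sigma> W j)}) \<and>
       snd wz \<in> (\<Pi>\<^sub>E j\<in>J1. {0..int (eps \<sigma> W j)}) \<and>
       real n / 2 - real (\<Sum>j\<in>J0. eps \<sigma> W j) / 2 - real (\<Sum>j\<in>J1. eps \<sigma> W j)
         + real_of_int (\<Sum>j\<in>J0. fst wz j) + 2 * real_of_int (\<Sum>j\<in>J1. snd wz j) = real r)"
proof -
  note J_defs = J0_def J1_def J1ev_def
  have sig: "has_signature B (span (\<Union>j\<in>J0 \<union> J1. W j)) r s" and n: "n = r + s" by fact+
  have q: "\<exists>A::'v set. finite A \<and> span A = UNIV" "bilinear B" "\<And>u v. B u v = B v u" "\<And>u. (\<forall>v. B u v = 0) \<Longrightarrow> u = 0"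
    using \<open>quadratic_space B\<close> by (auto simp: quadratic_space_def)
  obtain A :: "'v set" where A: "finite A" "span A = UNIV" using q(1) by blast
  \<comment> \<open>The hypothesis gives a finite spanning set; the locales are built on a
    basis.\<close>
  obtain Bs where Bs: "Bs \<subseteq> A" "independent Bs" "A \<subseteq> span Bs" using maximal_independent_subset[of A] by blast
  have fin: "finite Bs" using Bs(1) A(1) by (rule finite_subset)
  have sp: "span Bs = UNIV" using span_minimal[OF Bs(3) subspace_span] A(2) by auto
  have s: "linear \<sigma>" "bij \<sigma>" "\<And>u v. B (\<sigma> u) (\<sigma> v) = B u v"
    using \<open>\<sigma> \<in> orth_group B\<close> by (auto simp: orth_group_def GL_def)
  note D = \<open>orth_decomposition B \<sigma> W\<close>[unfolded orth_decomposition_def Let_def]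
  have d: "direct_sum (I_all (charpoly \<sigma>) \<times> {1..}) W UNIV" using D by (elim conjE)
  have d2: "\<forall>j\<in>I_all (charpoly \<sigma>) \<times> {1..}. \<sigma> ` W j \<subseteq> W j" using D by (elim conjE)
  have d3: "\<forall>i\<in>I_all (charpoly \<sigma>) \<times> {1..}. \<forall>j\<in>I_all (charpoly \<sigma>) \<times> {1..}. i \<noteq> j \<longrightarrow> (\<forall>u\<in>W i. \<forall>v\<in>W j. B u v = 0)" using D by (elim conjE)
  have d4: "\<forall>(p, l)\<in>I_all (charpoly \<sigma>) \<times> {1..}. free_quot \<sigma> (p ^ l) (W (p, l))" using D by (elim conjE)
  have d5: "\<forall>p\<in>I_all (charpoly \<sigma>). direct_sum {1..} (\<lambda>l. W (p, l)) (primary_component \<sigma> p)" using D by (elim conjE)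
  have form: "iso_form \<sigma> B" using q s(3) by (auto simp: iso_form_def symf_def)
  interpret orth_isom_sys Bs \<sigma> "charpoly \<sigma>" W B
  proof (intro orth_isom_sys.intro isom_sys.intro fin_dim.intro isom_sys_axioms.intro orth_isom_sys_axioms.intro)
    show "\<sigma> ` W j \<subseteq> W j" if "j \<in> I_all (charpoly \<sigma>) \<times> {1..}" for j using d2 that by blast
    show "free_quot \<sigma> (p ^ l) (W (p, l))" if "p \<in> I_all (charpoly \<sigma>)" "1 \<le> l" for p l using d4 that by auto
    show "direct_sum {1..} (\<lambda>l. W (p, l)) (primary_component \<sigma> p)" if "p \<in> I_all (charpoly \<sigma>)" for p using d5 that by blast
    show "B u v = 0" if "i \<in> I_all (charpoly \<sigma>) \<times> {1..}" "j \<in> I_all (charpoly \<sigma>) \<times> {1..}" "i \<noteq> j" "u \<in> W i" "v \<in> W j" for i j u v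
      using d3 that by blast
  qed (fact fin Bs(2) sp s(1) s(2) d form)+
  show ?thesis
    using rigidity_iff[of r s] sig unfolding admissible_iff[OF n]
    by (simp only: J_defs J0_def J1_def J1ev_def)
qed

end
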